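(* Let $\mathbb L=\wp_\Gamma(\Sigma)$ be a maximum scattered linear set in $\mathrm{PG}(1,q^5)$ not of pseudoregulus type, where $\Sigma\subseteq\mathrm{PG}(4,q^5)$ is a canonical $\mathbb F_q$-subgeometry and $\Gamma$ is a plane with $\Gamma\cap\Sigma=\emptyset$. Let $\sigma$ be a generator of $\mathbb G$, and let $A=\Gamma\cap\Gamma^{\sigma^4}$ and $B=\Gamma\cap\Gamma^{\sigma^3}$ (these are points). If $\mathrm{rk}\,A=5$ or $\mathrm{rk}\,B=5$, then $\mathbb L$ is of LP type. Otherwise $q>25$, $\mathbb L$ is not of LP type, and $\mathbb L$ is, up to equivalence under $\mathrm{P\Gamma L}(2,q^5)$, one of $$\mathbb E=\{\langle(\eta(x^q-x)+\mathrm{Tr}_{q^5/q}(\rho x),\ x^q-x^{q^4})\rangle_{\mathbb F_{q^5}}: x\in\mathbb F_{q^5}^*\}$$ for some $\eta,\rho\in\mathbb F_{q^5}$ with $\eta\neq0$ and $\mathrm{Tr}_{q^5/q}(\eta)=0\neq\mathrm{Tr}_{q^5/q}(\rho)$, or $$L_F=\{\langle(x,F(x))\rangle_{\mathbb F_{q^5}}: x\in\mathbb F_{q^5}^*\},\qquad F(x)=k(x^q+x^{q^3})+x^{q^2}+x^{q^4},$$ for some $k\in\mathbb F_{q^5}$ with $\mathrm N_{q^5/q}(k)=1$.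
   Context: $q$ is a prime power; $\mathrm{Tr}_{q^5/q}(x)=x+x^q+x^{q^2}+x^{q^3}+x^{q^4}$ and $\mathrm N_{q^5/q}(x)=x^{1+q+q^2+q^3+q^4}$. An $\mathbb F_q$-linear set of rank 5 in $\mathrm{PG}(1,q^5)$ is $L_U=\{\langle v\rangle_{\mathbb F_{q^5}}:v\in U\setminus\{0\}\}$ for a 5-dimensional $\mathbb F_q$-subspace $U\subseteq\mathbb F_{q^5}^2$; it is maximum scattered if it has $(q^5-1)/(q-1)$ points. It is of pseudoregulus type if it is $\mathrm{P\Gamma L}(2,q^5)$-equivalent to $\{\langle(x,x^{q^s})\rangle_{\mathbb F_{q^5}}:x\in\mathbb F_{q^5}^*\}$ with $\gcd(s,5)=1$, and of LP type if equivalent to $\{\langle(x,x^{q^s}+\delta x^{q^{5-s}})\rangle_{\mathbb F_{q^5}}:x\in\mathbb F_{q^5}^*\}$ with $\gcd(s,5)=1$, $\mathrm N_{q^5/q}(\delta)\notin\{0,1\}$. A canonical $\mathbb F_q$-subgeometry of $\mathrm{PG}(4,q^5)$ is the image under a projectivity of the set of points having coordinates in $\mathbb F_q$. $\wp_\Gamma(\Sigma)$ denotes the projection of $\Sigma$ from the vertex $\Gamma$ onto a line disjoint from $\Gamma$ (a linear set of rank 5 in $\mathrm{PG}(1,q^5)$, well defined up to projectivity). $\mathbb G$ is the subgroup of $\mathrm{P\Gamma L}(5,q^5)$ fixing $\Sigma$ pointwise (cyclic of order 5). For a point $X$, its rank is $\mathrm{rk}\,X=1+\dim\langle X,X^\sigma,X^{\sigma^2},X^{\sigma^3},X^{\sigma^4}\rangle$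 (projective dimension of the span). *)

theory Defs
  imports "HOL-Analysis.Analysis" "HOL-Algebra.Bij" "HOL-Algebra.Generated_Groups"
    "HOL-Number_Theory.Prime_Powers"
begin

text \<open>
  The field with \<open>q ^ 5\<close> elements is a finite field type \<open>'a\<close> with \<open>CARD('a) = q ^ 5\<close>.
  Projective subspaces are linear subspaces of \<open>'a ^ 'n\<close>, given as sets of vectors; a point is
  a one-dimensional subspace, so that the empty projective subspace is \<open>{0}\<close> and the projective
  dimension is \<open>vec.dim\<close> minus one.
\<close>

definition Fq :: "nat \<Rightarrow> 'a::field set" where
  "Fq q = {x. x ^ q = x}"

definition Tr5 :: "nat \<Rightarrow> 'a::field \<Rightarrow> 'a" where
  "Tr5 q x = x + x ^ q + x ^ (q ^ 2) + x ^ (q ^ 3) + x ^ (q ^ 4)"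

definition N5 :: "nat \<Rightarrow> 'a::field \<Rightarrow> 'a" where
  "N5 q x = x ^ (1 + q + q ^ 2 + q ^ 3 + q ^ 4)"

definition subspaces :: "('a::field ^ 'n) set set" where
  "subspaces = {S. vec.subspace S}"

definition pt :: "'a::field ^ 'n \<Rightarrow> ('a ^ 'n) set" where
  "pt v = vec.span {v}"

definition points :: "('a::field ^ 'n) set set" where
  "points = {pt v | v. v \<noteq> 0}"

definition field_aut :: "('a::field \<Rightarrow> 'a) \<Rightarrow> bool" where
  "field_aut \<phi> \<longleftrightarrow> bij \<phi> \<and> \<phi> 1 = 1 \<and>
     (\<forall>a b. \<phi> (a + b) = \<phi> a + \<phi> b) \<and> (\<forall>a b. \<phi> (a * b) = \<phi> a * \<phi> b)"

definition GammaL :: "('a::field ^ 'n \<Rightarrow> 'a ^ 'n) set" where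
  "GammaL = {f. bij f \<and> (\<forall>u v. f (u + v) = f u + f v) \<and>
     (\<exists>\<phi>. field_aut \<phi> \<and> (\<forall>c v. f (c *s v) = \<phi> c *s f v))}"

text \<open>
  Collineations are functions on the lattice of subspaces. Restricting to subspaces identifies
  semilinear maps that differ by a scalar, so \<open>PGammaL\<close> and \<open>PGL\<close> are the actual quotient groups
  (as subgroups of \<open>BijGroup subspaces\<close>).
\<close>

definition collineation :: "('a::field ^ 'n \<Rightarrow> 'a ^ 'n) \<Rightarrow> ('a ^ 'n) set \<Rightarrow> ('a ^ 'n) set" where
  "collineation f = (\<lambda>S\<in>subspaces. f ` S)"

definition PGammaL :: "(('a::field ^ 'n) set \<Rightarrow> ('a ^ 'n) set) set" where
  "PGammaL = collineation ` GammaL"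

definition PGL :: "(('a::field ^ 'n) set \<Rightarrow> ('a ^ 'n) set) set" where
  "PGL = collineation ` {f. Vector_Spaces.linear (*s) (*s) f \<and> bij f}"

definition PGammaL_equiv :: "('a::field ^ 'n) set set \<Rightarrow> ('a ^ 'n) set set \<Rightarrow> bool" where
  "PGammaL_equiv L L' \<longleftrightarrow> (\<exists>\<kappa>\<in>PGammaL. \<kappa> ` L = L')"

text \<open>\<open>U\<close> is an \<open>m\<close>-dimensional subspace over the subfield: it has a basis \<open>b 0, \<dots>, b (m - 1)\<close>,
  i.e. every element of \<open>U\<close> is a unique combination of the \<open>b i\<close> with coefficients in \<open>Fq q\<close>.\<close>

definition Fq_subspace_dim :: "nat \<Rightarrow> nat \<Rightarrow> ('a::field ^ 'n) set \<Rightarrow> bool" where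
  "Fq_subspace_dim q m U \<longleftrightarrow>
     (\<exists>b. bij_betw (\<lambda>c. \<Sum>i<m. c i *s b i) ({..<m} \<rightarrow>\<^sub>E Fq q) U)"

definition linear_set :: "('a::field ^ 'n) set \<Rightarrow> ('a ^ 'n) set set" where
  "linear_set U = {pt v | v. v \<in> U - {0}}"

definition linear_set_of_rank :: "nat \<Rightarrow> nat \<Rightarrow> ('a::field ^ 'n) set set \<Rightarrow> bool" where
  "linear_set_of_rank q m L \<longleftrightarrow> (\<exists>U. Fq_subspace_dim q m U \<and> L = linear_set U)"

definition max_scattered :: "nat \<Rightarrow> ('a::field ^ 2) set set \<Rightarrow> bool" where
  "max_scattered q L \<longleftrightarrow> linear_set_of_rank q 5 L \<and> card L = (q ^ 5 - 1) div (q - 1)"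

definition pseudoregulus_type :: "nat \<Rightarrow> ('a::field ^ 2) set set \<Rightarrow> bool" where
  "pseudoregulus_type q L \<longleftrightarrow>
     (\<exists>s. gcd s 5 = 1 \<and> PGammaL_equiv L {pt (vector [x, x ^ (q ^ s)]) | x. x \<noteq> 0})"

text \<open>The bound \<open>s < 5\<close> keeps the subtraction \<open>5 - s\<close> on natural numbers from truncating.\<close>

definition LP_type :: "nat \<Rightarrow> ('a::field ^ 2) set set \<Rightarrow> bool" where
  "LP_type q L \<longleftrightarrow>
     (\<exists>s \<delta>. s < 5 \<and> gcd s 5 = 1 \<and> N5 q \<delta> \<notin> {0, 1} \<and>
        PGammaL_equiv L {pt (vector [x, x ^ (q ^ s) + \<delta> * x ^ (q ^ (5 - s))]) | x. x \<noteq> 0})"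

definition canonical_subgeometry :: "nat \<Rightarrow> ('a::field ^ 'n) set set \<Rightarrow> bool" where
  "canonical_subgeometry q \<Sigma> \<longleftrightarrow>
     (\<exists>\<kappa>\<in>PGL. \<Sigma> = \<kappa> ` {pt v | v. v \<noteq> 0 \<and> (\<forall>i. v $ i \<in> Fq q)})"

definition pointwise_stabilizer ::
    "('a::field ^ 'n) set set \<Rightarrow> (('a ^ 'n) set \<Rightarrow> ('a ^ 'n) set) set" where
  "pointwise_stabilizer \<Sigma> = {g \<in> PGammaL. \<forall>P\<in>\<Sigma>. g P = P}"

definition projection ::
    "('a::field ^ 'n) set \<Rightarrow> ('a ^ 'n) set \<Rightarrow> ('a ^ 'n) set set \<Rightarrow> ('a ^ 'n) set set" where
  "projection \<Gamma> \<Lambda> \<Sigma> = {vec.span (\<Gamma> \<union> P) \<inter> \<Lambda> | P. P \<in> \<Sigma>}"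

text \<open>The projection from \<open>\<Gamma>\<close> onto a line \<open>\<Lambda>\<close> disjoint from \<open>\<Gamma>\<close>, transported to \<open>PG(1, q ^ 5)\<close>
  by some choice of homogeneous coordinates \<open>h\<close> on \<open>\<Lambda>\<close>. Such a set is determined by \<open>\<Gamma>\<close> and \<open>\<Sigma>\<close>
  only up to projectivity, hence a relation.\<close>

definition is_projection ::
    "('a::field ^ 5) set \<Rightarrow> ('a ^ 5) set set \<Rightarrow> ('a ^ 2) set set \<Rightarrow> bool" where
  "is_projection \<Gamma> \<Sigma> L \<longleftrightarrow>
     (\<exists>\<Lambda> h. vec.subspace \<Lambda> \<and> vec.dim \<Lambda> = 2 \<and> \<Gamma> \<inter> \<Lambda> = {0} \<and>
        Vector_Spaces.linear (*s) (*s) h \<and> bij_betw h \<Lambda> UNIV \<and>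
        L = (\<lambda>P. h ` P) ` projection \<Gamma> \<Lambda> \<Sigma>)"

text \<open>The rank of a point is one plus the projective dimension of the span of its orbit,
  which is the vector space dimension of that span.\<close>

definition rk ::
    "(('a::field ^ 'n) set \<Rightarrow> ('a ^ 'n) set) \<Rightarrow> ('a ^ 'n) set \<Rightarrow> nat" where
  "rk \<sigma> X = vec.dim (vec.span (\<Union>i<5. (\<sigma> ^^ i) X))"

definition E_set :: "nat \<Rightarrow> 'a::field \<Rightarrow> 'a \<Rightarrow> ('a ^ 2) set set" where
  "E_set q \<eta> \<rho> =
     {pt (vector [\<eta> * (x ^ q - x) + Tr5 q (\<rho> * x), x ^ q - x ^ (q ^ 4)]) | x. x \<noteq> 0}"

definition LF_set :: "nat \<Rightarrow> 'a::field \<Rightarrow> ('a ^ 2) set set" where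
  "LF_set q k =
     {pt (vector [x, k * (x ^ q + x ^ (q ^ 3)) + x ^ (q ^ 2) + x ^ (q ^ 4)]) | x. x \<noteq> 0}"

end

theory Submission
  imports Defs "HOL-Algebra.Algebraic_Closure_Type" "HOL-Number_Theory.Residues"
begin

text \<open>
  The linear set is given by two functionals \<open>a\<close>, \<open>b\<close> on \<open>F_q^5\<close> with coefficients in the big field, and it is
  maximum scattered iff the \<open>F_q\<close>-bilinear alternating map \<open>a \<and> b\<close> has no isotropic pair of independent
  rational vectors. Over the algebraic closure this map becomes an alternating map \<open>D\<close> into a
  five-dimensional space commuting with Frobenius, i.e. a codimension five linear section of the
  Grassmannian of lines of \<open>P^4\<close>. If this elliptic normal curve (or its dual) were smooth, a Lang-type
  count (a resultant of degree \<open>4 q + 4\<close> with \<open>4 q + 5\<close> zeros) would give a contradiction. Hence it is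
  singular, and its singularities form a Frobenius orbit of five points: a pentagon. In the basis of the
  pentagon \<open>a \<and> b\<close> has only two nonzero coordinates, which is the Lunardon--Polverino normal form.
  So the exceptional branch of the statement never occurs.
\<close>

text \<open>The count is an elementary form of deg(1 + F) + deg(1 - F) = 2q + 2 for the Frobenius F
  of an elliptic curve. A rank-two form c = a \<and> b sends a curve member V to the functional in
  the span of a and b that kills V. This is a double cover of the projective line, and its deck
  involution plays the role of V \<mapsto> const - V. Two such covers, one of them twisted by
  Frobenius, give an equation for pairs (V, Y) with four families of solutions, one for each choice
  of sheets. One family would consist of rational points and is empty, two have 2q + 2 members each
  and exhaust the degree, and the last contains a pair chosen beforehand. Multiplicities are
  controlled in every characteristic alike: the exponent q makes one side constant to first order,
  and a second member over the same value certifies a simple root. Smoothness is the absence of a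
  curve member inside the radical of a rank-two form. If such an incidence exists, any two members
  of its Frobenius orbit meet, either as subspaces or dually in a common functional, and this
  rigidity closes the orbit up after five steps.\<close>

abbreviation dot :: "'b::field ^ 'n \<Rightarrow> 'b ^ 'n \<Rightarrow> 'b" where
  "dot \<equiv> scalar_product"

section \<open>Dot products, annihilators and dual bases\<close>

lemma dot_add_left: "dot (x + y) z = dot x z + dot y z"
  and dot_add_right: "dot z (x + y) = dot z x + dot z y"
  and dot_diff_left: "dot (x - y) z = dot x z - dot y z"
  and dot_diff_right: "dot z (x - y) = dot z x - dot z y"
  and dot_scale_left: "dot (k *s x) z = k * dot x z"
  and dot_scale_right: "dot z (k *s x) = k * dot z x"
  and dot_minus_left: "dot (- x) z = - dot x z"
  and dot_minus_right: "dot z (- x) = - dot z x"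
  and dot_zero_left [simp]: "dot 0 z = 0"
  and dot_zero_right [simp]: "dot z 0 = 0"
  by (simp_all add: scalar_product_def algebra_simps sum.distrib sum_subtractf sum_distrib_left
      sum_negf)

lemmas dot_simps = dot_add_left dot_add_right dot_diff_left dot_diff_right dot_scale_left
  dot_scale_right dot_minus_left dot_minus_right

lemma dot_commute: "dot x y = dot y x"
  by (simp add: scalar_product_def mult.commute)

lemma dot_sum_left: "dot (\<Sum>i\<in>A. f i) z = (\<Sum>i\<in>A. dot (f i) z)"
  by (induction A rule: infinite_finite_induct) (auto simp: dot_add_left)

lemma dot_sum_right: "dot z (\<Sum>i\<in>A. f i) = (\<Sum>i\<in>A. dot z (f i))"
  by (induction A rule: infinite_finite_induct) (auto simp: dot_add_right)

lemma dot_axis: "dot x (axis i 1) = x $ i"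
  by (simp add: scalar_product_def axis_def if_distrib cong: if_cong)

lemma dot_eq_0_all: "(\<And>x. dot c x = 0) \<Longrightarrow> c = 0"
  by (metis dot_axis vec_eq_iff zero_index)

definition perp :: "('b::field ^ 'n) set \<Rightarrow> ('b ^ 'n) set" where
  "perp S = {c. \<forall>x\<in>S. dot c x = 0}"

lemma perp_iff: "c \<in> perp S \<longleftrightarrow> (\<forall>x\<in>S. dot c x = 0)"
  by (simp add: perp_def)

lemma subspace_perp [simp]: "vec.subspace (perp S)"
  by (auto simp: vec.subspace_def perp_def dot_simps)

lemma subspace_kernel: "vec.subspace {x. dot c x = 0}"
  by (auto simp: vec.subspace_def dot_simps)

lemma dot_span_zero: "x \<in> vec.span S \<Longrightarrow> (\<And>y. y \<in> S \<Longrightarrow> dot c y = 0) \<Longrightarrow> dot c x = 0"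
  using vec.span_minimal[OF _ subspace_kernel, of S c] by auto

lemma perp_span: "perp (vec.span S) = perp S"
  by (auto simp: perp_def vec.span_base intro: dot_span_zero)

text \<open>The coordinate functional \<open>vec.representation B _ b\<close> is linear; its values
  on the standard axes are the entries of the dual vector \<open>f b\<close>.\<close>

lemma dual_basis:
  fixes B :: "('b::field ^ 'n) set"
  assumes "vec.independent B" "vec.span B = UNIV"
  obtains f where "\<And>b b'. b \<in> B \<Longrightarrow> b' \<in> B \<Longrightarrow> dot (f b) b' = (if b = b' then 1 else 0)"
    and "\<And>c. c = (\<Sum>b\<in>B. dot c b *s f b)"
proof -
  have fin: "finite B" using assms(1) by (rule vec.finiteI_independent)
  define f where "f b = (\<chi> i. vec.representation B (axis i 1) b)" for b
  have rep: "dot (f b) x = vec.representation B x b" for b x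
  proof -
    have "x = (\<Sum>i\<in>UNIV. x $ i *s axis i 1)"
      by (simp add: basis_expansion)
    then have "vec.representation B x b
        = vec.representation B (\<Sum>i\<in>UNIV. x $ i *s axis i 1) b" by simp
    also have "\<dots> = (\<Sum>i\<in>UNIV. x $ i * vec.representation B (axis i 1) b)"
      by (subst vec.representation_sum)
        (auto simp: assms vec.representation_scale)
    finally show ?thesis
      by (simp add: scalar_product_def f_def mult.commute)
  qed
  have 1: "dot (f b) b' = (if b = b' then 1 else 0)" if "b \<in> B" "b' \<in> B" for b b'
    using that by (auto simp: rep vec.representation_basis[OF assms(1)])
  have 2: "c = (\<Sum>b\<in>B. dot c b *s f b)" for c
  proof -
    have "dot (c - (\<Sum>b\<in>B. dot c b *s f b)) x = 0" for x
    proof (rule dot_span_zero[of x B])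
      fix y assume "y \<in> B"
      have "(\<Sum>b\<in>B. dot c b * dot (f b) y) = (\<Sum>b\<in>B. if b = y then dot c y else 0)"
        by (rule sum.cong) (auto simp: 1 \<open>y \<in> B\<close>)
      then show "dot (c - (\<Sum>b\<in>B. dot c b *s f b)) y = 0"
        using fin \<open>y \<in> B\<close> by (simp add: dot_simps dot_sum_left)
    qed (simp add: assms)
    then show ?thesis using dot_eq_0_all by fastforce
  qed
  from that[OF 1 2] show thesis by blast
qed

text \<open>Extend a basis \<open>B\<close> of the span of \<open>S\<close> to a basis
  \<open>B'\<close> of the whole space: the dual vectors that belong to \<open>B' - B\<close> form a
  basis of the annihilator.\<close>

lemma dim_perp:
  fixes S :: "('b::field ^ 'n) set"
  shows "vec.dim (perp S) = CARD('n) - vec.dim S"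
proof -
  obtain B where B: "B \<subseteq> S" "vec.independent B" "S \<subseteq> vec.span B" "card B = vec.dim S"
    using vec.basis_exists by blast
  obtain B' where B': "B \<subseteq> B'" "vec.independent B'" "vec.span B' = UNIV"
  proof -
    obtain B' where B': "B \<subseteq> B'" "B' \<subseteq> UNIV" "vec.independent B'" "UNIV \<subseteq> vec.span B'"
      using vec.maximal_independent_subset_extend[OF subset_UNIV B(2)] by blast
    have "vec.span B' = UNIV" using B'(4) by (rule top.extremum_uniqueI)
    with B'(1,3) show ?thesis using that by blast
  qed
  have fin: "finite B'" using B'(2) by (rule vec.finiteI_independent)
  have card: "card B' = CARD('n)"
  proof -
    have "vec.span B' = vec.span (UNIV :: ('b ^ 'n) set)" by (simp only: B'(3) vec.span_UNIV)
    from vec.dim_eq_card[OF this B'(2)] show ?thesis by (simp only: vec_dim_card)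
  qed
  obtain f where f: "\<And>b b'. b \<in> B' \<Longrightarrow> b' \<in> B' \<Longrightarrow> dot (f b) b' = (if b = b' then 1 else 0)"
    "\<And>c. c = (\<Sum>b\<in>B'. dot c b *s f b)"
    using dual_basis[OF B'(2,3)] by blast
  have inj: "inj_on f B'"
    by (rule inj_onI) (metis f(1) zero_neq_one)
  have ind: "vec.independent (f ` (B' - B))"
  proof -
    have "u v = 0" if s: "(\<Sum>v\<in>f ` (B' - B). u v *s v) = 0" and v: "v \<in> f ` (B' - B)" for u v
    proof -
      from v obtain b where b: "b \<in> B' - B" "v = f b" by auto
      have "0 = dot (\<Sum>v\<in>f ` (B' - B). u v *s v) b" by (simp add: s)
      also have "(\<Sum>v\<in>f ` (B' - B). u v *s v) = (\<Sum>a\<in>B' - B. u (f a) *s f a)"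
        by (rule sum.reindex_cong[OF inj_on_subset[OF inj]]) auto
      also have "dot \<dots> b = (\<Sum>a\<in>B' - B. if a = b then u (f b) else 0)"
        unfolding dot_sum_left by (rule sum.cong) (use b f(1) in \<open>auto simp: dot_simps\<close>)
      also have "\<dots> = u v" using b fin by simp
      finally show ?thesis by simp
    qed
    then show ?thesis
      by (subst vec.dependent_finite) (use fin in auto)
  qed
  have "vec.dim (perp S) = card (f ` (B' - B))"
  proof (rule vec.dim_unique)
    show "f ` (B' - B) \<subseteq> perp S"
    proof (clarsimp simp: perp_iff)
      fix b x assume "b \<in> B'" "b \<notin> B" "x \<in> S"
      then show "dot (f b) x = 0"
        using B(3) B'(1) f(1) by (intro dot_span_zero[of x B]) auto
    qed
    show "perp S \<subseteq> vec.span (f ` (B' - B))"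
    proof
      fix c assume c: "c \<in> perp S"
      have "c = (\<Sum>b\<in>B'. dot c b *s f b)" by (rule f)
      also have "\<dots> = (\<Sum>b\<in>B' - B. dot c b *s f b)"
        using c B(1) fin by (intro sum.mono_neutral_right) (auto simp: perp_iff)
      also have "\<dots> \<in> vec.span (f ` (B' - B))"
        by (intro vec.span_sum vec.span_scale vec.span_base) simp
      finally show "c \<in> vec.span (f ` (B' - B))" .
    qed
  qed (use ind in auto)
  also have "\<dots> = card B' - card B"
    using B'(1) fin by (subst card_image[OF inj_on_subset[OF inj]])
      (auto simp: card_Diff_subset finite_subset)
  finally show ?thesis by (simp add: card B(4))
qed

lemma perp_perp:
  fixes S :: "('b::field ^ 'n) set"
  assumes "vec.subspace S"
  shows "perp (perp S) = S"
proof (rule sym, rule vec.subspace_dim_equal)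
  show "S \<subseteq> perp (perp S)" by (auto simp: perp_def) (metis dot_commute)
  show "vec.dim S \<ge> vec.dim (perp (perp S))"
    using vec.dim_subset_UNIV[of S] by (simp add: dim_perp)
qed (use assms in auto)

lemma perp_nonzero:
  fixes S :: "('b::field ^ 'n) set"
  assumes "vec.dim S < CARD('n)"
  obtains c where "c \<noteq> 0" "\<And>x. x \<in> S \<Longrightarrow> dot c x = 0"
proof -
  have "\<not> perp S \<subseteq> {0}"
    using assms dim_perp[of S] by (metis vec.dim_eq_0 zero_less_diff less_irrefl)
  then show thesis using that unfolding perp_iff subset_iff by (metis singletonI)
qed

text \<open>With two dimensions to spare the annihilator does not fit into a line. This is how a
  second form, independent of a given one, is found in \<open>curve_at_most_two\<close>.\<close>

lemma perp_not_in_line: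
  fixes S :: "('b::field ^ 'n) set"
  assumes "vec.dim S + 1 < CARD('n)"
  obtains c where "c \<notin> vec.span {c0}" "\<And>x. x \<in> S \<Longrightarrow> dot c x = 0"
proof -
  have "\<not> perp S \<subseteq> vec.span {c0}"
  proof
    assume "perp S \<subseteq> vec.span {c0}"
    then have "vec.dim (perp S) \<le> vec.dim {c0}" by (rule vec.dim_mono)
    also have "\<dots> \<le> 1" by simp
    finally show False using assms by (simp add: dim_perp)
  qed
  then show thesis using that unfolding perp_iff subset_iff by blast
qed

lemma separating_functional:
  fixes v :: "'b::field ^ 'n"
  assumes "v \<notin> vec.span S"
  obtains c where "dot c v = 1" "\<And>x. x \<in> S \<Longrightarrow> dot c x = 0"
proof -
  have "v \<notin> perp (perp (vec.span S))" using assms by (simp add: perp_perp)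
  then obtain c where c: "c \<in> perp S" "dot v c \<noteq> 0" by (auto simp: perp_iff[of v] perp_span)
  then show thesis
    using that[of "inverse (dot v c) *s c"] by (auto simp: perp_iff dot_simps dot_commute[of v])
qed

lemma in_span_1: "x \<in> vec.span {a} \<longleftrightarrow> (\<exists>r. x = r *s a)"
  by (auto simp: vec.span_singleton)

lemma in_span_insert: "x \<in> vec.span (insert a S) \<longleftrightarrow> (\<exists>r. \<exists>y\<in>vec.span S. x = r *s a + y)"
proof
  assume "x \<in> vec.span (insert a S)"
  then obtain k where "x - k *s a \<in> vec.span S" by (auto simp: vec.span_breakdown_eq)
  then show "\<exists>r. \<exists>y\<in>vec.span S. x = r *s a + y"
    by (intro exI[of _ k] bexI[of _ "x - k *s a"]) auto
next
  assume "\<exists>r. \<exists>y\<in>vec.span S. x = r *s a + y"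
  then obtain r y where "y \<in> vec.span S" "x = r *s a + y" by blast
  then show "x \<in> vec.span (insert a S)"
    by (auto simp: vec.span_breakdown_eq intro!: exI[of _ r])
qed

lemma in_span_2: "x \<in> vec.span {a, b} \<longleftrightarrow> (\<exists>r s. x = r *s a + s *s b)"
  unfolding in_span_insert[of x a] Bex_def in_span_1 by blast

lemma in_span_3: "x \<in> vec.span {a, b, c} \<longleftrightarrow> (\<exists>r s t. x = r *s a + s *s b + t *s c)"
  unfolding in_span_insert[of x a] Bex_def in_span_2 add.assoc by blast

text \<open>Independence of a pair is expressed by \<open>vec.dim {x, y} = 2\<close> throughout.
  Unlike independence of the set \<open>{x, y}\<close>, this rules out \<open>x = y\<close>.\<close>

lemma dim2_iff: "vec.dim {x, y} = 2 \<longleftrightarrow> (\<forall>r s. r *s x + s *s y = 0 \<longrightarrow> r = 0 \<and> s = 0)"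
  for x y :: "'b::field ^ 'n"
proof
  assume d: "vec.dim {x, y} = 2"
  then have y: "y \<noteq> 0" and x: "x \<notin> vec.span {y}"
    by (auto simp: vec.dim_insert split: if_splits)
  show "\<forall>r s. r *s x + s *s y = 0 \<longrightarrow> r = 0 \<and> s = 0"
  proof (intro allI impI)
    fix r s assume e: "r *s x + s *s y = 0"
    have "r = 0"
    proof (rule ccontr)
      assume "r \<noteq> 0"
      have "x = (inverse r * r) *s x" using \<open>r \<noteq> 0\<close> by simp
      also have "\<dots> = inverse r *s (r *s x)" by (simp only: vector_smult_assoc)
      also have "r *s x = (- s) *s y" using e by (simp add: eq_neg_iff_add_eq_0)
      finally have "x = (inverse r * - s) *s y" by (simp only: vector_smult_assoc)
      with x show False unfolding in_span_1 by blast
    qed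
    with e y show "r = 0 \<and> s = 0" by simp
  qed
next
  assume *: "\<forall>r s. r *s x + s *s y = 0 \<longrightarrow> r = 0 \<and> s = 0"
  have "y \<noteq> 0" using *[rule_format, of 0 1] by auto
  moreover have "x \<notin> vec.span {y}"
  proof
    assume "x \<in> vec.span {y}"
    then obtain r where "x = r *s y" by (auto simp: in_span_1)
    then show False using *[rule_format, of 1 "- r"] by simp
  qed
  ultimately show "vec.dim {x, y} = 2" by (simp add: vec.dim_insert)
qed

lemma dim2D:
  fixes x y :: "'b::field ^ 'n"
  shows "vec.dim {x, y} = 2 \<Longrightarrow> r *s x + s *s y = 0 \<Longrightarrow> r = 0 \<and> s = 0"
  using dim2_iff by blast

lemma subspace_dim2_span:
  fixes V :: "('b::field ^ 'n) set"
  assumes "vec.subspace V" "vec.dim V = 2" "x \<in> V" "y \<in> V" "vec.dim {x, y} = 2"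
  shows "V = vec.span {x, y}"
proof (rule sym, rule vec.subspace_dim_equal)
  show "vec.span {x, y} \<subseteq> V" by (rule vec.span_minimal) (use assms in auto)
qed (use assms in auto)

lemma obtain_basis2:
  fixes V :: "('b::field ^ 'n) set"
  assumes "vec.subspace V" "vec.dim V = 2"
  obtains x y where "V = vec.span {x, y}" "vec.dim {x, y} = 2" "x \<in> V" "y \<in> V"
proof -
  obtain B where B: "B \<subseteq> V" "vec.independent B" "V \<subseteq> vec.span B" "card B = vec.dim V"
    using vec.basis_exists by blast
  then obtain x y where xy: "B = {x, y}" "x \<noteq> y"
    using assms by (auto simp: card_2_iff)
  have d: "vec.dim {x, y} = 2"
    using B xy by (metis assms(2) vec.dim_eq_card_independent)
  have "x \<in> V" "y \<in> V" using B xy by auto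
  with that[OF subspace_dim2_span[OF assms this d] d] show thesis by blast
qed

section \<open>Polynomials\<close>

text \<open>Splitting off a linear factor leaves a polynomial with the same property, and the root
  of that factor is not repeated because the derivative does not vanish there.\<close>

lemma card_simple_roots:
  fixes p :: "'b::alg_closed_field poly"
  assumes "\<And>x. poly p x = 0 \<Longrightarrow> poly (pderiv p) x \<noteq> 0" "p \<noteq> 0"
  shows "card {x. poly p x = 0} = Polynomial.degree p"
proof -
  have "\<And>p::'b poly. Polynomial.degree p = n \<Longrightarrow> p \<noteq> 0 \<Longrightarrow>
      (\<And>x. poly p x = 0 \<Longrightarrow> poly (pderiv p) x \<noteq> 0) \<Longrightarrow> card {x. poly p x = 0} = n" for n
  proof (induction n)
    case 0
    then obtain c where "p = [:c:]" by (auto elim: degree_eq_zeroE)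
    with 0 show ?case by auto
  next
    case (Suc n)
    obtain a where a: "poly p a = 0"
      using alg_closed_imp_poly_has_root[of p] Suc by auto
    then obtain r where r: "p = [:-a, 1:] * r" by (auto simp: poly_eq_0_iff_dvd dvd_def)
    have r0: "r \<noteq> 0" using r Suc by auto
    have deg: "Polynomial.degree r = n"
      using Suc(2) r0 unfolding r by (subst (asm) degree_mult_eq) auto
    have ra: "poly r a \<noteq> 0"
      using Suc(4)[OF a] unfolding r pderiv_mult by (auto simp: pderiv_pCons)
    have "poly (pderiv r) x \<noteq> 0" if "poly r x = 0" for x
      using Suc(4)[of x] that unfolding r pderiv_mult by (auto simp: pderiv_pCons)
    with Suc.IH[OF deg r0] have "card {x. poly r x = 0} = n" by blast
    moreover have "{x. poly p x = 0} = insert a {x. poly r x = 0}"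
      unfolding r by auto
    ultimately show ?case using ra poly_roots_finite[OF r0] by simp
  qed
  with assms show ?thesis by blast
qed

lemma binary_quadratic_root:
  fixes a b c :: "'b::alg_closed_field"
  obtains s t where "s \<noteq> 0 \<or> t \<noteq> 0" "a * s\<^sup>2 + b * (s * t) + c * t\<^sup>2 = 0"
proof (cases "a = 0")
  case True
  then show thesis using that[of 1 0] by simp
next
  case False
  then have "Polynomial.degree [:c, b, a:] > 0" by simp
  from alg_closed_imp_poly_has_root[OF this] obtain x where "poly [:c, b, a:] x = 0" by blast
  then show thesis using that[of x 1] by (simp add: power2_eq_square algebra_simps)
qed

text \<open>Euclid's argument: in a finite field the product of all \<open>X - a\<close>, plus one,
  has no root.\<close>

lemma infinite_alg_closed: "infinite (UNIV :: 'b::alg_closed_field set)"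
proof
  assume fin: "finite (UNIV :: 'b set)"
  define p :: "'b poly" where "p = (\<Prod>a\<in>UNIV. [:-a, 1:]) + 1"
  have deg: "Polynomial.degree (\<Prod>a\<in>UNIV. [:-a, 1::'b:]) = card (UNIV :: 'b set)"
    by (simp add: degree_prod_eq_sum_degree)
  have "Polynomial.degree p = card (UNIV :: 'b set)"
    unfolding p_def using deg fin by (subst degree_add_eq_left) (auto simp: card_gt_0_iff)
  then have "Polynomial.degree p > 0" using fin by (simp add: card_gt_0_iff)
  then obtain x where "poly p x = 0" using alg_closed_imp_poly_has_root by blast
  moreover have "poly p x = 1"
    using fin by (auto simp: p_def poly_prod intro: prod_zero)
  ultimately show False by simp
qed

section \<open>Alternating maps on five-space that commute with Frobenius\<close>

definition frob :: "nat \<Rightarrow> 'b::field ^ 'n \<Rightarrow> 'b ^ 'n" where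
  "frob q x = (\<chi> i. x $ i ^ q)"

definition wedge :: "'b::field ^ 'n \<Rightarrow> 'b ^ 'n \<Rightarrow> 'b ^ 'n \<Rightarrow> 'b ^ 'n \<Rightarrow> 'b" where
  "wedge a b x y = dot a x * dot b y - dot a y * dot b x"

lemma not_in_span_dot: "(\<And>y. y \<in> S \<Longrightarrow> dot y z = 0) \<Longrightarrow> dot x z \<noteq> 0 \<Longrightarrow> x \<notin> vec.span S"
  using dot_span_zero[of x S z] by (metis dot_commute)

text \<open>Five vectors that span a five-dimensional space are distinct, so the dual basis of their
  set can be indexed by \<open>{..<5}\<close>.\<close>

lemma family_dual_basis:
  fixes z :: "nat \<Rightarrow> 'b::field ^ 5"
  assumes "vec.dim (z ` {..<5}) = 5"
  obtains e where "\<And>i j. i < 5 \<Longrightarrow> j < 5 \<Longrightarrow> dot (e i) (z j) = (if i = j then 1 else 0)"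
    and "\<And>y. y = (\<Sum>i<5. dot (e i) y *s z i)" and "\<And>c. c = (\<Sum>i<5. dot c (z i) *s e i)"
proof -
  let ?B = "z ` {..<5::nat}"
  have c5: "card ?B = 5"
    using vec.dim_le_card'[of ?B] card_image_le[of "{..<5::nat}" z] assms by simp
  have inj: "inj_on z {..<5}" by (rule eq_card_imp_inj_on) (simp_all add: c5)
  have ind: "vec.independent ?B"
    by (rule vec.card_le_dim_spanning[of _ "vec.span ?B"]) (auto simp: assms c5 vec.span_base)
  have "vec.span ?B = UNIV"
    by (rule vec.subspace_dim_equal) (simp_all add: assms vec_dim_card del: vec.dim_UNIV)
  from dual_basis[OF ind this] obtain f where
    f: "\<And>b b'. b \<in> ?B \<Longrightarrow> b' \<in> ?B \<Longrightarrow> dot (f b) b' = (if b = b' then 1 else 0)"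
    "\<And>c. c = (\<Sum>b\<in>?B. dot c b *s f b)" by blast
  define e where "e i = f (z i)" for i
  have 1: "dot (e i) (z j) = (if i = j then 1 else 0)" if "i < 5" "j < 5" for i j
    using that f(1)[of "z i" "z j"] inj by (auto simp: e_def inj_on_def)
  have 3: "c = (\<Sum>i<5. dot c (z i) *s e i)" for c
    using f(2)[of c] by (simp add: sum.reindex[OF inj] e_def)
  have 2: "y = (\<Sum>i<5. dot (e i) y *s z i)" for y
  proof -
    have "dot (y - (\<Sum>i<5. dot (e i) y *s z i)) c = 0" for c
    proof -
      have "dot y c = (\<Sum>i<5. dot c (z i) * dot y (e i))"
        by (subst 3[of c]) (simp add: dot_sum_right dot_simps)
      also have "\<dots> = (\<Sum>i<5. dot (e i) y * dot (z i) c)"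
        by (simp add: dot_commute mult.commute)
      finally show ?thesis by (simp add: dot_simps dot_sum_left)
    qed
    then show ?thesis using dot_eq_0_all by fastforce
  qed
  from that[OF 1 2 3] show thesis by blast
qed

text \<open>The vectors fixed by \<open>frob q\<close> are the rational ones, with coordinates in
  the field of q elements. In the application \<open>D\<close> lists the five conjugates of
  \<open>a \<and> b\<close> in a basis that Frobenius permutes cyclically. Therefore
  \<open>D\<close> commutes with Frobenius, and \<open>no_rational_zero\<close> is
  scatteredness.\<close>

locale alternating_system =
  fixes q :: nat and D :: "'b::alg_closed_field ^ 5 \<Rightarrow> 'b ^ 5 \<Rightarrow> 'b ^ 5"
  assumes q_ge_2: "2 \<le> q" and q_zero: "of_nat q = (0::'b)"
    and power_q_add: "\<And>x y::'b. (x + y) ^ q = x ^ q + y ^ q"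
    and D_add_left: "D (x + y) z = D x z + D y z"
    and D_scale_left: "D (k *s x) z = k *s D x z"
    and D_add_right: "D z (x + y) = D z x + D z y"
    and D_scale_right: "D z (k *s x) = k *s D z x"
    and D_self [simp]: "D x x = 0"
    and D_frob: "D (frob q x) (frob q y) = frob q (D x y)"
    and no_rational_zero:
      "frob q x = x \<Longrightarrow> frob q y = y \<Longrightarrow> D x y = 0 \<Longrightarrow> vec.dim {x, y} \<noteq> 2"
begin

abbreviation "Fr \<equiv> frob q :: 'b ^ 5 \<Rightarrow> 'b ^ 5"

subsection \<open>The Frobenius map\<close>

lemma q_pos [simp]: "0 < q" "q \<noteq> 0" using q_ge_2 by auto

lemma power_q_minus: "(- x) ^ q = - (x ^ q)" for x :: 'b
  using power_q_add[of x "- x"] by (simp add: zero_power eq_neg_iff_add_eq_0 add.commute)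

lemma power_q_diff: "(x - y) ^ q = x ^ q - y ^ q" for x y :: 'b
  using power_q_add[of x "- y"] by (simp add: power_q_minus)

lemma power_q_sum: "(\<Sum>i\<in>A. f i) ^ q = (\<Sum>i\<in>A. f i ^ q)" for f :: "_ \<Rightarrow> 'b"
  by (induction A rule: infinite_finite_induct) (auto simp: power_q_add zero_power)

lemma power_q_inj: "x ^ q = y ^ q \<longleftrightarrow> x = y" for x y :: 'b
  using power_q_diff[of x y] by auto

lemma Fr_add: "Fr (x + y) = Fr x + Fr y"
  and Fr_diff: "Fr (x - y) = Fr x - Fr y"
  and Fr_scale: "Fr (k *s x) = k ^ q *s Fr x"
  and Fr_0 [simp]: "Fr 0 = 0"
  and Fr_minus: "Fr (- x) = - Fr x"
  by (simp_all add: frob_def vec_eq_iff power_q_add power_q_diff power_mult_distrib zero_power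
      power_q_minus)

lemma Fr_eq_iff [simp]: "Fr x = Fr y \<longleftrightarrow> x = y"
  by (simp add: frob_def vec_eq_iff power_q_inj)

lemma Fr_eq_0_iff [simp]: "Fr x = 0 \<longleftrightarrow> x = 0"
  using Fr_eq_iff[of x 0] by simp

lemma Fr_surj: "\<exists>y. Fr y = x"
proof -
  have "\<forall>i. \<exists>y. y ^ q = x $ i" by (auto intro: nth_root_exists)
  then obtain f where "\<forall>i. f i ^ q = x $ i" by metis
  then show ?thesis by (intro exI[of _ "\<chi> i. f i"]) (simp add: frob_def vec_eq_iff)
qed

lemma dot_Fr: "dot (Fr c) (Fr x) = dot c x ^ q"
  by (simp add: scalar_product_def frob_def power_q_sum power_mult_distrib)

lemma dot_Fr_0_iff: "dot (Fr c) (Fr x) = 0 \<longleftrightarrow> dot c x = 0"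
  by (simp add: dot_Fr)

lemma Fr_image_subspace: "vec.subspace V \<Longrightarrow> vec.subspace (Fr ` V)"
proof (rule vec.subspaceI)
  assume V: "vec.subspace V"
  show "0 \<in> Fr ` V" using vec.subspace_0[OF V] Fr_0 by (metis imageI)
  show "x + y \<in> Fr ` V" if "x \<in> Fr ` V" "y \<in> Fr ` V" for x y
    using that vec.subspace_add[OF V] by (auto simp flip: Fr_add)
  show "k *s x \<in> Fr ` V" if x: "x \<in> Fr ` V" for k x
  proof -
    obtain l where "l ^ q = k" using nth_root_exists[of q k] by auto
    then show ?thesis using x vec.subspace_scale[OF V] by (auto simp flip: Fr_scale)
  qed
qed

lemma Fr_image_span: "Fr ` vec.span S = vec.span (Fr ` S)"
proof (rule subset_antisym)
  show "Fr ` vec.span S \<subseteq> vec.span (Fr ` S)"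
  proof (rule image_subsetI)
    fix x assume "x \<in> vec.span S"
    then show "Fr x \<in> vec.span (Fr ` S)"
      by (induction rule: vec.span_induct_alt)
        (auto simp: Fr_add Fr_scale intro!: vec.span_add vec.span_scale
          intro: vec.span_base vec.span_zero)
  qed
  show "vec.span (Fr ` S) \<subseteq> Fr ` vec.span S"
    by (rule vec.span_minimal) (auto simp: Fr_image_subspace vec.span_base)
qed

lemma Fr_mem_span: "Fr x \<in> vec.span (Fr ` S) \<longleftrightarrow> x \<in> vec.span S"
  unfolding Fr_image_span[symmetric] by auto

lemma dim_Fr: "vec.dim (Fr ` S) = vec.dim S"
proof -
  have le: "vec.dim (Fr ` B) = card B" if "finite B" "vec.independent B" for B
    using that
  proof (induction B)
    case (insert x B)
    then have "x \<notin> vec.span B" "vec.independent B"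
      by (auto simp: vec.independent_insert)
    then show ?case using insert
      by (simp add: vec.dim_insert Fr_mem_span)
  qed simp
  obtain B where B: "B \<subseteq> S" "vec.independent B" "S \<subseteq> vec.span B" "card B = vec.dim S"
    using vec.basis_exists by blast
  have "vec.span B = vec.span S"
    by (metis B(1,3) vec.span_eq vec.span_superset subset_trans)
  then have "vec.dim (Fr ` S) = vec.dim (Fr ` B)"
    by (metis Fr_image_span vec.dim_span)
  with le[OF _ B(2)] B show ?thesis by (simp add: vec.finiteI_independent)
qed

text \<open>Over the closure these are the subspaces defined over the field of q elements. Galois
  descent is used in the form of \<open>rational_vector\<close> and
  \<open>rational_vector_2\<close>.\<close>

definition stable :: "('b ^ 5) set \<Rightarrow> bool" where
  "stable T \<longleftrightarrow> vec.subspace T \<and> (\<forall>x\<in>T. Fr x \<in> T)"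

lemma stable_span: "(\<And>x. x \<in> S \<Longrightarrow> Fr x \<in> vec.span S) \<Longrightarrow> stable (vec.span S)"
proof -
  assume "\<And>x. x \<in> S \<Longrightarrow> Fr x \<in> vec.span S"
  then have "vec.span (Fr ` S) \<subseteq> vec.span S" by (intro vec.span_minimal) auto
  then show ?thesis by (auto simp: stable_def simp flip: Fr_image_span)
qed

lemma stable_perp:
  assumes "stable T"
  shows "stable (perp T)"
proof -
  have sub: "Fr ` T \<subseteq> T" "vec.subspace T" using assms by (auto simp: stable_def)
  have "Fr ` T = T"
    by (rule vec.subspace_dim_equal) (use sub in \<open>auto simp: dim_Fr Fr_image_subspace\<close>)
  have "dot (Fr c) x = 0" if c: "\<forall>x\<in>T. dot c x = 0" and "x \<in> T" for c x
  proof -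
    obtain y where "y \<in> T" "x = Fr y" using \<open>Fr ` T = T\<close> \<open>x \<in> T\<close> by blast
    then show ?thesis using c by (simp add: dot_Fr_0_iff)
  qed
  then show ?thesis by (simp add: stable_def perp_iff)
qed

text \<open>Descent by minimal support: scale a vector with fewest nonzero coordinates so that one
  of them is 1. Then \<open>Fr u - u\<close> has strictly smaller support and must vanish.\<close>

lemma rational_vector:
  assumes "stable T" "v \<in> T" "v \<noteq> 0"
  obtains x where "x \<in> T" "x \<noteq> 0" "Fr x = x"
proof -
  define N where "N v = card {i. v $ i \<noteq> 0}" for v :: "'b ^ 5"
  obtain v where v: "v \<in> T" "v \<noteq> 0" and min: "\<And>u. u \<in> T \<Longrightarrow> u \<noteq> 0 \<Longrightarrow> N v \<le> N u"
    using ex_has_least_nat[of "\<lambda>v. v \<in> T \<and> v \<noteq> 0" v N] assms by blast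
  then obtain k where k: "v $ k \<noteq> 0" by (auto simp: vec_eq_iff)
  define u where "u = inverse (v $ k) *s v"
  have sub: "vec.subspace T" using assms by (simp add: stable_def)
  have u: "u \<in> T" "u \<noteq> 0" "u $ k = 1"
    using v k vec.subspace_scale[OF sub] by (auto simp: u_def)
  have d: "Fr u - u \<in> T"
    using vec.subspace_diff[OF sub] assms(1) u by (auto simp: stable_def)
  have "{i. (Fr u - u) $ i \<noteq> 0} \<subset> {i. v $ i \<noteq> 0}"
  proof (rule psubsetI)
    show "{i. (Fr u - u) $ i \<noteq> 0} \<subseteq> {i. v $ i \<noteq> 0}"
      by (auto simp: frob_def u_def zero_power)
    have "k \<notin> {i. (Fr u - u) $ i \<noteq> 0}" using u(3) by (simp add: frob_def)
    then show "{i. (Fr u - u) $ i \<noteq> 0} \<noteq> {i. v $ i \<noteq> 0}" using k by blast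
  qed
  then have "N (Fr u - u) < N v" unfolding N_def by (intro psubset_card_mono) auto
  with min[OF d] have "Fr u = u" by fastforce
  with that u show thesis by blast
qed

text \<open>Cut \<open>T\<close> by a coordinate hyperplane that misses \<open>x\<close>. The
  section is stable and nonzero, so it has a rational vector, which cannot be proportional to
  \<open>x\<close>.\<close>

lemma rational_vector_2:
  assumes "stable T" "2 \<le> vec.dim T" "x \<noteq> 0"
  obtains y where "y \<in> T" "Fr y = y" "vec.dim {x, y} = 2"
proof -
  from assms(3) obtain k where k: "x $ k \<noteq> 0" by (auto simp: vec_eq_iff)
  define T' where "T' = {v \<in> T. v $ k = 0}"
  have sub: "vec.subspace T" using assms by (simp add: stable_def)
  have st: "stable T'"
    using assms(1) by (auto simp: stable_def T'_def vec.subspace_def frob_def zero_power)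
  obtain T2 where T2: "vec.subspace T2" "T2 \<subseteq> vec.span T" "vec.dim T2 = 2"
    by (rule vec.choose_subspace_of_subspace[OF assms(2)])
  then have T2: "vec.subspace T2" "T2 \<subseteq> T" "vec.dim T2 = 2"
    using sub by (simp_all add: vec.span_eq_iff[THEN iffD2])
  obtain a b where "T2 = vec.span {a, b}" and ab: "vec.dim {a, b} = 2" "a \<in> T2" "b \<in> T2"
    by (rule obtain_basis2[OF T2(1,3)])
  then have ab: "vec.dim {a, b} = 2" "a \<in> T" "b \<in> T" using T2(2) by auto
  have "\<exists>v\<in>T'. v \<noteq> 0"
  proof (cases "a $ k = 0")
    case True
    then show ?thesis using ab dim2D[OF ab(1), of 1 0] by (auto simp: T'_def)
  next
    case False
    then have "(b $ k) *s a + (- (a $ k)) *s b \<noteq> 0" using dim2D[OF ab(1)] by fastforce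
    moreover have "(b $ k) *s a + (- (a $ k)) *s b \<in> T'"
      using ab vec.subspace_diff[OF sub] vec.subspace_scale[OF sub] by (simp add: T'_def)
    ultimately show ?thesis by blast
  qed
  then obtain y where y: "y \<in> T'" "y \<noteq> 0" "Fr y = y"
    using rational_vector[OF st] by metis
  have "x \<notin> vec.span {y}" using y k by (auto simp: T'_def in_span_1)
  then have "vec.dim {x, y} = 2" using y by (simp add: vec.dim_insert)
  with that y show thesis by (auto simp: T'_def)
qed

subsection \<open>The alternating forms of the system\<close>

lemma D_zero [simp]: "D 0 x = 0" "D x 0 = 0"
  using D_scale_left[of 0 0 x] D_scale_right[of x 0 0] by simp_all

lemma D_swap: "D x y = - D y x"
proof -
  have "D (x + y) (x + y) = 0" by (rule D_self)
  then show ?thesis unfolding D_add_left D_add_right by (simp add: eq_neg_iff_add_eq_0 add.commute)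
qed

lemma D_minus: "D (- x) y = - D x y" "D x (- y) = - D x y"
  using D_scale_left[of "-1" x y] D_scale_right[of x "-1" y] by simp_all

lemma D_diff: "D (x - y) z = D x z - D y z" "D z (x - y) = D z x - D z y"
  using D_add_left[of x "- y" z] D_add_right[of z x "- y"] by (simp_all add: D_minus)

lemmas D_simps = D_add_left D_add_right D_scale_left D_scale_right D_minus D_diff

definition form :: "'b ^ 5 \<Rightarrow> 'b ^ 5 \<Rightarrow> 'b ^ 5 \<Rightarrow> 'b" where
  "form c x y = dot c (D x y)"

lemma form_simps:
  "form c (x + y) z = form c x z + form c y z" "form c z (x + y) = form c z x + form c z y"
  "form c (x - y) z = form c x z - form c y z" "form c z (x - y) = form c z x - form c z y"
  "form c (k *s x) z = k * form c x z" "form c z (k *s x) = k * form c z x"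
  "form c (- x) z = - form c x z" "form c z (- x) = - form c z x"
  "form (c + c') x y = form c x y + form c' x y" "form (c - c') x y = form c x y - form c' x y"
  "form (k *s c) x y = k * form c x y"
  by (simp_all add: form_def D_simps dot_simps)

lemma form_zero [simp]: "form c 0 y = 0" "form c x 0 = 0" "form c x x = 0" "form 0 x y = 0"
  by (simp_all add: form_def)

lemma form_swap: "form c x y = - form c y x"
  unfolding form_def by (subst D_swap) (simp add: dot_simps)

lemma form_Fr: "form (Fr c) (Fr x) (Fr y) = form c x y ^ q"
  by (simp add: form_def D_frob dot_Fr)

lemma form_functional: "\<exists>a. \<forall>y. form c x y = dot a y"
proof -
  define a :: "'b ^ 5" where "a = (\<chi> i. form c x (axis i 1))"
  have "form c x y = dot a y" for y
  proof -
    have "y = (\<Sum>i\<in>UNIV. y $ i *s axis i 1)" by (simp add: basis_expansion)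
    then have "form c x y = form c x (\<Sum>i\<in>UNIV. y $ i *s axis i 1)" by simp
    also have "\<dots> = (\<Sum>i\<in>UNIV. y $ i * form c x (axis i 1))"
    proof -
      have "form c x (\<Sum>i\<in>A. y $ i *s axis i 1) = (\<Sum>i\<in>A. y $ i * form c x (axis i 1))" for A
        by (induction A rule: infinite_finite_induct) (auto simp: form_simps)
      then show ?thesis .
    qed
    finally show ?thesis by (simp add: a_def scalar_product_def mult.commute)
  qed
  then show ?thesis by blast
qed

definition fnl :: "'b ^ 5 \<Rightarrow> 'b ^ 5 \<Rightarrow> 'b ^ 5" where
  "fnl c x = (SOME a. \<forall>y. form c x y = dot a y)"

lemma dot_fnl: "dot (fnl c x) y = form c x y"
  unfolding fnl_def using someI_ex[OF form_functional[of c x]] by (rule allE) (rule sym)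

definition rad :: "'b ^ 5 \<Rightarrow> ('b ^ 5) set" where
  "rad c = {x. \<forall>y. form c x y = 0}"

lemma subspace_rad [simp]: "vec.subspace (rad c)"
  by (auto simp: vec.subspace_def rad_def form_simps)

lemma stable_rad: "Fr c = c \<Longrightarrow> stable (rad c)"
  unfolding stable_def
proof (intro conjI ballI)
  fix x assume c: "Fr c = c" and x: "x \<in> rad c"
  have "form c (Fr x) y = 0" for y
  proof -
    obtain y' where y': "Fr y' = y" using Fr_surj by blast
    have "form (Fr c) (Fr x) (Fr y') = 0" using x by (simp only: form_Fr) (simp add: rad_def)
    then show ?thesis by (simp add: c y')
  qed
  then show "Fr x \<in> rad c" by (simp add: rad_def)
qed simp

text \<open>Two orthogonal hyperbolic planes: each of the four functionals is nonzero at exactly one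
  of \<open>u\<close>, \<open>v\<close>, \<open>t\<close>, \<open>t'\<close>, namely at its partner,
  so the four are independent.\<close>

lemma two_planes_radical:
  assumes "form c u v \<noteq> 0" "form c u t = 0" "form c v t = 0" "form c u t' = 0" "form c v t' = 0"
    "form c t t' \<noteq> 0"
  shows "vec.dim (perp {fnl c u, fnl c v, fnl c t, fnl c t'}) = 1"
proof -
  have sw: "form c v u \<noteq> 0" "form c t u = 0" "form c t v = 0" "form c t' u = 0" "form c t' v = 0"
    "form c t' t \<noteq> 0"
    using assms form_swap by (metis neg_equal_0_iff_equal)+
  have "fnl c t' \<noteq> 0" using sw(6) dot_fnl[of c t' t] by auto
  moreover have "fnl c t \<notin> vec.span {fnl c t'}"
    by (rule not_in_span_dot[of _ t']) (use assms sw in \<open>auto simp: dot_fnl\<close>)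
  moreover have "fnl c v \<notin> vec.span {fnl c t, fnl c t'}"
    by (rule not_in_span_dot[of _ u]) (use assms sw in \<open>auto simp: dot_fnl\<close>)
  moreover have "fnl c u \<notin> vec.span {fnl c v, fnl c t, fnl c t'}"
    by (rule not_in_span_dot[of _ v]) (use assms sw in \<open>auto simp: dot_fnl\<close>)
  ultimately show ?thesis by (simp add: dim_perp vec.dim_insert)
qed

lemma plane_split:
  assumes "form c u v \<noteq> 0"
  obtains \<alpha> \<beta> t where "y = \<alpha> *s u + \<beta> *s v + t" "form c u t = 0" "form c v t = 0"
proof -
  define \<alpha> where "\<alpha> = form c y v / form c u v"
  define \<beta> where "\<beta> = form c u y / form c u v"
  define t where "t = y - \<alpha> *s u - \<beta> *s v"
  have "form c v u = - form c u v" "form c v y = - form c y v" by (rule form_swap)+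
  then have "form c u t = 0" "form c v t = 0"
    using assms by (simp_all add: t_def \<alpha>_def \<beta>_def form_simps)
  moreover have "y = \<alpha> *s u + \<beta> *s v + t" by (simp add: t_def)
  ultimately show thesis using that by blast
qed

text \<open>Alternating forms in odd dimension are degenerate. Either the orthogonal complement of
  one hyperbolic plane is totally isotropic, or a second plane splits off and the line orthogonal to
  both planes is the radical.\<close>

lemma rad_nonzero: "\<exists>x\<in>rad c. x \<noteq> 0"
proof (cases "\<exists>u v. form c u v \<noteq> 0")
  case False
  then show ?thesis by (intro bexI[of _ "axis 1 1"]) (auto simp: rad_def)
next
  case True
  then obtain u v where uv: "form c u v \<noteq> 0" by blast
  have vu: "form c v u \<noteq> 0" using uv form_swap[of c v u] by simp
  have d2: "vec.dim {fnl c u, fnl c v} \<le> 2" by (simp add: vec.dim_insert)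
  show ?thesis
  proof (cases "\<exists>t t'. form c u t = 0 \<and> form c v t = 0 \<and> form c u t' = 0 \<and> form c v t' = 0
      \<and> form c t t' \<noteq> 0")
    case False
    obtain x where x: "x \<noteq> 0" "\<And>y. y \<in> {fnl c u, fnl c v} \<Longrightarrow> dot x y = 0"
      using perp_nonzero[of "{fnl c u, fnl c v}"] d2 by auto
    have xu: "form c u x = 0" "form c v x = 0"
      using x(2)[of "fnl c u"] x(2)[of "fnl c v"] by (simp_all add: dot_commute[of x] dot_fnl)
    have "form c x y = 0" for y
    proof -
      obtain \<alpha> \<beta> t where "y = \<alpha> *s u + \<beta> *s v + t" "form c u t = 0" "form c v t = 0"
        using plane_split[OF uv] by blast
      then show ?thesis using False xu form_swap[of c x u] form_swap[of c x v]
        by (auto simp: form_simps)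
    qed
    with x show ?thesis by (auto simp: rad_def)
  next
    case True
    then obtain t t' where t: "form c u t = 0" "form c v t = 0" "form c u t' = 0" "form c v t' = 0"
      "form c t t' \<noteq> 0" by blast
    let ?S = "{fnl c u, fnl c v, fnl c t, fnl c t'}"
    have d: "vec.dim (perp ?S) = 1" by (rule two_planes_radical) (use uv t in auto)
    obtain x where x: "x \<noteq> 0" "x \<in> perp ?S"
      using d by (metis vec.dim_eq_0 subsetI insertCI zero_neq_one)
    have span: "perp ?S \<subseteq> vec.span {x}"
    proof -
      have "vec.span {x} = perp ?S"
        by (rule vec.subspace_dim_equal) (use x d in \<open>auto simp: in_span_1 vec.subspace_scale\<close>)
      then show ?thesis by simp
    qed
    have x0: "form c u x = 0" "form c v x = 0" "form c t x = 0" "form c t' x = 0"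
      using x(2) by (auto simp: perp_iff dot_commute[of x] dot_fnl)
    have "form c x y = 0" for y
    proof -
      obtain \<alpha> \<beta> s where s: "y = \<alpha> *s u + \<beta> *s v + s" "form c u s = 0" "form c v s = 0"
        using plane_split[OF uv] by blast
      obtain \<gamma> \<delta> r where r: "s = \<gamma> *s t + \<delta> *s t' + r" "form c t r = 0" "form c t' r = 0"
        using plane_split[OF t(5)] by blast
      have "form c u r = 0" "form c v r = 0" using r s t by (auto simp: form_simps)
      then have "r \<in> perp ?S" using r by (auto simp: perp_iff dot_commute[of r] dot_fnl)
      then obtain k where "r = k *s x" using span in_span_1[of r x] by blast
      then show ?thesis
        using x0 form_swap[of c x] by (simp add: s(1) r(1) form_simps)
    qed
    with x show ?thesis by (auto simp: rad_def)
  qed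
qed

subsection \<open>Rational forms have rank four\<close>

lemma finite_rational: "finite {x. Fr x = x}"
proof -
  have "finite {x::'b. x ^ q = x}"
  proof -
    let ?p = "Polynomial.monom 1 q - Polynomial.monom 1 1 :: 'b poly"
    have "Polynomial.coeff ?p q = 1" using q_ge_2 by simp
    then have "?p \<noteq> 0" by (metis coeff_0 zero_neq_one)
    from poly_roots_finite[OF this] show ?thesis by (simp add: poly_monom)
  qed
  then have "finite {f :: 5 \<Rightarrow> 'b. \<forall>i. f i \<in> {x. x ^ q = x}}"
    using finite_set_of_finite_funs[of "UNIV :: 5 set" "{x::'b. x ^ q = x}" undefined] by simp
  then have "finite ((\<lambda>f. \<chi> i. f i) ` {f :: 5 \<Rightarrow> 'b. \<forall>i. f i \<in> {x. x ^ q = x}})" by simp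
  moreover have "{x. Fr x = x} \<subseteq> (\<lambda>f. \<chi> i. f i) ` {f :: 5 \<Rightarrow> 'b. \<forall>i. f i \<in> {x. x ^ q = x}}"
  proof
    fix x :: "'b ^ 5" assume "x \<in> {x. Fr x = x}"
    then show "x \<in> (\<lambda>f. \<chi> i. f i) ` {f. \<forall>i. f i \<in> {x. x ^ q = x}}"
      by (intro image_eqI[where x = "vec_nth x"]) (auto simp: frob_def vec_eq_iff)
  qed
  ultimately show ?thesis by (rule finite_subset[rotated])
qed

lemma rational_line_card:
  assumes "Fr x = x" "x \<noteq> 0"
  shows "card {y. y \<in> vec.span {x} \<and> Fr y = y \<and> y \<noteq> 0} = card {k::'b. k ^ q = k \<and> k \<noteq> 0}"
proof -
  have "{y. y \<in> vec.span {x} \<and> Fr y = y \<and> y \<noteq> 0} = (\<lambda>k. k *s x) ` {k::'b. k ^ q = k \<and> k \<noteq> 0}"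
    using assms by (auto simp: in_span_1 Fr_scale)
  moreover have "inj_on (\<lambda>k. k *s x) A" for A using assms by (auto simp: inj_on_def)
  ultimately show ?thesis by (simp add: card_image)
qed

text \<open>The kernel of \<open>D x\<close> is stable. If it were larger than the line of
  \<open>x\<close>, it would contain a second rational vector and violate
  \<open>no_rational_zero\<close>.\<close>

lemma kernel_D_rational:
  assumes "Fr x = x" "x \<noteq> 0"
  shows "D x y = 0 \<longleftrightarrow> y \<in> vec.span {x}"
proof
  let ?K = "{y. D x y = 0}"
  have st: "stable ?K"
    using D_frob[of x] assms by (auto simp: stable_def vec.subspace_def D_simps)
  have "\<not> 2 \<le> vec.dim ?K"
  proof
    assume "2 \<le> vec.dim ?K"
    from rational_vector_2[OF st this assms(2)] obtain y
      where "D x y = 0" "Fr y = y" "vec.dim {x, y} = 2" by auto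
    with no_rational_zero assms show False by blast
  qed
  then have "vec.dim ?K \<le> vec.dim {x}" using assms by simp
  moreover have "vec.span {x} \<subseteq> ?K" by (auto simp: in_span_1 D_simps)
  ultimately have "vec.span {x} = ?K"
    using st by (intro vec.subspace_dim_equal) (auto simp: stable_def)
  then show "D x y = 0 \<Longrightarrow> y \<in> vec.span {x}" by blast
qed (auto simp: in_span_1 D_simps)

lemma dim_range_D:
  assumes "Fr x = x" "x \<noteq> 0"
  shows "vec.dim (range (D x)) = 4"
proof -
  obtain c where c: "dot c x = 1" using separating_functional[of x "{}"] assms by auto
  have lin: "Vector_Spaces.linear (*s) (*s) (D x)"
    by unfold_locales (auto simp: D_simps)
  have T: "vec.subspace (perp {c})" "vec.dim (perp {c}) = 4"
    using c by (auto simp: dim_perp vec.dim_insert)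
  have "inj_on (D x) (perp {c})"
  proof (rule inj_onI)
    fix y z assume yz: "y \<in> perp {c}" "z \<in> perp {c}" "D x y = D x z"
    have "y - z \<in> vec.span {x}"
      unfolding kernel_D_rational[OF assms, symmetric] using yz by (simp add: D_simps)
    then obtain k where k: "y - z = k *s x" by (auto simp: in_span_1)
    have "dot c (y - z) = 0" using yz by (simp add: perp_iff dot_simps dot_commute[of _ c])
    then have "k = 0" using c by (simp add: k dot_simps)
    with k show "y = z" by simp
  qed
  then have "vec.dim (D x ` perp {c}) = 4"
    using vec.dim_image_eq[OF lin, of "perp {c}"] T by (metis vec.span_eq_iff)
  moreover have "range (D x) = D x ` perp {c}"
  proof -
    have "D x y \<in> D x ` perp {c}" for y
    proof (rule image_eqI)
      show "D x y = D x (y - dot c y *s x)" by (simp add: D_simps)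
      show "y - dot c y *s x \<in> perp {c}"
        using c by (simp add: perp_iff dot_simps dot_commute[of _ c])
    qed
    then show ?thesis by auto
  qed
  ultimately show ?thesis by simp
qed

text \<open>Count pairs of nonzero rational vectors \<open>(x, d)\<close> with
  \<open>x \<in> rad d\<close>. Each \<open>x\<close> has exactly \<open>m\<close> partners, because
  \<open>range (D x)\<close> is a rational hyperplane and its annihilator a rational line. Each
  \<open>d\<close> has at least \<open>m\<close> partners, because its radical contains a rational
  line. The totals agree, so no \<open>d\<close> can have more, as a two-dimensional radical would
  require.\<close>

lemma dim_rad_rational:
  assumes "Fr c = c" "c \<noteq> 0"
  shows "vec.dim (rad c) \<le> 1"
proof (rule ccontr)
  assume "\<not> vec.dim (rad c) \<le> 1"
  then have dim: "2 \<le> vec.dim (rad c)" by simp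
  define R where "R = {x::'b ^ 5. Fr x = x \<and> x \<noteq> 0}"
  define m where "m = card {k::'b. k ^ q = k \<and> k \<noteq> 0}"
  have finR: "finite R" using finite_rational by (auto simp: R_def)
  have 1: "card {d \<in> R. x \<in> rad d} = m" if x: "x \<in> R" for x
  proof -
    have x': "Fr x = x" "x \<noteq> 0" using x by (auto simp: R_def)
    have eq: "x \<in> rad d \<longleftrightarrow> d \<in> perp (range (D x))" for d
      by (auto simp: rad_def perp_iff form_def)
    have st: "stable (range (D x))"
    proof -
      have "vec.subspace (range (D x))"
        by (rule vec.subspaceI)
          (metis D_zero(2) rangeI, (auto simp flip: D_add_right D_scale_right)[2])
      moreover have "Fr (D x y) = D x (Fr y)" for y using D_frob[of x y] x' by simp
      ultimately show ?thesis by (auto simp: stable_def)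
    qed
    have d1: "vec.dim (perp (range (D x))) = 1"
      using dim_range_D[OF x'] by (simp add: dim_perp)
    then obtain v where "v \<in> perp (range (D x))" "v \<noteq> 0"
      by (metis vec.dim_eq_0 subsetI insertCI zero_neq_one)
    then obtain d where d: "d \<in> perp (range (D x))" "d \<noteq> 0" "Fr d = d"
      using rational_vector[OF stable_perp[OF st]] by blast
    have "vec.span {d} = perp (range (D x))"
      by (rule vec.subspace_dim_equal) (use d d1 in \<open>auto simp: in_span_1 vec.subspace_scale\<close>)
    then have "{d' \<in> R. x \<in> rad d'} = {y. y \<in> vec.span {d} \<and> Fr y = y \<and> y \<noteq> 0}"
      by (auto simp: R_def eq)
    with rational_line_card[OF d(3,2)] show ?thesis by (simp add: m_def)
  qed
  have 2: "m \<le> card {x \<in> R. x \<in> rad d}" if d: "d \<in> R" for d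
  proof -
    obtain v where "v \<in> rad d" "v \<noteq> 0" using rad_nonzero by blast
    then obtain x where x: "x \<in> rad d" "x \<noteq> 0" "Fr x = x"
      using rational_vector[OF stable_rad] d by (auto simp: R_def)
    then have "{y. y \<in> vec.span {x} \<and> Fr y = y \<and> y \<noteq> 0} \<subseteq> {x \<in> R. x \<in> rad d}"
      by (auto simp: R_def in_span_1 vec.subspace_scale)
    from card_mono[OF _ this] show ?thesis
      using rational_line_card[OF x(3,2)] finR by (simp add: m_def)
  qed
  have 3: "m < card {x \<in> R. x \<in> rad c}"
  proof -
    obtain v where "v \<in> rad c" "v \<noteq> 0" using rad_nonzero by blast
    then obtain x where x: "x \<in> rad c" "x \<noteq> 0" "Fr x = x"
      using rational_vector[OF stable_rad] assms by (auto simp: R_def)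
    obtain y where y: "y \<in> rad c" "Fr y = y" "vec.dim {x, y} = 2"
      using rational_vector_2[OF stable_rad[OF assms(1)] dim x(2)] by blast
    have "y \<notin> vec.span {x}" "y \<noteq> 0"
      using y(3) by (auto simp: insert_commute[of x] vec.dim_insert vec.span_zero split: if_splits)
    then have "{y. y \<in> vec.span {x} \<and> Fr y = y \<and> y \<noteq> 0} \<subset> {x \<in> R. x \<in> rad c}"
      using x y by (auto simp: R_def in_span_1 vec.subspace_scale)
    from psubset_card_mono[OF _ this] show ?thesis
      using rational_line_card[OF x(3,2)] finR by (simp add: m_def)
  qed
  have "(\<Sum>x\<in>R. card {d \<in> R. x \<in> rad d}) = (\<Sum>d\<in>R. card {x \<in> R. x \<in> rad d})"
    by (rule sum_multicount_gen[OF finR finR, simplified]) auto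
  moreover have "(\<Sum>x\<in>R. card {d \<in> R. x \<in> rad d}) = (\<Sum>d\<in>R. m)"
    using 1 by simp
  moreover have "(\<Sum>d\<in>R. m) < (\<Sum>d\<in>R. card {x \<in> R. x \<in> rad d})"
    by (rule sum_strict_mono_ex1[OF finR]) (use 2 3 assms in \<open>auto simp: R_def\<close>)
  ultimately show False by simp
qed

end

lemma span2_eq_of_dim:
  fixes a b :: "'b::field ^ 'n"
  assumes "x \<in> vec.span {a, b}" "y \<in> vec.span {a, b}" "vec.dim {x, y} = 2"
  shows "vec.span {a, b} = vec.span {x, y}"
proof (rule sym, rule vec.subspace_dim_equal)
  have "vec.dim {a, b} \<le> 2" by (simp add: vec.dim_insert)
  then show "vec.dim (vec.span {a, b}) \<le> vec.dim (vec.span {x, y})" using assms by simp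
  show "vec.span {x, y} \<subseteq> vec.span {a, b}" by (rule vec.span_minimal) (use assms in auto)
qed auto

context alternating_system
begin

subsection \<open>The curve and its dual\<close>

definition curve :: "('b ^ 5) set set" where
  "curve = {V. \<exists>x y. V = vec.span {x, y} \<and> vec.dim {x, y} = 2 \<and> D x y = 0}"

text \<open>A form of rank two in the system, that is, a point of the dual curve. Only the span of
  \<open>a\<close> and \<open>b\<close> is intrinsic: a change of basis of determinant one gives the
  same form.\<close>

definition dual_pt :: "'b ^ 5 \<Rightarrow> 'b ^ 5 \<Rightarrow> 'b ^ 5 \<Rightarrow> bool" where
  "dual_pt c a b \<longleftrightarrow> c \<noteq> 0 \<and> (\<forall>x y. form c x y = wedge a b x y)"

lemma curveI: "vec.dim {x, y} = 2 \<Longrightarrow> D x y = 0 \<Longrightarrow> vec.span {x, y} \<in> curve"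
  by (auto simp: curve_def)

lemma curveE:
  assumes "V \<in> curve"
  obtains x y where "V = vec.span {x, y}" "vec.dim {x, y} = 2" "D x y = 0"
  using assms by (auto simp: curve_def)

lemma curve_subspace: "V \<in> curve \<Longrightarrow> vec.subspace V"
  and curve_dim: "V \<in> curve \<Longrightarrow> vec.dim V = 2"
  by (auto simp: curve_def)

lemma curve_D: "V \<in> curve \<Longrightarrow> x \<in> V \<Longrightarrow> y \<in> V \<Longrightarrow> D x y = 0"
proof (elim curveE)
  fix u v assume V: "V = vec.span {u, v}" "D u v = 0" "x \<in> V" "y \<in> V"
  then obtain r s r' s' where "x = r *s u + s *s v" "y = r' *s u + s' *s v"
    by (metis in_span_2)
  then show ?thesis using V(2) D_swap[of v u] by (simp add: D_simps)
qed

lemma curve_span_eq: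
  assumes "V \<in> curve" "x \<in> V" "y \<in> V" "vec.dim {x, y} = 2"
  shows "V = vec.span {x, y}"
  using subspace_dim2_span[OF curve_subspace[OF assms(1)] curve_dim[OF assms(1)]] assms by blast

lemma curve_Fr: "V \<in> curve \<Longrightarrow> Fr ` V \<in> curve"
proof (elim curveE)
  fix x y assume V: "V = vec.span {x, y}" "vec.dim {x, y} = 2" "D x y = 0"
  then have "Fr ` V = vec.span {Fr x, Fr y}" by (simp add: Fr_image_span)
  moreover have "vec.dim {Fr x, Fr y} = 2" using dim_Fr[of "{x, y}"] V by simp
  moreover have "D (Fr x) (Fr y) = 0" using V by (simp add: D_frob)
  ultimately show ?thesis by (auto simp: curve_def)
qed

text \<open>By descent such a space would contain two independent rational vectors \<open>x\<close>,
  \<open>y\<close> with \<open>D x y = 0\<close>.\<close>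

lemma stable_isotropic:
  assumes "stable T" "2 \<le> vec.dim T" "\<And>x y. x \<in> T \<Longrightarrow> y \<in> T \<Longrightarrow> D x y = 0"
  shows False
proof -
  have "T \<noteq> {0}" "0 \<in> T" using assms(1,2) vec.subspace_0 by (auto simp: stable_def)
  then obtain v where "v \<in> T" "v \<noteq> 0" by blast
  then obtain x where x: "x \<in> T" "x \<noteq> 0" "Fr x = x" by (rule rational_vector[OF assms(1)])
  obtain y where "y \<in> T" "Fr y = y" "vec.dim {x, y} = 2"
    by (rule rational_vector_2[OF assms(1,2) x(2)])
  with assms(3) x no_rational_zero show False by blast
qed

lemma curve_not_stable: "V \<in> curve \<Longrightarrow> Fr ` V \<noteq> V"
  using stable_isotropic[of V] curve_subspace curve_dim curve_D
  by (metis imageI le_refl stable_def)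

text \<open>If a Frobenius-stable line lies on some member of the curve, all vectors annihilated by its
  rational generator form a rational space of dimension at least two.\<close>

lemma curve_no_stable_line:
  assumes "V \<in> curve" "x \<in> V" "x \<noteq> 0" "Fr x = k *s x"
  shows False
proof -
  have "stable (vec.span {x})" by (rule stable_span) (auto simp: assms(4) in_span_1)
  then obtain y where y: "y \<in> vec.span {x}" "y \<noteq> 0" "Fr y = y"
    by (rule rational_vector[of _ x]) (auto simp: assms vec.span_base)
  have "y \<in> V" using y(1) assms(2) curve_subspace[OF assms(1)]
    by (auto simp: in_span_1 vec.subspace_scale)
  then have "V \<subseteq> vec.span {y}"
    using kernel_D_rational[OF y(3,2)] curve_D[OF assms(1)] by blast
  from vec.dim_mono[OF this] show False using curve_dim[OF assms(1)] y(2) by simp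
qed

text \<open>The vectors \<open>c\<close> with zero form make a stable space; a rational one would
  have the whole space as radical. This is the source of the linear independence of the conjugates
  of \<open>a \<and> b\<close>.\<close>

lemma form_nondegenerate:
  assumes "c \<noteq> 0"
  shows "\<exists>x y. form c x y \<noteq> 0"
proof (rule ccontr)
  assume *: "\<not> ?thesis"
  let ?T = "{c. \<forall>x y. form c x y = 0}"
  have "stable ?T"
    unfolding stable_def
  proof (intro conjI ballI)
    show "vec.subspace ?T" by (auto simp: vec.subspace_def form_simps)
    fix c assume c: "c \<in> ?T"
    have "form (Fr c) x y = 0" for x y
    proof -
      obtain x' y' where "Fr x' = x" "Fr y' = y" using Fr_surj by metis
      then show ?thesis using c form_Fr[of c x' y'] by (simp add: zero_power)
    qed
    then show "Fr c \<in> ?T" by simp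
  qed
  then obtain d where d: "d \<in> ?T" "d \<noteq> 0" "Fr d = d"
    by (rule rational_vector[of _ c]) (use * assms in auto)
  then have "rad d = UNIV" by (auto simp: rad_def)
  then show False using dim_rad_rational[OF d(3,2)] by (simp add: vec_dim_card del: vec.dim_UNIV)
qed

lemma dual_pt_dim: "dual_pt c a b \<Longrightarrow> vec.dim {a, b} = 2"
proof -
  assume d: "dual_pt c a b"
  then obtain x y where xy: "wedge a b x y \<noteq> 0"
    using form_nondegenerate by (metis dual_pt_def)
  show ?thesis unfolding dim2_iff
  proof (intro allI impI)
    fix r s assume e: "r *s a + s *s b = 0"
    have ex: "r * dot a z = - (s * dot b z)" for z
      using arg_cong[OF e, of "\<lambda>v. dot v z"] by (simp add: dot_simps eq_neg_iff_add_eq_0)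
    have "r * wedge a b x y = (r * dot a x) * dot b y - (r * dot a y) * dot b x"
      by (simp add: wedge_def algebra_simps)
    also have "\<dots> = 0" unfolding ex by simp
    finally have "r = 0" using xy by simp
    have "s * wedge a b x y = dot a x * (s * dot b y) - dot a y * (s * dot b x)"
      by (simp add: wedge_def algebra_simps)
    also have "\<dots> = 0" using ex[of x] ex[of y] \<open>r = 0\<close> by auto
    finally show "r = 0 \<and> s = 0" using xy \<open>r = 0\<close> by simp
  qed
qed

lemma dual_pt_rad:
  assumes "dual_pt c a b"
  shows "rad c = perp {a, b}"
proof
  show "perp {a, b} \<subseteq> rad c"
    using assms by (auto simp: rad_def perp_iff dual_pt_def wedge_def dot_commute)
  show "rad c \<subseteq> perp {a, b}"
  proof
    fix x assume x: "x \<in> rad c"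
    have d: "vec.dim {a, b} = 2" "vec.dim {b, a} = 2"
      using dual_pt_dim[OF assms] by (simp_all add: insert_commute)
    then have "a \<notin> vec.span {b}" "b \<notin> vec.span {a}" by (auto simp: vec.dim_insert split: if_splits)
    then obtain y z where y: "dot y a = 1" "dot y b = 0" and z: "dot z b = 1" "dot z a = 0"
      by (metis separating_functional singletonI)
    have "wedge a b x y = 0" "wedge a b x z = 0" using x assms by (auto simp: rad_def dual_pt_def)
    then show "x \<in> perp {a, b}"
      using y z by (auto simp: wedge_def perp_iff dot_commute[of x] dot_commute[of y] dot_commute[of z])
  qed
qed

lemma dual_pt_Fr: "dual_pt c a b \<Longrightarrow> dual_pt (Fr c) (Fr a) (Fr b)"
  unfolding dual_pt_def
proof (intro conjI allI)
  assume d: "c \<noteq> 0 \<and> (\<forall>x y. form c x y = wedge a b x y)"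
  then show "Fr c \<noteq> 0" by simp
  fix x y
  obtain x' y' where "Fr x' = x" "Fr y' = y" using Fr_surj by metis
  then show "form (Fr c) x y = wedge (Fr a) (Fr b) x y"
    using form_Fr[of c x' y'] d
    by (simp add: wedge_def power_q_diff power_mult_distrib flip: dot_Fr)
qed

lemma rational_not_large_radical:
  assumes "stable T" "c \<in> T" "c \<noteq> 0" "\<And>d. d \<in> T \<Longrightarrow> 2 \<le> vec.dim (rad d)"
  shows False
proof -
  obtain d where "d \<in> T" "d \<noteq> 0" "Fr d = d" by (rule rational_vector[OF assms(1-3)])
  then show False using dim_rad_rational[of d] assms(4)[of d] by simp
qed

text \<open>With \<open>dot w z = 1\<close> every vector is a multiple of \<open>z\<close> plus a
  vector of the hyperplane, and expanding along this splitting gives the form as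
  \<open>w \<and> fnl c z\<close>.\<close>

lemma isotropic_hyperplane_dual:
  assumes "c \<noteq> 0" "w \<noteq> 0" "\<And>x y. dot w x = 0 \<Longrightarrow> dot w y = 0 \<Longrightarrow> form c x y = 0"
  obtains w' where "dual_pt c w w'"
proof -
  obtain z where z: "dot z w = 1" using separating_functional[of w "{}"] assms by auto
  then have z: "dot w z = 1" by (simp add: dot_commute)
  have "form c x y = wedge w (fnl c z) x y" for x y
  proof -
    define h where "h = x - dot w x *s z"
    define h' where "h' = y - dot w y *s z"
    have "form c h h' = 0" by (rule assms(3)) (simp_all add: h_def h'_def dot_simps z)
    then show ?thesis
      using form_swap[of c x z]
      by (simp add: h_def h'_def form_simps wedge_def dot_fnl algebra_simps)
  qed
  then show thesis using that assms(1) by (auto simp: dual_pt_def)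
qed

text \<open>The forms that vanish on \<open>H\<close> make a stable space. A rational one would have
  rank two, hence a radical of dimension three, against \<open>dim_rad_rational\<close>.\<close>

lemma stable_isotropic_hyperplane:
  assumes "stable H" "vec.dim H = 4" "c \<noteq> 0" "\<And>x y. x \<in> H \<Longrightarrow> y \<in> H \<Longrightarrow> form c x y = 0"
  shows False
proof -
  let ?T = "{c. \<forall>x\<in>H. \<forall>y\<in>H. form c x y = 0}"
  have sub: "Fr ` H \<subseteq> H" "vec.subspace H" using assms(1) by (auto simp: stable_def)
  have FH: "Fr ` H = H"
    by (rule vec.subspace_dim_equal) (use sub in \<open>auto simp: dim_Fr Fr_image_subspace\<close>)
  have st: "stable ?T"
    unfolding stable_def
  proof (intro conjI ballI)
    show "vec.subspace ?T" by (auto simp: vec.subspace_def form_simps)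
    fix c assume c: "c \<in> ?T"
    have "form (Fr c) x y = 0" if "x \<in> H" "y \<in> H" for x y
    proof -
      have "x \<in> Fr ` H" "y \<in> Fr ` H" using that by (simp_all only: FH)
      then obtain x' y' where "x = Fr x'" "y = Fr y'" "x' \<in> H" "y' \<in> H" by (elim imageE)
      then show ?thesis using c by (simp add: form_Fr zero_power)
    qed
    then show "Fr c \<in> ?T" by simp
  qed
  obtain w where w: "w \<noteq> 0" "\<And>x. x \<in> H \<Longrightarrow> dot w x = 0"
    using perp_nonzero[of H] assms(2) by auto
  have Hw: "H = {x. dot w x = 0}"
  proof -
    have "vec.dim (perp {w}) = 4" using w by (simp add: dim_perp vec.dim_insert)
    then have "H = perp {w}"
      using sub w assms(2) by (intro vec.subspace_dim_equal) (auto simp: perp_iff dot_commute)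
    then show ?thesis by (auto simp: perp_iff dot_commute)
  qed
  obtain d where d: "d \<in> ?T" "d \<noteq> 0" "Fr d = d"
    by (rule rational_vector[OF st, of c]) (use assms in auto)
  obtain w' where "dual_pt d w w'"
    by (rule isotropic_hyperplane_dual[OF d(2) w(1)]) (use d(1) Hw in auto)
  then have "vec.dim (rad d) = 3"
    using dual_pt_rad dual_pt_dim by (simp add: dim_perp)
  then show False using dim_rad_rational[OF d(3,2)] by simp
qed

lemma stable_in_radical:
  assumes "stable Y" "2 \<le> vec.dim Y" "c \<noteq> 0" "Y \<subseteq> rad c"
  shows False
proof -
  let ?T = "{c. Y \<subseteq> rad c}"
  have sub: "Fr ` Y \<subseteq> Y" "vec.subspace Y" using assms(1) by (auto simp: stable_def)
  have FY: "Fr ` Y = Y"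
    by (rule vec.subspace_dim_equal) (use sub in \<open>auto simp: dim_Fr Fr_image_subspace\<close>)
  have st: "stable ?T"
    unfolding stable_def
  proof (intro conjI ballI)
    show "vec.subspace ?T" by (auto simp: vec.subspace_def form_simps rad_def subset_iff)
    fix c assume c: "c \<in> ?T"
    have "form (Fr c) x y = 0" if "x \<in> Y" for x y
    proof -
      have "x \<in> Fr ` Y" using that by (simp only: FY)
      then obtain x' where x': "x = Fr x'" "x' \<in> Y" by (rule imageE)
      obtain y' where "y = Fr y'" using Fr_surj by metis
      then show ?thesis using c x' by (auto simp: form_Fr zero_power rad_def)
    qed
    then show "Fr c \<in> ?T" by (auto simp: rad_def)
  qed
  have "2 \<le> vec.dim (rad d)" if "d \<in> ?T" for d
    using that vec.dim_subset[of Y "rad d"] assms(2) by simp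
  then show False using rational_not_large_radical[OF st, of c] assms by blast
qed

text \<open>The form \<open>a \<and> b\<close> vanishes on the two-dimensional \<open>V\<close>, so
  the restrictions of \<open>a\<close> and \<open>b\<close> to \<open>V\<close> are dependent. The
  functional found here is the value of \<open>V\<close> under the double cover attached to
  \<open>c\<close>.\<close>

lemma functional_killing:
  assumes "dual_pt c a b" "V \<in> curve"
  obtains w where "w \<in> vec.span {a, b}" "w \<noteq> 0" "w \<in> perp V"
proof -
  obtain x y where V: "V = vec.span {x, y}" "D x y = 0" by (rule curveE[OF assms(2)])
  have "form c x y = 0" using V by (simp add: form_def)
  then have w0: "wedge a b x y = 0" using assms by (simp add: dual_pt_def)
  have ab: "vec.dim {a, b} = 2" by (rule dual_pt_dim[OF assms(1)])
  note result = that
  have fin: thesis if "r \<noteq> 0 \<or> s \<noteq> 0" "r * dot a x + s * dot b x = 0" "r * dot a y + s * dot b y = 0"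
    for r s
  proof (rule result[of "r *s a + s *s b"])
    show "r *s a + s *s b \<in> vec.span {a, b}" by (auto simp: in_span_2)
    show "r *s a + s *s b \<noteq> 0" using dim2D[OF ab] that by blast
    show "r *s a + s *s b \<in> perp V"
      using that unfolding V perp_span by (simp add: perp_iff dot_simps)
  qed
  consider "dot b x \<noteq> 0 \<or> dot a x \<noteq> 0" | "dot b x = 0" "dot a x = 0" "dot b y \<noteq> 0 \<or> dot a y \<noteq> 0"
    | "dot b x = 0" "dot a x = 0" "dot b y = 0" "dot a y = 0" by blast
  then show thesis
  proof cases
    case 1
    then show ?thesis using w0
      by (intro fin[of "dot b x" "- dot a x"]) (auto simp: wedge_def algebra_simps)
  next
    case 2
    then show ?thesis by (intro fin[of "dot b y" "- dot a y"]) auto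
  next
    case 3
    then show ?thesis by (intro fin[of 1 0]) auto
  qed
qed

text \<open>In three dimensions every bivector is decomposable, so a linear relation between the
  three values of \<open>D\<close> comes from an isotropic pair.\<close>

lemma curve_from_bivector:
  assumes dim: "vec.dim {u1, u2, u3} = 3" and nz: "\<alpha> \<noteq> 0 \<or> \<beta> \<noteq> 0 \<or> \<gamma> \<noteq> 0"
    and zero: "\<alpha> *s D u2 u3 + \<beta> *s D u3 u1 + \<gamma> *s D u1 u2 = 0"
  obtains V where "V \<in> curve" "V \<subseteq> vec.span {u1, u2, u3}"
proof -
  have *: "\<exists>V\<in>curve. V \<subseteq> vec.span {u1, u2, u3}"
    if "vec.dim {u1, u2, u3} = 3" "\<alpha> \<noteq> 0" "\<alpha> *s D u2 u3 + \<beta> *s D u3 u1 + \<gamma> *s D u1 u2 = 0"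
    for u1 u2 u3 \<alpha> \<beta> \<gamma>
  proof -
    define x where "x = \<alpha> *s u2 - \<beta> *s u1"
    define y where "y = \<alpha> *s u3 - \<gamma> *s u1"
    have "D x y = \<alpha> *s (\<alpha> *s D u2 u3 + \<beta> *s D u3 u1 + \<gamma> *s D u1 u2)"
      using D_swap[of u2 u1] D_swap[of u1 u3]
      by (simp add: x_def y_def D_simps vec_eq_iff algebra_simps)
    then have D0: "D x y = 0" using that by simp
    have u: "u3 \<noteq> 0" "u2 \<notin> vec.span {u3}" "u1 \<notin> vec.span {u2, u3}"
      using that(1) by (auto simp: vec.dim_insert split: if_splits)
    have "vec.dim {x, y} = 2"
      unfolding dim2_iff
    proof (intro allI impI)
      fix r s assume e: "r *s x + s *s y = 0"
      have e': "(r * \<beta> + s * \<gamma>) *s u1 = (r * \<alpha>) *s u2 + (s * \<alpha>) *s u3"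
        using e by (simp add: x_def y_def vec_eq_iff algebra_simps)
      have "r * \<beta> + s * \<gamma> = 0"
      proof (rule ccontr)
        assume nz: "r * \<beta> + s * \<gamma> \<noteq> 0"
        let ?k = "inverse (r * \<beta> + s * \<gamma>)"
        have "?k * (r * \<beta> + s * \<gamma>) = 1" using nz by simp
        then have "u1 = ?k *s ((r * \<beta> + s * \<gamma>) *s u1)"
          by (simp only: vector_smult_assoc vec.scale_one)
        also have "\<dots> = (?k * (r * \<alpha>)) *s u2 + (?k * (s * \<alpha>)) *s u3"
          unfolding e' by (simp add: vec.scale_right_distrib)
        finally show False using u(3) unfolding in_span_2 by blast
      qed
      then have "(r * \<alpha>) *s u2 + (s * \<alpha>) *s u3 = 0" using e' by simp
      moreover have "vec.dim {u2, u3} = 2" using u by (simp add: vec.dim_insert)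
      ultimately show "r = 0 \<and> s = 0" using dim2D[of u2 u3] \<open>\<alpha> \<noteq> 0\<close> by fastforce
    qed
    moreover have "vec.span {x, y} \<subseteq> vec.span {u1, u2, u3}"
      by (rule vec.span_minimal)
        (auto simp: x_def y_def vec.span_base intro!: vec.span_diff vec.span_scale)
    ultimately show ?thesis using curveI[OF _ D0] by blast
  qed
  consider "\<alpha> \<noteq> 0" | "\<beta> \<noteq> 0" | "\<gamma> \<noteq> 0" using nz by blast
  then have "\<exists>V\<in>curve. V \<subseteq> vec.span {u1, u2, u3}"
  proof cases
    case 1
    then show ?thesis using *[of u1 u2 u3 \<alpha> \<beta> \<gamma>] dim zero by blast
  next
    case 2
    have s: "{u2, u3, u1} = {u1, u2, u3}" by auto
    show ?thesis using *[of u2 u3 u1 \<beta> \<gamma> \<alpha>] dim zero 2 unfolding s by (simp add: algebra_simps)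
  next
    case 3
    have s: "{u3, u1, u2} = {u1, u2, u3}" by auto
    show ?thesis using *[of u3 u1 u2 \<gamma> \<alpha> \<beta>] dim zero 3 unfolding s by (simp add: algebra_simps)
  qed
  with that show thesis by blast
qed

end

section \<open>Determinants of small systems and completion to bases\<close>

lemma linear_system_3:
  fixes a1 :: "'b::field"
  shows "a1 * (b2 * c3 - b3 * c2) - b1 * (a2 * c3 - a3 * c2) + c1 * (a2 * b3 - a3 * b2) = 0 \<longleftrightarrow>
    (\<exists>x y z. (x \<noteq> 0 \<or> y \<noteq> 0 \<or> z \<noteq> 0) \<and> a1 * x + b1 * y + c1 * z = 0 \<and>
      a2 * x + b2 * y + c2 * z = 0 \<and> a3 * x + b3 * y + c3 * z = 0)" (is "?L \<longleftrightarrow> ?R")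
proof -
  define A :: "'b ^ 3 ^ 3" where
    "A = vector [vector [a1, b1, c1], vector [a2, b2, c2], vector [a3, b3, c3]]"
  have det: "det A = a1 * (b2 * c3 - b3 * c2) - b1 * (a2 * c3 - a3 * c2) + c1 * (a2 * b3 - a3 * b2)"
    by (simp add: A_def det_3 vector_3 algebra_simps)
  have "det A = 0 \<longleftrightarrow> \<not> (\<exists>B. B ** A = mat 1)"
    using invertible_det_nz[of A] by (metis invertible_left_inverse)
  also have "\<dots> \<longleftrightarrow> (\<exists>v. A *v v = 0 \<and> v \<noteq> 0)"
    using matrix_left_invertible_ker[of A] by blast
  also have "\<dots> \<longleftrightarrow> ?R"
  proof
    assume "\<exists>v. A *v v = 0 \<and> v \<noteq> 0"
    then obtain v where v: "A *v v = 0" "v \<noteq> 0" by blast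
    then show ?R
      by (intro exI[of _ "v $ 1"] exI[of _ "v $ 2"] exI[of _ "v $ 3"])
        (auto simp: vec_eq_iff forall_3 A_def vector_3 matrix_vector_mult_def sum_3)
  next
    assume ?R
    then obtain x y z where "x \<noteq> 0 \<or> y \<noteq> 0 \<or> z \<noteq> 0" "a1 * x + b1 * y + c1 * z = 0"
      "a2 * x + b2 * y + c2 * z = 0" "a3 * x + b3 * y + c3 * z = 0" by blast
    then show "\<exists>v. A *v v = 0 \<and> v \<noteq> 0"
      by (intro exI[of _ "vector [x, y, z]"])
        (auto simp: vec_eq_iff forall_3 A_def vector_3 matrix_vector_mult_def sum_3)
  qed
  finally show ?thesis using det by simp
qed

text \<open>A \<open>3 \<times> 3\<close> determinant whose second and third columns are linear forms in \<open>(s, t)\<close> is a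
  binary quadratic form, so over an algebraically closed field it vanishes somewhere.\<close>

lemma pencil_kernel:
  fixes m p p' r r' :: "nat \<Rightarrow> 'b::alg_closed_field"
  obtains s t x y z where "s \<noteq> 0 \<or> t \<noteq> 0" "x \<noteq> 0 \<or> y \<noteq> 0 \<or> z \<noteq> 0"
    and "\<And>j. j < 3 \<Longrightarrow> m j * x + (s * p j + t * p' j) * y + (s * r j + t * r' j) * z = 0"
proof -
  define d where "d a b c = a 0 * (b 1 * c 2 - b 2 * c 1) - b 0 * (a 1 * c 2 - a 2 * c 1)
    + c 0 * (a 1 * b 2 - a 2 * b 1)" for a b c :: "nat \<Rightarrow> 'b"
  obtain s t where st: "s \<noteq> 0 \<or> t \<noteq> 0"
    "d m p r * s\<^sup>2 + (d m p r' + d m p' r) * (s * t) + d m p' r' * t\<^sup>2 = 0"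
    by (rule binary_quadratic_root)
  have "d m (\<lambda>j. s * p j + t * p' j) (\<lambda>j. s * r j + t * r' j) = 0"
    using st(2) by (simp add: d_def power2_eq_square algebra_simps)
  then obtain x y z where "x \<noteq> 0 \<or> y \<noteq> 0 \<or> z \<noteq> 0"
    "m 0 * x + (s * p 0 + t * p' 0) * y + (s * r 0 + t * r' 0) * z = 0"
    "m 1 * x + (s * p 1 + t * p' 1) * y + (s * r 1 + t * r' 1) * z = 0"
    "m 2 * x + (s * p 2 + t * p' 2) * y + (s * r 2 + t * r' 2) * z = 0"
    unfolding d_def linear_system_3 by blast
  then show thesis
    by (intro that[OF st(1), of x y z]) (auto simp: less_Suc_eq numeral_3_eq_3 numeral_2_eq_2)
qed

lemma exists_not_in_span:
  fixes T :: "('b::field ^ 'n) set"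
  assumes "vec.dim S < vec.dim T"
  obtains x where "x \<in> T" "x \<notin> vec.span S"
  using assms vec.dim_mono[of T S] by (metis leD subsetI)

lemma obtain_independent_3:
  fixes T :: "('b::field ^ 'n) set"
  assumes "3 \<le> vec.dim T"
  obtains a b c where "a \<in> T" "b \<in> T" "c \<in> T" "vec.dim {a, b, c} = 3"
proof -
  have "vec.dim ({} :: ('b ^ 'n) set) < vec.dim T" using assms by simp
  then obtain c where c: "c \<in> T" "c \<notin> vec.span {}" by (rule exists_not_in_span)
  then have "vec.dim {c} < vec.dim T" using assms by simp
  then obtain b where b: "b \<in> T" "b \<notin> vec.span {c}" by (rule exists_not_in_span)
  have d: "vec.dim {b, c} = 2" using b c by (simp add: vec.dim_insert)
  then have "vec.dim {b, c} < vec.dim T" using assms by simp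
  then obtain a where a: "a \<in> T" "a \<notin> vec.span {b, c}" by (rule exists_not_in_span)
  then have "vec.dim {a, b, c} = 3" using d by (simp add: vec.dim_insert[of a])
  with that a b c show thesis by blast
qed

text \<open>A vector that \<open>c\<close> and \<open>c'\<close> kill for structural reasons is
  tested by three further functionals, so that its vanishing becomes a 3 by 3 system.\<close>

lemma complete_functionals:
  fixes c :: "'b::field ^ 5"
  assumes "vec.dim {c', c} = 2"
  obtains f :: "nat \<Rightarrow> 'b ^ 5" where "\<And>v. dot c v = 0 \<Longrightarrow> dot c' v = 0 \<Longrightarrow> (\<And>j. j < 3 \<Longrightarrow> dot (f j) v = 0) \<Longrightarrow> v = 0"
proof -
  have U: "vec.dim (UNIV :: ('b ^ 5) set) = 5" by (simp add: vec_dim_card del: vec.dim_UNIV)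
  obtain x where x: "x \<notin> vec.span {c', c}"
    using exists_not_in_span[of "{c', c}" UNIV] assms U by auto
  then have d3: "vec.dim {x, c', c} = 3" using assms by (simp add: vec.dim_insert[of x])
  obtain y where y: "y \<notin> vec.span {x, c', c}"
    using exists_not_in_span[of "{x, c', c}" UNIV] d3 U by auto
  then have d4: "vec.dim {y, x, c', c} = 4" using d3 by (simp add: vec.dim_insert[of y])
  obtain z where z: "z \<notin> vec.span {y, x, c', c}"
    using exists_not_in_span[of "{y, x, c', c}" UNIV] d4 U by auto
  then have d5: "vec.dim {z, y, x, c', c} = 5" using d4 by (simp add: vec.dim_insert[of z])
  define f where "f j = [x, y, z] ! j" for j :: nat
  have "v = 0" if "dot c v = 0" "dot c' v = 0" "\<And>j. j < 3 \<Longrightarrow> dot (f j) v = 0" for v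
  proof -
    have "dot x v = 0" "dot y v = 0" "dot z v = 0"
      using that(3)[of 0] that(3)[of 1] that(3)[of 2] by (auto simp: f_def)
    then have "v \<in> perp {z, y, x, c', c}" using that by (auto simp: perp_iff dot_commute[of v])
    moreover have "vec.dim (perp {z, y, x, c', c}) = 0" using d5 by (simp add: dim_perp)
    ultimately show ?thesis by (metis vec.dim_eq_0 singletonD subsetD)
  qed
  then show thesis using that by blast
qed

lemma biorthogonal_dim:
  fixes u y :: "nat \<Rightarrow> 'b::field ^ 'n"
  assumes "\<And>i j. i < n \<Longrightarrow> j < n \<Longrightarrow> dot (u i) (y j) = 0 \<longleftrightarrow> i \<noteq> j"
  shows "vec.dim (u ` {..<n}) = n"
  using assms
proof (induction n)
  case (Suc n)
  have "u n \<notin> vec.span (u ` {..<n})"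
    by (rule not_in_span_dot[of _ "y n"]) (use Suc.prems in auto)
  moreover have "vec.dim (u ` {..<n}) = n" by (rule Suc.IH) (use Suc.prems in auto)
  ultimately show ?case by (simp add: lessThan_Suc vec.dim_insert)
qed simp

lemma image_lessThan_5: "f ` {..<5::nat} = {f 4, f 3, f 2, f 1, f 0}"
  by (simp add: eval_nat_numeral lessThan_Suc)

context alternating_system
begin

subsection \<open>Incident pairs\<close>

text \<open>\<open>V\<close> lies in the radical of a rank-two form, which means that the hyperplane
  \<open>c\<close> is tangent to the Grassmannian at \<open>V\<close>. This is the condition for the
  linear section to be singular at \<open>V\<close>, and equally for the dual section to be singular
  at \<open>c\<close>.\<close>

definition incident :: "('b ^ 5) set \<Rightarrow> 'b ^ 5 \<Rightarrow> 'b ^ 5 \<Rightarrow> 'b ^ 5 \<Rightarrow> bool" where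
  "incident V c a b \<longleftrightarrow> V \<in> curve \<and> dual_pt c a b \<and> a \<in> perp V \<and> b \<in> perp V"

text \<open>A radical of dimension two excludes a second hyperbolic plane orthogonal to
  \<open>u\<close>, \<open>v\<close>, since two such planes leave a radical of dimension one. So the
  form is carried by the plane of \<open>u\<close> and \<open>v\<close>.\<close>

lemma dual_pt_of_radical:
  assumes "c \<noteq> 0" "2 \<le> vec.dim (rad c)"
  obtains a b where "dual_pt c a b"
proof -
  obtain u v where uv: "form c u v \<noteq> 0" using form_nondegenerate assms by blast
  have T: "form c t t' = 0"
    if t: "form c u t = 0" "form c v t = 0" "form c u t' = 0" "form c v t' = 0" for t t'
  proof (rule ccontr)
    let ?S = "{fnl c u, fnl c v, fnl c t, fnl c t'}"
    assume "form c t t' \<noteq> 0"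
    then have d: "vec.dim (perp ?S) = 1" by (intro two_planes_radical) (use uv t in auto)
    have "rad c \<subseteq> perp ?S"
    proof
      fix x assume "x \<in> rad c"
      then have "form c y x = 0" for y using form_swap[of c y x] by (simp add: rad_def)
      then show "x \<in> perp ?S" by (auto simp: perp_iff dot_commute[of x] dot_fnl)
    qed
    from vec.dim_subset[OF this] show False using assms d by simp
  qed
  define f where "f = form c u v"
  have f: "f \<noteq> 0" using uv by (simp add: f_def)
  have vu: "form c v u = - f" by (simp add: f_def form_swap[of c v u])
  have "form c x y = wedge ((- inverse f) *s fnl c v) (fnl c u) x y" for x y
  proof -
    obtain \<alpha> \<beta> t where x: "x = \<alpha> *s u + \<beta> *s v + t" "form c u t = 0" "form c v t = 0"
      using plane_split[OF uv] by blast
    obtain \<alpha>' \<beta>' t' where y: "y = \<alpha>' *s u + \<beta>' *s v + t'" "form c u t' = 0" "form c v t' = 0"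
      using plane_split[OF uv] by blast
    have "form c t u = 0" "form c t v = 0" using x form_swap[of c t] by simp_all
    then have "form c x y = (\<alpha> * \<beta>' - \<beta> * \<alpha>') * f"
      using x y T[OF x(2,3) y(2,3)] vu by (simp add: form_simps f_def algebra_simps)
    moreover have "dot (fnl c u) x = \<beta> * f" "dot (fnl c u) y = \<beta>' * f"
      "dot (fnl c v) x = - (\<alpha> * f)" "dot (fnl c v) y = - (\<alpha>' * f)"
      using x y vu by (simp_all add: dot_fnl form_simps f_def)
    ultimately show ?thesis using f by (simp add: wedge_def dot_simps field_simps)
  qed
  then show thesis using that assms(1) by (auto simp: dual_pt_def)
qed

text \<open>Any nonzero functional of the span can be taken as first factor, because the form
  vanishes on its kernel.\<close>

lemma dual_pt_change:
  assumes "dual_pt c a b" "w \<in> vec.span {a, b}" "w \<noteq> 0"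
  obtains w' where "dual_pt c w w'"
proof -
  obtain r s where w: "w = r *s a + s *s b" using assms(2) by (auto simp: in_span_2)
  have "form c x y = 0" if xy: "dot w x = 0" "dot w y = 0" for x y
  proof -
    have e: "r * dot a x + s * dot b x = 0" "r * dot a y + s * dot b y = 0"
      using xy by (simp_all add: w dot_simps)
    have "r * wedge a b x y = (r * dot a x + s * dot b x) * dot b y - (r * dot a y + s * dot b y) * dot b x"
      "s * wedge a b x y = dot a x * (r * dot a y + s * dot b y) - dot a y * (r * dot a x + s * dot b x)"
      by (simp_all add: wedge_def algebra_simps)
    then have "r * wedge a b x y = 0" "s * wedge a b x y = 0" using e by simp_all
    moreover have "r \<noteq> 0 \<or> s \<noteq> 0" using assms(3) w by auto
    ultimately show ?thesis using assms(1) by (auto simp: dual_pt_def)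
  qed
  then show thesis
    using isotropic_hyperplane_dual[OF _ assms(3)] assms(1) that by (metis dual_pt_def)
qed

text \<open>The two members generate a pencil \<open>span {x, s *s y + t *s y'}\<close> of members.
  Incidence with the member at (s : t) puts \<open>x\<close> and \<open>s *s y + t *s y'\<close>
  into the radical of a form. On the forms with \<open>x\<close> in the radical this leaves three
  equations, whose determinant is quadratic in (s : t) and hence has a zero.\<close>

lemma curve_meet_incident:
  assumes "V \<in> curve" "V' \<in> curve" "V \<noteq> V'" "x \<in> V" "x \<in> V'" "x \<noteq> 0"
  shows "\<exists>V c a b. incident V c a b"
proof -
  have dx: "vec.dim {x} < vec.dim V" "vec.dim {x} < vec.dim V'"
    using assms curve_dim by simp_all
  obtain y where y: "y \<in> V" "y \<notin> vec.span {x}" by (rule exists_not_in_span[OF dx(1)])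
  obtain y' where y': "y' \<in> V'" "y' \<notin> vec.span {x}" by (rule exists_not_in_span[OF dx(2)])
  have d2: "vec.dim {y, x} = 2" "vec.dim {y', x} = 2" using y y' assms by (simp_all add: vec.dim_insert)
  have Veq: "V = vec.span {y, x}" "V' = vec.span {y', x}"
    using curve_span_eq[OF assms(1) y(1) assms(4) d2(1)]
      curve_span_eq[OF assms(2) y'(1) assms(5) d2(2)] .
  have y'V: "y' \<notin> vec.span {y, x}"
  proof
    assume "y' \<in> vec.span {y, x}"
    then have "V = vec.span {y', x}" using curve_span_eq[OF assms(1)] Veq assms d2 by metis
    with Veq assms show False by simp
  qed
  then have d3: "vec.dim {y', y, x} = 3" using d2 by (simp add: vec.dim_insert[of y'])
  have U: "vec.dim (UNIV :: ('b ^ 5) set) = 5" by (simp add: vec_dim_card del: vec.dim_UNIV)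
  obtain e where e: "e \<notin> vec.span {y', y, x}"
    using exists_not_in_span[of "{y', y, x}" UNIV] d3 U by auto
  then have d4: "vec.dim {e, y', y, x} = 4" using d3 by (simp add: vec.dim_insert[of e])
  obtain e' where e': "e' \<notin> vec.span {e, y', y, x}"
    using exists_not_in_span[of "{e, y', y, x}" UNIV] d4 U by auto
  then have d5: "vec.dim {e', e, y', y, x} = 5" using d4 by (simp add: vec.dim_insert[of e'])
  have span: "vec.span {e', e, y', y, x} = UNIV"
    by (rule vec.subspace_dim_equal) (use d5 U in \<open>auto simp del: vec.dim_UNIV\<close>)
  have rad_I: "u \<in> rad c" if "\<And>z. z \<in> {e', e, y', y, x} \<Longrightarrow> form c u z = 0" for c u
  proof -
    have "dot (fnl c u) z = 0" for z
      by (rule dot_span_zero[of z "{e', e, y', y, x}"]) (use that span in \<open>auto simp: dot_fnl\<close>)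
    then show ?thesis by (simp add: rad_def dot_fnl)
  qed
  have D0: "D x y = 0" "D x y' = 0"
    using curve_D[OF assms(1,4)] curve_D[OF assms(2,5)] y y' by auto
  \<comment> \<open>The forms with \<open>x\<close> in the radical: \<open>D x y\<close> and
    \<open>D x y'\<close> vanish already, so only \<open>e\<close> and \<open>e'\<close> impose
    conditions and at least three dimensions remain.\<close>
  let ?P = "perp {D x e, D x e'}"
  have "vec.dim {D x e, D x e'} \<le> 2" by (simp add: vec.dim_insert)
  then have "3 \<le> vec.dim ?P" by (simp add: dim_perp)
  then obtain c1 c2 c3 where c: "c1 \<in> ?P" "c2 \<in> ?P" "c3 \<in> ?P" "vec.dim {c1, c2, c3} = 3"
    by (rule obtain_independent_3)
  obtain s t \<gamma>1 \<gamma>2 \<gamma>3 where st: "s \<noteq> 0 \<or> t \<noteq> 0"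
    and \<gamma>: "\<gamma>1 \<noteq> 0 \<or> \<gamma>2 \<noteq> 0 \<or> \<gamma>3 \<noteq> 0"
      "\<gamma>1 * form c1 y y' + \<gamma>2 * form c2 y y' + \<gamma>3 * form c3 y y' = 0"
      "\<gamma>1 * form c1 (s *s y + t *s y') e + \<gamma>2 * form c2 (s *s y + t *s y') e
        + \<gamma>3 * form c3 (s *s y + t *s y') e = 0"
      "\<gamma>1 * form c1 (s *s y + t *s y') e' + \<gamma>2 * form c2 (s *s y + t *s y') e'
        + \<gamma>3 * form c3 (s *s y + t *s y') e' = 0"
  proof -
    let ?c = "\<lambda>j. [c1, c2, c3] ! j"
    define d where "d a b c = a 0 * (b 1 * c 2 - b 2 * c 1) - b 0 * (a 1 * c 2 - a 2 * c 1)
      + c 0 * (a 1 * b 2 - a 2 * b 1)" for a b c :: "nat \<Rightarrow> 'b"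
    let ?m = "\<lambda>j. form (?c j) y y'" and ?p = "\<lambda>j. form (?c j) y e" and ?p' = "\<lambda>j. form (?c j) y' e"
    let ?r = "\<lambda>j. form (?c j) y e'" and ?r' = "\<lambda>j. form (?c j) y' e'"
    obtain s t where st: "s \<noteq> 0 \<or> t \<noteq> 0"
      "d ?m ?p ?r * s\<^sup>2 + (d ?m ?p ?r' + d ?m ?p' ?r) * (s * t) + d ?m ?p' ?r' * t\<^sup>2 = 0"
      by (rule binary_quadratic_root)
    define w where "w = s *s y + t *s y'"
    have "form c1 y y' * (form c2 w e * form c3 w e' - form c2 w e' * form c3 w e)
      - form c2 y y' * (form c1 w e * form c3 w e' - form c1 w e' * form c3 w e)
      + form c3 y y' * (form c1 w e * form c2 w e' - form c1 w e' * form c2 w e) = 0"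
      using st(2) by (simp add: w_def d_def form_simps power2_eq_square algebra_simps)
    then have "\<exists>x z u. (x \<noteq> 0 \<or> z \<noteq> 0 \<or> u \<noteq> 0) \<and>
      form c1 y y' * x + form c2 y y' * z + form c3 y y' * u = 0 \<and>
      form c1 w e * x + form c2 w e * z + form c3 w e * u = 0 \<and>
      form c1 w e' * x + form c2 w e' * z + form c3 w e' * u = 0"
      unfolding linear_system_3[symmetric] by (simp add: algebra_simps)
    then show thesis using that[OF st(1)] unfolding w_def by (auto simp: mult.commute)
  qed
  define c where "c = \<gamma>1 *s c1 + \<gamma>2 *s c2 + \<gamma>3 *s c3"
  define yt where "yt = s *s y + t *s y'"
  have "c \<noteq> 0"
  proof
    assume "c = 0"
    have ni: "c3 \<noteq> 0" "c2 \<notin> vec.span {c3}" "c1 \<notin> vec.span {c2, c3}"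
      using c(4) by (auto simp: vec.dim_insert split: if_splits)
    obtain f1 where f1: "dot f1 c1 = 1" "\<forall>z\<in>{c2, c3}. dot f1 z = 0"
      using separating_functional[OF ni(3)] by metis
    have "dot f1 c = \<gamma>1" using f1 by (simp add: c_def dot_simps)
    then have "\<gamma>1 = 0" using \<open>c = 0\<close> by simp
    obtain f2 where f2: "dot f2 c2 = 1" "\<forall>z\<in>{c3}. dot f2 z = 0"
      using separating_functional[OF ni(2)] by metis
    have "dot f2 c = \<gamma>2" using f2 \<open>\<gamma>1 = 0\<close> by (simp add: c_def dot_simps)
    then have "\<gamma>2 = 0" using \<open>c = 0\<close> by simp
    with \<open>\<gamma>1 = 0\<close> \<open>c = 0\<close> ni(1) have "\<gamma>3 = 0" by (simp add: c_def)
    with \<open>\<gamma>1 = 0\<close> \<open>\<gamma>2 = 0\<close> \<gamma>(1) show False by simp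
  qed
  have cz: "dot c z = \<gamma>1 * dot c1 z + \<gamma>2 * dot c2 z + \<gamma>3 * dot c3 z" for z
    by (simp add: c_def dot_simps)
  have "x \<in> rad c"
  proof (rule rad_I)
    fix z assume "z \<in> {e', e, y', y, x}"
    then show "form c x z = 0"
      using c D0 by (auto simp: form_def cz perp_iff)
  qed
  have yy': "form c y y' = 0" using \<gamma>(2) by (simp add: form_def cz)
  have "yt \<in> rad c"
  proof (rule rad_I)
    fix z assume z: "z \<in> {e', e, y', y, x}"
    have "form c yt e = 0" "form c yt e' = 0"
      using \<gamma>(3,4) by (simp_all add: form_def cz yt_def)
    moreover have "form c yt y = 0" "form c yt y' = 0"
      using yy' form_swap[of c y' y] by (simp_all add: yt_def form_simps)
    moreover have "form c yt x = 0"
      using \<open>x \<in> rad c\<close> form_swap[of c yt x] by (simp add: rad_def)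
    ultimately show "form c yt z = 0" using z by auto
  qed
  have dt: "vec.dim {x, yt} = 2"
    unfolding dim2_iff
  proof (intro allI impI)
    fix k l assume kl: "k *s x + l *s yt = 0"
    have ni: "y' \<notin> vec.span {y, x}" "y \<notin> vec.span {x}" by (fact y'V y)+
    obtain f1 where f1: "dot f1 y' = 1" "\<forall>z\<in>{y, x}. dot f1 z = 0"
      using separating_functional[OF ni(1)] by metis
    obtain f2 where f2: "dot f2 y = 1" "\<forall>z\<in>{x}. dot f2 z = 0"
      using separating_functional[OF ni(2)] by metis
    have lt: "l * t = 0" using arg_cong[OF kl, of "dot f1"] f1 by (simp add: yt_def dot_simps)
    have "l * s + l * t * dot f2 y' = 0"
      using arg_cong[OF kl, of "dot f2"] f2 by (simp add: yt_def dot_simps algebra_simps)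
    with lt st have "l = 0" by auto
    with kl assms(6) show "k = 0 \<and> l = 0" by simp
  qed
  have VtC: "vec.span {x, yt} \<in> curve"
    by (rule curveI[OF dt]) (simp add: yt_def D_simps D0)
  have sub: "vec.span {x, yt} \<subseteq> rad c"
    by (rule vec.span_minimal) (use \<open>x \<in> rad c\<close> \<open>yt \<in> rad c\<close> in auto)
  have "2 \<le> vec.dim (rad c)" using vec.dim_subset[OF sub] dt by simp
  then obtain a b where ab: "dual_pt c a b" by (rule dual_pt_of_radical[OF \<open>c \<noteq> 0\<close>])
  then have "a \<in> perp (vec.span {x, yt})" "b \<in> perp (vec.span {x, yt})"
    using sub unfolding dual_pt_rad[OF ab] by (auto simp: perp_iff dot_commute[of a] dot_commute[of b])
  with ab VtC show ?thesis by (auto simp: incident_def)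
qed

text \<open>The mirror image of \<open>curve_meet_incident\<close>. Forms with the common factor
  \<open>w\<close> generate a pencil of forms \<open>w \<and> (s *s w1 + t *s w2)\<close>, with
  three-dimensional radicals. A bivector of such a radical is killed by \<open>c\<close> and
  \<open>c'\<close> anyway, so three equations for three unknowns remain, again with a determinant
  quadratic in (s : t).\<close>

lemma dual_meet_incident:
  assumes c: "dual_pt c a b" "dual_pt c' a' b'" "c' \<notin> vec.span {c}"
    and w: "w \<in> vec.span {a, b}" "w \<in> vec.span {a', b'}" "w \<noteq> 0"
  shows "\<exists>V c a b. incident V c a b"
proof -
  obtain w1 where w1: "dual_pt c w w1" by (rule dual_pt_change[OF c(1) w(1,3)])
  obtain w2 where w2: "dual_pt c' w w2" by (rule dual_pt_change[OF c(2) w(2,3)])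
  have fc: "form c x y = wedge w w1 x y" "form c' x y = wedge w w2 x y" for x y
    using w1 w2 by (auto simp: dual_pt_def)
  have c0: "c \<noteq> 0" using w1 by (simp add: dual_pt_def)
  have d2: "vec.dim {w1, w} = 2" using dual_pt_dim[OF w1] by (simp add: insert_commute)
  have ni2: "w2 \<notin> vec.span {w1, w}"
  proof
    assume "w2 \<in> vec.span {w1, w}"
    then obtain k l where kl: "w2 = k *s w1 + l *s w" by (auto simp: in_span_2)
    have "form (c' - k *s c) x y = 0" for x y
      by (simp add: form_simps fc kl wedge_def dot_simps algebra_simps)
    then have "c' - k *s c = 0" using form_nondegenerate by blast
    then have "c' = k *s c" by simp
    with c(3) show False by (auto simp: in_span_1)
  qed
  have d3: "vec.dim {w2, w1, w} = 3" using ni2 d2 by (simp add: vec.dim_insert[of w2])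
  have d3': "vec.dim {w1, w2, w} = 3" using d3 by (simp add: insert_commute)
  have "vec.dim {w2, w} \<le> 2" by (simp add: vec.dim_insert)
  then have ni1: "w1 \<notin> vec.span {w2, w}" using d3' by (auto simp: vec.dim_insert[of w1])
  obtain z1 where z1: "dot z1 w1 = 1" "dot z1 w2 = 0" "dot z1 w = 0"
    using separating_functional[OF ni1] by (metis insertCI)
  obtain z2 where z2: "dot z2 w2 = 1" "dot z2 w1 = 0" "dot z2 w = 0"
    using separating_functional[OF ni2] by (metis insertCI)
  have "vec.dim (perp {w2, w1, w}) = 2" using d3 by (simp add: dim_perp)
  then obtain y1 y2 where Y: "perp {w2, w1, w} = vec.span {y1, y2}" "vec.dim {y1, y2} = 2"
    "y1 \<in> perp {w2, w1, w}" "y2 \<in> perp {w2, w1, w}"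
    by (rule obtain_basis2[OF subspace_perp])
  have y: "dot w y1 = 0" "dot w1 y1 = 0" "dot w2 y1 = 0" "dot w y2 = 0" "dot w1 y2 = 0" "dot w2 y2 = 0"
    using Y(3,4) by (auto simp: perp_iff dot_commute[of y1] dot_commute[of y2])
  have z: "dot w z1 = 0" "dot w1 z1 = 1" "dot w2 z1 = 0" "dot w z2 = 0" "dot w1 z2 = 0" "dot w2 z2 = 1"
    using z1 z2 by (simp_all add: dot_commute[of _ z1] dot_commute[of _ z2])
  have "vec.dim {c', c} = 2" using c(3) c0 by (simp add: vec.dim_insert)
  then obtain f :: "nat \<Rightarrow> 'b ^ 5" where f: "\<And>v. dot c v = 0 \<Longrightarrow> dot c' v = 0 \<Longrightarrow> (\<And>j. j < 3 \<Longrightarrow> dot (f j) v = 0) \<Longrightarrow> v = 0"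
    by (rule complete_functionals) blast
  obtain s t \<gamma> \<alpha> \<beta> where st: "s \<noteq> 0 \<or> t \<noteq> 0" and abc: "\<gamma> \<noteq> 0 \<or> \<alpha> \<noteq> 0 \<or> \<beta> \<noteq> 0"
    and eq: "\<And>j. j < 3 \<Longrightarrow> dot (f j) (D y1 y2) * \<gamma>
        + (s * dot (f j) (D y2 (- z2)) + t * dot (f j) (D y2 z1)) * \<alpha>
        + (s * dot (f j) (D (- z2) y1) + t * dot (f j) (D z1 y1)) * \<beta> = 0"
    by (rule pencil_kernel[of "\<lambda>j. dot (f j) (D y1 y2)" "\<lambda>j. dot (f j) (D y2 (- z2))"
          "\<lambda>j. dot (f j) (D y2 z1)" "\<lambda>j. dot (f j) (D (- z2) y1)" "\<lambda>j. dot (f j) (D z1 y1)"]) blast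
  \<comment> \<open>Together with \<open>y1\<close> and \<open>y2\<close> this spans the radical:
    \<open>s *s w1 + t *s w2\<close> takes the value s t - t s = 0 on it.\<close>
  define \<zeta> where "\<zeta> = t *s z1 - s *s z2"
  have zw: "dot w \<zeta> = 0" "dot w1 \<zeta> = t" "dot w2 \<zeta> = - s" by (simp_all add: \<zeta>_def dot_simps z)
  let ?v = "\<alpha> *s D y2 \<zeta> + \<beta> *s D \<zeta> y1 + \<gamma> *s D y1 y2"
  have "?v = 0"
  proof (rule f)
    have "form c u u' = 0" "form c' u u' = 0" if "u \<in> {y1, y2}" for u u'
      using that y by (auto simp: fc wedge_def)
    then have "form c y2 \<zeta> = 0" "form c \<zeta> y1 = 0" "form c y1 y2 = 0"
       "form c' y2 \<zeta> = 0" "form c' \<zeta> y1 = 0" "form c' y1 y2 = 0"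
      using form_swap[of c \<zeta> y1] form_swap[of c' \<zeta> y1] by simp_all
    then show "dot c ?v = 0" "dot c' ?v = 0" by (simp_all add: form_def dot_simps)
    fix j :: nat assume "j < 3"
    from eq[OF this] show "dot (f j) ?v = 0"
      by (simp add: \<zeta>_def D_simps dot_simps algebra_simps)
  qed
  moreover have "vec.dim {\<zeta>, y1, y2} = 3"
  proof -
    have "\<zeta> \<notin> perp {w2, w1, w}" using st zw by (auto simp: perp_iff dot_commute[of \<zeta>])
    then show ?thesis using Y by (simp add: vec.dim_insert[of \<zeta>])
  qed
  then have "vec.dim {y1, y2, \<zeta>} = 3" by (simp add: insert_commute)
  ultimately obtain V where V: "V \<in> curve" "V \<subseteq> vec.span {y1, y2, \<zeta>}"
    by (elim curve_from_bivector) (use abc in auto)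
  have cc: "s *s c + t *s c' \<noteq> 0"
    using dim2D[OF \<open>vec.dim {c', c} = 2\<close>, of t s] st by (auto simp: add.commute)
  have "dual_pt (s *s c + t *s c') w (s *s w1 + t *s w2)"
    using cc by (simp add: dual_pt_def form_simps fc wedge_def dot_simps algebra_simps)
  moreover have "w \<in> perp V"
  proof -
    have "dot w v = 0" if "v \<in> V" for v
      by (rule dot_span_zero[of v "{y1, y2, \<zeta>}"]) (use that V y zw in auto)
    then show ?thesis by (simp add: perp_iff)
  qed
  moreover have "s *s w1 + t *s w2 \<in> perp V"
  proof -
    have "dot (s *s w1 + t *s w2) v = 0" if "v \<in> V" for v
      by (rule dot_span_zero[of v "{y1, y2, \<zeta>}"]) (use that V y zw in \<open>auto simp: dot_simps\<close>)
    then show ?thesis by (simp add: perp_iff)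
  qed
  ultimately show ?thesis using V(1) by (auto simp: incident_def)
qed

end

lemma nonzero_multiple_in_subspace:
  assumes "vec.subspace S" "k *s x \<in> S" "k \<noteq> 0"
  shows "x \<in> S"
  using vec.subspace_scale[OF assms(1,2), of "inverse k"] assms(3)
  by (simp add: vector_smult_assoc)

lemma family_dual_basis_ex:
  fixes z :: "nat \<Rightarrow> 'b::field ^ 5"
  assumes "vec.dim (z ` {..<5}) = 5"
  shows "\<exists>e. (\<forall>i<5. \<forall>j<5. dot (e i) (z j) = (if i = j then 1 else 0)) \<and>
    (\<forall>c. c = (\<Sum>i<5. dot c (z i) *s e i))"
proof (rule family_dual_basis[OF assms])
  fix e :: "nat \<Rightarrow> 'b ^ 5"
  assume 1: "\<And>i j. i < 5 \<Longrightarrow> j < 5 \<Longrightarrow> dot (e i) (z j) = (if i = j then 1 else 0)"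
    and 2: "\<And>c. c = (\<Sum>i<5. dot c (z i) *s e i)"
  show ?thesis by (intro exI[of _ e] conjI allI impI 1 2)
qed

lemma lessThan_5: "{..<5::nat} = {0, 1, 2, 3, 4}"
  by auto

context alternating_system
begin

subsection \<open>Orbits of incident pairs\<close>

lemma incident_Fr: "incident V c a b \<Longrightarrow> incident (Fr ` V) (Fr c) (Fr a) (Fr b)"
  unfolding incident_def
  by (auto simp: curve_Fr dual_pt_Fr perp_iff dot_Fr zero_power)

lemma incident_span_perp: "incident V c a b \<Longrightarrow> w \<in> vec.span {a, b} \<Longrightarrow> x \<in> V \<Longrightarrow> dot w x = 0"
proof -
  assume i: "incident V c a b" and w: "w \<in> vec.span {a, b}" and x: "x \<in> V"
  have "dot x w = 0"
    by (rule dot_span_zero[OF w])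
      (use i x in \<open>auto simp: incident_def perp_iff dot_commute[of x]\<close>)
  then show ?thesis by (simp add: dot_commute)
qed

lemma curve_disjoint_dim:
  assumes "V \<in> curve" "V' \<in> curve" "\<And>x. x \<in> V \<Longrightarrow> x \<in> V' \<Longrightarrow> x = 0"
  shows "4 \<le> vec.dim (V \<union> V')"
proof -
  have "V \<inter> V' \<subseteq> {0}" using assms(3) by auto
  then have "vec.dim (V \<inter> V') = 0" by (simp add: vec.dim_eq_0)
  have "vec.dim {x + y |x y. x \<in> V \<and> y \<in> V'} = 4"
    using vec.dim_sums_Int[OF curve_subspace[OF assms(1)] curve_subspace[OF assms(2)]]
      curve_dim[OF assms(1)] curve_dim[OF assms(2)] \<open>vec.dim (V \<inter> V') = 0\<close> by linarith
  moreover have "vec.dim {x + y |x y. x \<in> V \<and> y \<in> V'} \<le> vec.dim (V \<union> V')"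
    by (rule vec.dim_mono) (auto intro: vec.span_add vec.span_base)
  ultimately show ?thesis by linarith
qed

lemma perp_line_proportional:
  fixes S :: "('b ^ 5) set"
  assumes "4 \<le> vec.dim S" "w \<in> perp S" "w \<noteq> 0" "w' \<in> perp S"
  shows "\<exists>k. w' = k *s w"
proof (rule ccontr)
  assume "\<nexists>k. w' = k *s w"
  then have "vec.dim {w', w} = 2" using assms(3) by (simp add: vec.dim_insert in_span_1)
  moreover have "vec.dim {w', w} \<le> vec.dim (perp S)"
    by (rule vec.dim_subset) (use assms in auto)
  ultimately show False using assms(1) by (simp add: dim_perp)
qed

text \<open>If \<open>V\<close> and \<open>V'\<close> are disjoint, their sum has dimension four and
  one killing functional up to scalars. A functional of \<open>span {a, b}\<close> that kills
  \<open>V'\<close> also kills \<open>V\<close> by incidence, and the same holds on the other side,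
  so both spans contain that functional.\<close>

lemma incident_meet:
  assumes "incident V c a b" "incident V' c' a' b'"
  shows "(\<exists>x. x \<noteq> 0 \<and> x \<in> V \<and> x \<in> V') \<or> (\<exists>w. w \<noteq> 0 \<and> w \<in> vec.span {a, b} \<and> w \<in> vec.span {a', b'})"
proof (rule disjCI)
  assume nw: "\<not> (\<exists>w. w \<noteq> 0 \<and> w \<in> vec.span {a, b} \<and> w \<in> vec.span {a', b'})"
  show "\<exists>x. x \<noteq> 0 \<and> x \<in> V \<and> x \<in> V'"
  proof (rule ccontr)
    assume nx: "\<not> ?thesis"
    have VC: "V \<in> curve" "V' \<in> curve" "dual_pt c a b" "dual_pt c' a' b'"
      using assms by (auto simp: incident_def)
    have d: "4 \<le> vec.dim (V \<union> V')" using curve_disjoint_dim[OF VC(1,2)] nx by blast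
    obtain w where w: "w \<in> vec.span {a, b}" "w \<noteq> 0" "w \<in> perp V'"
      by (rule functional_killing[OF VC(3,2)])
    obtain w' where w': "w' \<in> vec.span {a', b'}" "w' \<noteq> 0" "w' \<in> perp V"
      by (rule functional_killing[OF VC(4,1)])
    have "w \<in> perp (V \<union> V')" "w' \<in> perp (V \<union> V')"
      using w w' incident_span_perp[OF assms(1)] incident_span_perp[OF assms(2)]
      by (auto simp: perp_iff)
    then obtain k where "w = k *s w'" using perp_line_proportional[OF d] w' by blast
    then have "w \<in> vec.span {a', b'}" using w' by (simp add: vec.span_scale)
    with nw w show False by blast
  qed
qed

lemma incident_isotropic:
  assumes "incident V c a b" "w \<in> vec.span {a, b}" "w \<noteq> 0" "dot w x = 0" "dot w y = 0"
  shows "form c x y = 0"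
proof -
  obtain w' where "dual_pt c w w'"
    using dual_pt_change[OF _ assms(2,3)] assms(1) by (metis incident_def)
  then show ?thesis using assms by (simp add: dual_pt_def wedge_def)
qed

lemma stable_span_iterates:
  assumes "(Fr ^^ Suc n) x \<in> vec.span ((\<lambda>i. (Fr ^^ i) x) ` {..n})"
  shows "stable (vec.span ((\<lambda>i. (Fr ^^ i) x) ` {..n}))"
proof (rule stable_span)
  fix y assume "y \<in> (\<lambda>i. (Fr ^^ i) x) ` {..n}"
  then obtain i where i: "i \<le> n" "y = (Fr ^^ i) x" by auto
  show "Fr y \<in> vec.span ((\<lambda>i. (Fr ^^ i) x) ` {..n})"
  proof (cases "i = n")
    case True
    then show ?thesis using assms i by simp
  next
    case False
    then show ?thesis using i by (intro vec.span_base image_eqI[of _ _ "Suc i"]) auto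
  qed
qed

lemma Fr_stable_perp_line:
  assumes "stable S" "vec.dim S = 4" "p \<in> perp S" "p \<noteq> 0"
  shows "\<exists>k. Fr p = k *s p"
  using stable_perp[OF assms(1)] perp_line_proportional[of S p "Fr p"] assms
  by (auto simp: stable_def)

text \<open>If consecutive members \<open>W i\<close> meet, their intersections \<open>x i\<close>
  are the pentagon. A dependence among the first five would create a stable isotropic subspace or a
  stable hyperplane isotropic for one form. Otherwise consecutive functional spaces
  \<open>L i\<close> meet, the same argument runs for the functionals \<open>y i\<close>, and the
  pentagon is their dual basis. Sides are isotropic in the first case and diagonals in the second,
  whence \<open>g = 1\<close> or \<open>g = 2\<close>.\<close>

theorem incident_pentagon:
  assumes inc: "incident V c a b"
  obtains z g where "g \<in> {1, 2}" "vec.dim ((\<lambda>i. (Fr ^^ i) z) ` {..<5}) = 5"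
    "\<exists>k. (Fr ^^ 5) z = k *s z" "D z ((Fr ^^ g) z) = 0"
proof -
  define W where "W i = (Fr ^^ i) ` V" for i
  define A where "A i = (Fr ^^ i) a" for i
  define B where "B i = (Fr ^^ i) b" for i
  define K where "K i = (Fr ^^ i) c" for i
  define L where "L i = vec.span {A i, B i}" for i
  have W_Suc: "W (Suc i) = Fr ` W i" for i by (auto simp: W_def)
  have Suc': "A (Suc i) = Fr (A i)" "B (Suc i) = Fr (B i)" for i by (auto simp: A_def B_def)
  have I: "incident (W i) (K i) (A i) (B i)" for i
  proof (induction i)
    case 0
    then show ?case using inc by (simp add: W_def A_def B_def K_def)
  next
    case (Suc i)
    from incident_Fr[OF Suc] show ?case by (simp add: W_Suc A_def B_def K_def)
  qed
  have WC: "W i \<in> curve" and du: "dual_pt (K i) (A i) (B i)" for i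
    using I by (auto simp: incident_def)
  have K0: "K i \<noteq> 0" for i using du by (simp add: dual_pt_def)
  have L_sub: "vec.subspace (L i)" for i by (simp add: L_def)
  have L_W: "w \<in> L i \<Longrightarrow> x \<in> W i \<Longrightarrow> dot w x = 0" for w x i
    using incident_span_perp[OF I] by (simp add: L_def)
  have L_dim: "vec.dim (L i) = 2" for i using dual_pt_dim[OF du] by (simp add: L_def)
  have L_Suc: "Fr ` L i = L (Suc i)" for i by (simp add: L_def Fr_image_span Suc')
  have meet: "(\<exists>x. x \<noteq> 0 \<and> x \<in> W i \<and> x \<in> W j) \<or> (\<exists>w. w \<noteq> 0 \<and> w \<in> L i \<and> w \<in> L j)" for i j
    unfolding L_def by (rule incident_meet[OF I I])
  have perpL_rad: "perp (L i) = rad (K i)" for i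
    using dual_pt_rad[OF du] by (simp add: L_def perp_span)
  have perpL_Fr: "x \<in> perp (L i) \<Longrightarrow> Fr x \<in> perp (L (Suc i))" for x i
    by (auto simp: perp_iff dot_Fr zero_power simp flip: L_Suc)
  have perpL_Fr': "Fr x \<in> perp (L (Suc i)) \<Longrightarrow> x \<in> perp (L i)" for x i
    by (auto simp: perp_iff dot_Fr zero_power simp flip: L_Suc)
  have perpW_Fr: "x \<in> perp (W i) \<Longrightarrow> Fr x \<in> perp (W (Suc i))" for x i
    by (auto simp: perp_iff dot_Fr zero_power W_Suc)
  have perpW_Fr': "Fr x \<in> perp (W (Suc i)) \<Longrightarrow> x \<in> perp (W i)" for x i
    by (auto simp: perp_iff dot_Fr zero_power W_Suc)
  have img: "f ` {..0::nat} = {f 0}" "f ` {..1} = {f 1, f 0}" "f ` {..2} = {f 2, f 1, f 0}"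
    "f ` {..3} = {f 3, f 2, f 1, f 0}" for f :: "nat \<Rightarrow> 'b ^ 5"
    by (auto simp: eval_nat_numeral atMost_Suc)
  show thesis
  proof (cases "\<exists>x. x \<noteq> 0 \<and> x \<in> W 0 \<and> x \<in> W 1")
    case True
    then obtain x0 where x0: "x0 \<noteq> 0" "x0 \<in> W 0" "x0 \<in> W 1" by blast
    define x where "x i = (Fr ^^ i) x0" for i
    have x_Suc: "x (Suc i) = Fr (x i)" for i by (simp add: x_def)
    have x00: "x 0 = x0" by (simp add: x_def)
    have x_W: "x i \<in> W i" "x i \<in> W (Suc i)" for i
      by (induction i) (use x0 in \<open>auto simp: x_Suc x00 W_Suc\<close>)
    have x_ne: "x i \<noteq> 0" for i by (induction i) (auto simp: x_Suc x00 x0)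
    have s1: "x 1 \<notin> vec.span {x 0}"
    proof
      assume "x 1 \<in> vec.span {x 0}"
      then obtain k where "Fr (x 0) = k *s x 0" using x_Suc[of 0] by (auto simp: in_span_1)
      then show False using curve_no_stable_line[OF WC x_W(1) x_ne] by blast
    qed
    have d01: "vec.dim {x 1, x 0} = 2" using s1 x_ne by (simp add: vec.dim_insert)
    have W1: "W 1 = vec.span {x 1, x 0}"
      by (rule curve_span_eq[OF WC]) (use x_W[of 0] x_W(1)[of 1] d01 in auto)
    have W1': "W (Suc 0) = vec.span {x (Suc 0), x 0}" using W1 by simp
    have W_eq: "W (Suc i) = vec.span {x (Suc i), x i}" for i
    proof (induction i)
      case (Suc i)
      then show ?case unfolding W_Suc[of "Suc i"] by (simp add: Fr_image_span x_Suc)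
    qed (use W1 in simp)
    have W2: "W 2 = vec.span {x 2, x 1}" and W3: "W 3 = vec.span {x 3, x 2}"
      and W4: "W 4 = vec.span {x 4, x 3}" and W5: "W 5 = vec.span {x 5, x 4}"
      using W_eq[of 1] W_eq[of 2] W_eq[of 3] W_eq[of 4] by (simp_all add: eval_nat_numeral)
    have Dx: "D (x i) (x (Suc i)) = 0" for i
      using curve_D[OF WC x_W(2)[of i] x_W(1)[of "Suc i"]] .
    have st: "stable (vec.span (x ` {..n}))" if "x (Suc n) \<in> vec.span (x ` {..n})" for n
      using stable_span_iterates[of n x0] that by (simp add: x_def[abs_def])
    have s2: "x 2 \<notin> vec.span {x 1, x 0}"
    proof
      assume "x 2 \<in> vec.span {x 1, x 0}"
      then have "stable (W 1)" using st[of 1] unfolding W1 img by (simp add: eval_nat_numeral)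
      then show False
        using stable_isotropic[of "W 1"] curve_D[OF WC] curve_dim[OF WC] by auto
    qed
    have d012: "vec.dim {x 2, x 1, x 0} = 3" using s2 d01 by (simp add: vec.dim_insert[of "x 2"])
    have s3: "x 3 \<notin> vec.span {x 2, x 1, x 0}"
    proof
      define T where "T = vec.span {x 2, x 1, x 0}"
      assume "x 3 \<in> vec.span {x 2, x 1, x 0}"
      then have sT: "stable T" using st[of 2] unfolding T_def img by (simp add: eval_nat_numeral)
      have FT: "Fr ` T = T"
        by (rule vec.subspace_dim_equal)
          (use sT in \<open>auto simp: stable_def dim_Fr Fr_image_subspace\<close>)
      have "D (x 0) (x 1) = 0" "D (x 1) (x 2) = 0"
        using Dx[of 0] Dx[of 1] by (simp_all add: eval_nat_numeral)
      then have D1: "D (x 1) (x 0) = 0" "D (x 1) (x 2) = 0" "D (x 2) (x 1) = 0" "D (x 0) (x 1) = 0"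
        using D_swap[of "x 1" "x 0"] D_swap[of "x 2" "x 1"] by simp_all
      have D1T: "D (x 1) y = 0" if "y \<in> T" for y
        using that D1 unfolding T_def in_span_3 by (auto simp: D_simps)
      \<comment> \<open>\<open>Fr\<close> is onto \<open>T\<close>, so applying it to
        \<open>D (x 1) y = 0\<close> with \<open>x 0 = Fr y\<close> turns the orthogonality of
        \<open>x 1\<close> into that of \<open>x 2\<close> and \<open>x 0\<close>; then
        \<open>T\<close> is isotropic.\<close>
      have "x 0 \<in> T" by (simp add: T_def vec.span_base)
      then have "x 0 \<in> Fr ` T" by (simp only: FT)
      then obtain y where y: "y \<in> T" "x 0 = Fr y" by blast
      have "D (x 2) (x 0) = Fr (D (x 1) y)"
        using D_frob[of "x 1" y] x_Suc[of 1] y by (simp add: eval_nat_numeral)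
      then have D2: "D (x 2) (x 0) = 0" "D (x 0) (x 2) = 0"
        using D1T[OF y(1)] D_swap[of "x 0" "x 2"] by simp_all
      have "D u v = 0" if "u \<in> T" "v \<in> T" for u v
        using that D1 D2 unfolding T_def in_span_3 by (auto simp: D_simps)
      then show False using stable_isotropic[OF sT] d012 by (simp add: T_def)
    qed
    have d0123: "vec.dim {x 3, x 2, x 1, x 0} = 4"
      using s3 d012 by (simp add: vec.dim_insert[of "x 3"])
    have disj13: "v = 0" if "v \<in> W 1" "v \<in> W 3" for v
    proof -
      obtain r s r' s' where v: "v = r *s x 1 + s *s x 0" "v = r' *s x 3 + s' *s x 2"
        using \<open>v \<in> W 1\<close> \<open>v \<in> W 3\<close> unfolding W1 W3 in_span_2 by blast
      obtain f where f: "dot f (x 3) = 1" "\<forall>z\<in>{x 2, x 1, x 0}. dot f z = 0"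
        using separating_functional[OF s3] by metis
      have "dot f v = r'" unfolding v(2) using f by (simp add: dot_simps)
      moreover have "dot f v = 0" unfolding v(1) using f by (simp add: dot_simps)
      ultimately have r': "r' = 0" by simp
      obtain f2 where f2: "dot f2 (x 2) = 1" "\<forall>z\<in>{x 1, x 0}. dot f2 z = 0"
        using separating_functional[OF s2] by metis
      have "dot f2 v = s'" unfolding v(2) using f2 r' by (simp add: dot_simps)
      moreover have "dot f2 v = 0" unfolding v(1) using f2 by (simp add: dot_simps)
      ultimately show ?thesis using r' v(2) by simp
    qed
    have s4: "x 4 \<notin> vec.span {x 3, x 2, x 1, x 0}"
    proof
      define H where "H = vec.span {x 3, x 2, x 1, x 0}"
      assume "x 4 \<in> vec.span {x 3, x 2, x 1, x 0}"
      then have sH: "stable H" using st[of 3] unfolding H_def img by (simp add: eval_nat_numeral)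
      \<comment> \<open>\<open>W 1\<close> and \<open>W 3\<close> are disjoint, so the alternative
        in \<open>meet\<close> provides a common functional. It kills all of \<open>H\<close>, and
        \<open>K 1\<close> vanishes on its kernel.\<close>
      obtain w where w: "w \<noteq> 0" "w \<in> L 1" "w \<in> L 3" using meet[of 1 3] disj13 by blast
      have wx: "dot w (x 0) = 0" "dot w (x 1) = 0" "dot w (x 2) = 0" "dot w (x 3) = 0"
        using L_W[OF w(2)] L_W[OF w(3)] by (auto simp: W1' W3 vec.span_base)
      have wH: "dot w y = 0" if "y \<in> H" for y
        using that unfolding H_def by (rule dot_span_zero) (use wx in auto)
      have "form (K 1) u v = 0" if "u \<in> H" "v \<in> H" for u v
        by (rule incident_isotropic[OF I w(2)[unfolded L_def] w(1)]) (use that wH in auto)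
      then show False
        using stable_isotropic_hyperplane[OF sH _ K0[of 1]] d0123 by (simp add: H_def)
    qed
    have d5: "vec.dim {x 4, x 3, x 2, x 1, x 0} = 5"
      using s4 d0123 by (simp add: vec.dim_insert[of "x 4"])
    then have d5': "vec.dim (x ` {..<5}) = 5" by (simp add: image_lessThan_5)
    obtain e where e: "\<forall>i<5. \<forall>j<5. dot (e i) (x j) = (if i = j then 1 else 0)"
      "\<forall>c. c = (\<Sum>i<5. dot c (x i) *s e i)"
      using family_dual_basis_ex[OF d5'] by (elim exE conjE)
    have ex: "w = dot w (x 0) *s e 0 + dot w (x 1) *s e 1 + dot w (x 2) *s e 2
        + dot w (x 3) *s e 3 + dot w (x 4) *s e 4" for w
      using e(2)[rule_format, of w] unfolding lessThan_5 by (simp add: add.assoc)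
    have ed [simp]: "dot (e i) (x j) = (if i = j then 1 else 0)" if "i < 5" "j < 5" for i j
      using e(1) that by blast
    have disj14: "v = 0" if "v \<in> W 1" "v \<in> W 4" for v
    proof -
      obtain r s r' s' where v: "v = r *s x 1 + s *s x 0" "v = r' *s x 4 + s' *s x 3"
        using \<open>v \<in> W 1\<close> \<open>v \<in> W 4\<close> unfolding W1 W4 in_span_2 by blast
      have "dot (e 4) v = 0" "dot (e 3) v = 0" unfolding v(1) by (simp_all add: dot_simps)
      then have "r' = 0" "s' = 0" unfolding v(2) by (simp_all add: dot_simps)
      with v show ?thesis by simp
    qed
    have disj24: "v = 0" if "v \<in> W 2" "v \<in> W 4" for v
    proof -
      obtain r s r' s' where v: "v = r *s x 2 + s *s x 1" "v = r' *s x 4 + s' *s x 3"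
        using \<open>v \<in> W 2\<close> \<open>v \<in> W 4\<close> unfolding W2 W4 in_span_2 by blast
      have "dot (e 4) v = 0" "dot (e 3) v = 0" unfolding v(1) by (simp_all add: dot_simps)
      then have "r' = 0" "s' = 0" unfolding v(2) by (simp_all add: dot_simps)
      with v show ?thesis by simp
    qed
    \<comment> \<open>Disjoint \<open>W 1\<close> and \<open>W 4\<close> again share a functional.
      Killing four of the five basis vectors makes it a multiple of one dual vector; the same device
      yields \<open>e4\<close> and \<open>e0\<close>.\<close>
    have e2: "e 2 \<in> L 1" "e 2 \<in> L 4"
    proof -
      obtain w where w: "w \<noteq> 0" "w \<in> L 1" "w \<in> L 4" using meet[of 1 4] disj14 by blast
      have "dot w (x 0) = 0" "dot w (x 1) = 0" "dot w (x 3) = 0" "dot w (x 4) = 0"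
        using L_W[OF w(2)] L_W[OF w(3)] by (auto simp: W1' W4 vec.span_base)
      then have "w = dot w (x 2) *s e 2" using ex[of w] by simp
      then show "e 2 \<in> L 1" "e 2 \<in> L 4"
        using w nonzero_multiple_in_subspace[OF L_sub, of "dot w (x 2)" "e 2"] by fastforce+
    qed
    have e4: "e 4 \<in> L 1"
    proof -
      obtain w where w: "w \<noteq> 0" "w \<in> L 1" "w \<in> L 3" using meet[of 1 3] disj13 by blast
      have "dot w (x 0) = 0" "dot w (x 1) = 0" "dot w (x 2) = 0" "dot w (x 3) = 0"
        using L_W[OF w(2)] L_W[OF w(3)] by (auto simp: W1' W3 vec.span_base)
      then have "w = dot w (x 4) *s e 4" using ex[of w] by simp
      then show ?thesis
        using w nonzero_multiple_in_subspace[OF L_sub, of "dot w (x 4)" "e 4"] by fastforce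
    qed
    have e0: "e 0 \<in> L 4"
    proof -
      obtain w where w: "w \<noteq> 0" "w \<in> L 2" "w \<in> L 4" using meet[of 2 4] disj24 by blast
      have "dot w (x 1) = 0" "dot w (x 2) = 0" "dot w (x 3) = 0" "dot w (x 4) = 0"
        using L_W[OF w(2)] L_W[OF w(3)] by (auto simp: W2 W4 vec.span_base)
      then have "w = dot w (x 0) *s e 0" using ex[of w] by simp
      then show ?thesis
        using w nonzero_multiple_in_subspace[OF L_sub, of "dot w (x 0)" "e 0"] by fastforce
    qed
    have d2: "vec.dim {e i, e j} = 2" if "i < 5" "j < 5" "i \<noteq> j" for i j
      unfolding dim2_iff
    proof (intro allI impI)
      fix r s assume *: "r *s e i + s *s e j = 0"
      show "r = 0 \<and> s = 0"
        using arg_cong[OF *, of "\<lambda>v. dot v (x i)"] arg_cong[OF *, of "\<lambda>v. dot v (x j)"] that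
        by (simp add: dot_simps)
    qed
    have L1: "L 1 = vec.span {e 2, e 4}"
      by (rule subspace_dim2_span[OF L_sub L_dim e2(1) e4 d2]) auto
    have L4: "L 4 = vec.span {e 0, e 2}"
      by (rule subspace_dim2_span[OF L_sub L_dim e0 e2(2) d2]) auto
    have p1: "x 3 \<in> perp (L 1)" and p4: "x 1 \<in> perp (L 4)"
      unfolding L1 L4 perp_span by (auto simp: perp_iff dot_commute[of "x _"])
    \<comment> \<open>Transport by Frobenius: two steps forward from \<open>p1\<close>, one step
      back and one step forward from \<open>p4\<close>.\<close>
    have p3: "x 5 \<in> perp (L 3)" "x 0 \<in> perp (L 3)" and p5: "x 2 \<in> perp (L 5)"
    proof -
      show "x 5 \<in> perp (L 3)"
        using perpL_Fr[OF perpL_Fr[OF p1]] x_Suc[of 3] x_Suc[of 4] by (simp add: eval_nat_numeral)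
      show "x 0 \<in> perp (L 3)"
        using perpL_Fr'[of "x 0" 3] p4 x_Suc[of 0] by (simp add: eval_nat_numeral)
      show "x 2 \<in> perp (L 5)"
        using perpL_Fr[OF p4] x_Suc[of 1] by (simp add: eval_nat_numeral)
    qed
    have p3': "x 2 \<in> perp (L 3)" "x 3 \<in> perp (L 3)"
      using L_W[of _ 3] by (auto simp: perp_iff W3 vec.span_base dot_commute[of "x _"])
    have "x 5 \<in> vec.span {x 0, x 2, x 3}"
    proof -
      have "vec.span {x 0, x 2, x 3} = perp (L 3)"
      proof (rule vec.subspace_dim_equal)
        show "vec.span {x 0, x 2, x 3} \<subseteq> perp (L 3)"
          by (rule vec.span_minimal) (use p3 p3' in auto)
        have "x 3 \<noteq> 0" by (rule x_ne)
        moreover have "x 2 \<notin> vec.span {x 3}"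
          by (rule not_in_span_dot[of _ "e 2"]) (auto simp: dot_commute[of "x _"])
        moreover have "x 0 \<notin> vec.span {x 2, x 3}"
          by (rule not_in_span_dot[of _ "e 0"]) (auto simp: dot_commute[of "x _"])
        ultimately show "vec.dim (vec.span {x 0, x 2, x 3}) \<ge> vec.dim (perp (L 3))"
          by (simp add: vec.dim_insert dim_perp L_dim)
      qed auto
      then show ?thesis using p3 by simp
    qed
    then obtain l0 l2 l3 where x5: "x 5 = l0 *s x 0 + l2 *s x 2 + l3 *s x 3"
      unfolding in_span_3 by blast
    \<comment> \<open>Members 1 and 5 meet too. A common vector forces \<open>l2\<close> and
      \<open>l3\<close> to vanish by comparison of coordinates; a common functional would kill the
      whole basis.\<close>
    have "x 5 = l0 *s x 0"
    proof (cases "\<exists>v. v \<noteq> 0 \<and> v \<in> W 1 \<and> v \<in> W 5")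
      case True
      then obtain v r s r' s' where v: "v \<noteq> 0" "v = r *s x 1 + s *s x 0" "v = r' *s x 5 + s' *s x 4"
        unfolding W1 W5 in_span_2 by blast
      have "dot (e 4) v = 0" "dot (e 3) v = 0" "dot (e 2) v = 0" unfolding v(2) by (simp_all add: dot_simps)
      then have "s' = 0" "r' * l3 = 0" "r' * l2 = 0" unfolding v(3) x5 by (simp_all add: dot_simps)
      moreover have "r' \<noteq> 0" using v(1,3) \<open>s' = 0\<close> by auto
      ultimately show ?thesis using x5 by simp
    next
      case False
      then obtain w where w: "w \<noteq> 0" "w \<in> L 1" "w \<in> L 5" using meet[of 1 5] by blast
      have "dot w (x 0) = 0" "dot w (x 1) = 0" "dot w (x 4) = 0"
        using L_W[OF w(2)] L_W[OF w(3)] by (auto simp: W1' W5 vec.span_base)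
      moreover have "dot w (x 3) = 0" "dot w (x 2) = 0"
        using p1 p5 w by (auto simp: perp_iff dot_commute[of w])
      ultimately have "w = 0" using ex[of w] by simp
      with w show ?thesis by simp
    qed
    then have "(Fr ^^ 5) x0 = l0 *s x0" by (simp only: x_def) simp
    then show thesis
    proof (intro that[of 1 x0])
      show "vec.dim ((\<lambda>i. (Fr ^^ i) x0) ` {..<5}) = 5" using d5' unfolding x_def[abs_def] .
      show "D x0 ((Fr ^^ 1) x0) = 0" using Dx[of 0] by (simp add: x_def)
    qed auto
  next
    case False
    \<comment> \<open>The same argument with the roles of \<open>W\<close> and \<open>L\<close>, of
      vectors and functionals, exchanged.\<close>
    with meet[of 0 1] obtain y0 where y0: "y0 \<noteq> 0" "y0 \<in> L 0" "y0 \<in> L 1" by auto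
    define y where "y i = (Fr ^^ i) y0" for i
    have y_Suc: "y (Suc i) = Fr (y i)" for i by (simp add: y_def)
    have y00: "y 0 = y0" by (simp add: y_def)
    have y_L: "y i \<in> L i" "y i \<in> L (Suc i)" for i
      by (induction i) (use y0 in \<open>auto simp: y_Suc y00 simp flip: L_Suc\<close>)
    have y_ne: "y i \<noteq> 0" for i by (induction i) (auto simp: y_Suc y00 y0)
    have st: "stable (vec.span (y ` {..n}))" if "y (Suc n) \<in> vec.span (y ` {..n})" for n
      using stable_span_iterates[of n y0] that by (simp add: y_def[abs_def])
    have s1: "y 1 \<notin> vec.span {y 0}"
    proof
      assume "y 1 \<in> vec.span {y 0}"
      then have "stable (vec.span {y 0})" using st[of 0] by simp
      then have sH: "stable (perp {y 0})" using stable_perp by (metis perp_span)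
      have d: "vec.dim (perp {y 0}) = 4" using y_ne[of 0] by (simp add: dim_perp)
      have "form (K 0) u v = 0" if "u \<in> perp {y 0}" "v \<in> perp {y 0}" for u v
        by (rule incident_isotropic[OF I y_L(1)[of 0, unfolded L_def] y_ne])
          (use that in \<open>auto simp: perp_iff dot_commute[of "y 0"]\<close>)
      then show False using stable_isotropic_hyperplane[OF sH d K0] by blast
    qed
    have d01: "vec.dim {y 1, y 0} = 2" using s1 y_ne by (simp add: vec.dim_insert)
    have L1: "L 1 = vec.span {y 1, y 0}"
      by (rule subspace_dim2_span[OF L_sub L_dim _ _ d01]) (use y_L[of 0] y_L(1)[of 1] in auto)
    have L1': "L (Suc 0) = vec.span {y (Suc 0), y 0}" using L1 by simp
    have L_eq: "L (Suc i) = vec.span {y (Suc i), y i}" for i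
    proof (induction i)
      case (Suc i)
      then show ?case unfolding L_Suc[of "Suc i", symmetric] by (simp add: Fr_image_span y_Suc)
    qed (use L1 in simp)
    have L2: "L 2 = vec.span {y 2, y 1}" and L3: "L 3 = vec.span {y 3, y 2}"
      and L4: "L 4 = vec.span {y 4, y 3}" and L5: "L 5 = vec.span {y 5, y 4}"
      using L_eq[of 1] L_eq[of 2] L_eq[of 3] L_eq[of 4] by (simp_all add: eval_nat_numeral)
    have s2: "y 2 \<notin> vec.span {y 1, y 0}"
    proof
      assume "y 2 \<in> vec.span {y 1, y 0}"
      then have "stable (L 1)" using st[of 1] unfolding L1 img by (simp add: eval_nat_numeral)
      then have "stable (perp (L 1))" by (rule stable_perp)
      moreover have "2 \<le> vec.dim (perp (L 1))" unfolding dim_perp by (simp add: L_dim)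
      ultimately show False
        using stable_in_radical[OF _ _ K0[of 1]] perpL_rad[of 1] by blast
    qed
    have d012: "vec.dim {y 2, y 1, y 0} = 3" using s2 d01 by (simp add: vec.dim_insert[of "y 2"])
    have s3: "y 3 \<notin> vec.span {y 2, y 1, y 0}"
    proof
      assume "y 3 \<in> vec.span {y 2, y 1, y 0}"
      then have "stable (vec.span {y 2, y 1, y 0})" using st[of 2] unfolding img by (simp add: eval_nat_numeral)
      then have "stable (perp {y 2, y 1, y 0})" using stable_perp by (metis perp_span)
      moreover have "perp {y 2, y 1, y 0} \<subseteq> rad (K 1)"
        unfolding perpL_rad[symmetric] L1 perp_span by (auto simp: perp_iff)
      moreover have "2 \<le> vec.dim (perp {y 2, y 1, y 0})" unfolding dim_perp d012 by simp
      ultimately show False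
        using stable_in_radical[OF _ _ K0[of 1]] by blast
    qed
    have d0123: "vec.dim {y 3, y 2, y 1, y 0} = 4"
      using s3 d012 by (simp add: vec.dim_insert[of "y 3"])
    have disj13: "v = 0" if "v \<in> L 1" "v \<in> L 3" for v
    proof -
      obtain r s r' s' where v: "v = r *s y 1 + s *s y 0" "v = r' *s y 3 + s' *s y 2"
        using \<open>v \<in> L 1\<close> \<open>v \<in> L 3\<close> unfolding L1 L3 in_span_2 by blast
      obtain f where f: "dot f (y 3) = 1" "\<forall>z\<in>{y 2, y 1, y 0}. dot f z = 0"
        using separating_functional[OF s3] by metis
      have "dot f v = r'" unfolding v(2) using f by (simp add: dot_simps)
      moreover have "dot f v = 0" unfolding v(1) using f by (simp add: dot_simps)
      ultimately have r': "r' = 0" by simp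
      obtain f2 where f2: "dot f2 (y 2) = 1" "\<forall>z\<in>{y 1, y 0}. dot f2 z = 0"
        using separating_functional[OF s2] by metis
      have "dot f2 v = s'" unfolding v(2) using f2 r' by (simp add: dot_simps)
      moreover have "dot f2 v = 0" unfolding v(1) using f2 by (simp add: dot_simps)
      ultimately show ?thesis using r' v(2) by simp
    qed
    have W_L: "x \<in> W i \<Longrightarrow> w \<in> L i \<Longrightarrow> dot x w = 0" for x w i
      using L_W[of w i x] by (simp add: dot_commute)
    have s4: "y 4 \<notin> vec.span {y 3, y 2, y 1, y 0}"
    proof
      define H where "H = vec.span {y 3, y 2, y 1, y 0}"
      assume "y 4 \<in> vec.span {y 3, y 2, y 1, y 0}"
      then have sH: "stable H" using st[of 3] unfolding H_def img by (simp add: eval_nat_numeral)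
      obtain p where p: "p \<noteq> 0" "p \<in> W 1" "p \<in> W 3" using meet[of 1 3] disj13 by blast
      have "dot p (y 0) = 0" "dot p (y 1) = 0" "dot p (y 2) = 0" "dot p (y 3) = 0"
        using W_L[OF p(2)] W_L[OF p(3)] by (auto simp: L1' L3 vec.span_base)
      then have "p \<in> perp H" unfolding H_def perp_span by (auto simp: perp_iff)
      then have "\<exists>k. Fr p = k *s p"
        using Fr_stable_perp_line[OF sH] p d0123 by (simp add: H_def)
      then show False using curve_no_stable_line[OF WC p(2,1)] by blast
    qed
    have d5: "vec.dim {y 4, y 3, y 2, y 1, y 0} = 5"
      using s4 d0123 by (simp add: vec.dim_insert[of "y 4"])
    then have d5': "vec.dim (y ` {..<5}) = 5" by (simp add: image_lessThan_5)
    obtain z where z: "\<forall>i<5. \<forall>j<5. dot (z i) (y j) = (if i = j then 1 else 0)"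
      "\<forall>c. c = (\<Sum>i<5. dot c (y i) *s z i)"
      using family_dual_basis_ex[OF d5'] by (elim exE conjE)
    have ex: "u = dot u (y 0) *s z 0 + dot u (y 1) *s z 1 + dot u (y 2) *s z 2
        + dot u (y 3) *s z 3 + dot u (y 4) *s z 4" for u
      using z(2)[rule_format, of u] unfolding lessThan_5 by (simp add: add.assoc)
    have zd [simp]: "dot (z i) (y j) = (if i = j then 1 else 0)" if "i < 5" "j < 5" for i j
      using z(1) that by blast
    have zd' [simp]: "dot (y j) (z i) = (if i = j then 1 else 0)" if "i < 5" "j < 5" for i j
      using zd[OF that] by (simp add: dot_commute)
    have disj14: "v = 0" if "v \<in> L 1" "v \<in> L 4" for v
    proof -
      obtain r s r' s' where v: "v = r *s y 1 + s *s y 0" "v = r' *s y 4 + s' *s y 3"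
        using \<open>v \<in> L 1\<close> \<open>v \<in> L 4\<close> unfolding L1 L4 in_span_2 by blast
      have "dot (z 4) v = 0" "dot (z 3) v = 0" unfolding v(1) by (simp_all add: dot_simps)
      then have "r' = 0" "s' = 0" unfolding v(2) by (simp_all add: dot_simps)
      with v show ?thesis by simp
    qed
    have disj24: "v = 0" if "v \<in> L 2" "v \<in> L 4" for v
    proof -
      obtain r s r' s' where v: "v = r *s y 2 + s *s y 1" "v = r' *s y 4 + s' *s y 3"
        using \<open>v \<in> L 2\<close> \<open>v \<in> L 4\<close> unfolding L2 L4 in_span_2 by blast
      have "dot (z 4) v = 0" "dot (z 3) v = 0" unfolding v(1) by (simp_all add: dot_simps)
      then have "r' = 0" "s' = 0" unfolding v(2) by (simp_all add: dot_simps)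
      with v show ?thesis by simp
    qed
    have W_sub: "vec.subspace (W i)" and W_dim: "vec.dim (W i) = 2" for i
      using curve_subspace[OF WC] curve_dim[OF WC] by auto
    have z2: "z 2 \<in> W 1" "z 2 \<in> W 4"
    proof -
      obtain p where p: "p \<noteq> 0" "p \<in> W 1" "p \<in> W 4" using meet[of 1 4] disj14 by blast
      have "dot p (y 0) = 0" "dot p (y 1) = 0" "dot p (y 3) = 0" "dot p (y 4) = 0"
        using W_L[OF p(2)] W_L[OF p(3)] by (auto simp: L1' L4 vec.span_base)
      then have "p = dot p (y 2) *s z 2" using ex[of p] by simp
      then show "z 2 \<in> W 1" "z 2 \<in> W 4"
        using p nonzero_multiple_in_subspace[OF W_sub, of "dot p (y 2)" "z 2"] by fastforce+
    qed
    have z4: "z 4 \<in> W 1"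
    proof -
      obtain p where p: "p \<noteq> 0" "p \<in> W 1" "p \<in> W 3" using meet[of 1 3] disj13 by blast
      have "dot p (y 0) = 0" "dot p (y 1) = 0" "dot p (y 2) = 0" "dot p (y 3) = 0"
        using W_L[OF p(2)] W_L[OF p(3)] by (auto simp: L1' L3 vec.span_base)
      then have "p = dot p (y 4) *s z 4" using ex[of p] by simp
      then show ?thesis
        using p nonzero_multiple_in_subspace[OF W_sub, of "dot p (y 4)" "z 4"] by fastforce
    qed
    have z0: "z 0 \<in> W 4"
    proof -
      obtain p where p: "p \<noteq> 0" "p \<in> W 2" "p \<in> W 4" using meet[of 2 4] disj24 by blast
      have "dot p (y 1) = 0" "dot p (y 2) = 0" "dot p (y 3) = 0" "dot p (y 4) = 0"
        using W_L[OF p(2)] W_L[OF p(3)] by (auto simp: L2 L4 vec.span_base)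
      then have "p = dot p (y 0) *s z 0" using ex[of p] by simp
      then show ?thesis
        using p nonzero_multiple_in_subspace[OF W_sub, of "dot p (y 0)" "z 0"] by fastforce
    qed
    have d2: "vec.dim {z i, z j} = 2" if "i < 5" "j < 5" "i \<noteq> j" for i j
      unfolding dim2_iff
    proof (intro allI impI)
      fix r s assume *: "r *s z i + s *s z j = 0"
      show "r = 0 \<and> s = 0"
        using arg_cong[OF *, of "\<lambda>v. dot v (y i)"] arg_cong[OF *, of "\<lambda>v. dot v (y j)"] that
        by (simp add: dot_simps)
    qed
    have W1: "W 1 = vec.span {z 2, z 4}"
      by (rule subspace_dim2_span[OF W_sub W_dim z2(1) z4 d2]) auto
    have W4: "W 4 = vec.span {z 0, z 2}"
      by (rule subspace_dim2_span[OF W_sub W_dim z0 z2(2) d2]) auto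
    have p1: "y 3 \<in> perp (W 1)" and p4: "y 1 \<in> perp (W 4)"
      unfolding W1 W4 perp_span by (auto simp: perp_iff)
    have p3: "y 5 \<in> perp (W 3)" "y 0 \<in> perp (W 3)" and p5: "y 2 \<in> perp (W 5)"
    proof -
      show "y 5 \<in> perp (W 3)"
        using perpW_Fr[OF perpW_Fr[OF p1]] y_Suc[of 3] y_Suc[of 4] by (simp add: eval_nat_numeral)
      show "y 0 \<in> perp (W 3)"
        using perpW_Fr'[of "y 0" 3] p4 y_Suc[of 0] by (simp add: eval_nat_numeral)
      show "y 2 \<in> perp (W 5)"
        using perpW_Fr[OF p4] y_Suc[of 1] by (simp add: eval_nat_numeral)
    qed
    have p3': "y 2 \<in> perp (W 3)" "y 3 \<in> perp (W 3)"
      using L_W[of _ 3] by (auto simp: perp_iff L3 vec.span_base)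
    have "y 5 \<in> vec.span {y 0, y 2, y 3}"
    proof -
      have "vec.span {y 0, y 2, y 3} = perp (W 3)"
      proof (rule vec.subspace_dim_equal)
        show "vec.span {y 0, y 2, y 3} \<subseteq> perp (W 3)"
          by (rule vec.span_minimal) (use p3 p3' in auto)
        have "y 3 \<noteq> 0" by (rule y_ne)
        moreover have "y 2 \<notin> vec.span {y 3}"
          by (rule not_in_span_dot[of _ "z 2"]) auto
        moreover have "y 0 \<notin> vec.span {y 2, y 3}"
          by (rule not_in_span_dot[of _ "z 0"]) auto
        ultimately show "vec.dim (vec.span {y 0, y 2, y 3}) \<ge> vec.dim (perp (W 3))"
          by (simp add: vec.dim_insert dim_perp W_dim)
      qed auto
      then show ?thesis using p3 by simp
    qed
    then obtain l0 l2 l3 where y5: "y 5 = l0 *s y 0 + l2 *s y 2 + l3 *s y 3"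
      unfolding in_span_3 by blast
    have y5': "y 5 = l0 *s y 0"
    proof (cases "\<exists>v. v \<noteq> 0 \<and> v \<in> L 1 \<and> v \<in> L 5")
      case True
      then obtain v r s r' s' where v: "v \<noteq> 0" "v = r *s y 1 + s *s y 0" "v = r' *s y 5 + s' *s y 4"
        unfolding L1 L5 in_span_2 by blast
      have "dot (z 4) v = 0" "dot (z 3) v = 0" "dot (z 2) v = 0" unfolding v(2) by (simp_all add: dot_simps)
      then have "s' = 0" "r' * l3 = 0" "r' * l2 = 0" unfolding v(3) y5 by (simp_all add: dot_simps)
      moreover have "r' \<noteq> 0" using v(1,3) \<open>s' = 0\<close> by auto
      ultimately show ?thesis using y5 by simp
    next
      case False
      then obtain p where p: "p \<noteq> 0" "p \<in> W 1" "p \<in> W 5" using meet[of 1 5] by blast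
      have "dot p (y 0) = 0" "dot p (y 1) = 0" "dot p (y 4) = 0"
        using W_L[OF p(2)] W_L[OF p(3)] by (auto simp: L1' L5 vec.span_base)
      moreover have "dot p (y 3) = 0" "dot p (y 2) = 0"
        using p1 p5 p by (auto simp: perp_iff dot_commute[of p])
      ultimately have "p = 0" using ex[of p] by simp
      with p show ?thesis by simp
    qed
    then have l0: "l0 \<noteq> 0" using y_ne[of 5] by auto
    \<comment> \<open>Since \<open>y 5\<close> is a multiple of \<open>y 0\<close>, Frobenius
      permutes the dual basis cyclically up to scalars; \<open>inverse l0\<close> appears at the
      wrap-around from 4 to 0.\<close>
    have Fz: "\<exists>k. k \<noteq> 0 \<and> Fr (z i) = k *s z (Suc i mod 5)" if i: "i < 5" for i
    proof -
      have F: "dot (Fr (z i)) (y (Suc j)) = (if i = j then 1 else 0)" if "j < 5" for j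
        using i that by (simp add: y_Suc dot_Fr zero_power)
      have F0: "dot (Fr (z i)) (y 0) = (if i = 4 then inverse l0 else 0)"
      proof -
        have "l0 * dot (Fr (z i)) (y 0) = dot (Fr (z i)) (y 5)" by (simp add: y5' dot_simps)
        also have "\<dots> = (if i = 4 then 1 else 0)" using F[of 4] by (simp add: eval_nat_numeral)
        finally show ?thesis using l0 by (auto simp: field_simps split: if_splits)
      qed
      have F14: "dot (Fr (z i)) (y 1) = (if i = 0 then 1 else 0)"
        "dot (Fr (z i)) (y 2) = (if i = 1 then 1 else 0)"
        "dot (Fr (z i)) (y 3) = (if i = 2 then 1 else 0)"
        "dot (Fr (z i)) (y 4) = (if i = 3 then 1 else 0)"
        using F[of 0] F[of 1] F[of 2] F[of 3] by (simp_all add: eval_nat_numeral)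
      have "i = 0 \<or> i = 1 \<or> i = 2 \<or> i = 3 \<or> i = 4" using i by linarith
      then show ?thesis
        using ex[of "Fr (z i)"] unfolding F0 F14
        by (elim disjE) (use l0 in \<open>auto simp: numeral_2_eq_2 intro: exI[of _ 1] exI[of _ "inverse l0"]\<close>)
    qed
    have iter: "\<exists>k. k \<noteq> 0 \<and> (Fr ^^ i) (z 0) = k *s z (i mod 5)" for i
    proof (induction i)
      case 0
      then show ?case by (intro exI[of _ 1]) simp
    next
      case (Suc i)
      then obtain k where k: "k \<noteq> 0" "(Fr ^^ i) (z 0) = k *s z (i mod 5)" by blast
      obtain k' where k': "k' \<noteq> 0" "Fr (z (i mod 5)) = k' *s z (Suc (i mod 5) mod 5)"
        using Fz[of "i mod 5"] by auto
      show ?case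
        by (rule exI[of _ "k ^ q * k'"]) (use k k' in \<open>simp add: Fr_scale mod_Suc_eq\<close>)
    qed
    have dim5: "vec.dim ((\<lambda>i. (Fr ^^ i) (z 0)) ` {..<5}) = 5"
    proof (rule biorthogonal_dim[where y = y])
      fix i j :: nat assume ij: "i < 5" "j < 5"
      obtain k where "k \<noteq> 0" "(Fr ^^ i) (z 0) = k *s z (i mod 5)" using iter by blast
      then show "dot ((Fr ^^ i) (z 0)) (y j) = 0 \<longleftrightarrow> i \<noteq> j" using ij by (simp add: dot_simps)
    qed
    \<comment> \<open>\<open>L (Suc i)\<close> is spanned by \<open>y i\<close> and
      \<open>y (Suc i)\<close>, so the form it belongs to is a multiple of their wedge.\<close>
    have fK: "\<exists>k. k \<noteq> 0 \<and> (\<forall>u v. form (K (Suc i)) u v = k * wedge (y i) (y (Suc i)) u v)" for i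
    proof -
      obtain w where w: "dual_pt (K (Suc i)) (y i) w"
        by (rule dual_pt_change[OF du y_L(2)[of i, unfolded L_def] y_ne])
      have "perp {y i, w} = perp (L (Suc i))" using dual_pt_rad[OF w] perpL_rad by simp
      then have "vec.span {y i, w} = L (Suc i)"
        using perp_perp[OF L_sub, of "Suc i"] perp_perp[of "vec.span {y i, w}"]
        by (simp add: perp_span)
      then have "w \<in> vec.span {y (Suc i), y i}" by (metis L_eq insertCI vec.span_base)
      then obtain k l where kl: "w = k *s y (Suc i) + l *s y i" by (auto simp: in_span_2)
      have f: "form (K (Suc i)) u v = k * wedge (y i) (y (Suc i)) u v" for u v
        using w by (simp add: dual_pt_def kl wedge_def dot_simps algebra_simps)
      moreover have "k \<noteq> 0" using f form_nondegenerate[OF K0[of "Suc i"]] by auto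
      ultimately show ?thesis by blast
    qed
    have wy: "wedge (y i) (y (Suc i)) (z j) (z (Suc j mod 5)) = 0 \<longleftrightarrow> i \<noteq> j"
      and wy': "wedge (y i) (y (Suc i)) (z 0) (z 2) = 0" if ij: "i < 5" "j < 5" for i j
    proof -
      have zy5: "dot (y 5) (z j) = (if j = 0 then l0 else 0)" if "j < 5" for j
        using that by (simp add: y5' dot_simps)
      have "i = 0 \<or> i = 1 \<or> i = 2 \<or> i = 3 \<or> i = 4" "j = 0 \<or> j = 1 \<or> j = 2 \<or> j = 3 \<or> j = 4"
        using ij by linarith+
      then show "wedge (y i) (y (Suc i)) (z j) (z (Suc j mod 5)) = 0 \<longleftrightarrow> i \<noteq> j"
        and "wedge (y i) (y (Suc i)) (z 0) (z 2) = 0"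
        using l0 zy5 by (auto simp: wedge_def numeral_eq_Suc[symmetric] simp del: One_nat_def
            simp flip: numeral_2_eq_2 numeral_3_eq_3 eval_nat_numeral Suc_eq_plus1)
    qed
    \<comment> \<open>The five forms are biorthogonal to the values of \<open>D\<close> on the sides
      of the pentagon, hence independent. All of them vanish on the diagonal \<open>z 0\<close>,
      \<open>z 2\<close>, so \<open>D\<close> itself vanishes there.\<close>
    have dK: "vec.dim ((\<lambda>i. K (Suc i)) ` {..<5}) = 5"
    proof (rule biorthogonal_dim[where y = "\<lambda>j. D (z j) (z (Suc j mod 5))"])
      fix i j :: nat assume ij: "i < 5" "j < 5"
      obtain k where "k \<noteq> 0" "\<forall>u v. form (K (Suc i)) u v = k * wedge (y i) (y (Suc i)) u v"
        using fK by blast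
      then show "dot (K (Suc i)) (D (z j) (z (Suc j mod 5))) = 0 \<longleftrightarrow> i \<noteq> j"
        using wy[OF ij] by (simp flip: form_def)
    qed
    have "D (z 0) (z 2) \<in> perp ((\<lambda>i. K (Suc i)) ` {..<5})"
    proof -
      have "form (K (Suc i)) (z 0) (z 2) = 0" if "i < 5" for i
        using fK[of i] wy'[OF that, of 0] by auto
      then show ?thesis by (auto simp: perp_iff form_def dot_commute[of "D _ _"])
    qed
    moreover have "vec.dim (perp ((\<lambda>i. K (Suc i)) ` {..<5})) = 0" by (simp add: dim_perp dK)
    ultimately have "D (z 0) (z 2) = 0" by (metis vec.dim_eq_0 singletonD subsetD)
    moreover obtain k where "(Fr ^^ 2) (z 0) = k *s z 2" using iter[of 2] by auto
    ultimately have "D (z 0) ((Fr ^^ 2) (z 0)) = 0" by (simp only: D_scale_right) simp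
    moreover obtain k' where "(Fr ^^ 5) (z 0) = k' *s z 0" using iter[of 5] by auto
    ultimately show thesis using that[of 2 "z 0"] dim5 by blast
  qed
qed

end

section \<open>Forms of bidegree (2, 2) and the geometry of a smooth system\<close>

definition biquadratic :: "(nat \<Rightarrow> nat \<Rightarrow> 'b::field) \<Rightarrow> 'b \<Rightarrow> 'b \<Rightarrow> 'b \<Rightarrow> 'b \<Rightarrow> 'b" where
  "biquadratic g s t u v = (\<Sum>i\<le>2. \<Sum>j\<le>2. g i j * s ^ i * t ^ (2 - i) * u ^ j * v ^ (2 - j))"

lemma sum_atMost_2: "(\<Sum>i\<le>2. f i) = f 0 + f 1 + f (2::nat)"
  by (simp add: eval_nat_numeral)

definition coeff_st :: "(nat \<Rightarrow> nat \<Rightarrow> 'b::field) \<Rightarrow> 'b \<Rightarrow> 'b \<Rightarrow> nat \<Rightarrow> 'b" where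
  "coeff_st g u v i = g i 0 * v\<^sup>2 + g i 1 * (u * v) + g i 2 * u\<^sup>2"

lemma biquadratic_coeff_st:
  "biquadratic g s t u v
    = coeff_st g u v 2 * s\<^sup>2 + coeff_st g u v 1 * (s * t) + coeff_st g u v 0 * t\<^sup>2"
  by (simp add: biquadratic_def coeff_st_def sum_atMost_2 algebra_simps power2_eq_square)

text \<open>A double root at \<open>s\<close> would leave no other root. The second root is
  homogeneous since it may lie at infinity.\<close>

lemma quadratic_simple_root:
  fixes q0 q1 q2 :: "'b::field"
  assumes "q2 \<noteq> 0 \<or> q1 \<noteq> 0 \<or> q0 \<noteq> 0" "q2 * s\<^sup>2 + q1 * s + q0 = 0"
    "q2 * s'\<^sup>2 + q1 * (s' * t') + q0 * t'\<^sup>2 = 0" "s' \<noteq> s * t'"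
  shows "2 * q2 * s + q1 \<noteq> 0"
proof
  assume d: "2 * q2 * s + q1 = 0"
  then have q1: "q1 = - (2 * q2 * s)" by (simp add: eq_neg_iff_add_eq_0 add.commute)
  then have q0: "q0 = q2 * s\<^sup>2" using assms(2) by (simp add: power2_eq_square algebra_simps)
  have "q2 * (s' - s * t')\<^sup>2 = 0"
    using assms(3) unfolding q1 q0 by (simp add: power2_eq_square algebra_simps)
  then have "q2 = 0" using assms(4) by simp
  with q1 q0 assms(1) show False by simp
qed

text \<open>This locale exists to be refuted in \<open>smooth_contradiction\<close>;
  \<open>dual_ex\<close> provides the first double cover.\<close>

locale smooth_system = alternating_system q D
  for q :: nat and D :: "'b::alg_closed_field ^ 5 \<Rightarrow> 'b ^ 5 \<Rightarrow> 'b ^ 5" +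
  assumes no_incident: "\<not> incident V c a b"
    and dual_ex: "\<exists>c a b. dual_pt c a b"
begin

lemma curve_disjoint:
  assumes "V \<in> curve" "V' \<in> curve" "V \<noteq> V'" "x \<in> V" "x \<in> V'"
  shows "x = 0"
  using curve_meet_incident[OF assms] no_incident by blast

lemma dual_unique:
  assumes "dual_pt c a b" "dual_pt c' a' b'" "w \<in> vec.span {a, b}" "w \<in> vec.span {a', b'}" "w \<noteq> 0"
  shows "c' \<in> vec.span {c}"
  using dual_meet_incident[OF assms(1,2) _ assms(3-5)] no_incident by blast

lemma curve_not_in_radical:
  assumes "V \<in> curve" "dual_pt c a b" "w \<in> vec.span {a, b}" "w' \<in> vec.span {a, b}"
    "w \<in> perp V" "w' \<in> perp V"
  shows "vec.dim {w, w'} \<noteq> 2"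
proof
  assume "vec.dim {w, w'} = 2"
  then have "vec.span {a, b} = vec.span {w, w'}" by (rule span2_eq_of_dim[OF assms(3,4)])
  moreover have "vec.span {w, w'} \<subseteq> perp V" by (rule vec.span_minimal) (use assms in auto)
  ultimately have "a \<in> perp V" "b \<in> perp V" by (metis insertCI subsetD vec.span_base)+
  with no_incident[of V c a b] assms show False by (simp add: incident_def)
qed

text \<open>Two independent killing functionals would span \<open>span {a, b}\<close> and make
  \<open>V\<close> incident with \<open>c\<close>. Hence the value (r : s) of \<open>V\<close> is
  well defined.\<close>

lemma killing_unique:
  assumes "V \<in> curve" "dual_pt c a b" "r *s a + s *s b \<in> perp V" "r' *s a + s' *s b \<in> perp V"
  shows "r * s' = r' * s"
proof -
  have "vec.dim {r *s a + s *s b, r' *s a + s' *s b} \<noteq> 2"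
    by (rule curve_not_in_radical[OF assms(1,2) _ _ assms(3,4)]) (auto simp: in_span_2)
  then obtain k l where kl: "k *s (r *s a + s *s b) + l *s (r' *s a + s' *s b) = 0" "k \<noteq> 0 \<or> l \<noteq> 0"
    unfolding dim2_iff by blast
  have "(k * r + l * r') *s a + (k * s + l * s') *s b = 0"
    using kl(1) by (simp add: vec_eq_iff algebra_simps)
  from dim2D[OF dual_pt_dim[OF assms(2)] this]
  have e: "k * r + l * r' = 0" "k * s + l * s' = 0" by auto
  have "k * (r * s' - r' * s) = (k * r + l * r') * s' - (k * s + l * s') * r'"
    "l * (r * s' - r' * s) = (k * s + l * s') * r - (k * r + l * r') * s"
    by (simp_all add: algebra_simps)
  then have "k * (r * s' - r' * s) = 0" "l * (r * s' - r' * s) = 0" by (simp_all only: e) simp_all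
  with kl(2) show ?thesis by auto
qed

lemma dual_not_rational:
  assumes "dual_pt c a b"
  shows "Fr c \<notin> vec.span {c}"
proof
  assume "Fr c \<in> vec.span {c}"
  then have st: "stable (vec.span {c})" by (intro stable_span) auto
  show False
  proof (rule rational_not_large_radical[OF st])
    show "c \<in> vec.span {c}" by (simp add: vec.span_base)
    show "c \<noteq> 0" using assms by (simp add: dual_pt_def)
    fix d assume "d \<in> vec.span {c}"
    then have "rad c \<subseteq> rad d" by (auto simp: in_span_1 rad_def form_simps)
    moreover have "vec.dim (rad c) = 3"
      unfolding dual_pt_rad[OF assms] dim_perp dual_pt_dim[OF assms] by simp
    ultimately show "2 \<le> vec.dim (rad d)" using vec.dim_subset[of "rad c" "rad d"] by simp
  qed
qed

lemma curve_pair_dim: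
  assumes "V \<in> curve" "V' \<in> curve" "V \<noteq> V'"
  shows "4 \<le> vec.dim (V \<union> V')"
  using curve_disjoint_dim[OF assms(1,2)] curve_disjoint[OF assms] by blast

text \<open>The values under two different covers separate members: for \<open>V \<noteq> V'\<close>
  only one functional kills both, and it would be common to the spans of two different
  forms.\<close>

lemma curve_determined:
  assumes "V \<in> curve" "V' \<in> curve" "dual_pt c a b" "dual_pt c' a' b'" "c' \<notin> vec.span {c}"
    and w: "w \<in> vec.span {a, b}" "w \<noteq> 0" "w \<in> perp V" "w \<in> perp V'"
    and w': "w' \<in> vec.span {a', b'}" "w' \<noteq> 0" "w' \<in> perp V" "w' \<in> perp V'"
  shows "V = V'"
proof (rule ccontr)
  assume "V \<noteq> V'"
  then have d: "4 \<le> vec.dim (V \<union> V')" using curve_pair_dim assms by blast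
  have "w \<in> perp (V \<union> V')" "w' \<in> perp (V \<union> V')" using w w' by (auto simp: perp_iff)
  then obtain k where "w' = k *s w" using perp_line_proportional[OF d _ w(2)] by blast
  then have "w' \<in> vec.span {a, b}" using w(1) by (simp add: vec.span_scale)
  with dual_unique[OF assms(3,4) _ w'(1,2)] assms(5) show False by blast
qed

text \<open>\<open>V\<close> and \<open>V'\<close> span the kernel of \<open>w\<close>. The form
  vanishes on each of them because they belong to the curve, and between them by assumption, so
  \<open>w\<close> divides it.\<close>

lemma isotropic_pair:
  assumes "V \<in> curve" "V' \<in> curve" "V \<noteq> V'" "V = vec.span {x, y}" "V' = vec.span {x', y'}"
    and w: "w \<noteq> 0" "w \<in> perp V" "w \<in> perp V'"
    and c: "c \<noteq> 0" "form c x x' = 0" "form c x y' = 0" "form c y x' = 0" "form c y y' = 0"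
  obtains w' where "dual_pt c w w'"
proof (rule isotropic_hyperplane_dual[OF c(1) w(1)])
  have "vec.span (V \<union> V') = perp {w}"
  proof (rule vec.subspace_dim_equal)
    show "vec.span (V \<union> V') \<subseteq> perp {w}"
      by (rule vec.span_minimal) (use w in \<open>auto simp: perp_iff dot_commute\<close>)
    show "vec.dim (vec.span (V \<union> V')) \<ge> vec.dim (perp {w})"
      using curve_pair_dim[OF assms(1-3)] w(1) by (simp add: dim_perp)
  qed auto
  moreover have "vec.span (V \<union> V') = vec.span {x, y, x', y'}"
  proof -
    have "V \<union> V' \<subseteq> vec.span {x, y, x', y'}"
      unfolding assms(4,5) by (intro Un_least vec.span_mono) auto
    then have "vec.span (V \<union> V') \<subseteq> vec.span {x, y, x', y'}" by (intro vec.span_minimal) auto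
    moreover have "{x, y, x', y'} \<subseteq> V \<union> V'" unfolding assms(4,5) by (auto intro: vec.span_base)
    then have "vec.span {x, y, x', y'} \<subseteq> vec.span (V \<union> V')" by (rule vec.span_mono)
    ultimately show ?thesis by blast
  qed
  ultimately have H: "u \<in> vec.span {x, y, x', y'}" if "dot w u = 0" for u
    using that by (auto simp: perp_iff dot_commute)
  have D0: "D x y = 0" "D x' y' = 0"
    using curve_D[OF assms(1), of x y] curve_D[OF assms(2), of x' y'] assms(4,5)
    by (auto simp: vec.span_base)
  have f0: "form c x y = 0" "form c x' y' = 0" by (simp_all add: form_def D0)
  have z: "form c u v = 0" if "u \<in> {x, y, x', y'}" "v \<in> {x, y, x', y'}" for u v
    using that c(2-) f0 form_swap[of c u v] by auto
  fix u v assume "dot w u = 0" "dot w v = 0"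
  then have uv: "u \<in> vec.span {x, y, x', y'}" "v \<in> vec.span {x, y, x', y'}" using H by blast+
  have 1: "form c u' v = 0" if "u' \<in> {x, y, x', y'}" for u'
    using dot_span_zero[OF uv(2), of "fnl c u'"] z that by (simp add: dot_fnl)
  have "form c v u = 0"
    using dot_span_zero[OF uv(1), of "fnl c v"] 1 form_swap[of c v] by (simp add: dot_fnl)
  then show "form c u v = 0" using form_swap[of c u v] by simp
qed (rule that)

text \<open>Three members over one value lie in the hyperplane \<open>perp {w}\<close>, where
  \<open>V3\<close> is the graph of an isomorphism from \<open>V1\<close> to \<open>V2\<close>. Its
  isotropy ties two of the four conditions between \<open>V1\<close> and \<open>V2\<close> together,
  so besides \<open>c\<close> a second form vanishes on the hyperplane, and two different forms
  share the factor \<open>w\<close>.\<close>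

lemma curve_at_most_two:
  assumes C: "V1 \<in> curve" "V2 \<in> curve" "V3 \<in> curve" and c: "dual_pt c a b"
    and w: "w \<in> vec.span {a, b}" "w \<noteq> 0" "w \<in> perp V1" "w \<in> perp V2" "w \<in> perp V3"
  shows "V1 = V2 \<or> V1 = V3 \<or> V2 = V3"
proof (rule ccontr)
  assume "\<not> ?thesis"
  then have ne: "V1 \<noteq> V2" "V1 \<noteq> V3" "V2 \<noteq> V3" by auto
  obtain x3 y3 where V3: "V3 = vec.span {x3, y3}" "vec.dim {x3, y3} = 2" "D x3 y3 = 0"
    by (rule curveE[OF C(3)])
  have x3V: "x3 \<in> V3" "y3 \<in> V3" using V3 by (auto simp: vec.span_base)
  have "vec.span (V1 \<union> V2) = perp {w}"
  proof (rule vec.subspace_dim_equal)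
    show "vec.span (V1 \<union> V2) \<subseteq> perp {w}"
      by (rule vec.span_minimal) (use w in \<open>auto simp: perp_iff dot_commute\<close>)
    show "vec.dim (vec.span (V1 \<union> V2)) \<ge> vec.dim (perp {w})"
      using curve_pair_dim[OF C(1,2) ne(1)] w(2) by (simp add: dim_perp)
  qed auto
  then have split: "\<exists>u\<in>V1. \<exists>v\<in>V2. z = u + v" if "z \<in> V3" for z
  proof -
    have "dot w z = 0" using w(5) that by (simp add: perp_iff)
    then have "dot z w = 0" by (simp add: dot_commute)
    then have "z \<in> vec.span (V1 \<union> V2)" using \<open>vec.span (V1 \<union> V2) = perp {w}\<close> by (simp add: perp_iff)
    then show ?thesis
      unfolding vec.span_Un vec.span_eq_iff[THEN iffD2, OF curve_subspace[OF C(1)]]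
        vec.span_eq_iff[THEN iffD2, OF curve_subspace[OF C(2)]] by auto
  qed
  obtain x1 x2 where x: "x1 \<in> V1" "x2 \<in> V2" "x3 = x1 + x2" using split[OF x3V(1)] by blast
  obtain y1 y2 where y: "y1 \<in> V1" "y2 \<in> V2" "y3 = y1 + y2" using split[OF x3V(2)] by blast
  note sub = curve_subspace[OF C(1)] curve_subspace[OF C(2)] curve_subspace[OF C(3)]
  have d: "vec.dim {x1, y1} = 2" "vec.dim {x2, y2} = 2"
  proof -
    have *: "r = 0 \<and> s = 0"
      if "r *s x1 + s *s y1 = 0 \<or> r *s x2 + s *s y2 = 0" for r s
    proof -
      have e: "r *s x3 + s *s y3 = (r *s x1 + s *s y1) + (r *s x2 + s *s y2)"
        using x y by (simp add: vec_eq_iff algebra_simps)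
      have "r *s x3 + s *s y3 \<in> V3" "r *s x1 + s *s y1 \<in> V1" "r *s x2 + s *s y2 \<in> V2"
        by (intro vec.subspace_add vec.subspace_scale sub x(1,2) y(1,2) x3V)+
      then have "r *s x3 + s *s y3 = 0"
        using that e curve_disjoint[OF C(1,3) ne(2)] curve_disjoint[OF C(2,3) ne(3)] by auto
      then show ?thesis using dim2D[OF V3(2)] by blast
    qed
    then show "vec.dim {x1, y1} = 2" "vec.dim {x2, y2} = 2" unfolding dim2_iff by blast+
  qed
  have V12: "V1 = vec.span {x1, y1}" "V2 = vec.span {x2, y2}"
    using curve_span_eq[OF C(1) x(1) y(1) d(1)] curve_span_eq[OF C(2) x(2) y(2) d(2)] .
  have "D x1 y2 + D x2 y1 = 0"
    using V3(3) curve_D[OF C(1) x(1) y(1)] curve_D[OF C(2) x(2) y(2)] unfolding x(3) y(3)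
    by (simp add: D_simps add.commute)
  then have Dxy: "D x1 y2 = D y1 x2" using D_swap[of x2 y1] by simp
  \<comment> \<open>Three conditions instead of four, thanks to \<open>Dxy\<close>; the solutions
    form a space of dimension at least two and are not confined to the line of
    \<open>c\<close>.\<close>
  have "vec.dim {D x1 x2, D x1 y2, D y1 y2} + 1 < CARD(5)" by (simp add: vec.dim_insert)
  then obtain c' where c': "c' \<notin> vec.span {c}" "\<forall>z\<in>{D x1 x2, D x1 y2, D y1 y2}. dot c' z = 0"
    using perp_not_in_line[of "{D x1 x2, D x1 y2, D y1 y2}" c] by metis
  have "c' \<noteq> 0" using c'(1) by (auto simp: vec.span_zero)
  have f: "form c' x1 x2 = 0" "form c' x1 y2 = 0" "form c' y1 x2 = 0" "form c' y1 y2 = 0"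
    using c'(2) Dxy by (simp_all add: form_def)
  obtain w' where "dual_pt c' w w'"
    by (rule isotropic_pair[OF C(1,2) ne(1) V12 w(2-4) \<open>c' \<noteq> 0\<close> f])
  then have "c' \<in> vec.span {c}"
    using dual_unique[OF c _ w(1) _ w(2)] by (metis insertCI vec.span_base)
  with c'(1) show False by blast
qed

text \<open>Four conditions on a five-dimensional system leave a form that vanishes between
  \<open>V\<close> and \<open>V'\<close>. Any two members are therefore exchanged by the involution
  of some cover.\<close>

lemma dual_through_pair:
  assumes "V \<in> curve" "V' \<in> curve" "V \<noteq> V'"
  obtains c w w' where "dual_pt c w w'" "w \<in> perp V" "w \<in> perp V'"
proof -
  obtain x y where V: "V = vec.span {x, y}" by (rule curveE[OF assms(1)])
  obtain x' y' where V': "V' = vec.span {x', y'}" by (rule curveE[OF assms(2)])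
  have "vec.dim {D x x', D x y', D y x', D y y'} < CARD(5)" by (simp add: vec.dim_insert)
  then obtain c where c: "c \<noteq> 0" "\<forall>z\<in>{D x x', D x y', D y x', D y y'}. dot c z = 0"
    using perp_nonzero[of "{D x x', D x y', D y x', D y y'}"] by metis
  have "vec.dim {x, y, x', y'} < CARD(5)" by (simp add: vec.dim_insert)
  then obtain w where w: "w \<noteq> 0" "\<forall>z\<in>{x, y, x', y'}. dot w z = 0"
    using perp_nonzero[of "{x, y, x', y'}"] by metis
  have wV: "w \<in> perp V" "w \<in> perp V'"
    unfolding V V' perp_span using w by (auto simp: perp_iff)
  have f: "form c x x' = 0" "form c x y' = 0" "form c y x' = 0" "form c y y' = 0"
    using c by (simp_all add: form_def)
  obtain w' where "dual_pt c w w'"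
    by (rule isotropic_pair[OF assms V V' w(1) wV c(1) f])
  with that wV show thesis by blast
qed

text \<open>Two covers map the curve to a curve of bidegree (2, 2) in a product of two lines.
  Prescribing both values confines \<open>V\<close> to the three-space of \<open>\<sigma>\<close>,
  \<open>\<tau>\<close>, \<open>E 4\<close>, where \<open>c\<close> and \<open>c'\<close> vanish
  identically. Three functionals remain, and the columns of the determinant, from
  \<open>D \<sigma> \<tau>\<close>, \<open>D \<sigma> (E 4)\<close> and
  \<open>D \<tau> (E 4)\<close>, have bidegrees (1, 1), (1, 0) and (0, 1).\<close>

lemma biquadratic_relation:
  assumes c: "dual_pt c a b" "dual_pt c' a' b'" "c' \<notin> vec.span {c}"
  shows "\<exists>g. \<forall>s t u v. (s \<noteq> 0 \<or> t \<noteq> 0) \<longrightarrow> (u \<noteq> 0 \<or> v \<noteq> 0) \<longrightarrow>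
    (biquadratic g s t u v = 0 \<longleftrightarrow>
      (\<exists>V\<in>curve. s *s a + t *s b \<in> perp V \<and> u *s a' + v *s b' \<in> perp V))"
proof -
  have ab: "vec.dim {a, b} = 2" "vec.dim {a', b'} = 2" using dual_pt_dim c by auto
  have disj: "w = 0" if "w \<in> vec.span {a, b}" "w \<in> vec.span {a', b'}" for w
    using dual_unique[OF c(1,2) that] c(3) by blast
  have ni: "b \<notin> vec.span {a', b'}" "a \<notin> vec.span {b, a', b'}"
  proof -
    show "b \<notin> vec.span {a', b'}"
    proof
      assume b: "b \<in> vec.span {a', b'}"
      have "b \<in> vec.span {a, b}" by (simp add: vec.span_base)
      from disj[OF this b] show False using dim2D[OF ab(1), of 0 1] by simp
    qed
    show "a \<notin> vec.span {b, a', b'}"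
    proof
      assume "a \<in> vec.span {b, a', b'}"
      then obtain r y where ry: "y \<in> vec.span {a', b'}" "a = r *s b + y"
        unfolding in_span_insert[of a b] by blast
      then have "y = 1 *s a + (- r) *s b" by simp
      then have "y \<in> vec.span {a, b}" unfolding in_span_2 by blast
      from disj[OF this ry(1)] have "1 *s a + (- r) *s b = 0" using \<open>y = 1 *s a + (- r) *s b\<close> by simp
      from dim2D[OF ab(1) this] show False by simp
    qed
  qed
  have d4: "vec.dim {a, b, a', b'} = 4"
    using ni ab(2) by (simp add: vec.dim_insert[of a] vec.dim_insert[of b])
  have U: "vec.dim (UNIV :: ('b ^ 5) set) = 5" by (simp add: vec_dim_card del: vec.dim_UNIV)
  obtain f0 where f0: "f0 \<notin> vec.span {a, b, a', b'}"
    using exists_not_in_span[of "{a, b, a', b'}" UNIV] d4 U by auto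
  define z where "z i = [a, b, a', b', f0] ! i" for i :: nat
  have z_simps: "z 0 = a" "z 1 = b" "z 2 = a'" "z 3 = b'" "z 4 = f0" by (simp_all add: z_def)
  have "z ` {..<5} = insert f0 {a, b, a', b'}" unfolding image_lessThan_5 z_simps by auto
  then have "vec.dim (z ` {..<5}) = 5" using f0 d4 by (simp add: vec.dim_insert[of f0])
  from family_dual_basis_ex[OF this] obtain E where
    E: "\<forall>i<5. \<forall>j<5. dot (E i) (z j) = (if i = j then 1 else 0)"
    "\<forall>x. x = (\<Sum>i<5. dot x (z i) *s E i)" by (elim exE conjE)
  have Ez: "dot (z j) (E i) = (if i = j then 1 else 0)" if "i < 5" "j < 5" for i j
    using E(1) that by (simp add: dot_commute[of "z j"])
  have Ed: "dot a (E i) = (if i = 0 then 1 else 0)" "dot b (E i) = (if i = 1 then 1 else 0)"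
    "dot a' (E i) = (if i = 2 then 1 else 0)" "dot b' (E i) = (if i = 3 then 1 else 0)" if "i < 5" for i
    using Ez[of i 0] Ez[of i 1] Ez[of i 2] Ez[of i 3] that unfolding z_simps by auto
  have Ex: "x = dot a x *s E 0 + dot b x *s E 1 + dot a' x *s E 2 + dot b' x *s E 3 + dot f0 x *s E 4" for x
    using E(2)[rule_format, of x] unfolding lessThan_5
    by (simp add: z_simps[unfolded One_nat_def] dot_commute[of x] add.assoc)
  have "vec.dim {c', c} = 2" using c by (simp add: vec.dim_insert dual_pt_def)
  then obtain f :: "nat \<Rightarrow> 'b ^ 5" where
    f: "\<And>v. dot c v = 0 \<Longrightarrow> dot c' v = 0 \<Longrightarrow> (\<And>j. j < 3 \<Longrightarrow> dot (f j) v = 0) \<Longrightarrow> v = 0"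
    by (rule complete_functionals) blast
  define d where "d m p r = m 0 * (p 1 * r 2 - p 2 * r 1) - p 0 * (m 1 * r 2 - m 2 * r 1)
    + r 0 * (m 1 * p 2 - m 2 * p 1)" for m p r :: "nat \<Rightarrow> 'b"
  define P where "P i k j = dot (f j) (D (E i) (E k))" for i k j
  \<comment> \<open>The coefficients of that determinant, expanded by trilinearity in its columns;
    rows belong to powers of \<open>s\<close>, columns to powers of \<open>u\<close>.\<close>
  define g where "g i j = [[d (P 0 2) (P 0 4) (P 2 4), - d (P 0 2) (P 0 4) (P 3 4) - d (P 0 3) (P 0 4) (P 2 4),
        d (P 0 3) (P 0 4) (P 3 4)],
      [- d (P 0 2) (P 1 4) (P 2 4) - d (P 1 2) (P 0 4) (P 2 4),
        d (P 0 2) (P 1 4) (P 3 4) + d (P 0 3) (P 1 4) (P 2 4) + d (P 1 2) (P 0 4) (P 3 4) + d (P 1 3) (P 0 4) (P 2 4),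
        - d (P 0 3) (P 1 4) (P 3 4) - d (P 1 3) (P 0 4) (P 3 4)],
      [d (P 1 2) (P 1 4) (P 2 4), - d (P 1 2) (P 1 4) (P 3 4) - d (P 1 3) (P 1 4) (P 2 4),
        d (P 1 3) (P 1 4) (P 3 4)]] ! i ! j" for i j :: nat
  have "biquadratic g s t u v = 0 \<longleftrightarrow>
      (\<exists>V\<in>curve. s *s a + t *s b \<in> perp V \<and> u *s a' + v *s b' \<in> perp V)"
    if st: "s \<noteq> 0 \<or> t \<noteq> 0" and uv: "u \<noteq> 0 \<or> v \<noteq> 0" for s t u v
  proof -
    \<comment> \<open>\<open>\<sigma>\<close> and \<open>\<tau>\<close> are the zeros of
      \<open>s *s a + t *s b\<close> in the plane of \<open>E 0\<close>, \<open>E 1\<close> and of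
      \<open>u *s a' + v *s b'\<close> in the plane of \<open>E 2\<close>,
      \<open>E 3\<close>.\<close>
    define \<sigma> where "\<sigma> = t *s E 0 - s *s E 1"
    define \<tau> where "\<tau> = v *s E 2 - u *s E 3"
    define m where "m j = dot (f j) (D \<sigma> \<tau>)" for j
    define p where "p j = dot (f j) (D \<sigma> (E 4))" for j
    define r where "r j = dot (f j) (D \<tau> (E 4))" for j
    have m': "m j = t * v * P 0 2 j - t * u * P 0 3 j - s * v * P 1 2 j + s * u * P 1 3 j" for j
      by (simp add: m_def \<sigma>_def \<tau>_def P_def D_simps dot_simps algebra_simps)
    have p': "p j = t * P 0 4 j - s * P 1 4 j" for j
      by (simp add: p_def \<sigma>_def P_def D_simps dot_simps)
    have r': "r j = v * P 2 4 j - u * P 3 4 j" for j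
      by (simp add: r_def \<tau>_def P_def D_simps dot_simps)
    have lin: "d (\<lambda>j. k1 * m1 j - k2 * m2 j - k3 * m3 j + k4 * m4 j) p r
        = k1 * d m1 p r - k2 * d m2 p r - k3 * d m3 p r + k4 * d m4 p r"
      "d m1 (\<lambda>j. k1 * p1 j - k2 * p2 j) r = k1 * d m1 p1 r - k2 * d m1 p2 r"
      "d m1 p (\<lambda>j. k1 * r1 j - k2 * r2 j) = k1 * d m1 p r1 - k2 * d m1 p r2"
      for k1 k2 k3 k4 m1 m2 m3 m4 p r p1 p2 r1 r2
      by (simp_all add: d_def algebra_simps)
    have g_simps: "g 0 0 = d (P 0 2) (P 0 4) (P 2 4)"
      "g 0 1 = - d (P 0 2) (P 0 4) (P 3 4) - d (P 0 3) (P 0 4) (P 2 4)"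
      "g 0 2 = d (P 0 3) (P 0 4) (P 3 4)"
      "g 1 0 = - d (P 0 2) (P 1 4) (P 2 4) - d (P 1 2) (P 0 4) (P 2 4)"
      "g 1 1 = d (P 0 2) (P 1 4) (P 3 4) + d (P 0 3) (P 1 4) (P 2 4) + d (P 1 2) (P 0 4) (P 3 4)
        + d (P 1 3) (P 0 4) (P 2 4)"
      "g 1 2 = - d (P 0 3) (P 1 4) (P 3 4) - d (P 1 3) (P 0 4) (P 3 4)"
      "g 2 0 = d (P 1 2) (P 1 4) (P 2 4)"
      "g 2 1 = - d (P 1 2) (P 1 4) (P 3 4) - d (P 1 3) (P 1 4) (P 2 4)"
      "g 2 2 = d (P 1 3) (P 1 4) (P 3 4)"
      by (simp_all add: g_def)
    have "d m p r = biquadratic g s t u v"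
      unfolding biquadratic_coeff_st coeff_st_def g_simps
      unfolding m'[abs_def] p'[abs_def] r'[abs_def] lin
      by (simp add: power2_eq_square algebra_simps)
    then have "biquadratic g s t u v = 0 \<longleftrightarrow>
        (\<exists>x y z. (x \<noteq> 0 \<or> y \<noteq> 0 \<or> z \<noteq> 0) \<and> m 0 * x + p 0 * y + r 0 * z = 0 \<and>
          m 1 * x + p 1 * y + r 1 * z = 0 \<and> m 2 * x + p 2 * y + r 2 * z = 0)"
      unfolding linear_system_3[symmetric] d_def by simp
    also have "\<dots> \<longleftrightarrow> (\<exists>x y z. (x \<noteq> 0 \<or> y \<noteq> 0 \<or> z \<noteq> 0) \<and>
        x *s D \<sigma> \<tau> + y *s D \<sigma> (E 4) + z *s D \<tau> (E 4) = 0)"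
    proof -
      have "m 0 * x + p 0 * y + r 0 * z = 0 \<and> m 1 * x + p 1 * y + r 1 * z = 0 \<and>
          m 2 * x + p 2 * y + r 2 * z = 0 \<longleftrightarrow> x *s D \<sigma> \<tau> + y *s D \<sigma> (E 4) + z *s D \<tau> (E 4) = 0"
        (is "?A \<longleftrightarrow> ?v = 0") for x y z
      proof
        have fv: "dot (f j) ?v = m j * x + p j * y + r j * z" for j
          by (simp add: dot_simps m_def p_def r_def mult.commute)
        show "?v = 0 \<Longrightarrow> ?A" using fv by (metis dot_zero_right)
        assume A: ?A
        have zero: "dot a (E 4) = 0" "dot b (E 4) = 0" "dot a' (E 4) = 0" "dot b' (E 4) = 0"
          "dot a \<tau> = 0" "dot b \<tau> = 0" "dot a' \<sigma> = 0" "dot b' \<sigma> = 0"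
          using Ed by (simp_all add: \<sigma>_def \<tau>_def dot_simps)
        have "form c \<sigma> \<tau> = 0" "form c \<sigma> (E 4) = 0" "form c \<tau> (E 4) = 0"
          "form c' \<sigma> \<tau> = 0" "form c' \<sigma> (E 4) = 0" "form c' \<tau> (E 4) = 0"
          using c zero by (simp_all add: dual_pt_def wedge_def)
        then have "dot c ?v = 0" "dot c' ?v = 0" by (simp_all add: dot_simps form_def)
        moreover have "dot (f j) ?v = 0" if "j < 3" for j
        proof -
          have "j = 0 \<or> j = 1 \<or> j = 2" using that by linarith
          then show ?thesis using A unfolding fv by blast
        qed
        ultimately show "?v = 0" by (rule f)
      qed
      then show ?thesis by simp
    qed
    also have "\<dots> \<longleftrightarrow> (\<exists>V\<in>curve. s *s a + t *s b \<in> perp V \<and> u *s a' + v *s b' \<in> perp V)"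
    proof
      assume "\<exists>x y z. (x \<noteq> 0 \<or> y \<noteq> 0 \<or> z \<noteq> 0) \<and>
        x *s D \<sigma> \<tau> + y *s D \<sigma> (E 4) + z *s D \<tau> (E 4) = 0"
      then obtain x y z' where xyz: "x \<noteq> 0 \<or> y \<noteq> 0 \<or> z' \<noteq> 0"
        "x *s D \<sigma> \<tau> + y *s D \<sigma> (E 4) + z' *s D \<tau> (E 4) = 0" by blast
      have "E 4 \<noteq> 0" using Ez[of 4 4] by auto
      moreover have "\<tau> \<notin> vec.span {E 4}"
      proof (cases "v = 0")
        case True
        show ?thesis
          by (rule not_in_span_dot[of _ b']) (use Ed True uv in \<open>auto simp: \<tau>_def dot_simps dot_commute[of _ b']\<close>)
      next
        case False
        show ?thesis
          by (rule not_in_span_dot[of _ a']) (use Ed False in \<open>auto simp: \<tau>_def dot_simps dot_commute[of _ a']\<close>)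
      qed
      moreover have "\<sigma> \<notin> vec.span {\<tau>, E 4}"
      proof (cases "t = 0")
        case True
        show ?thesis
          by (rule not_in_span_dot[of _ b])
            (use Ed True st in \<open>auto simp: \<sigma>_def \<tau>_def dot_simps dot_commute[of _ b]\<close>)
      next
        case False
        show ?thesis
          by (rule not_in_span_dot[of _ a])
            (use Ed False in \<open>auto simp: \<sigma>_def \<tau>_def dot_simps dot_commute[of _ a]\<close>)
      qed
      ultimately have "vec.dim {\<sigma>, \<tau>, E 4} = 3" by (simp add: vec.dim_insert)
      then have d3: "vec.dim {E 4, \<sigma>, \<tau>} = 3" by (simp add: insert_commute)
      have "x *s D \<sigma> \<tau> + z' *s D \<tau> (E 4) + (- y) *s D (E 4) \<sigma> = 0"
        using xyz(2) D_swap[of "E 4" \<sigma>] by (simp add: algebra_simps)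
      then obtain V where V: "V \<in> curve" "V \<subseteq> vec.span {E 4, \<sigma>, \<tau>}"
        using curve_from_bivector[OF d3, of x z' "- y"] xyz(1) by auto
      have "dot (s *s a + t *s b) y = 0" "dot (u *s a' + v *s b') y = 0" if "y \<in> V" for y
      proof -
        have y: "y \<in> vec.span {E 4, \<sigma>, \<tau>}" using V that by blast
        show "dot (s *s a + t *s b) y = 0"
          by (rule dot_span_zero[OF y]) (use Ed in \<open>auto simp: \<sigma>_def \<tau>_def dot_simps\<close>)
        show "dot (u *s a' + v *s b') y = 0"
          by (rule dot_span_zero[OF y]) (use Ed in \<open>auto simp: \<sigma>_def \<tau>_def dot_simps\<close>)
      qed
      with V show "\<exists>V\<in>curve. s *s a + t *s b \<in> perp V \<and> u *s a' + v *s b' \<in> perp V"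
        by (auto simp: perp_iff)
    next
      assume "\<exists>V\<in>curve. s *s a + t *s b \<in> perp V \<and> u *s a' + v *s b' \<in> perp V"
      then obtain V where V: "V \<in> curve" "s *s a + t *s b \<in> perp V" "u *s a' + v *s b' \<in> perp V"
        by blast
      obtain x y where xy: "V = vec.span {x, y}" "vec.dim {x, y} = 2" "D x y = 0"
        by (rule curveE[OF V(1)])
      have line: "\<exists>k. \<alpha> = k * t' \<and> \<beta> = - (k * s')"
        if "s' \<noteq> 0 \<or> t' \<noteq> 0" "s' * \<alpha> + t' * \<beta> = 0" for s' t' \<alpha> \<beta> :: 'b
      proof (cases "t' = 0")
        case True
        then show ?thesis using that by (intro exI[of _ "- \<beta> / s'"]) auto
      next
        case False
        then show ?thesis using that
          by (intro exI[of _ "\<alpha> / t'"]) (auto simp: field_simps add_eq_0_iff2)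
      qed
      have dec: "\<exists>k l n. x = k *s \<sigma> + l *s \<tau> + n *s E 4" if "x \<in> V" for x
      proof -
        have "s * dot a x + t * dot b x = 0" "u * dot a' x + v * dot b' x = 0"
          using V(2,3) that by (auto simp: perp_iff dot_simps)
        then obtain k l where "dot a x = k * t \<and> dot b x = - (k * s)" "dot a' x = l * v \<and> dot b' x = - (l * u)"
          using line st uv by meson
        then show ?thesis
          using Ex[of x] by (intro exI[of _ k] exI[of _ l] exI[of _ "dot f0 x"])
            (simp add: \<sigma>_def \<tau>_def vec_eq_iff algebra_simps)
      qed
      obtain k l n where x: "x = k *s \<sigma> + l *s \<tau> + n *s E 4"
        using dec[of x] xy by (auto simp: vec.span_base)
      obtain k' l' n' where y: "y = k' *s \<sigma> + l' *s \<tau> + n' *s E 4"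
        using dec[of y] xy by (auto simp: vec.span_base)
      have "D x y = (k * l' - l * k') *s D \<sigma> \<tau> + (k * n' - n * k') *s D \<sigma> (E 4)
          + (l * n' - n * l') *s D \<tau> (E 4)"
        unfolding x y using D_swap[of \<tau> \<sigma>] D_swap[of "E 4" \<sigma>] D_swap[of "E 4" \<tau>]
        by (simp add: D_simps vec_eq_iff algebra_simps)
      moreover have "k * l' - l * k' \<noteq> 0 \<or> k * n' - n * k' \<noteq> 0 \<or> l * n' - n * l' \<noteq> 0"
      proof (rule ccontr)
        assume "\<not> ?thesis"
        then have e: "k * l' = l * k'" "k * n' = n * k'" "l * n' = n * l'" by auto
        have "k' *s x + (- k) *s y = 0" "l' *s x + (- l) *s y = 0" "n' *s x + (- n) *s y = 0"
          unfolding x y using e by (simp_all add: vec_eq_iff algebra_simps)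
        from this[THEN dim2D[OF xy(2)]] have "x = 0" unfolding x by simp
        then show False using dim2D[OF xy(2), of 1 0] by simp
      qed
      ultimately show "\<exists>x y z. (x \<noteq> 0 \<or> y \<noteq> 0 \<or> z \<noteq> 0) \<and>
        x *s D \<sigma> \<tau> + y *s D \<sigma> (E 4) + z *s D \<tau> (E 4) = 0" using xy(3) by metis
    qed
    finally show ?thesis .
  qed
  then show ?thesis by blast
qed

end

section \<open>Binary quadratic forms and their resultants\<close>

definition qform :: "'b::field \<Rightarrow> 'b \<Rightarrow> 'b \<Rightarrow> 'b \<Rightarrow> 'b \<Rightarrow> 'b" where
  "qform p2 p1 p0 u v = p2 * u\<^sup>2 + p1 * (u * v) + p0 * v\<^sup>2"

text \<open>The linear factor \<open>v * U - u * V\<close> of the known root is split off; the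
  cofactor is \<open>m * U + n * V\<close>, so the other root is (n : -m).\<close>

lemma qform_factor:
  fixes p2 p1 p0 :: "'b::field"
  assumes "qform p2 p1 p0 u v = 0" "u \<noteq> 0 \<or> v \<noteq> 0"
  obtains m n where "p2 = v * m" "p1 = v * n - u * m" "p0 = - (u * n)"
proof (cases "v = 0")
  case True
  then have "p2 = 0" "u \<noteq> 0" using assms by (auto simp: qform_def)
  then show thesis using that[of "- p1 / u" "- p0 / u"] True by simp
next
  case False
  define m where "m = p2 / v"
  define n where "n = (p1 + u * m) / v"
  have 1: "p2 = v * m" "p1 = v * n - u * m" using False by (simp_all add: m_def n_def)
  have "v * (v * (p0 + u * n)) = qform p2 p1 p0 u v"
    unfolding qform_def 1 by (simp add: power2_eq_square algebra_simps)
  then have "p0 + u * n = 0" using assms False by simp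
  then have "p0 = - (u * n)" by (simp add: eq_neg_iff_add_eq_0)
  with that 1 show thesis by blast
qed

text \<open>The hypothesis says that the resultant vanishes. It is the product of the values of the
  first form at the two roots of the second.\<close>

lemma resultant_common_root:
  fixes p2 :: "'b::alg_closed_field"
  assumes "(p2 * r0 - p0 * r2)\<^sup>2 = (p2 * r1 - p1 * r2) * (p1 * r0 - p0 * r1)"
  obtains u v where "u \<noteq> 0 \<or> v \<noteq> 0" "qform p2 p1 p0 u v = 0" "qform r2 r1 r0 u v = 0"
proof -
  obtain u v where uv: "u \<noteq> 0 \<or> v \<noteq> 0" "qform r2 r1 r0 u v = 0"
    using binary_quadratic_root[of r2 r1 r0] unfolding qform_def by blast
  obtain m n where mn: "r2 = v * m" "r1 = v * n - u * m" "r0 = - (u * n)"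
    by (rule qform_factor[OF uv(2,1)])
  have "qform p2 p1 p0 u v * qform p2 p1 p0 n (- m)
      = (p2 * r0 - p0 * r2)\<^sup>2 - (p2 * r1 - p1 * r2) * (p1 * r0 - p0 * r1)"
    unfolding qform_def mn by (simp add: power2_eq_square algebra_simps)
  then have "qform p2 p1 p0 u v = 0 \<or> qform p2 p1 p0 n (- m) = 0" using assms by simp
  then show thesis
  proof
    assume "qform p2 p1 p0 u v = 0"
    then show thesis using that uv by blast
  next
    assume *: "qform p2 p1 p0 n (- m) = 0"
    have r: "qform r2 r1 r0 n (- m) = 0"
      unfolding qform_def mn by (simp add: power2_eq_square algebra_simps)
    show thesis
    proof (cases "m = 0 \<and> n = 0")
      case True
      then have "r2 = 0" "r1 = 0" "r0 = 0" using mn by auto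
      moreover obtain u' v' where "u' \<noteq> 0 \<or> v' \<noteq> 0" "qform p2 p1 p0 u' v' = 0"
        using binary_quadratic_root[of p2 p1 p0] unfolding qform_def by blast
      ultimately show thesis using that by (auto simp: qform_def)
    next
      case False
      then show thesis using that[of n "- m"] * r by auto
    qed
  qed
qed

lemma qform_two_roots_proportional:
  fixes p2 :: "'b::field"
  assumes "qform p2 p1 p0 u v = 0" "qform r2 r1 r0 u v = 0" "u \<noteq> 0 \<or> v \<noteq> 0"
    "qform p2 p1 p0 u' v' = 0" "qform r2 r1 r0 u' v' = 0" "u * v' \<noteq> u' * v"
  shows "p2 * r0 - p0 * r2 = 0" "p2 * r1 - p1 * r2 = 0" "p1 * r0 - p0 * r1 = 0"
proof -
  obtain m n where mn: "p2 = v * m" "p1 = v * n - u * m" "p0 = - (u * n)"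
    by (rule qform_factor[OF assms(1,3)])
  obtain k l where kl: "r2 = v * k" "r1 = v * l - u * k" "r0 = - (u * l)"
    by (rule qform_factor[OF assms(2,3)])
  have "(v * u' - u * v') * (m * u' + n * v') = qform p2 p1 p0 u' v'"
    "(v * u' - u * v') * (k * u' + l * v') = qform r2 r1 r0 u' v'"
    unfolding qform_def mn kl by (simp_all add: power2_eq_square algebra_simps)
  then have e: "m * u' + n * v' = 0" "k * u' + l * v' = 0"
    using assms(4-6) by (simp_all add: mult.commute)
  have uv': "u' \<noteq> 0 \<or> v' \<noteq> 0" using assms(6) by auto
  have "u' * (m * l - n * k) = (m * u' + n * v') * l - (k * u' + l * v') * n"
    "v' * (m * l - n * k) = (k * u' + l * v') * m - (m * u' + n * v') * k"
    by (simp_all add: algebra_simps)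
  then have "m * l - n * k = 0" using e uv' by auto
  moreover have "p2 * r0 - p0 * r2 = - ((m * l - n * k) * (u * v))"
    "p2 * r1 - p1 * r2 = (m * l - n * k) * v\<^sup>2" "p1 * r0 - p0 * r1 = (m * l - n * k) * u\<^sup>2"
    unfolding mn kl by (simp_all add: power2_eq_square algebra_simps)
  ultimately show "p2 * r0 - p0 * r2 = 0" "p2 * r1 - p1 * r2 = 0" "p1 * r0 - p0 * r1 = 0" by simp_all
qed

text \<open>The derivative of the resultant in the direction \<open>(d2, d1, d0)\<close> of the first form, at a common
  root which is a simple root of the second form.\<close>

lemma resultant_derivative:
  fixes p2 :: "'b::field"
  assumes "qform p2 p1 p0 u v = 0" "qform r2 r1 r0 u v = 0" "u \<noteq> 0 \<or> v \<noteq> 0"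
    and "qform r2 r1 r0 u' v' = 0" "u * v' \<noteq> u' * v" "r2 \<noteq> 0 \<or> r1 \<noteq> 0 \<or> r0 \<noteq> 0"
    and "p2 * r0 - p0 * r2 \<noteq> 0 \<or> p2 * r1 - p1 * r2 \<noteq> 0 \<or> p1 * r0 - p0 * r1 \<noteq> 0"
    and "2 * (p2 * r0 - p0 * r2) * (d2 * r0 - d0 * r2) - (d2 * r1 - d1 * r2) * (p1 * r0 - p0 * r1)
      - (p2 * r1 - p1 * r2) * (d1 * r0 - d0 * r1) = 0"
  shows "qform d2 d1 d0 u v = 0"
proof -
  obtain m n where mn: "p2 = v * m" "p1 = v * n - u * m" "p0 = - (u * n)"
    by (rule qform_factor[OF assms(1,3)])
  obtain k l where kl: "r2 = v * k" "r1 = v * l - u * k" "r0 = - (u * l)"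
    by (rule qform_factor[OF assms(2,3)])
  have "(v * u' - u * v') * (k * u' + l * v') = qform r2 r1 r0 u' v'"
    unfolding qform_def kl by (simp add: power2_eq_square algebra_simps)
  then have e: "k * u' + l * v' = 0" using assms(4,5) by (simp add: mult.commute)
  have kl0: "k \<noteq> 0 \<or> l \<noteq> 0" using assms(6) kl by auto
  have simple: "k * u + l * v \<noteq> 0"
  proof
    assume e': "k * u + l * v = 0"
    have "k * (u * v' - u' * v) = (k * u + l * v) * v' - (k * u' + l * v') * v"
      "l * (u * v' - u' * v) = (k * u' + l * v') * u - (k * u + l * v) * u'"
      by (simp_all add: algebra_simps)
    then have "k * (u * v' - u' * v) = 0" "l * (u * v' - u' * v) = 0" using e e' by simp_all
    with kl0 assms(5) show False by auto
  qed
  have cross: "p2 * r0 - p0 * r2 = (n * k - m * l) * (u * v)" "p2 * r1 - p1 * r2 = - ((n * k - m * l) * v\<^sup>2)"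
    "p1 * r0 - p0 * r1 = - ((n * k - m * l) * u\<^sup>2)"
    unfolding mn kl by (simp_all add: power2_eq_square algebra_simps)
  then have \<kappa>: "n * k - m * l \<noteq> 0" using assms(7) by auto
  have "2 * (p2 * r0 - p0 * r2) * (d2 * r0 - d0 * r2) - (d2 * r1 - d1 * r2) * (p1 * r0 - p0 * r1)
      - (p2 * r1 - p1 * r2) * (d1 * r0 - d0 * r1)
    = - ((n * k - m * l) * (k * u + l * v) * qform d2 d1 d0 u v)"
    unfolding cross unfolding kl qform_def by (simp add: power2_eq_square algebra_simps)
  with assms(8) \<kappa> simple show ?thesis by simp
qed

text \<open>Serves the degenerate case of \<open>resultant_nonzero\<close>: if a form and its
  derivative are both proportional to a third form, a root of the form is a root of the
  derivative.\<close>

lemma qform_proportional_root: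
  fixes p2 :: "'b::field"
  assumes "p2 * r0 - p0 * r2 = 0" "p2 * r1 - p1 * r2 = 0" "p1 * r0 - p0 * r1 = 0"
    and "d2 * r0 - d0 * r2 = 0" "d2 * r1 - d1 * r2 = 0" "d1 * r0 - d0 * r1 = 0"
    and "qform p2 p1 p0 u v = 0" "p2 \<noteq> 0 \<or> p1 \<noteq> 0 \<or> p0 \<noteq> 0" "r2 \<noteq> 0 \<or> r1 \<noteq> 0 \<or> r0 \<noteq> 0"
  shows "qform d2 d1 d0 u v = 0"
proof -
  have cross: "r2 * qform p2 p1 p0 u v = p2 * qform r2 r1 r0 u v
      \<and> r1 * qform p2 p1 p0 u v = p1 * qform r2 r1 r0 u v
      \<and> r0 * qform p2 p1 p0 u v = p0 * qform r2 r1 r0 u v"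
    if z: "p2 * r0 - p0 * r2 = 0" "p2 * r1 - p1 * r2 = 0" "p1 * r0 - p0 * r1 = 0" for p2 p1 p0
  proof -
    have "r2 * qform p2 p1 p0 u v - p2 * qform r2 r1 r0 u v
        = - ((p2 * r1 - p1 * r2) * (u * v)) - (p2 * r0 - p0 * r2) * v\<^sup>2"
      "r1 * qform p2 p1 p0 u v - p1 * qform r2 r1 r0 u v
        = (p2 * r1 - p1 * r2) * u\<^sup>2 - (p1 * r0 - p0 * r1) * v\<^sup>2"
      "r0 * qform p2 p1 p0 u v - p0 * qform r2 r1 r0 u v
        = (p2 * r0 - p0 * r2) * u\<^sup>2 + (p1 * r0 - p0 * r1) * (u * v)"
      by (simp_all add: qform_def power2_eq_square algebra_simps)
    then show ?thesis unfolding z by simp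
  qed
  have r: "qform r2 r1 r0 u v = 0" using cross[OF assms(1-3)] assms(7,8) by auto
  then show ?thesis using cross[OF assms(4-6)] assms(9) by auto
qed

definition coeff_uv :: "(nat \<Rightarrow> nat \<Rightarrow> 'b::field) \<Rightarrow> 'b \<Rightarrow> 'b \<Rightarrow> nat \<Rightarrow> 'b" where
  "coeff_uv g s t j = g 0 j * t\<^sup>2 + g 1 j * (s * t) + g 2 j * s\<^sup>2"

lemma biquadratic_coeff_uv:
  "biquadratic g s t u v = qform (coeff_uv g s t 2) (coeff_uv g s t 1) (coeff_uv g s t 0) u v"
  by (simp add: biquadratic_def coeff_uv_def qform_def sum_atMost_2 algebra_simps power2_eq_square)

section \<open>Double covers of the line and self-conjugate members\<close>

context smooth_system
begin

definition relates :: "(nat \<Rightarrow> nat \<Rightarrow> 'b) \<Rightarrow> 'b ^ 5 \<Rightarrow> 'b ^ 5 \<Rightarrow> 'b ^ 5 \<Rightarrow> 'b ^ 5 \<Rightarrow> bool" where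
  "relates g a b a' b' \<longleftrightarrow> (\<forall>s t u v. (s \<noteq> 0 \<or> t \<noteq> 0) \<longrightarrow> (u \<noteq> 0 \<or> v \<noteq> 0) \<longrightarrow>
    (biquadratic g s t u v = 0 \<longleftrightarrow>
      (\<exists>V\<in>curve. s *s a + t *s b \<in> perp V \<and> u *s a' + v *s b' \<in> perp V)))"

lemma relates_iff:
  "relates g a b a' b' \<Longrightarrow> s \<noteq> 0 \<or> t \<noteq> 0 \<Longrightarrow> u \<noteq> 0 \<or> v \<noteq> 0 \<Longrightarrow>
    biquadratic g s t u v = 0 \<longleftrightarrow>
      (\<exists>V\<in>curve. s *s a + t *s b \<in> perp V \<and> u *s a' + v *s b' \<in> perp V)"
  by (simp add: relates_def)

lemma dual_comb_nonzero: "dual_pt c a b \<Longrightarrow> s \<noteq> 0 \<or> t \<noteq> 0 \<Longrightarrow> s *s a + t *s b \<noteq> 0"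
  using dim2D[OF dual_pt_dim] by blast

lemma dual_comb_in_span: "s *s a + t *s b \<in> vec.span {a, b}"
  by (auto simp: in_span_2)

text \<open>The members over the values (1 : 0), (0 : 1), (1 : 1) are distinct and would all be
  killed by \<open>w\<close>. So neither coefficient triple of a relation vanishes
  identically.\<close>

lemma three_distinct:
  assumes "dual_pt c a b" "dual_pt c' a' b'" "w \<in> vec.span {a', b'}" "w \<noteq> 0"
    and all: "\<And>s t. s \<noteq> 0 \<or> t \<noteq> 0 \<Longrightarrow> \<exists>V\<in>curve. s *s a + t *s b \<in> perp V \<and> w \<in> perp V"
  shows False
proof -
  obtain V1 where V1: "V1 \<in> curve" "1 *s a + 0 *s b \<in> perp V1" "w \<in> perp V1" using all[of 1 0] by auto
  obtain V2 where V2: "V2 \<in> curve" "0 *s a + 1 *s b \<in> perp V2" "w \<in> perp V2" using all[of 0 1] by auto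
  obtain V3 where V3: "V3 \<in> curve" "1 *s a + 1 *s b \<in> perp V3" "w \<in> perp V3" using all[of 1 1] by auto
  have "V1 = V2 \<or> V1 = V3 \<or> V2 = V3"
    using curve_at_most_two[OF V1(1) V2(1) V3(1) assms(2-4) V1(3) V2(3) V3(3)] .
  then show False
    using killing_unique[OF V1(1) assms(1) V1(2), of 0 1] killing_unique[OF V1(1) assms(1) V1(2), of 1 1]
      killing_unique[OF V2(1) assms(1) V2(2), of 1 1] V2(2) V3(2) by auto
qed

lemma coeff_st_nonzero:
  assumes "dual_pt c a b" "dual_pt c' a' b'" "relates g a b a' b'" "u \<noteq> 0 \<or> v \<noteq> 0"
  shows "coeff_st g u v 2 \<noteq> 0 \<or> coeff_st g u v 1 \<noteq> 0 \<or> coeff_st g u v 0 \<noteq> 0"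
proof (rule ccontr)
  assume "\<not> ?thesis"
  then have z: "biquadratic g s t u v = 0" for s t by (simp add: biquadratic_coeff_st)
  show False
    by (rule three_distinct[OF assms(1,2) dual_comb_in_span dual_comb_nonzero[OF assms(2,4)]])
      (use relates_iff[OF assms(3) _ assms(4)] z in blast)
qed

lemma coeff_uv_nonzero:
  assumes "dual_pt c a b" "dual_pt c' a' b'" "relates g a b a' b'" "s \<noteq> 0 \<or> t \<noteq> 0"
  shows "coeff_uv g s t 2 \<noteq> 0 \<or> coeff_uv g s t 1 \<noteq> 0 \<or> coeff_uv g s t 0 \<noteq> 0"
proof (rule ccontr)
  assume "\<not> ?thesis"
  then have z: "biquadratic g s t u v = 0" for u v by (simp add: biquadratic_coeff_uv qform_def)
  show False
    by (rule three_distinct[OF assms(2,1) dual_comb_in_span dual_comb_nonzero[OF assms(1,4)]])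
      (use relates_iff[OF assms(3,4)] z in blast)
qed

lemma obtain_killing:
  assumes "dual_pt c a b" "V \<in> curve"
  obtains s t where "s \<noteq> 0 \<or> t \<noteq> 0" "s *s a + t *s b \<in> perp V"
proof -
  obtain w where w: "w \<in> vec.span {a, b}" "w \<noteq> 0" "w \<in> perp V"
    by (rule functional_killing[OF assms])
  then obtain s t where st: "w = s *s a + t *s b" by (auto simp: in_span_2)
  then have "s \<noteq> 0 \<or> t \<noteq> 0" using w(2) by auto
  with w(3) st that[of s t] show thesis by blast
qed

text \<open>\<open>V\<close> and \<open>V'\<close> lie over the same (u : v) but have different
  values (s : t), so the quadratic in (s : t) has two distinct roots and a nonzero derivative at the
  first, also in characteristic two. The second claim is the root at infinity.\<close>

lemma fibre_simple:
  assumes c: "dual_pt c a b" "dual_pt c' a' b'" "c' \<notin> vec.span {c}" and g: "relates g a b a' b'"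
    and V: "V \<in> curve" "V' \<in> curve" "V \<noteq> V'" and uv: "u \<noteq> 0 \<or> v \<noteq> 0"
    and k: "u *s a' + v *s b' \<in> perp V" "u *s a' + v *s b' \<in> perp V'"
  shows "s *s a + 1 *s b \<in> perp V \<Longrightarrow> 2 * coeff_st g u v 2 * s + coeff_st g u v 1 \<noteq> 0"
    and "1 *s a + 0 *s b \<in> perp V \<Longrightarrow> coeff_st g u v 1 \<noteq> 0"
proof -
  obtain s' t' where s': "s' \<noteq> 0 \<or> t' \<noteq> 0" "s' *s a + t' *s b \<in> perp V'"
    by (rule obtain_killing[OF c(1) V(2)])
  have ne: "r' * t' \<noteq> s' * t''" if rt: "r' \<noteq> 0 \<or> t'' \<noteq> 0" "r' *s a + t'' *s b \<in> perp V" for r' t''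
  proof
    assume e: "r' * t' = s' * t''"
    have "\<exists>l. s' = l * r' \<and> t' = l * t''"
    proof (cases "r' = 0")
      case True
      then show ?thesis using e rt s' by (intro exI[of _ "t' / t''"]) auto
    next
      case False
      then show ?thesis using e by (intro exI[of _ "s' / r'"]) (auto simp: field_simps)
    qed
    then obtain l where l: "s' = l * r'" "t' = l * t''" by blast
    then have "l \<noteq> 0" using s' by auto
    have "l *s (r' *s a + t'' *s b) \<in> perp V'" using s' l by (simp add: vec_eq_iff vec.scale_right_distrib)
    then have "r' *s a + t'' *s b \<in> perp V'"
      using \<open>l \<noteq> 0\<close> nonzero_multiple_in_subspace[OF subspace_perp] by blast
    then show False
      using curve_determined[OF V(1,2) c dual_comb_in_span dual_comb_nonzero[OF c(1) rt(1)] rt(2) _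
          dual_comb_in_span dual_comb_nonzero[OF c(2) uv] k] V(3) by blast
  qed
  note nz = coeff_st_nonzero[OF c(1,2) g uv]
  have Q': "coeff_st g u v 2 * s'\<^sup>2 + coeff_st g u v 1 * (s' * t') + coeff_st g u v 0 * t'\<^sup>2 = 0"
    using relates_iff[OF g s'(1) uv] V(2) s'(2) k(2) unfolding biquadratic_coeff_st by blast
  show "2 * coeff_st g u v 2 * s + coeff_st g u v 1 \<noteq> 0" if s: "s *s a + 1 *s b \<in> perp V"
  proof (rule quadratic_simple_root[OF nz _ Q'])
    have "biquadratic g s 1 u v = 0"
      using relates_iff[OF g _ uv, of s 1] V(1) s k(1) by auto
    then show "coeff_st g u v 2 * s\<^sup>2 + coeff_st g u v 1 * s + coeff_st g u v 0 = 0"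
      by (simp add: biquadratic_coeff_st)
    show "s' \<noteq> s * t'" using ne[OF _ s] by simp
  qed
  show "coeff_st g u v 1 \<noteq> 0" if s: "1 *s a + 0 *s b \<in> perp V"
  proof
    assume z: "coeff_st g u v 1 = 0"
    have "biquadratic g 1 0 u v = 0"
      using relates_iff[OF g _ uv, of 1 0] V(1) s k(1) by auto
    then have z2: "coeff_st g u v 2 = 0" by (simp add: biquadratic_coeff_st)
    have "t' \<noteq> 0" using ne[OF _ s] by simp
    then have "coeff_st g u v 0 = 0" using Q' z z2 by simp
    with nz z z2 show False by simp
  qed
qed

text \<open>Members with the same value as their Frobenius image. As \<open>Fr\<close> fixes no
  member, \<open>Fr\<close> acts on them as the deck involution does: on an elliptic curve these are
  the solutions of V + F V = const.\<close>

definition selfconj :: "'b ^ 5 \<Rightarrow> 'b ^ 5 \<Rightarrow> ('b ^ 5) set set" where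
  "selfconj a b = {V \<in> curve. \<exists>w\<in>vec.span {a, b}. w \<noteq> 0 \<and> w \<in> perp V \<and> w \<in> perp (Fr ` V)}"

lemma perp_Fr: "Fr w \<in> perp (Fr ` V) \<longleftrightarrow> w \<in> perp V"
  by (auto simp: perp_iff dot_Fr_0_iff)

lemma obtain_preimage_dual:
  assumes "dual_pt c a b"
  obtains c1 a1 b1 where "dual_pt c1 a1 b1" "Fr c1 = c" "Fr a1 = a" "Fr b1 = b"
proof -
  obtain c1 a1 b1 where 1: "Fr c1 = c" "Fr a1 = a" "Fr b1 = b" using Fr_surj by metis
  have "form c1 x y = wedge a1 b1 x y" for x y
  proof -
    have "form c1 x y ^ q = form c (Fr x) (Fr y)" by (simp flip: 1 form_Fr)
    also have "\<dots> = wedge a b (Fr x) (Fr y)" using assms by (simp add: dual_pt_def)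
    also have "\<dots> = wedge a1 b1 x y ^ q"
      by (simp add: wedge_def dot_Fr power_q_diff power_mult_distrib flip: 1)
    finally show ?thesis by (simp add: power_q_inj)
  qed
  moreover have "c1 \<noteq> 0" using assms 1 by (auto simp: dual_pt_def)
  ultimately show thesis using that 1 by (auto simp: dual_pt_def)
qed

lemma Fr_comb: "Fr (s *s a + t *s b) = s ^ q *s Fr a + t ^ q *s Fr b"
  by (simp add: Fr_add Fr_scale)

lemma selfconj_iff:
  assumes "dual_pt c a b"
  shows "V \<in> selfconj (Fr a) (Fr b) \<longleftrightarrow> V \<in> curve \<and> (\<exists>s t. (s \<noteq> 0 \<or> t \<noteq> 0) \<and>
    s *s a + t *s b \<in> perp V \<and> s ^ q *s Fr a + t ^ q *s Fr b \<in> perp V)"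
proof
  assume V: "V \<in> selfconj (Fr a) (Fr b)"
  then obtain w where w: "w \<in> vec.span {Fr a, Fr b}" "w \<noteq> 0" "w \<in> perp V" "w \<in> perp (Fr ` V)"
    by (auto simp: selfconj_def)
  have "w \<in> Fr ` vec.span {a, b}" using w(1) by (simp add: Fr_image_span)
  then obtain s t where st: "w = Fr (s *s a + t *s b)" by (auto simp: in_span_2)
  have "s *s a + t *s b \<in> perp V" using w(4) unfolding st perp_Fr .
  moreover have "s \<noteq> 0 \<or> t \<noteq> 0" using w(2) st by auto
  ultimately show "V \<in> curve \<and> (\<exists>s t. (s \<noteq> 0 \<or> t \<noteq> 0) \<and>
    s *s a + t *s b \<in> perp V \<and> s ^ q *s Fr a + t ^ q *s Fr b \<in> perp V)"
    using V w(3) st by (auto simp: selfconj_def Fr_comb)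
next
  assume "V \<in> curve \<and> (\<exists>s t. (s \<noteq> 0 \<or> t \<noteq> 0) \<and>
    s *s a + t *s b \<in> perp V \<and> s ^ q *s Fr a + t ^ q *s Fr b \<in> perp V)"
  then obtain s t where st: "V \<in> curve" "s \<noteq> 0 \<or> t \<noteq> 0" "s *s a + t *s b \<in> perp V"
    "Fr (s *s a + t *s b) \<in> perp V" by (auto simp: Fr_comb)
  have "Fr (s *s a + t *s b) \<noteq> 0" using dual_comb_nonzero[OF assms st(2)] by simp
  moreover have "Fr (s *s a + t *s b) \<in> vec.span {Fr a, Fr b}" by (simp add: Fr_comb dual_comb_in_span)
  moreover have "Fr (s *s a + t *s b) \<in> perp (Fr ` V)" using st by (simp add: perp_Fr)
  ultimately show "V \<in> selfconj (Fr a) (Fr b)"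
    unfolding selfconj_def using st(1,4) by blast
qed

lemma card_selfconj_Fr:
  assumes c: "dual_pt c a b"
  shows "finite (selfconj (Fr a) (Fr b))" "card (selfconj (Fr a) (Fr b)) = 2 * q + 2"
proof -
  have c': "dual_pt (Fr c) (Fr a) (Fr b)" "Fr c \<notin> vec.span {c}"
    using dual_pt_Fr[OF c] dual_not_rational[OF c] .
  obtain g where g: "relates g a b (Fr a) (Fr b)"
    using biquadratic_relation[OF c c'] unfolding relates_def by blast
  define p where "p = (\<Sum>i\<le>2. \<Sum>j\<le>2. Polynomial.monom (g i j) (i + q * j))"
  have poly_p: "poly p s = biquadratic g s 1 (s ^ q) 1" for s
    by (simp add: p_def biquadratic_def poly_sum poly_monom power_add power_mult mult.assoc)
  have dp: "poly (pderiv p) s = 2 * coeff_st g (s ^ q) 1 2 * s + coeff_st g (s ^ q) 1 1" for s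
  proof -
    have "of_nat (i + q * j) = (of_nat i :: 'b)" for i j by (simp add: q_zero)
    then show ?thesis
      using q_ge_2 by (simp add: p_def sum_atMost_2 pderiv_add pderiv_monom poly_monom coeff_st_def
          power_add power_mult power2_eq_square algebra_simps q_zero)
  qed
  define R where "R = {V \<in> curve. \<exists>s. s *s a + 1 *s b \<in> perp V \<and> s ^ q *s Fr a + 1 *s Fr b \<in> perp V}"
  \<comment> \<open>The solution at t = 0, invisible to the polynomial \<open>p\<close>; it occurs
    exactly if the top coefficient \<open>g 2 2\<close> vanishes.\<close>
  define Inf where "Inf = {V \<in> curve. 1 *s a + 0 *s b \<in> perp V \<and> 1 *s Fr a + 0 *s Fr b \<in> perp V}"
  have other: "Fr ` V \<in> curve" "V \<noteq> Fr ` V" if "V \<in> curve" for V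
    using that curve_Fr curve_not_stable by auto
  have FrV: "s ^ q *s Fr a + t ^ q *s Fr b \<in> perp (Fr ` V)" if "s *s a + t *s b \<in> perp V" for s t V
    using that by (simp flip: Fr_comb add: perp_Fr)
  have split: "selfconj (Fr a) (Fr b) = R \<union> Inf"
  proof (intro equalityI subsetI)
    fix V assume "V \<in> selfconj (Fr a) (Fr b)"
    then obtain s t where V: "V \<in> curve" "s \<noteq> 0 \<or> t \<noteq> 0" "s *s a + t *s b \<in> perp V"
      "s ^ q *s Fr a + t ^ q *s Fr b \<in> perp V" unfolding selfconj_iff[OF c] by blast
    show "V \<in> R \<union> Inf"
    proof (cases "t = 0")
      case True
      then have "s \<noteq> 0" using V by simp
      have "s *s a \<in> perp V" "s ^ q *s Fr a \<in> perp V" using V True by (simp_all add: zero_power)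
      then have "a \<in> perp V" "Fr a \<in> perp V"
        using \<open>s \<noteq> 0\<close> nonzero_multiple_in_subspace[OF subspace_perp] by (metis power_not_zero)+
      then show ?thesis using V by (simp add: Inf_def)
    next
      case False
      have "t *s ((s / t) *s a + 1 *s b) \<in> perp V"
        "t ^ q *s ((s / t) ^ q *s Fr a + 1 *s Fr b) \<in> perp V"
        using V False by (simp_all add: vec.scale_right_distrib vector_smult_assoc power_divide)
      then have "(s / t) *s a + 1 *s b \<in> perp V" "(s / t) ^ q *s Fr a + 1 *s Fr b \<in> perp V"
        using False nonzero_multiple_in_subspace[OF subspace_perp] by (metis power_not_zero)+
      then show ?thesis using V by (auto simp: R_def)
    qed
  next
    fix V assume "V \<in> R \<union> Inf"
    then show "V \<in> selfconj (Fr a) (Fr b)"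
    proof
      assume "V \<in> R"
      then obtain s where "V \<in> curve" "s *s a + 1 *s b \<in> perp V" "s ^ q *s Fr a + 1 *s Fr b \<in> perp V"
        by (auto simp: R_def)
      then show ?thesis unfolding selfconj_iff[OF c] by (intro conjI exI[of _ s] exI[of _ 1]) auto
    next
      assume "V \<in> Inf"
      then have "V \<in> curve" "1 *s a + 0 *s b \<in> perp V" "1 *s Fr a + 0 *s Fr b \<in> perp V"
        by (auto simp: Inf_def)
      then show ?thesis unfolding selfconj_iff[OF c]
        by (intro conjI exI[of _ 1] exI[of _ 0]) (auto simp: zero_power)
    qed
  qed
  have disj: "R \<inter> Inf = {}"
    using killing_unique[OF _ c, of _ _ 1 1 0] by (auto simp: R_def Inf_def)
  have simple: "poly (pderiv p) s \<noteq> 0" if "poly p s = 0" for s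
  proof -
    have "biquadratic g s 1 (s ^ q) 1 = 0" using that by (simp add: poly_p)
    then obtain V where V: "V \<in> curve" "s *s a + 1 *s b \<in> perp V" "s ^ q *s Fr a + 1 *s Fr b \<in> perp V"
      using relates_iff[OF g, of s 1 "s ^ q" 1] by auto
    have "s ^ q *s Fr a + 1 *s Fr b \<in> perp (Fr ` V)" using FrV[OF V(2)] by simp
    from fibre_simple(1)[OF c c' g V(1) other[OF V(1)] _ V(3) this V(2)] show ?thesis
      by (simp add: dp)
  qed
  \<comment> \<open>Simplicity of the root at infinity: the degree drops by one at most, so
    \<open>Inf\<close> makes up exactly for the loss.\<close>
  have inf_simple: "g 1 2 \<noteq> 0" if "g 2 2 = 0"
  proof -
    have "biquadratic g 1 0 1 0 = 0" using that by (simp add: biquadratic_def sum_atMost_2)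
    then obtain V where V: "V \<in> curve" "1 *s a + 0 *s b \<in> perp V" "1 *s Fr a + 0 *s Fr b \<in> perp V"
      using relates_iff[OF g, of 1 0 1 0] by auto
    have "1 *s Fr a + 0 *s Fr b \<in> perp (Fr ` V)" using FrV[OF V(2)] by (simp add: zero_power)
    from fibre_simple(2)[OF c c' g V(1) other[OF V(1)] _ V(3) this V(2)] show ?thesis
      by (simp add: coeff_st_def)
  qed
  have cf: "Polynomial.coeff p n = (\<Sum>i\<le>2. \<Sum>j\<le>2. if n = i + q * j then g i j else 0)" for n
    by (auto simp: p_def coeff_sum intro!: sum.cong)
  have c22: "Polynomial.coeff p (2 * q + 2) = g 2 2"
    using q_ge_2 by (simp add: cf sum_atMost_2)
  have c12: "Polynomial.coeff p (2 * q + 1) = g 1 2"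
    using q_ge_2 by (simp add: cf sum_atMost_2)
  have chigh: "Polynomial.coeff p n = 0" if "n > 2 * q + 2" for n
    using that q_ge_2 by (simp add: cf sum_atMost_2)
  have p0: "p \<noteq> 0" using c22 c12 inf_simple by (metis coeff_0)
  have deg: "Polynomial.degree p = (if g 2 2 = 0 then 2 * q + 1 else 2 * q + 2)"
  proof (cases "g 2 2 = 0")
    case True
    have "Polynomial.degree p \<le> 2 * q + 1"
    proof (rule degree_le, intro allI impI)
      fix i assume "2 * q + 1 < i"
      then show "Polynomial.coeff p i = 0" using c22 True chigh by (cases "i = 2 * q + 2") auto
    qed
    moreover have "2 * q + 1 \<le> Polynomial.degree p"
      by (rule le_degree) (use c12 inf_simple[OF True] in auto)
    ultimately show ?thesis using True by simp
  next
    case False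
    have "Polynomial.degree p \<le> 2 * q + 2" by (rule degree_le) (use chigh in auto)
    moreover have "2 * q + 2 \<le> Polynomial.degree p" by (rule le_degree) (use c22 False in auto)
    ultimately show ?thesis using False by simp
  qed
  have roots: "finite {s. poly p s = 0}" "card {s. poly p s = 0} = Polynomial.degree p"
    using poly_roots_finite[OF p0] card_simple_roots[OF simple p0] by auto
  define \<Phi> where "\<Phi> s = (SOME V. V \<in> curve \<and> s *s a + 1 *s b \<in> perp V \<and>
    s ^ q *s Fr a + 1 *s Fr b \<in> perp V)" for s
  have \<Phi>: "\<Phi> s \<in> curve \<and> s *s a + 1 *s b \<in> perp (\<Phi> s) \<and> s ^ q *s Fr a + 1 *s Fr b \<in> perp (\<Phi> s)"
    if "poly p s = 0" for s
    unfolding \<Phi>_def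
    by (rule someI_ex) (use relates_iff[OF g, of s 1 "s ^ q" 1] that in \<open>auto simp: poly_p\<close>)
  have bij: "bij_betw \<Phi> {s. poly p s = 0} R"
  proof (rule bij_betwI')
    fix s s' assume "s \<in> {s. poly p s = 0}" "s' \<in> {s. poly p s = 0}"
    then have "\<Phi> s \<in> curve" "s *s a + 1 *s b \<in> perp (\<Phi> s)" "s' *s a + 1 *s b \<in> perp (\<Phi> s')"
      using \<Phi> by auto
    then show "\<Phi> s = \<Phi> s' \<longleftrightarrow> s = s'"
      using killing_unique[OF _ c, of "\<Phi> s" s 1 s' 1] by auto
  next
    fix s assume "s \<in> {s. poly p s = 0}"
    then show "\<Phi> s \<in> R" using \<Phi>[of s] by (auto simp: R_def)
  next
    fix V assume "V \<in> R"
    then obtain s where V: "V \<in> curve" "s *s a + 1 *s b \<in> perp V" "s ^ q *s Fr a + 1 *s Fr b \<in> perp V"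
      by (auto simp: R_def)
    then have ps: "poly p s = 0" using relates_iff[OF g, of s 1 "s ^ q" 1] by (auto simp: poly_p)
    have "V = \<Phi> s"
      using curve_determined[OF V(1) _ c c' dual_comb_in_span dual_comb_nonzero[OF c] V(2) _
          dual_comb_in_span dual_comb_nonzero[OF c'(1)] V(3)] \<Phi>[OF ps] by simp
    then show "\<exists>s\<in>{s. poly p s = 0}. V = \<Phi> s" using ps by blast
  qed
  have R: "finite R" "card R = Polynomial.degree p"
    using roots bij_betw_finite[OF bij] bij_betw_same_card[OF bij] by simp_all
  have Inf: "finite Inf \<and> card Inf = (if g 2 2 = 0 then 1 else 0)"
  proof (cases "g 2 2 = 0")
    case True
    then have "biquadratic g 1 0 1 0 = 0" by (simp add: biquadratic_def sum_atMost_2)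
    then obtain V where V: "V \<in> curve" "1 *s a + 0 *s b \<in> perp V" "1 *s Fr a + 0 *s Fr b \<in> perp V"
      using relates_iff[OF g, of 1 0 1 0] by auto
    have uniq: "V' = V" if "V' \<in> Inf" for V'
    proof -
      have V': "V' \<in> curve" "1 *s a + 0 *s b \<in> perp V'" "1 *s Fr a + 0 *s Fr b \<in> perp V'"
        using that by (auto simp: Inf_def)
      show ?thesis
        by (rule curve_determined[OF V'(1) V(1) c c' dual_comb_in_span dual_comb_nonzero[OF c] V'(2) V(2)
          dual_comb_in_span dual_comb_nonzero[OF c'(1)] V'(3) V(3)]) auto
    qed
    have "V \<in> Inf" using V by (simp add: Inf_def)
    moreover have "Inf \<subseteq> {V}" by (intro subsetI singleton_iff[THEN iffD2] uniq)
    ultimately have "Inf = {V}" by blast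
    then show ?thesis using True by simp
  next
    case False
    then have "biquadratic g 1 0 1 0 \<noteq> 0" by (simp add: biquadratic_def sum_atMost_2)
    then have "Inf = {}" using relates_iff[OF g, of 1 0 1 0] by (auto simp: Inf_def)
    then show ?thesis using False by simp
  qed
  show "finite (selfconj (Fr a) (Fr b))" using split R Inf by simp
  have "card (selfconj (Fr a) (Fr b)) = card R + card Inf"
    unfolding split using R Inf disj by (intro card_Un_disjoint) auto
  then show "card (selfconj (Fr a) (Fr b)) = 2 * q + 2" using R Inf deg by simp
qed

lemma card_selfconj:
  assumes "dual_pt c a b"
  shows "finite (selfconj a b)" "card (selfconj a b) = 2 * q + 2"
proof -
  obtain c1 a1 b1 where 1: "dual_pt c1 a1 b1" "Fr a1 = a" "Fr b1 = b"
    by (rule obtain_preimage_dual[OF assms])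
  show "finite (selfconj a b)" "card (selfconj a b) = 2 * q + 2"
    using card_selfconj_Fr[OF 1(1)] 1(2,3) by simp_all
qed

end

text \<open>With roots (u : v) and (n : -m) the discriminant is the square of
  \<open>m * u + n * v\<close>, so it detects distinct roots in characteristic two as well.\<close>

lemma qform_disc:
  fixes p2 :: "'b::field"
  assumes "qform p2 p1 p0 u v = 0" "u \<noteq> 0 \<or> v \<noteq> 0" "p2 \<noteq> 0 \<or> p1 \<noteq> 0 \<or> p0 \<noteq> 0"
  shows "p1\<^sup>2 - 4 * (p2 * p0) \<noteq> 0 \<longleftrightarrow>
    (\<exists>u' v'. (u' \<noteq> 0 \<or> v' \<noteq> 0) \<and> qform p2 p1 p0 u' v' = 0 \<and> u * v' \<noteq> u' * v)"
proof -
  obtain m n where mn: "p2 = v * m" "p1 = v * n - u * m" "p0 = - (u * n)"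
    by (rule qform_factor[OF assms(1,2)])
  have disc: "p1\<^sup>2 - 4 * (p2 * p0) = (m * u + n * v)\<^sup>2"
    unfolding mn by (simp add: power2_eq_square algebra_simps)
  have mn0: "m \<noteq> 0 \<or> n \<noteq> 0" using assms(3) mn by auto
  have f: "qform p2 p1 p0 u' v' = (v * u' - u * v') * (m * u' + n * v')" for u' v'
    unfolding qform_def mn by (simp add: power2_eq_square algebra_simps)
  show ?thesis
  proof
    assume "p1\<^sup>2 - 4 * (p2 * p0) \<noteq> 0"
    then have "m * u + n * v \<noteq> 0" unfolding disc by simp
    then have "u * (- m) \<noteq> n * v" by (simp add: neg_eq_iff_add_eq_0 mult.commute)
    moreover have "qform p2 p1 p0 n (- m) = 0" by (simp add: f)
    ultimately show "\<exists>u' v'. (u' \<noteq> 0 \<or> v' \<noteq> 0) \<and> qform p2 p1 p0 u' v' = 0 \<and> u * v' \<noteq> u' * v"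
      using mn0 by (intro exI[of _ n] exI[of _ "- m"]) auto
  next
    assume "\<exists>u' v'. (u' \<noteq> 0 \<or> v' \<noteq> 0) \<and> qform p2 p1 p0 u' v' = 0 \<and> u * v' \<noteq> u' * v"
    then obtain u' v' where uv: "qform p2 p1 p0 u' v' = 0" "u * v' \<noteq> u' * v" by blast
    then have e: "m * u' + n * v' = 0" by (simp add: f mult.commute)
    show "p1\<^sup>2 - 4 * (p2 * p0) \<noteq> 0"
    proof
      assume "p1\<^sup>2 - 4 * (p2 * p0) = 0"
      then have e': "m * u + n * v = 0" unfolding disc by simp
      have "m * (u * v' - u' * v) = (m * u + n * v) * v' - (m * u' + n * v') * v"
        "n * (u * v' - u' * v) = (m * u' + n * v') * u - (m * u + n * v) * u'"
        by (simp_all add: algebra_simps)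
      then have "m * (u * v' - u' * v) = 0" "n * (u * v' - u' * v) = 0" using e e' by simp_all
      with mn0 uv(2) show False by auto
    qed
  qed
qed

lemma qform_common_root_resultant:
  fixes p2 :: "'b::field"
  assumes "qform p2 p1 p0 u v = 0" "qform r2 r1 r0 u v = 0" "u \<noteq> 0 \<or> v \<noteq> 0"
  shows "(p2 * r0 - p0 * r2)\<^sup>2 - (p2 * r1 - p1 * r2) * (p1 * r0 - p0 * r1) = 0"
proof -
  obtain m n where mn: "p2 = v * m" "p1 = v * n - u * m" "p0 = - (u * n)"
    by (rule qform_factor[OF assms(1,3)])
  obtain k l where kl: "r2 = v * k" "r1 = v * l - u * k" "r0 = - (u * l)"
    by (rule qform_factor[OF assms(2,3)])
  show ?thesis unfolding mn kl by (simp add: power2_eq_square algebra_simps)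
qed

text \<open>The coefficient of \<open>u ^ j * v ^ (2 - j)\<close> as a polynomial in
  \<open>s\<close>, after \<open>s ^ n\<close> is substituted and t = 1. Only n = 1 and n = q occur,
  and for n = q its derivative is zero.\<close>

definition coeff_poly :: "(nat \<Rightarrow> nat \<Rightarrow> 'b::field) \<Rightarrow> nat \<Rightarrow> nat \<Rightarrow> 'b poly" where
  "coeff_poly g n j = (\<Sum>i\<le>2. Polynomial.monom (g i j) (n * i))"

lemma poly_coeff_poly: "poly (coeff_poly g n j) s = coeff_uv g (s ^ n) 1 j"
  by (simp add: coeff_poly_def coeff_uv_def sum_atMost_2 poly_monom flip: power_mult)

lemma degree_coeff_poly: "Polynomial.degree (coeff_poly g n j) \<le> 2 * n"
  unfolding coeff_poly_def
  by (rule degree_sum_le) (auto intro!: order.trans[OF degree_monom_le])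

lemma poly_pderiv_coeff_poly_1: "poly (pderiv (coeff_poly g 1 j)) s = g 1 j + 2 * g 2 j * s"
  by (simp add: coeff_poly_def sum_atMost_2 pderiv_add pderiv_monom poly_monom)

lemma pderiv_coeff_poly_0:
  assumes "of_nat n = (0::'b::field)"
  shows "pderiv (coeff_poly (g :: nat \<Rightarrow> nat \<Rightarrow> 'b) n j) = 0"
  using assms by (simp add: coeff_poly_def sum_atMost_2 pderiv_add pderiv_monom)

lemma card_le_2:
  assumes "finite S" "\<And>x y z. x \<in> S \<Longrightarrow> y \<in> S \<Longrightarrow> z \<in> S \<Longrightarrow> x = y \<or> x = z \<or> y = z"
  shows "card S \<le> 2"
proof (rule ccontr)
  assume "\<not> card S \<le> 2"
  then have "3 \<le> card S" by simp
  then obtain T where T: "T \<subseteq> S" "card T = 3" by (rule obtain_subset_with_card_n)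
  then obtain x y z where "T = {x, y, z}" "x \<noteq> y" "y \<noteq> z" "x \<noteq> z" by (auto simp: card_3_iff)
  with T assms(2)[of x y z] show False by auto
qed

section \<open>Linked members and ramification\<close>

context smooth_system
begin

lemma same_span:
  assumes "dual_pt c a b" "dual_pt c' a' b'" "c' \<in> vec.span {c}"
  shows "vec.span {a', b'} = vec.span {a, b}"
proof -
  obtain k where k: "c' = k *s c" using assms(3) by (auto simp: in_span_1)
  then have "k \<noteq> 0" using assms(2) by (auto simp: dual_pt_def)
  then have "rad c' = rad c" by (auto simp: rad_def form_simps k)
  then have "perp (vec.span {a', b'}) = perp (vec.span {a, b})"
    using dual_pt_rad assms by (simp add: perp_span)
  then have "perp (perp (vec.span {a', b'})) = perp (perp (vec.span {a, b}))" by simp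
  then show ?thesis by (simp add: perp_perp)
qed

lemma killer_proportional:
  assumes "V \<in> curve" "dual_pt c a b" "w \<in> vec.span {a, b}" "w' \<in> vec.span {a, b}"
    "w \<in> perp V" "w' \<in> perp V" "w \<noteq> 0"
  obtains k where "w' = k *s w"
proof -
  have "vec.dim {w, w'} \<noteq> 2" by (rule curve_not_in_radical[OF assms(1-6)])
  then obtain r s where rs: "r *s w + s *s w' = 0" "r \<noteq> 0 \<or> s \<noteq> 0"
    unfolding dim2_iff by blast
  then have "s \<noteq> 0" using assms(7) by auto
  have "s *s w' = (- r) *s w" using rs(1) by (simp add: eq_neg_iff_add_eq_0 add.commute)
  then have "inverse s *s (s *s w') = inverse s *s ((- r) *s w)" by simp
  then have "w' = (inverse s * (- r)) *s w" using \<open>s \<noteq> 0\<close> by (simp add: vector_smult_assoc)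
  with that show thesis by blast
qed

text \<open>Equal values under the cover given by \<open>span {a, b}\<close>; a member is also
  linked to itself.\<close>

definition linked :: "'b ^ 5 \<Rightarrow> 'b ^ 5 \<Rightarrow> ('b ^ 5) set \<Rightarrow> ('b ^ 5) set \<Rightarrow> bool" where
  "linked a b V Y \<longleftrightarrow> (\<exists>w\<in>vec.span {a, b}. w \<noteq> 0 \<and> w \<in> perp V \<and> w \<in> perp Y)"

lemma linked_trans:
  assumes "V \<in> curve" "dual_pt c a b" "linked a b V Y" "w \<in> vec.span {a, b}" "w \<noteq> 0" "w \<in> perp V"
  shows "w \<in> perp Y"
proof -
  obtain w' where w': "w' \<in> vec.span {a, b}" "w' \<noteq> 0" "w' \<in> perp V" "w' \<in> perp Y"
    using assms(3) by (auto simp: linked_def)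
  obtain k where "w = k *s w'"
    by (rule killer_proportional[OF assms(1,2) w'(1) assms(4) w'(3) assms(6) w'(2)])
  then show ?thesis using w'(4) by (simp add: vec.subspace_scale)
qed

text \<open>If both forms were proportional, one functional would kill three distinct
  members.\<close>

lemma linked_distinct:
  assumes V: "V \<in> curve" "V1 \<in> curve" "V2 \<in> curve" "V \<noteq> V1" "V \<noteq> V2" "V1 \<noteq> V2"
    and c: "dual_pt c a b" "dual_pt c' a' b'" and l: "linked a b V V1" "linked a' b' V V2"
  shows "c' \<notin> vec.span {c}"
proof
  assume "c' \<in> vec.span {c}"
  then have s: "vec.span {a', b'} = vec.span {a, b}" by (rule same_span[OF c])
  obtain w where w: "w \<in> vec.span {a, b}" "w \<noteq> 0" "w \<in> perp V" "w \<in> perp V1"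
    using l(1) by (auto simp: linked_def)
  have "w \<in> perp V2" by (rule linked_trans[OF V(1) c(2) l(2) _ w(2,3)]) (simp add: s w(1))
  with curve_at_most_two[OF V(1-3) c(1) w] V(4-6) show False by blast
qed

text \<open>Each member excludes at most one \<open>\<mu>\<close>, and the field is infinite. The
  affine coordinate can thus be chosen with finitely many given members away from infinity.\<close>

lemma avoid_killing:
  assumes "dual_pt c a b" "finite F" "F \<subseteq> curve"
  shows "\<exists>\<mu>. \<forall>V\<in>F. a + \<mu> *s b \<notin> perp V"
proof -
  have "finite {\<mu>. a + \<mu> *s b \<in> perp V}" if "V \<in> F" for V
  proof -
    have "{\<mu>. a + \<mu> *s b \<in> perp V} \<subseteq> {l}" if l: "a + l *s b \<in> perp V" for l
    proof
      fix m assume "m \<in> {\<mu>. a + \<mu> *s b \<in> perp V}"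
      then have "1 *s a + m *s b \<in> perp V" "1 *s a + l *s b \<in> perp V" using l by simp_all
      from killing_unique[OF _ assms(1) this] \<open>V \<in> F\<close> assms(3) show "m \<in> {l}" by auto
    qed
    then show ?thesis
      by (cases "\<exists>l. a + l *s b \<in> perp V") (metis finite.simps finite_subset, simp)
  qed
  then have "finite (\<Union>V\<in>F. {\<mu>. a + \<mu> *s b \<in> perp V})" using assms(2) by blast
  then obtain \<mu> where "\<mu> \<notin> (\<Union>V\<in>F. {\<mu>. a + \<mu> *s b \<in> perp V})"
    using ex_new_if_finite[OF infinite_alg_closed] by blast
  then show ?thesis by blast
qed

lemma shift_span: "vec.span {a + \<mu> *s b, b} = vec.span {a, b}" for a b :: "'b ^ 5"
proof -
  have "r *s a + s *s b = r *s (a + \<mu> *s b) + (s - r * \<mu>) *s b"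
    "r *s (a + \<mu> *s b) + s *s b = r *s a + (s + r * \<mu>) *s b" for r s
    by (simp_all add: vec_eq_iff algebra_simps)
  then show ?thesis unfolding set_eq_iff in_span_2 by metis
qed

lemma dual_pt_shift: "dual_pt c a b \<Longrightarrow> dual_pt c (a + \<mu> *s b) b"
  by (simp add: dual_pt_def wedge_def dot_simps algebra_simps)

definition ramified :: "'b ^ 5 \<Rightarrow> 'b ^ 5 \<Rightarrow> ('b ^ 5) set set" where
  "ramified a b = {V \<in> curve. \<forall>V'\<in>curve. linked a b V V' \<longrightarrow> V' = V}"

lemma finite_ramified:
  assumes "dual_pt c a b"
  shows "finite (ramified a b)"
proof -
  have "card (selfconj a b) \<noteq> 0" using card_selfconj[OF assms] by simp
  then obtain V0 where "V0 \<in> selfconj a b" by fastforce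
  then have V0: "V0 \<in> curve" "linked a b V0 (Fr ` V0)" by (auto simp: selfconj_def linked_def)
  \<comment> \<open>Moves the value of \<open>V0\<close> away from infinity, so that the polynomial
    \<open>\<Delta>\<close> can be evaluated there.\<close>
  obtain \<mu> where \<mu>: "a + \<mu> *s b \<notin> perp V0"
    using avoid_killing[OF assms, of "{V0}"] V0 by auto
  define a' where "a' = a + \<mu> *s b"
  have c: "dual_pt c a' b" unfolding a'_def by (rule dual_pt_shift[OF assms])
  have sp: "vec.span {a', b} = vec.span {a, b}" unfolding a'_def by (rule shift_span)
  have ram: "ramified a b = ramified a' b" by (simp add: ramified_def linked_def sp)
  have V0': "linked a' b V0 (Fr ` V0)" using V0(2) by (simp add: linked_def sp)
  have c1: "dual_pt (Fr c) (Fr a') (Fr b)" by (rule dual_pt_Fr[OF c])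
  have "c \<notin> vec.span {Fr c}"
  proof
    assume "c \<in> vec.span {Fr c}"
    then obtain k where k: "c = k *s Fr c" by (auto simp: in_span_1)
    then have "k \<noteq> 0" using c by (auto simp: dual_pt_def)
    then have "Fr c = inverse k *s c" using arg_cong[OF k, of "\<lambda>v. inverse k *s v"]
      by (simp add: vector_smult_assoc)
    then have "Fr c \<in> vec.span {c}" by (auto simp: in_span_1)
    with dual_not_rational[OF c] show False by blast
  qed
  then obtain g where g: "relates g (Fr a') (Fr b) a' b"
    using biquadratic_relation[OF c1 c] unfolding relates_def by blast
  \<comment> \<open>Members over (u : v) are told apart by their values under the conjugate cover,
    so the discriminant is that of the quadratic in (s : t).\<close>
  define disc where "disc u v = (coeff_st g u v 1)\<^sup>2 - 4 * (coeff_st g u v 2 * coeff_st g u v 0)" for u v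
  define P where "P i = [:g i 0, g i 1, g i 2:]" for i
  define \<Delta> where "\<Delta> = (P 1)\<^sup>2 - Polynomial.smult 4 (P 2 * P 0)"
  have P: "poly (P i) u = coeff_st g u 1 i" for i u
    by (simp add: P_def coeff_st_def power2_eq_square algebra_simps)
  have \<Delta>: "poly \<Delta> u = disc u 1" for u by (simp add: \<Delta>_def P disc_def)
  have disc_iff: "disc u v \<noteq> 0 \<longleftrightarrow> (\<exists>V'\<in>curve. V' \<noteq> V \<and> u *s a' + v *s b \<in> perp V')"
    if V: "V \<in> curve" "u *s a' + v *s b \<in> perp V" and uv: "u \<noteq> 0 \<or> v \<noteq> 0" for u v V
  proof -
    obtain s t where st: "s \<noteq> 0 \<or> t \<noteq> 0" "s *s Fr a' + t *s Fr b \<in> perp V"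
      by (rule obtain_killing[OF c1 V(1)])
    have "biquadratic g s t u v = 0" using relates_iff[OF g st(1) uv] V st(2) by blast
    then have q0: "qform (coeff_st g u v 2) (coeff_st g u v 1) (coeff_st g u v 0) s t = 0"
      by (simp add: biquadratic_coeff_st qform_def)
    have eq: "disc u v \<noteq> 0 \<longleftrightarrow> (\<exists>s' t'. (s' \<noteq> 0 \<or> t' \<noteq> 0) \<and> biquadratic g s' t' u v = 0 \<and> s * t' \<noteq> s' * t)"
      using qform_disc[OF q0 st(1) coeff_st_nonzero[OF c1 c g uv]]
      by (simp add: disc_def biquadratic_coeff_st qform_def)
    show ?thesis
    proof
      assume "disc u v \<noteq> 0"
      then obtain s' t' where s': "s' \<noteq> 0 \<or> t' \<noteq> 0" "biquadratic g s' t' u v = 0" "s * t' \<noteq> s' * t"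
        using eq by blast
      then obtain V' where V': "V' \<in> curve" "s' *s Fr a' + t' *s Fr b \<in> perp V'" "u *s a' + v *s b \<in> perp V'"
        using relates_iff[OF g s'(1) uv] by blast
      have "V' \<noteq> V" using killing_unique[OF V(1) c1 st(2)] V'(2) s'(3) by blast
      with V' show "\<exists>V'\<in>curve. V' \<noteq> V \<and> u *s a' + v *s b \<in> perp V'" by blast
    next
      assume "\<exists>V'\<in>curve. V' \<noteq> V \<and> u *s a' + v *s b \<in> perp V'"
      then obtain V' where V': "V' \<in> curve" "V' \<noteq> V" "u *s a' + v *s b \<in> perp V'" by blast
      obtain s' t' where s': "s' \<noteq> 0 \<or> t' \<noteq> 0" "s' *s Fr a' + t' *s Fr b \<in> perp V'"
        by (rule obtain_killing[OF c1 V'(1)])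
      have "biquadratic g s' t' u v = 0" using relates_iff[OF g s'(1) uv] V' s'(2) by blast
      moreover have "s * t' \<noteq> s' * t"
      proof
        assume e: "s * t' = s' * t"
        have "\<exists>k. s' = k * s \<and> t' = k * t"
        proof (cases "s = 0")
          case True
          then show ?thesis using e st(1) s'(1) by (intro exI[of _ "t' / t"]) auto
        next
          case False
          then show ?thesis using e by (intro exI[of _ "s' / s"]) (auto simp: field_simps)
        qed
        then obtain k where k: "s' = k * s" "t' = k * t" by blast
        have "k \<noteq> 0" using k s'(1) by auto
        have "k *s (s *s Fr a' + t *s Fr b) \<in> perp V'"
          using s'(2) unfolding k by (simp add: vec.scale_right_distrib)
        then have "s *s Fr a' + t *s Fr b \<in> perp V'"
          using nonzero_multiple_in_subspace[OF subspace_perp _ \<open>k \<noteq> 0\<close>] by blast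
        then have "V = V'"
          using curve_determined[OF V(1) V'(1) c1 c \<open>c \<notin> vec.span {Fr c}\<close> dual_comb_in_span
            dual_comb_nonzero[OF c1 st(1)] st(2) _ dual_comb_in_span dual_comb_nonzero[OF c uv] V(2) V'(3)]
          by blast
        with V'(2) show False by simp
      qed
      ultimately show "disc u v \<noteq> 0" using eq s'(1) by blast
    qed
  qed
  have "\<Delta> \<noteq> 0"
  proof
    assume 0: "\<Delta> = 0"
    obtain s t where st: "s \<noteq> 0 \<or> t \<noteq> 0" "s *s a' + t *s b \<in> perp V0"
      by (rule obtain_killing[OF c V0(1)])
    have "t \<noteq> 0"
    proof
      assume "t = 0"
      then have "a' \<in> perp V0"
        using st nonzero_multiple_in_subspace[OF subspace_perp, of s a' V0] by simp
      with \<mu> show False by (simp add: a'_def)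
    qed
    have "t *s ((s / t) *s a' + 1 *s b) \<in> perp V0"
      using st(2) \<open>t \<noteq> 0\<close> by (simp add: vec.scale_right_distrib vector_smult_assoc)
    then have k: "(s / t) *s a' + 1 *s b \<in> perp V0"
      using nonzero_multiple_in_subspace[OF subspace_perp _ \<open>t \<noteq> 0\<close>] by blast
    have nz: "s / t \<noteq> 0 \<or> 1 \<noteq> (0::'b)" by simp
    have "(s / t) *s a' + 1 *s b \<in> perp (Fr ` V0)"
      by (rule linked_trans[OF V0(1) c V0' dual_comb_in_span dual_comb_nonzero[OF c nz] k])
    then have "disc (s / t) 1 \<noteq> 0"
      using disc_iff[OF V0(1) k nz] curve_Fr[OF V0(1)] curve_not_stable[OF V0(1)] by blast
    then show False using 0 \<Delta>[of "s / t"] by simp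
  qed
  define K where "K u v = {V \<in> ramified a' b. u *s a' + v *s b \<in> perp V}" for u v
  have fK: "finite (K u v)" if "u \<noteq> 0 \<or> v \<noteq> 0" for u v
  proof -
    have "V' = V" if "V \<in> K u v" "V' \<in> K u v" for V V'
    proof -
      have "linked a' b V V'"
        using that dual_comb_nonzero[OF c \<open>u \<noteq> 0 \<or> v \<noteq> 0\<close>] dual_comb_in_span
        unfolding linked_def K_def by blast
      then show ?thesis using that unfolding K_def ramified_def by blast
    qed
    then have "\<forall>V\<in>K u v. K u v \<subseteq> {V}" by blast
    then show ?thesis by (metis finite.simps finite_subset ex_in_conv)
  qed
  have "ramified a' b \<subseteq> K 1 0 \<union> (\<Union>u\<in>{u. poly \<Delta> u = 0}. K u 1)"
  proof
    fix V assume Vr: "V \<in> ramified a' b"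
    then have V: "V \<in> curve" by (simp add: ramified_def)
    obtain s t where st: "s \<noteq> 0 \<or> t \<noteq> 0" "s *s a' + t *s b \<in> perp V"
      by (rule obtain_killing[OF c V])
    show "V \<in> K 1 0 \<union> (\<Union>u\<in>{u. poly \<Delta> u = 0}. K u 1)"
    proof (cases "t = 0")
      case True
      then have "a' \<in> perp V"
        using st nonzero_multiple_in_subspace[OF subspace_perp, of s a' V] by simp
      then show ?thesis using Vr by (simp add: K_def)
    next
      case False
      have "t *s ((s / t) *s a' + 1 *s b) \<in> perp V"
        using st(2) False by (simp add: vec.scale_right_distrib vector_smult_assoc)
      then have k: "(s / t) *s a' + 1 *s b \<in> perp V"
        using nonzero_multiple_in_subspace[OF subspace_perp _ False] by blast
      have nz: "s / t \<noteq> 0 \<or> 1 \<noteq> (0::'b)" by simp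
      have "V' = V" if "V' \<in> curve" "(s / t) *s a' + 1 *s b \<in> perp V'" for V'
      proof -
        have "linked a' b V V'"
          using that(2) k dual_comb_nonzero[OF c nz] dual_comb_in_span unfolding linked_def by blast
        then show ?thesis using Vr that(1) unfolding ramified_def by blast
      qed
      then have "disc (s / t) 1 = 0" using disc_iff[OF V k nz] by blast
      then show ?thesis using Vr k by (auto simp: K_def \<Delta>)
    qed
  qed
  moreover have "finite (K 1 0 \<union> (\<Union>u\<in>{u. poly \<Delta> u = 0}. K u 1))"
    using fK poly_roots_finite[OF \<open>\<Delta> \<noteq> 0\<close>] by auto
  ultimately show ?thesis unfolding ram by (rule finite_subset)
qed

end

section \<open>The resultant and the count of solutions\<close>

context smooth_system
begin

lemma affine_killing:
  assumes "dual_pt c a b" "V \<in> curve" "a \<notin> perp V"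
  obtains s where "s *s a + 1 *s b \<in> perp V"
proof -
  obtain s t where st: "s \<noteq> 0 \<or> t \<noteq> 0" "s *s a + t *s b \<in> perp V"
    by (rule obtain_killing[OF assms(1,2)])
  have "t \<noteq> 0"
  proof
    assume "t = 0"
    then have "a \<in> perp V"
      using st nonzero_multiple_in_subspace[OF subspace_perp, of s a V] by simp
    with assms(3) show False ..
  qed
  have "t *s ((s / t) *s a + 1 *s b) \<in> perp V"
    using st(2) \<open>t \<noteq> 0\<close> by (simp add: vec.scale_right_distrib vector_smult_assoc)
  then show thesis
    using that nonzero_multiple_in_subspace[OF subspace_perp _ \<open>t \<noteq> 0\<close>] by blast
qed

lemma killing_same_point:
  assumes "dual_pt c a b" "dual_pt c' a' b'" "c' \<notin> vec.span {c}" "V \<in> curve" "V' \<in> curve"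
    and w: "w \<in> vec.span {a, b}" "w \<noteq> 0" "w \<in> perp V" "w \<in> perp V'"
    and k: "u *s a' + v *s b' \<in> perp V" "u' *s a' + v' *s b' \<in> perp V'"
    and uv: "u \<noteq> 0 \<or> v \<noteq> 0" "u' \<noteq> 0 \<or> v' \<noteq> 0" "u * v' = u' * v"
  shows "V = V'"
proof -
  have "\<exists>k. u' = k * u \<and> v' = k * v"
  proof (cases "u = 0")
    case True
    then show ?thesis using uv by (intro exI[of _ "v' / v"]) auto
  next
    case False
    then show ?thesis using uv by (intro exI[of _ "u' / u"]) (auto simp: field_simps)
  qed
  then obtain l where l: "u' = l * u" "v' = l * v" by blast
  have "l \<noteq> 0" using l uv(2) by auto
  have "l *s (u *s a' + v *s b') \<in> perp V'"
    using k(2) unfolding l by (simp add: vec.scale_right_distrib)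
  then have "u *s a' + v *s b' \<in> perp V'"
    using nonzero_multiple_in_subspace[OF subspace_perp _ \<open>l \<noteq> 0\<close>] by blast
  with curve_determined[OF assms(4,5,1-3) w dual_comb_in_span dual_comb_nonzero[OF assms(2) uv(1)] k(1)]
  show ?thesis by blast
qed

text \<open>A solution of a pair of quadratic forms in \<open>(u : v)\<close> that depend polynomially on \<open>s\<close>: the
  exponent \<open>q\<close> makes the second one constant to first order, so multiplicities of the zeros of the
  resultant are governed by the first form alone.\<close>

lemma resultant_nonzero:
  assumes c: "dual_pt c a b" "dual_pt c' a' b'" "c' \<notin> vec.span {c}" "c' \<notin> vec.span {Fr c}"
    and g: "relates g a b a' b'" "relates g' (Fr a) (Fr b) a' b'"
    and P: "\<And>j. P j = coeff_poly g 1 j" and P': "\<And>j. P' j = coeff_poly g' q j"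
  shows "(P 2 * P' 0 - P 0 * P' 2)\<^sup>2 - (P 2 * P' 1 - P 1 * P' 2) * (P 1 * P' 0 - P 0 * P' 1) \<noteq> 0"
    (is "?A\<^sup>2 - ?B * ?C \<noteq> 0")
proof
  assume R0: "?A\<^sup>2 - ?B * ?C = 0"
  have c1: "dual_pt (Fr c) (Fr a) (Fr b)" by (rule dual_pt_Fr[OF c(1)])
  define p where "p s j = poly (P j) s" for s j
  define r where "r s j = poly (P' j) s" for s j
  define d where "d s j = poly (pderiv (P j)) s" for s j
  note defs = p_def r_def d_def
  have p: "p s j = coeff_uv g s 1 j" for s j by (simp add: p_def P poly_coeff_poly)
  have r: "r s j = coeff_uv g' (s ^ q) 1 j" for s j by (simp add: r_def P' poly_coeff_poly)
  \<comment> \<open>These coefficients are polynomials in \<open>s ^ q\<close>, hence constant to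
    first order.\<close>
  have dP': "pderiv (P' j) = 0" for j unfolding P' by (rule pderiv_coeff_poly_0[OF q_zero])
  have pnz: "p s 2 \<noteq> 0 \<or> p s 1 \<noteq> 0 \<or> p s 0 \<noteq> 0" for s
    using coeff_uv_nonzero[OF c(1,2) g(1), of s 1] by (simp add: p)
  have rnz: "r s 2 \<noteq> 0 \<or> r s 1 \<noteq> 0 \<or> r s 0 \<noteq> 0" for s
    using coeff_uv_nonzero[OF c1 c(2) g(2), of "s ^ q" 1] by (simp add: r)
  have G: "biquadratic g s 1 u v = qform (p s 2) (p s 1) (p s 0) u v"
    "biquadratic g' (s ^ q) 1 u v = qform (r s 2) (r s 1) (r s 0) u v" for s u v
    by (simp_all add: biquadratic_coeff_uv p r)
  have dform: "qform (d s 2) (d s 1) (d s 0) u v = 2 * coeff_st g u v 2 * s + coeff_st g u v 1" for s u v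
    unfolding d_def P poly_pderiv_coeff_poly_1
    by (simp add: qform_def coeff_st_def power2_eq_square algebra_simps)
  \<comment> \<open>Off this finite set the root of the first form is simple in \<open>s\<close>, by
    \<open>fibre_simple\<close>, and the second form has two distinct roots in (u : v): the two
    hypotheses of the derivative argument.\<close>
  define bad where "bad = {s. \<exists>V\<in>ramified a' b'. s *s a + 1 *s b \<in> perp V}
    \<union> {s. \<exists>Y\<in>ramified (Fr a) (Fr b). s ^ q *s Fr a + 1 *s Fr b \<in> perp Y}"
  have "finite {s. \<exists>V\<in>ramified a' b'. s *s a + 1 *s b \<in> perp V}"
  proof (rule finite_subset)
    show "{s. \<exists>V\<in>ramified a' b'. s *s a + 1 *s b \<in> perp V}
      \<subseteq> (\<lambda>V. THE s. s *s a + 1 *s b \<in> perp V) ` ramified a' b'"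
    proof
      fix s assume "s \<in> {s. \<exists>V\<in>ramified a' b'. s *s a + 1 *s b \<in> perp V}"
      then obtain V where V: "V \<in> ramified a' b'" "s *s a + 1 *s b \<in> perp V" by blast
      have "V \<in> curve" using V(1) by (simp add: ramified_def)
      then have "x = s" if "x *s a + 1 *s b \<in> perp V" for x
        using killing_unique[OF _ c(1) that V(2)] by simp
      then have "s = (THE s. s *s a + 1 *s b \<in> perp V)"
        using the_equality[of "\<lambda>s. s *s a + 1 *s b \<in> perp V", OF V(2)] by metis
      then show "s \<in> (\<lambda>V. THE s. s *s a + 1 *s b \<in> perp V) ` ramified a' b'" using V(1) by (rule image_eqI)
    qed
  qed (intro finite_imageI finite_ramified[OF c(2)])
  moreover have "finite {s. \<exists>Y\<in>ramified (Fr a) (Fr b). s ^ q *s Fr a + 1 *s Fr b \<in> perp Y}"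
  proof (rule finite_subset)
    show "{s. \<exists>V\<in>ramified (Fr a) (Fr b). s ^ q *s Fr a + 1 *s Fr b \<in> perp V}
      \<subseteq> (\<lambda>V. THE s. s ^ q *s Fr a + 1 *s Fr b \<in> perp V) ` ramified (Fr a) (Fr b)"
    proof
      fix s assume "s \<in> {s. \<exists>V\<in>ramified (Fr a) (Fr b). s ^ q *s Fr a + 1 *s Fr b \<in> perp V}"
      then obtain V where V: "V \<in> ramified (Fr a) (Fr b)" "s ^ q *s Fr a + 1 *s Fr b \<in> perp V" by blast
      have "V \<in> curve" using V(1) by (simp add: ramified_def)
      then have "x = s" if "x ^ q *s Fr a + 1 *s Fr b \<in> perp V" for x
        using killing_unique[OF _ c1 that V(2)] by (simp add: power_q_inj)
      then have "s = (THE s. s ^ q *s Fr a + 1 *s Fr b \<in> perp V)"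
        using the_equality[of "\<lambda>s. s ^ q *s Fr a + 1 *s Fr b \<in> perp V", OF V(2)] by metis
      then show "s \<in> (\<lambda>V. THE s. s ^ q *s Fr a + 1 *s Fr b \<in> perp V) ` ramified (Fr a) (Fr b)"
        using V(1) by (rule image_eqI)
    qed
  qed (intro finite_imageI finite_ramified[OF c1])
  ultimately have fbad: "finite bad" by (simp add: bad_def)
  have root: "\<exists>u v. (u \<noteq> 0 \<or> v \<noteq> 0) \<and> qform (p s 2) (p s 1) (p s 0) u v = 0 \<and>
      qform (r s 2) (r s 1) (r s 0) u v = 0" for s
  proof -
    have "poly (?A\<^sup>2 - ?B * ?C) s = 0" unfolding R0 by simp
    then have "(p s 2 * r s 0 - p s 0 * r s 2)\<^sup>2 = (p s 2 * r s 1 - p s 1 * r s 2) * (p s 1 * r s 0 - p s 0 * r s 1)"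
      by (simp add: defs)
    from resultant_common_root[OF this] show ?thesis by metis
  qed
  have dnz: "qform (d s 2) (d s 1) (d s 0) u v \<noteq> 0"
    if s: "s \<notin> bad" and uv: "u \<noteq> 0 \<or> v \<noteq> 0" and z: "qform (p s 2) (p s 1) (p s 0) u v = 0" for s u v
  proof -
    obtain V where V: "V \<in> curve" "s *s a + 1 *s b \<in> perp V" "u *s a' + v *s b' \<in> perp V"
      using relates_iff[OF g(1) _ uv, of s 1] z by (auto simp: G)
    have "V \<notin> ramified a' b'" using s V(2) unfolding bad_def by blast
    then obtain V' where V': "V' \<in> curve" "linked a' b' V V'" "V' \<noteq> V"
      using V(1) unfolding ramified_def by blast
    have "u *s a' + v *s b' \<in> perp V'"
      by (rule linked_trans[OF V(1) c(2) V'(2) dual_comb_in_span dual_comb_nonzero[OF c(2) uv] V(3)])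
    from fibre_simple(1)[OF c(1-3) g(1) V(1) V'(1) V'(3)[symmetric] uv V(3) this V(2)]
    show ?thesis unfolding dform .
  qed
  have ABC: "poly ?A s = 0 \<and> poly ?B s = 0 \<and> poly ?C s = 0" if s: "s \<notin> bad" for s
  proof (rule ccontr)
    assume "\<not> (poly ?A s = 0 \<and> poly ?B s = 0 \<and> poly ?C s = 0)"
    then have nz: "p s 2 * r s 0 - p s 0 * r s 2 \<noteq> 0 \<or> p s 2 * r s 1 - p s 1 * r s 2 \<noteq> 0 \<or>
      p s 1 * r s 0 - p s 0 * r s 1 \<noteq> 0" by (simp add: defs)
    obtain u v where uv: "u \<noteq> 0 \<or> v \<noteq> 0" "qform (p s 2) (p s 1) (p s 0) u v = 0"
      "qform (r s 2) (r s 1) (r s 0) u v = 0" using root[of s] by blast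
    obtain Y where Y: "Y \<in> curve" "s ^ q *s Fr a + 1 *s Fr b \<in> perp Y" "u *s a' + v *s b' \<in> perp Y"
      using relates_iff[OF g(2) _ uv(1), of "s ^ q" 1] uv(3) by (auto simp: G)
    have "Y \<notin> ramified (Fr a) (Fr b)" using s Y(2) unfolding bad_def by blast
    then obtain Y' where Y': "Y' \<in> curve" "linked (Fr a) (Fr b) Y Y'" "Y' \<noteq> Y"
      using Y(1) unfolding ramified_def by blast
    have w0: "s ^ q *s Fr a + 1 *s Fr b \<noteq> 0" by (rule dual_comb_nonzero[OF c1]) simp
    have wY': "s ^ q *s Fr a + 1 *s Fr b \<in> perp Y'"
      by (rule linked_trans[OF Y(1) c1 Y'(2) dual_comb_in_span w0 Y(2)])
    obtain u' v' where uv': "u' \<noteq> 0 \<or> v' \<noteq> 0" "u' *s a' + v' *s b' \<in> perp Y'"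
      by (rule obtain_killing[OF c(2) Y'(1)])
    have "u * v' \<noteq> u' * v"
      using killing_same_point[OF c1 c(2,4) Y(1) Y'(1) dual_comb_in_span w0 Y(2) wY' Y(3) uv'(2) uv(1) uv'(1)]
        Y'(3) by blast
    moreover have "qform (r s 2) (r s 1) (r s 0) u' v' = 0"
      using relates_iff[OF g(2) _ uv'(1), of "s ^ q" 1] Y'(1) wY' uv'(2) by (auto simp: G)
    moreover have "poly (pderiv (?A\<^sup>2 - ?B * ?C)) s
      = 2 * (p s 2 * r s 0 - p s 0 * r s 2) * (d s 2 * r s 0 - d s 0 * r s 2)
      - (d s 2 * r s 1 - d s 1 * r s 2) * (p s 1 * r s 0 - p s 0 * r s 1)
      - (p s 2 * r s 1 - p s 1 * r s 2) * (d s 1 * r s 0 - d s 0 * r s 1)"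
      by (simp only: power2_eq_square pderiv_diff pderiv_mult dP' defs poly_diff poly_mult poly_add
          poly_0 mult_zero_right mult_zero_left add_0_left add_0_right) (simp add: algebra_simps)
    then have "2 * (p s 2 * r s 0 - p s 0 * r s 2) * (d s 2 * r s 0 - d s 0 * r s 2)
      - (d s 2 * r s 1 - d s 1 * r s 2) * (p s 1 * r s 0 - p s 0 * r s 1)
      - (p s 2 * r s 1 - p s 1 * r s 2) * (d s 1 * r s 0 - d s 0 * r s 1) = 0"
      unfolding R0 by simp
    ultimately have "qform (d s 2) (d s 1) (d s 0) u v = 0"
      using resultant_derivative[OF uv(2,3,1) _ _ rnz nz] by blast
    with dnz[OF s uv(1,2)] show False by blast
  qed
  have inf: "infinite (- bad)" using fbad infinite_alg_closed by (simp add: Compl_eq_Diff_UNIV)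
  have zero: "Q = 0" if "\<And>s. s \<notin> bad \<Longrightarrow> poly Q s = 0" for Q :: "'b poly"
  proof (rule ccontr)
    assume "Q \<noteq> 0"
    then have "finite {s. poly Q s = 0}" by (rule poly_roots_finite)
    moreover have "- bad \<subseteq> {s. poly Q s = 0}" using that by blast
    ultimately show False using inf finite_subset by blast
  qed
  \<comment> \<open>The minors vanish off \<open>bad\<close>, hence identically, and so do their
    derivatives. The two forms are then proportional to first order, which contradicts
    \<open>dnz\<close> too.\<close>
  have "?A = 0" "?B = 0" "?C = 0" using zero ABC by blast+
  then have dABC: "pderiv ?A = 0" "pderiv ?B = 0" "pderiv ?C = 0" by simp_all
  obtain s where s: "s \<notin> bad" using inf by (metis ComplD ex_in_conv finite.emptyI)
  obtain u v where uv: "u \<noteq> 0 \<or> v \<noteq> 0" "qform (p s 2) (p s 1) (p s 0) u v = 0"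
    using root[of s] by blast
  have "poly (pderiv ?A) s = 0" "poly (pderiv ?B) s = 0" "poly (pderiv ?C) s = 0"
    unfolding dABC by simp_all
  then have "d s 2 * r s 0 - d s 0 * r s 2 = 0" "d s 2 * r s 1 - d s 1 * r s 2 = 0"
    "d s 1 * r s 0 - d s 0 * r s 1 = 0"
    by (simp_all add: pderiv_diff pderiv_mult dP' defs mult.commute)
  moreover have "p s 2 * r s 0 - p s 0 * r s 2 = 0" "p s 2 * r s 1 - p s 1 * r s 2 = 0"
    "p s 1 * r s 0 - p s 0 * r s 1 = 0" using ABC[OF s] by (simp_all add: defs)
  ultimately have "qform (d s 2) (d s 1) (d s 0) u v = 0"
    using qform_proportional_root[OF _ _ _ _ _ _ uv(2) pnz rnz] by blast
  with dnz[OF s uv] show False by blast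
qed

text \<open>Send a solution to the parameter \<open>s\<close> of \<open>V\<close>. The number of
  solutions over \<open>s\<close> is at most the order of \<open>R\<close> at \<open>s\<close>: one
  common root makes \<open>R = A\<^sup>2 - B * C\<close> vanish, two common roots make all three
  minors vanish and \<open>R\<close> vanish doubly. The minors have degree at most 2 + 2q, so
  \<open>R\<close> has degree at most 4q + 4. The assumption \<open>na\<close> says that no solution
  lies at infinity.\<close>

lemma solutions_bound_aux:
  assumes c: "dual_pt c a b" "dual_pt c' a' b'" "c' \<notin> vec.span {c}" "c' \<notin> vec.span {Fr c}"
    and T: "finite T" "\<And>V Y. (V, Y) \<in> T \<Longrightarrow> V \<in> curve \<and> Y \<in> curve \<and> linked a' b' V Y \<and>
      linked (Fr a) (Fr b) (Fr ` V) Y" and na: "\<And>V Y. (V, Y) \<in> T \<Longrightarrow> a \<notin> perp V"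
  shows "card T \<le> 4 * q + 4"
proof -
  have c1: "dual_pt (Fr c) (Fr a) (Fr b)" by (rule dual_pt_Fr[OF c(1)])
  obtain g where g: "relates g a b a' b'"
    using biquadratic_relation[OF c(1,2,3)] unfolding relates_def by blast
  obtain g' where g': "relates g' (Fr a) (Fr b) a' b'"
    using biquadratic_relation[OF c1 c(2,4)] unfolding relates_def by blast
  define P where "P j = coeff_poly g 1 j" for j
  define P' where "P' j = coeff_poly g' q j" for j
  define A where "A = P 2 * P' 0 - P 0 * P' 2"
  define B where "B = P 2 * P' 1 - P 1 * P' 2"
  define C where "C = P 1 * P' 0 - P 0 * P' 1"
  define R where "R = A\<^sup>2 - B * C"
  have R0: "R \<noteq> 0"
    unfolding R_def A_def B_def C_def
    by (rule resultant_nonzero[OF c g g' P_def P'_def])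
  have "Polynomial.degree (P i * P' j) \<le> 2 * q + 2" for i j
    using degree_mult_le[of "P i" "P' j"] degree_coeff_poly[of g 1 i] degree_coeff_poly[of g' q j]
    unfolding P_def P'_def by linarith
  then have dABC: "Polynomial.degree A \<le> 2 * q + 2" "Polynomial.degree B \<le> 2 * q + 2"
    "Polynomial.degree C \<le> 2 * q + 2" unfolding A_def B_def C_def by (simp_all add: degree_diff_le)
  have degR: "Polynomial.degree R \<le> 4 * q + 4"
    unfolding R_def power2_eq_square
  proof (rule degree_diff_le)
    show "Polynomial.degree (A * A) \<le> 4 * q + 4" "Polynomial.degree (B * C) \<le> 4 * q + 4"
      using degree_mult_le[of A A] degree_mult_le[of B C] dABC by linarith+
  qed
  define \<tau> where "\<tau> V = (SOME s. s *s a + 1 *s b \<in> perp V)" for V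
  have \<tau>: "\<tau> V *s a + 1 *s b \<in> perp V" if VY: "(V, Y) \<in> T" for V Y
  proof -
    have "V \<in> curve" using T(2)[OF VY] by blast
    then obtain s where "s *s a + 1 *s b \<in> perp V"
      by (rule affine_killing[OF c(1) _ na[OF VY]])
    then show ?thesis unfolding \<tau>_def by (rule someI)
  qed
  define w0 where "w0 s = s ^ q *s Fr a + 1 *s Fr b" for s
  have w0: "w0 s \<in> vec.span {Fr a, Fr b}" "w0 s \<noteq> 0" for s
    unfolding w0_def by (rule dual_comb_in_span, rule dual_comb_nonzero[OF c1]) simp
  have w4: "s *s a + 1 *s b \<in> vec.span {a, b}" "s *s a + 1 *s b \<noteq> 0" for s
    by (rule dual_comb_in_span, rule dual_comb_nonzero[OF c(1)]) simp
  have \<tau>Y: "w0 (\<tau> V) \<in> perp Y" if VY: "(V, Y) \<in> T" for V Y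
  proof -
    have "w0 (\<tau> V) = Fr (\<tau> V *s a + 1 *s b)" by (simp add: w0_def Fr_add Fr_scale)
    then have "w0 (\<tau> V) \<in> perp (Fr ` V)" using \<tau>[OF VY] by (simp only: perp_Fr)
    from linked_trans[OF _ c1 _ w0 this] show ?thesis using T(2)[OF VY] curve_Fr by blast
  qed
  have ex: "\<exists>u v. (u \<noteq> 0 \<or> v \<noteq> 0) \<and> u *s a' + v *s b' \<in> perp V \<and> u *s a' + v *s b' \<in> perp Y"
    if VY: "(V, Y) \<in> T" for V Y
  proof -
    obtain u v where uv: "u \<noteq> 0 \<or> v \<noteq> 0" "u *s a' + v *s b' \<in> perp V"
      by (rule obtain_killing[OF c(2)]) (use T(2)[OF VY] in blast)
    have "u *s a' + v *s b' \<in> perp Y"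
      by (rule linked_trans[OF _ c(2) _ dual_comb_in_span dual_comb_nonzero[OF c(2) uv(1)] uv(2)])
        (use T(2)[OF VY] in blast)+
    with uv show ?thesis by blast
  qed
  have root: "qform (poly (P 2) s) (poly (P 1) s) (poly (P 0) s) u v = 0"
      "qform (poly (P' 2) s) (poly (P' 1) s) (poly (P' 0) s) u v = 0"
    if "(V, Y) \<in> T" "s = \<tau> V" "u \<noteq> 0 \<or> v \<noteq> 0" "u *s a' + v *s b' \<in> perp V" "u *s a' + v *s b' \<in> perp Y"
    for V Y u v s
  proof -
    have VY: "V \<in> curve" "Y \<in> curve" using T(2)[OF that(1)] by blast+
    have "biquadratic g s 1 u v = 0"
      using relates_iff[OF g _ that(3), of s 1] VY(1) \<tau>[OF that(1)] that(2,4) by auto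
    then show "qform (poly (P 2) s) (poly (P 1) s) (poly (P 0) s) u v = 0"
      by (simp add: biquadratic_coeff_uv P_def poly_coeff_poly)
    have "biquadratic g' (s ^ q) 1 u v = 0"
      using relates_iff[OF g' _ that(3), of "s ^ q" 1] VY(2) \<tau>Y[OF that(1)] that(2,5) by (auto simp: w0_def)
    then show "qform (poly (P' 2) s) (poly (P' 1) s) (poly (P' 0) s) u v = 0"
      by (simp add: biquadratic_coeff_uv P'_def poly_coeff_poly)
  qed
  \<comment> \<open>Solutions over the parameter \<open>s\<close>: at most two members have this
    value, and each determines its \<open>Y\<close> through the values under \<open>Fr c\<close> and
    \<open>c'\<close>.\<close>
  define F where "F s = {p \<in> T. \<tau> (fst p) = s}" for s
  have finF: "finite (F s)" for s using T(1) by (simp add: F_def)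
  have inj: "Y = Y'" if "(V, Y) \<in> F s" "(V, Y') \<in> F s" for V Y Y' s
  proof -
    have m: "(V, Y) \<in> T" "(V, Y') \<in> T" using that by (auto simp: F_def)
    obtain u v where uv: "u \<noteq> 0 \<or> v \<noteq> 0" "u *s a' + v *s b' \<in> perp V" "u *s a' + v *s b' \<in> perp Y"
      using ex[OF m(1)] by blast
    have "u *s a' + v *s b' \<in> perp Y'"
      by (rule linked_trans[OF _ c(2) _ dual_comb_in_span dual_comb_nonzero[OF c(2) uv(1)] uv(2)])
        (use T(2)[OF m(2)] in blast)+
    then show ?thesis
      using curve_determined[OF _ _ c1 c(2,4) w0 \<tau>Y[OF m(1)] \<tau>Y[OF m(2)] dual_comb_in_span
          dual_comb_nonzero[OF c(2) uv(1)] uv(3)] T(2)[OF m(1)] T(2)[OF m(2)] by blast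
  qed
  have card2: "card (F s) \<le> 2" for s
  proof (rule card_le_2[OF finF])
    fix x y z assume xyz: "x \<in> F s" "y \<in> F s" "z \<in> F s"
    obtain V1 Y1 V2 Y2 V3 Y3 where e: "x = (V1, Y1)" "y = (V2, Y2)" "z = (V3, Y3)"
      by (meson surj_pair)
    have m: "(V1, Y1) \<in> T" "(V2, Y2) \<in> T" "(V3, Y3) \<in> T" "\<tau> V1 = s" "\<tau> V2 = s" "\<tau> V3 = s"
      using xyz e by (auto simp: F_def)
    have cv: "V1 \<in> curve" "V2 \<in> curve" "V3 \<in> curve" using T(2) m(1-3) by blast+
    have "V1 = V2 \<or> V1 = V3 \<or> V2 = V3"
      using curve_at_most_two[OF cv c(1) w4, of s] \<tau>[OF m(1)] \<tau>[OF m(2)] \<tau>[OF m(3)] m(4-6) by simp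
    then show "x = y \<or> x = z \<or> y = z" using inj xyz e by blast
  qed
  have order: "card (F s) \<le> Polynomial.order s R" for s
  proof -
    have "1 \<le> Polynomial.order s R" if ne: "F s \<noteq> {}"
    proof -
      obtain V Y where VY: "(V, Y) \<in> F s" using ne by (metis ex_in_conv surj_pair)
      then have m: "(V, Y) \<in> T" "s = \<tau> V" by (auto simp: F_def)
      obtain u v where uv: "u \<noteq> 0 \<or> v \<noteq> 0" "u *s a' + v *s b' \<in> perp V" "u *s a' + v *s b' \<in> perp Y"
        using ex[OF m(1)] by blast
      have "poly R s = 0"
        using qform_common_root_resultant[OF root[OF m uv] uv(1)] by (simp add: R_def A_def B_def C_def)
      then show ?thesis using R0 by (simp add: order_root)
    qed
    moreover have "2 \<le> Polynomial.order s R" if two: "card (F s) = 2"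
    proof -
      obtain x y where xy: "F s = {x, y}" "x \<noteq> y" using two by (auto simp: card_2_iff)
      obtain V Y V' Y' where e: "x = (V, Y)" "y = (V', Y')" by (meson surj_pair)
      have inF: "(V, Y) \<in> F s" "(V', Y') \<in> F s" using xy(1) e by simp_all
      then have m: "(V, Y) \<in> T" "s = \<tau> V" "(V', Y') \<in> T" "s = \<tau> V'"
        by (auto simp: F_def)
      have cv: "V \<in> curve" "V' \<in> curve" using T(2) m by blast+
      obtain u v where uv: "u \<noteq> 0 \<or> v \<noteq> 0" "u *s a' + v *s b' \<in> perp V" "u *s a' + v *s b' \<in> perp Y"
        using ex[OF m(1)] by blast
      obtain u' v' where uv': "u' \<noteq> 0 \<or> v' \<noteq> 0" "u' *s a' + v' *s b' \<in> perp V'" "u' *s a' + v' *s b' \<in> perp Y'"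
        using ex[OF m(3)] by blast
      have "u * v' \<noteq> u' * v"
      proof
        assume "u * v' = u' * v"
        then have "V = V'"
          using killing_same_point[OF c(1-3) cv w4, of s] \<tau>[OF m(1)] \<tau>[OF m(3)] m(2,4) uv uv' by metis
        with inj[of V Y s Y'] inF xy(2) e show False by simp
      qed
      from qform_two_roots_proportional[OF root[OF m(1,2) uv] uv(1) root[OF m(3,4) uv'] this]
      have "poly A s = 0" "poly B s = 0" "poly C s = 0" by (simp_all add: A_def B_def C_def)
      then have d: "[:- s, 1:] dvd A" "[:- s, 1:] dvd B" "[:- s, 1:] dvd C" by (simp_all add: poly_eq_0_iff_dvd)
      have "[:- s, 1:] ^ 2 dvd R"
        unfolding R_def power2_eq_square by (intro dvd_diff mult_dvd_mono d)
      then show ?thesis using R0 by (simp only: order_divides) simp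
    qed
    moreover have "card (F s) = 0 \<longleftrightarrow> F s = {}" using finF by simp
    ultimately show ?thesis using card2[of s] by (cases "F s = {}"; cases "card (F s) = 2") auto
  qed
  have "card T = (\<Sum>s\<in>(\<lambda>p. \<tau> (fst p)) ` T. card (F s))"
    using sum.image_gen[OF T(1), of "\<lambda>_. 1::nat" "\<lambda>p. \<tau> (fst p)"] by (simp add: F_def)
  also have "\<dots> \<le> (\<Sum>s\<in>(\<lambda>p. \<tau> (fst p)) ` T. Polynomial.order s R)"
    by (intro sum_mono order)
  also have "\<dots> \<le> (\<Sum>s | poly R s = 0. Polynomial.order s R)"
  proof (rule sum_mono2)
    show "finite {s. poly R s = 0}" by (rule poly_roots_finite[OF R0])
    show "(\<lambda>p. \<tau> (fst p)) ` T \<subseteq> {s. poly R s = 0}"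
    proof
      fix s assume "s \<in> (\<lambda>p. \<tau> (fst p)) ` T"
      then have "F s \<noteq> {}" by (auto simp: F_def)
      then have "card (F s) \<noteq> 0" using finF by simp
      then have "Polynomial.order s R \<noteq> 0" using order[of s] by linarith
      then show "s \<in> {s. poly R s = 0}" using R0 by (simp add: order_root)
    qed
  qed simp
  also have "\<dots> \<le> Polynomial.degree R" by (rule sum_order_le_degree[OF R0])
  finally show ?thesis using degR by linarith
qed

text \<open>Replacing \<open>a\<close> by \<open>a + \<mu> *s b\<close> changes neither the spans
  nor the links, but moves the finitely many solutions away from infinity.\<close>

lemma solutions_bound:
  assumes c: "dual_pt c a b" "dual_pt c' a' b'" "c' \<notin> vec.span {c}" "c' \<notin> vec.span {Fr c}"
    and T: "finite T" "\<And>V Y. (V, Y) \<in> T \<Longrightarrow> V \<in> curve \<and> Y \<in> curve \<and> linked a' b' V Y \<and>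
      linked (Fr a) (Fr b) (Fr ` V) Y"
  shows "card T \<le> 4 * q + 4"
proof -
  have "fst ` T \<subseteq> curve" using T(2) by (intro image_subsetI) (simp add: prod_eq_iff split_paired_all)
  then obtain \<mu> where \<mu>: "\<forall>V\<in>fst ` T. a + \<mu> *s b \<notin> perp V"
    using avoid_killing[OF c(1) finite_imageI[OF T(1)]] by blast
  have sp: "vec.span {Fr (a + \<mu> *s b), Fr b} = vec.span {Fr a, Fr b}"
    unfolding Fr_add Fr_scale by (rule shift_span)
  show ?thesis
  proof (rule solutions_bound_aux[OF dual_pt_shift[OF c(1)] c(2-4) T(1)])
    show "V \<in> curve \<and> Y \<in> curve \<and> linked a' b' V Y \<and> linked (Fr (a + \<mu> *s b)) (Fr b) (Fr ` V) Y"
      if "(V, Y) \<in> T" for V Y using T(2)[OF that] unfolding linked_def sp .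
    show "a + \<mu> *s b \<notin> perp V" if "(V, Y) \<in> T" for V Y using bspec[OF \<mu> imageI[OF that, of fst]] by simp
  qed
qed

lemma linked_sym: "linked a b V Y \<longleftrightarrow> linked a b Y V"
  by (auto simp: linked_def)

theorem smooth_contradiction: False
proof -
  obtain c a b where c: "dual_pt c a b" using dual_ex by blast
  have cs: "finite (selfconj a b)" "card (selfconj a b) = 2 * q + 2" using card_selfconj[OF c] .
  then have "selfconj a b \<noteq> {}" by auto
  then obtain V0 where V0: "V0 \<in> curve" by (auto simp: selfconj_def)
  \<comment> \<open>Since 2q + 2 exceeds 2, the curve has a member other than \<open>V0\<close> and
    its image.\<close>
  have "\<not> selfconj a b \<subseteq> {V0, Fr ` V0}"
  proof
    assume "selfconj a b \<subseteq> {V0, Fr ` V0}"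
    then have "card (selfconj a b) \<le> card {V0, Fr ` V0}" by (intro card_mono) auto
    also have "\<dots> \<le> 2" by (simp add: card_insert_if)
    finally show False using cs(2) q_ge_2 by simp
  qed
  then obtain Y0 where Y0: "Y0 \<in> curve" "Y0 \<noteq> V0" "Y0 \<noteq> Fr ` V0" by (auto simp: selfconj_def)
  obtain c2 a2 b2 where c2: "dual_pt c2 a2 b2" and k2: "a2 \<in> perp V0" "a2 \<in> perp Y0"
    by (rule dual_through_pair[OF V0 Y0(1) Y0(2)[symmetric]])
  obtain c0 a0 b0 where c0: "dual_pt c0 a0 b0" and k0: "a0 \<in> perp Y0" "a0 \<in> perp (Fr ` V0)"
    by (rule dual_through_pair[OF Y0(1) curve_Fr[OF V0] Y0(3)])
  obtain c4 a4 b4 where c4: "dual_pt c4 a4 b4" and f: "Fr c4 = c0" "Fr a4 = a0" "Fr b4 = b0"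
    by (rule obtain_preimage_dual[OF c0])
  have nz: "a2 \<noteq> 0" "a0 \<noteq> 0" using dim2D[OF dual_pt_dim[OF c2], of 1 0] dim2D[OF dual_pt_dim[OF c0], of 1 0]
    by auto
  have l2: "linked a2 b2 V0 Y0" using k2 nz unfolding linked_def by (metis insertCI vec.span_base)
  have l0: "linked a0 b0 (Fr ` V0) Y0" using k0 nz unfolding linked_def by (metis insertCI vec.span_base)
  have n0: "c2 \<notin> vec.span {Fr c4}" unfolding f
    by (rule linked_distinct[OF Y0(1) curve_Fr[OF V0] V0 Y0(3,2) curve_not_stable[OF V0] c0 c2])
      (use l0 l2 linked_sym in blast)+
  \<comment> \<open>Otherwise \<open>a4\<close> would kill \<open>Y0\<close> as well, and its image
    \<open>a0\<close> would kill the three distinct members \<open>Fr\<close>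
    V0\<open>,\<close>Y0\<open>and\<close>Fr \<open>Y0\<close>.\<close>
  have n4: "c2 \<notin> vec.span {c4}"
  proof
    assume "c2 \<in> vec.span {c4}"
    then have s: "vec.span {a2, b2} = vec.span {a4, b4}" by (rule same_span[OF c4 c2])
    have "a4 \<in> perp V0" using k0(2) unfolding f(2)[symmetric] perp_Fr .
    moreover have "a4 \<noteq> 0" using nz f(2) by auto
    ultimately have "a4 \<in> perp Y0"
      by (intro linked_trans[OF V0 c2 l2]) (auto simp: s vec.span_base)
    then have k: "a0 \<in> perp (Fr ` Y0)" unfolding f(2)[symmetric] perp_Fr .
    have "Fr ` V0 \<noteq> Fr ` Y0" using Y0(2) by (simp add: inj_image_eq_iff inj_def)
    with curve_at_most_two[OF curve_Fr[OF V0] Y0(1) curve_Fr[OF Y0(1)] c0 _ nz(2) k0(2,1) k]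
      Y0(3) curve_not_stable[OF Y0(1)] show False by (auto simp: vec.span_base)
  qed
  define T1 where "T1 = (\<lambda>V. (V, Fr ` V)) ` selfconj a2 b2"
  define T2 where "T2 = (\<lambda>V. (V, V)) ` selfconj a0 b0"
  define T where "T = insert (V0, Y0) (T1 \<union> T2)"
  have T1: "finite T1" "card T1 = 2 * q + 2"
    using card_selfconj[OF c2] unfolding T1_def by (auto simp: card_image inj_on_def)
  have T2: "finite T2" "card T2 = 2 * q + 2"
    using card_selfconj[OF c0] unfolding T2_def by (auto simp: card_image inj_on_def)
  have "T1 \<inter> T2 = {}"
  proof -
    have "Fr ` V \<noteq> V" if "V \<in> selfconj a2 b2" for V
      using that curve_not_stable by (simp add: selfconj_def)
    then show ?thesis unfolding T1_def T2_def by (simp add: disjoint_iff image_iff)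
  qed
  then have "card (T1 \<union> T2) = 4 * q + 4" using T1 T2 by (simp add: card_Un_disjoint)
  moreover have "(V0, Y0) \<notin> T1 \<union> T2" using Y0 by (auto simp: T1_def T2_def)
  ultimately have cT: "card T = 4 * q + 5" using T1 T2 by (simp add: T_def)
  have "card T \<le> 4 * q + 4"
  proof (rule solutions_bound[OF c4 c2 n4 n0])
    show "finite T" using T1 T2 by (simp add: T_def)
    fix V Y assume "(V, Y) \<in> T"
    then consider "V = V0" "Y = Y0" | "V \<in> selfconj a2 b2" "Y = Fr ` V" | "V \<in> selfconj a0 b0" "Y = V"
      unfolding T_def T1_def T2_def by blast
    then show "V \<in> curve \<and> Y \<in> curve \<and> linked a2 b2 V Y \<and> linked (Fr a4) (Fr b4) (Fr ` V) Y"
    proof cases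
      case 1
      then show ?thesis using V0 Y0 l2 l0 f by simp
    next
      case 2
      then have V: "V \<in> curve" "linked a2 b2 V (Fr ` V)" by (auto simp: selfconj_def linked_def)
      obtain w where "w \<in> vec.span {a0, b0}" "w \<noteq> 0" "w \<in> perp (Fr ` V)"
        by (rule functional_killing[OF c0 curve_Fr[OF V(1)]])
      then have "linked a0 b0 (Fr ` V) (Fr ` V)" unfolding linked_def by blast
      then show ?thesis using V 2 curve_Fr f by simp
    next
      case 3
      then have V: "V \<in> curve" "linked a0 b0 (Fr ` V) V" by (auto simp: selfconj_def linked_def)
      obtain w where "w \<in> vec.span {a2, b2}" "w \<noteq> 0" "w \<in> perp V"
        by (rule functional_killing[OF c2 V(1)])
      then have "linked a2 b2 V V" unfolding linked_def by blast
      then show ?thesis using V 3 f by simp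
    qed
  qed
  with cT show False by simp
qed

end

theorem (in alternating_system) pentagon:
  assumes "dual_pt c a b"
  obtains z g where "g \<in> {1, 2::nat}" "vec.dim ((\<lambda>i. (Fr ^^ i) z) ` {..<5}) = 5"
    "\<exists>k. (Fr ^^ 5) z = k *s z" "D z ((Fr ^^ g) z) = 0"
proof -
  have "\<exists>V c a b. incident V c a b"
  proof (rule ccontr)
    assume n: "\<not> (\<exists>V c a b. incident V c a b)"
    interpret smooth_system q D
      using n assms by unfold_locales blast+
    show False by (rule smooth_contradiction)
  qed
  then obtain V c a b where "incident V c a b" by blast
  from incident_pentagon[OF this] that show thesis by metis
qed

lemma sum_lessThan_5: "(\<Sum>i<5. f i) = f 0 + f 1 + f 2 + f 3 + f (4::nat)"
  by (simp add: eval_nat_numeral)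

section \<open>Frobenius powers and the embedding into the algebraic closure\<close>

locale additive_power =
  fixes q :: nat and T :: "'b::field itself"
  assumes q_pos: "0 < q" and power_add: "\<And>x y::'b. (x + y) ^ q = x ^ q + y ^ q"
begin

lemma power_sum: "(\<Sum>i\<in>A. f i) ^ q = (\<Sum>i\<in>A. f i ^ q)" for f :: "_ \<Rightarrow> 'b"
  by (induction A rule: infinite_finite_induct) (use q_pos in \<open>auto simp: power_add zero_power\<close>)

lemma power_minus: "(- x) ^ q = - (x ^ q)" for x :: 'b
  using power_add[of x "- x"] q_pos by (simp add: zero_power eq_neg_iff_add_eq_0 add.commute)

lemma power_diff: "(x - y) ^ q = x ^ q - y ^ q" for x y :: 'b
  using power_add[of x "- y"] by (simp add: power_minus)

lemma power_eq_iff: "x ^ q = y ^ q \<longleftrightarrow> x = y" for x y :: 'b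
  using power_diff[of x y] q_pos by auto

lemma frob_add: "frob q (x + y) = frob q x + frob q y"
  and frob_scale: "frob q (k *s x) = k ^ q *s frob q x"
  and frob_0 [simp]: "frob q 0 = 0" for x y :: "'b ^ 'n"
  using q_pos by (simp_all add: frob_def vec_eq_iff power_add power_mult_distrib zero_power)

lemma frob_eq_iff: "frob q x = frob q y \<longleftrightarrow> x = y" for x y :: "'b ^ 'n"
  by (simp add: frob_def vec_eq_iff power_eq_iff)

lemma dot_frob: "dot (frob q c) (frob q x) = dot c x ^ q" for c x :: "'b ^ 'n"
  by (simp add: scalar_product_def frob_def power_sum power_mult_distrib)

lemma wedge_frob: "wedge (frob q a) (frob q b) (frob q x) (frob q y) = wedge a b x y ^ q"
  for a b x y :: "'b ^ 'n"
  by (simp add: wedge_def dot_frob power_diff power_mult_distrib)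

end

lemma frob_frob: "frob m (frob n x) = frob (n * m) x"
  by (simp add: frob_def vec_eq_iff power_mult)

lemma frob_1 [simp]: "frob (Suc 0) x = x"
  by (simp add: frob_def vec_eq_iff)

lemma funpow_frob: "(frob q ^^ n) x = frob (q ^ n) x"
  by (induction n) (simp_all add: frob_frob, simp_all add: frob_def vec_eq_iff mult.commute)

definition emb :: "'a::field ^ 'n \<Rightarrow> 'a alg_closure ^ 'n" where
  "emb v = (\<chi> i. to_ac (v $ i))"

lemma emb_nth [simp]: "emb v $ i = to_ac (v $ i)" by (simp add: emb_def)

lemma emb_eq_iff [simp]: "emb u = emb v \<longleftrightarrow> u = v"
  by (simp add: vec_eq_iff)

lemma emb_add: "emb (u + v) = emb u + emb v" and emb_scale: "emb (k *s u) = to_ac k *s emb u"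
  and emb_0 [simp]: "emb 0 = 0"
  by (simp_all add: vec_eq_iff)

lemma dot_emb: "dot (emb u) (emb v) = to_ac (dot u v)"
  by (simp add: scalar_product_def to_ac_sum)

lemma wedge_emb: "wedge (emb a) (emb b) (emb x) (emb y) = to_ac (wedge a b x y)"
  by (simp add: wedge_def dot_emb)

lemma frob_emb: "frob n (emb v) = emb (frob n v)"
  by (simp add: frob_def vec_eq_iff)

section \<open>The field with q^5 elements\<close>

locale quintic =
  fixes q :: nat and T :: "'a::{field, finite} itself"
  assumes primepow_q: "primepow q" and card_field: "CARD('a) = q ^ 5"
begin

lemma q_eq_power_CHAR: "\<exists>n. q = CHAR('a) ^ n" "Factorial_Ring.prime CHAR('a)"
proof -
  obtain p k where p: "Factorial_Ring.prime p" "k > 0" "q = p ^ k" using primepow_q by (auto simp: primepow_def)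
  show pc: "Factorial_Ring.prime CHAR('a)" by (rule prime_CHAR_semidom) (simp add: finite_imp_CHAR_pos)
  have "CHAR('a) dvd q ^ 5" using CHAR_dvd_CARD[where 'a = 'a] card_field by simp
  then have "CHAR('a) dvd p" using pc p(3) by (metis prime_dvd_power)
  then have "CHAR('a) = p" using pc p(1) primes_dvd_imp_eq by blast
  with p(3) show "\<exists>n. q = CHAR('a) ^ n" by blast
qed

lemma q_ge2: "2 \<le> q"
  using primepow_gt_Suc_0[OF primepow_q] by simp

lemma CHAR_closure: "CHAR('a alg_closure) = CHAR('a)"
proof (rule CHAR_eqI)
  show "of_nat CHAR('a) = (0 :: 'a alg_closure)"
    by (metis of_nat_CHAR to_ac_0 to_ac_of_nat)
  show "CHAR('a) dvd n" if "of_nat n = (0 :: 'a alg_closure)" for n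
  proof -
    have "to_ac (of_nat n :: 'a) = 0" using that by simp
    then show ?thesis by (metis of_nat_eq_0_iff_char_dvd to_ac_eq_0_iff)
  qed
qed

lemma additive_a: "additive_power TYPE('a) (q ^ n)"
proof
  show "0 < q ^ n" using q_ge2 by simp
  obtain m where m: "q = CHAR('a) ^ m" using q_eq_power_CHAR by blast
  have "q ^ n = CHAR('a) ^ (m * n)" unfolding m by (simp add: power_mult)
  then show "(x + y) ^ (q ^ n) = x ^ (q ^ n) + y ^ (q ^ n)" for x y :: 'a
    using freshmans_dream'[OF q_eq_power_CHAR(2), of "q ^ n"] by blast
qed

lemma additive_closure: "additive_power TYPE('a alg_closure) q"
proof
  show "0 < q" using q_ge2 by simp
  obtain m where m: "q = CHAR('a alg_closure) ^ m" using q_eq_power_CHAR CHAR_closure by metis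
  have "Factorial_Ring.prime CHAR('a alg_closure)" using q_eq_power_CHAR(2) CHAR_closure by metis
  from freshmans_dream'[OF this m]
  show "(x + y) ^ q = x ^ q + y ^ q" for x y :: "'a alg_closure" .
qed

lemma of_nat_q: "of_nat q = (0 :: 'a alg_closure)"
proof -
  obtain m where m: "q = CHAR('a) ^ m" using q_eq_power_CHAR by blast
  then have "m \<noteq> 0" using q_ge2 by (cases m) auto
  then have "CHAR('a alg_closure) dvd q" unfolding m CHAR_closure by simp
  then show ?thesis by (simp add: of_nat_eq_0_iff_char_dvd)
qed

text \<open>Multiplication by a nonzero \<open>x\<close> permutes the nonzero elements; compare the
  products.\<close>

lemma power_q5: "x ^ (q ^ 5) = x" for x :: 'a
proof (cases "x = 0")
  case False
  have "(\<Prod>y\<in>UNIV - {0}. x * y) = (\<Prod>y\<in>UNIV - {0::'a}. y)"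
    by (rule prod.reindex_bij_witness[of _ "\<lambda>y. y / x" "\<lambda>y. x * y"]) (use False in auto)
  then have "x ^ (CARD('a) - 1) * (\<Prod>y\<in>UNIV - {0}. y) = (\<Prod>y\<in>UNIV - {0::'a}. y)"
    by (simp add: prod.distrib card_Diff_singleton)
  then have "x ^ (q ^ 5 - 1) = 1" by (simp add: card_field)
  then have "x ^ Suc (q ^ 5 - 1) = x" by simp
  then show ?thesis using q_ge2 by simp
qed (use q_ge2 in simp)

lemma frob_q5: "frob (q ^ 5) v = v" for v :: "'a ^ 'n"
  by (simp add: frob_def vec_eq_iff power_q5)

lemma frob_q_period: "frob (q ^ (n + 5)) v = frob (q ^ n) v" for v :: "'a ^ 'n"
  using frob_frob[of "q ^ n" "q ^ 5" v] by (simp add: frob_q5 power_add mult.commute)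

lemma frob_q_mod: "frob (q ^ (n mod 5)) v = frob (q ^ n) v" for v :: "'a ^ 'n"
proof (induction n rule: less_induct)
  case (less n)
  show ?case
  proof (cases "n < 5")
    case False
    then obtain m where "n = m + 5" by (metis add.commute le_Suc_ex not_less)
    then show ?thesis using less[of m] frob_q_period[of m v] by simp
  qed simp
qed

text \<open>The polynomial X^(q^5) - X has at most q^5 roots, and the embedded field already
  supplies that many.\<close>

lemma in_range_to_ac:
  fixes x :: "'a alg_closure"
  assumes "x ^ (q ^ 5) = x"
  obtains y where "x = to_ac y"
proof -
  define p :: "'a alg_closure poly" where "p = Polynomial.monom 1 (q ^ 5) - Polynomial.monom 1 1"
  have q5: "1 < q ^ 5" using q_ge2 by (intro one_less_power) auto
  have p0: "p \<noteq> 0"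
  proof
    assume "p = 0"
    then have "Polynomial.coeff p 1 = 0" by simp
    then show False using q_ge2 by (simp add: p_def)
  qed
  have "Polynomial.degree p \<le> q ^ 5"
    unfolding p_def by (intro degree_diff_le order.trans[OF degree_monom_le]) (use q5 in auto)
  then have "card {x. poly p x = 0} \<le> q ^ 5" using card_poly_roots_bound[OF p0] by linarith
  moreover have "card (range (to_ac :: 'a \<Rightarrow> _)) = q ^ 5"
    by (subst card_image) (auto simp: inj_def card_field)
  moreover have "range to_ac \<subseteq> {x. poly p x = 0}"
    by (auto simp: p_def poly_monom power_q5 simp flip: to_ac_power)
  ultimately have "range to_ac = {x. poly p x = 0}"
    using poly_roots_finite[OF p0] by (intro card_seteq) auto
  moreover have "x \<in> {x. poly p x = 0}" using assms by (simp add: p_def poly_monom)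
  ultimately show thesis using that by blast
qed

text \<open>X^q - X has derivative -1, hence q simple roots in the closure, and all of them come
  from the field with q^5 elements.\<close>

lemma card_Fq: "card (Fq q :: 'a set) = q"
proof -
  define p :: "'a alg_closure poly" where "p = Polynomial.monom 1 q - Polynomial.monom 1 1"
  have q1: "1 < q" using q_ge2 by simp
  have deg: "Polynomial.degree p = q"
  proof (rule antisym)
    show "Polynomial.degree p \<le> q"
      unfolding p_def by (intro degree_diff_le order.trans[OF degree_monom_le]) (use q1 in auto)
    show "q \<le> Polynomial.degree p" by (rule le_degree) (use q1 in \<open>simp add: p_def\<close>)
  qed
  then have p0: "p \<noteq> 0" using q1 by auto
  have "card {x. poly p x = 0} = q"
    unfolding deg[symmetric]
    by (rule card_simple_roots[OF _ p0]) (simp add: p_def pderiv_diff pderiv_monom of_nat_q poly_monom)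
  moreover have "{x. poly p x = 0} = to_ac ` Fq q"
  proof (intro equalityI subsetI)
    fix x assume "x \<in> {x. poly p x = 0}"
    then have x: "x ^ q = x" by (simp add: p_def poly_monom)
    have "x ^ (q ^ n) = x" for n by (induction n) (simp_all add: power_mult x)
    then obtain y where "x = to_ac y" by (rule in_range_to_ac)
    with x show "x \<in> to_ac ` Fq q" by (auto simp: Fq_def simp flip: to_ac_power)
  qed (auto simp: p_def poly_monom Fq_def simp flip: to_ac_power)
  ultimately show ?thesis by (simp add: card_image inj_on_def)
qed

text \<open>A Moore matrix. A functional that kills every \<open>r \<beta>\<close> is a polynomial
  of degree at most q^4 with q^5 zeros, hence zero. So five of the vectors \<open>r \<beta>\<close>
  form an invertible matrix, and the transposed matrix consists of the conjugates of
  \<open>m\<close>.\<close>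

lemma moore_basis: "\<exists>m :: 'a ^ 5. vec.dim ((\<lambda>i. (frob q ^^ i) (emb m)) ` {..<5}) = 5"
proof -
  \<comment> \<open>The index type 5 has no canonical exponents; \<open>h\<close> assigns 0, ..., 4
    to its elements.\<close>
  obtain h where h: "bij_betw h (UNIV :: 5 set) {..<5::nat}"
    using bij_betw_iff_card[of "UNIV :: 5 set" "{..<5::nat}"] by auto
  define r where "r \<beta> = (\<chi> k. to_ac \<beta> ^ (q ^ h k))" for \<beta> :: 'a
  have "perp (range r) = {0}"
  proof -
    have "c = 0" if c: "c \<in> perp (range r)" for c
    proof -
      define p where "p = (\<Sum>k\<in>UNIV. Polynomial.monom (c $ k) (q ^ h k))"
      have ev: "poly p (to_ac \<beta>) = 0" for \<beta>
      proof -
        have "poly p (to_ac \<beta>) = dot c (r \<beta>)"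
          by (simp add: p_def poly_sum poly_monom scalar_product_def r_def)
        then show ?thesis using c by (auto simp: perp_iff)
      qed
      have "h k < 5" for k using bij_betwE[OF h] by simp
      then have "h k \<le> 4" for k using less_Suc_eq_le[of "h k" 4] by simp
      then have "Polynomial.degree p \<le> q ^ 4"
        unfolding p_def using q_ge2
        by (intro degree_sum_le) (auto intro!: order.trans[OF degree_monom_le] power_increasing)
      have "p = 0"
      proof (rule ccontr)
        assume p0: "p \<noteq> 0"
        have "card (range (to_ac :: 'a \<Rightarrow> _)) \<le> card {x. poly p x = 0}"
          by (intro card_mono poly_roots_finite[OF p0]) (use ev in auto)
        also have "\<dots> \<le> q ^ 4" using card_poly_roots_bound[OF p0] \<open>Polynomial.degree p \<le> q ^ 4\<close> by linarith
        also have "card (range (to_ac :: 'a \<Rightarrow> _)) = q ^ 5"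
          by (subst card_image) (auto simp: inj_def card_field)
        finally show False using q_ge2 power_strict_increasing[of 4 5 q] by simp
      qed
      have "c $ k = 0" for k
      proof -
        have inj: "q ^ h l = q ^ h k \<longleftrightarrow> l = k" for l
          using h q_ge2 by (auto simp: bij_betw_def inj_def)
        have "Polynomial.coeff p (q ^ h k) = c $ k"
          by (simp add: p_def coeff_sum inj)
        with \<open>p = 0\<close> show ?thesis by simp
      qed
      then show "c = 0" by (simp add: vec_eq_iff)
    qed
    then show ?thesis by (auto simp: perp_iff)
  qed
  then have dr: "vec.dim (range r) = 5"
    using dim_perp[of "range r"] vec.dim_subset[of "range r" UNIV]
    by (simp add: vec_dim_card del: vec.dim_UNIV)
  obtain B where B: "B \<subseteq> range r" "vec.independent B" "range r \<subseteq> vec.span B" "card B = 5"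
    using vec.basis_exists[of "range r"] dr by metis
  have fB: "finite B" using B(4) card.infinite by fastforce
  have sB: "vec.span B = UNIV"
    by (rule vec.subspace_dim_equal)
      (use B vec.dim_eq_card_independent[OF B(2)] in \<open>simp_all add: vec_dim_card del: vec.dim_UNIV\<close>)
  have "\<exists>f. \<forall>b\<in>B. \<forall>b'\<in>B. dot (f b) b' = (if b = b' then 1 else 0)"
  proof (rule dual_basis[OF B(2) sB])
    fix f assume "\<And>b b'. b \<in> B \<Longrightarrow> b' \<in> B \<Longrightarrow> dot (f b) b' = (if b = b' then 1 else 0)"
    then show ?thesis by (intro exI[of _ f] ballI)
  qed
  then obtain f where f: "\<And>b b'. b \<in> B \<Longrightarrow> b' \<in> B \<Longrightarrow> dot (f b) b' = (if b = b' then 1 else 0)"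
    by blast
  obtain t where t: "bij_betw t (UNIV :: 5 set) B"
    using bij_betw_iff_card[of "UNIV :: 5 set" B] fB B(4) by auto
  have "\<forall>k. \<exists>\<beta>. t k = r \<beta>" using bij_betwE[OF t] B(1) by blast
  then obtain \<beta> where \<beta>: "\<And>k. t k = r (\<beta> k)" by metis
  define m where "m = (\<chi> k. \<beta> k)"
  let ?S = "(\<lambda>i. (frob q ^^ i) (emb m)) ` {..<5}"
  have "d = 0" if d: "d \<in> perp ?S" for d
  proof -
    \<comment> \<open>Transposition: a functional \<open>d\<close> that kills all conjugates of
      \<open>m\<close> is a linear relation among the five vectors \<open>t l\<close>.\<close>
    have z: "(\<Sum>l\<in>UNIV. d $ l *s t l) = 0"
    proof -
      have "(\<Sum>l\<in>UNIV. d $ l *s t l) $ k = dot d ((frob q ^^ h k) (emb m))" for k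
        by (simp add: \<beta> r_def scalar_product_def funpow_frob frob_def m_def)
      moreover have "h k < 5" for k using bij_betwE[OF h] by blast
      ultimately show ?thesis using d by (auto simp: vec_eq_iff perp_iff)
    qed
    have "d $ k = 0" for k
    proof -
      have tB: "t l \<in> B" for l using bij_betwE[OF t] by blast
      have inj: "t k = t l \<longleftrightarrow> k = l" for l using t by (auto simp: bij_betw_def inj_def)
      have "dot (f (t k)) (\<Sum>l\<in>UNIV. d $ l *s t l) = d $ k"
        by (simp add: dot_sum_right dot_simps f[OF tB tB] inj if_distrib cong: if_cong)
      with z show ?thesis by simp
    qed
    then show "d = 0" by (simp add: vec_eq_iff)
  qed
  then have "perp ?S = {0}" by (auto simp: perp_iff)
  then have "vec.dim ?S = 5" using dim_perp[of ?S] vec.dim_subset[of ?S UNIV]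
    by (simp add: vec_dim_card del: vec.dim_UNIV)
  then show ?thesis by blast
qed

end

lemma wedge_pluecker:
  "wedge a b x1 x2 * wedge a b x3 x4 - wedge a b x1 x3 * wedge a b x2 x4
    + wedge a b x1 x4 * wedge a b x2 x3 = 0"
  by (simp add: wedge_def algebra_simps)

lemma wedge_swap: "wedge a b y x = - wedge a b x y"
  and wedge_swap_left: "wedge b a x y = - wedge a b x y"
  and wedge_self: "wedge a b x x = 0"
  by (simp_all add: wedge_def algebra_simps)

text \<open>The left vector is the contraction of \<open>a \<and> b\<close> with \<open>x\<close>.
  It lies in \<open>span {a, b}\<close>, and this is how elements of that span are recognised in
  \<open>normal_form_step\<close>.\<close>

lemma dot_contract: "dot (dot a x *s b - dot b x *s a) y = wedge a b x y"
  by (simp add: dot_simps wedge_def algebra_simps)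

lemma contract_in_span: "dot a x *s b - dot b x *s a \<in> vec.span {a, b}" for a b :: "'b::field ^ 'n"
  unfolding in_span_2 by (intro exI[of _ "- dot b x"] exI[of _ "dot a x"]) simp

section \<open>From a scattered pair to a pentagon over the field with q^5 elements\<close>

context quintic
begin

abbreviation Ph :: "nat \<Rightarrow> 'a ^ 'n \<Rightarrow> 'a ^ 'n" where
  "Ph n v \<equiv> frob (q ^ n) v"

lemma Ph_add: "Ph m (Ph n v) = Ph (m + n) v" for v :: "'a ^ 'n"
  by (simp add: frob_frob power_add mult.commute)

lemma Ph_cong: "m mod 5 = n mod 5 \<Longrightarrow> Ph m v = Ph n v" for v :: "'a ^ 'n"
  using frob_q_mod[of m v] frob_q_mod[of n v] by simp

lemma Ph_0: "Ph 0 v = v" for v :: "'a ^ 'n"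
  by (simp add: frob_def vec_eq_iff)

text \<open>\<open>4 * n\<close> stands for -n modulo 5 here and below.\<close>

lemma Ph_inv: "Ph n (Ph (4 * n) v) = v" for v :: "'a ^ 'n"
proof -
  have "Ph (n + 4 * n) v = Ph 0 v" by (rule Ph_cong) simp
  then show ?thesis unfolding Ph_add Ph_0 .
qed

lemmas Ph_linear = additive_power.frob_add[OF additive_a] additive_power.frob_scale[OF additive_a]

lemma dot_Ph: "dot (Ph n c) (Ph n x) = dot c x ^ (q ^ n)" for c x :: "'a ^ 'n"
  by (rule additive_power.dot_frob[OF additive_a])

lemma wedge_Ph: "wedge (Ph n a) (Ph n b) (Ph n x) (Ph n y) = wedge a b x y ^ (q ^ n)"
  for a b x y :: "'a ^ 'n"
  by (rule additive_power.wedge_frob[OF additive_a])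

definition scattered :: "'a ^ 5 \<Rightarrow> 'a ^ 5 \<Rightarrow> bool" where
  "scattered a b \<longleftrightarrow> (\<forall>u v. (\<forall>i. u $ i \<in> Fq q) \<longrightarrow> (\<forall>i. v $ i \<in> Fq q) \<longrightarrow>
    wedge a b u v = 0 \<longrightarrow> vec.dim {u, v} \<noteq> 2)"

lemma rational_emb:
  fixes x :: "'a alg_closure ^ 5"
  assumes "frob q x = x"
  obtains u :: "'a ^ 5" where "x = emb u" "\<forall>i. u $ i \<in> Fq q"
proof -
  have x: "x $ i ^ q = x $ i" for i using assms by (simp add: frob_def vec_eq_iff)
  have "(x $ i) ^ (q ^ n) = x $ i" for i n by (induction n) (simp_all add: power_mult x)
  then have "\<forall>i. \<exists>y. x $ i = to_ac y" using in_range_to_ac by metis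
  then obtain u where u: "\<And>i. x $ i = to_ac (u i)" by metis
  show thesis
  proof (rule that[of "\<chi> i. u i"])
    show "x = emb (\<chi> i. u i)" by (simp add: vec_eq_iff u)
    show "\<forall>i. (\<chi> i. u i) $ i \<in> Fq q"
      using x by (simp add: Fq_def u flip: to_ac_power)
  qed
qed

text \<open>\<open>D\<close> lists the conjugates of \<open>a \<and> b\<close> in the basis of
  conjugates of \<open>m\<close>; Frobenius shifts both lists cyclically. The pentagon of this
  system, rescaled, has coordinates in the field with q^5 elements. The independence of the
  conjugates of \<open>a \<and> b\<close> is \<open>form_nondegenerate\<close>.\<close>

lemma pentagon_and_independence:
  fixes a b :: "'a ^ 5"
  assumes "scattered a b"
  shows "(\<exists>z g. g \<in> {1, 2::nat} \<and> vec.dim ((\<lambda>i. Ph i z) ` {..<5}) = 5 \<and>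
      (\<forall>i. wedge a b (Ph i z) (Ph (i + g) z) = 0)) \<and>
    (\<forall>\<kappa>. (\<exists>i<5. \<kappa> i \<noteq> 0) \<longrightarrow> (\<exists>x y. (\<Sum>i<5. \<kappa> i * wedge (Ph i a) (Ph i b) x y) \<noteq> 0))"
proof -
  obtain m :: "'a ^ 5" where m: "vec.dim ((\<lambda>i. (frob q ^^ i) (emb m)) ` {..<5}) = 5"
    using moore_basis by blast
  have fp: "(frob q ^^ i) (emb v) = emb (Ph i v)" for i and v :: "'a ^ 5"
    by (simp add: funpow_frob frob_emb)
  have m': "vec.dim ((\<lambda>i. emb (Ph i m)) ` {..<5}) = 5" using m by (simp add: fp)
  from family_dual_basis_ex[OF m'] obtain e where
    e: "\<forall>i<5. \<forall>j<5. dot (e i) (emb (Ph j m)) = (if i = j then 1 else 0)" by blast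
  define W where "W i x y = wedge (emb (Ph i a)) (emb (Ph i b)) x y" for i x y
  define D where "D x y = (\<Sum>i<5. W i x y *s emb (Ph i m))" for x y
  interpret AC: additive_power q "TYPE('a alg_closure)" by (rule additive_closure)
  have frS: "frob q (emb (Ph i v)) = emb (Ph (Suc i) v)" for i and v :: "'a ^ 5"
    by (simp add: frob_emb frob_frob mult.commute)
  have W5: "W 5 = W 0" by (intro ext) (simp add: W_def frob_q5)
  have m5: "emb (Ph 5 m) = emb (Ph 0 m)" by (simp add: frob_q5)
  have Wfr: "W (Suc i) (frob q x) (frob q y) = W i x y ^ q" for i x y
    unfolding W_def by (simp only: frS[symmetric] AC.wedge_frob)
  have W_lin: "W i (x + y) z = W i x z + W i y z" "W i (k *s x) z = k * W i x z"
    "W i z (x + y) = W i z x + W i z y" "W i z (k *s x) = k * W i z x" "W i x x = 0" for i x y z k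
    by (simp_all add: W_def wedge_def dot_simps algebra_simps)
  have eD: "dot (e i) (D x y) = W i x y" if "i < 5" for i x y
  proof -
    have "dot (e i) (D x y) = (\<Sum>j<5. W j x y * dot (e i) (emb (Ph j m)))"
      unfolding D_def by (simp add: dot_sum_right dot_simps)
    also have "\<dots> = (\<Sum>j<5. if j = i then W i x y else 0)"
      using that e by (intro sum.cong) auto
    finally show ?thesis using that by simp
  qed
  interpret A: alternating_system q D
  proof
    show "2 \<le> q" by (rule q_ge2)
    show "of_nat q = (0 :: 'a alg_closure)" by (rule of_nat_q)
    show "(x + y) ^ q = x ^ q + y ^ q" for x y :: "'a alg_closure" by (rule AC.power_add)
    show "D (x + y) z = D x z + D y z" "D z (x + y) = D z x + D z y" for x y z
      by (simp_all add: D_def W_lin vec.scale_left_distrib sum.distrib)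
    show "D (k *s x) z = k *s D x z" "D z (k *s x) = k *s D z x" for k x z
      by (simp_all add: D_def W_lin vec.scale_sum_right vector_smult_assoc)
    show "D x x = 0" for x by (simp add: D_def W_lin)
    show "D (frob q x) (frob q y) = frob q (D x y)" for x y
    proof -
      let ?t = "\<lambda>i. W i (frob q x) (frob q y) *s emb (Ph i m)"
      have t: "frob q (W i x y *s emb (Ph i m)) = ?t (Suc i)" for i
        by (simp only: AC.frob_scale frS Wfr)
      have "frob q (D x y) = ?t (Suc 0) + ?t (Suc 1) + ?t (Suc 2) + ?t (Suc 3) + ?t (Suc 4)"
        unfolding D_def sum_lessThan_5 AC.frob_add t ..
      also have "\<dots> = ?t 1 + ?t 2 + ?t 3 + ?t 4 + ?t 5" by (simp add: eval_nat_numeral)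
      also have "?t 5 = ?t 0" by (simp only: W5 m5)
      also have "?t 1 + ?t 2 + ?t 3 + ?t 4 + ?t 0 = D (frob q x) (frob q y)"
        unfolding D_def sum_lessThan_5 by (simp only: ac_simps)
      finally show ?thesis ..
    qed
    show "vec.dim {x, y} \<noteq> 2" if xy: "frob q x = x" "frob q y = y" "D x y = 0" for x y
    proof
      assume d: "vec.dim {x, y} = 2"
      obtain u :: "'a ^ 5" where u: "x = emb u" "\<forall>i. u $ i \<in> Fq q" by (rule rational_emb[OF xy(1)])
      obtain v :: "'a ^ 5" where v: "y = emb v" "\<forall>i. v $ i \<in> Fq q" by (rule rational_emb[OF xy(2)])
      have "W 0 x y = 0" using eD[of 0 x y] xy(3) by simp
      then have "wedge a b u v = 0"
        by (simp only: W_def u(1) v(1) wedge_emb Ph_0 to_ac_eq_0_iff)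
      then have "vec.dim {u, v} \<noteq> 2" using assms u(2) v(2) unfolding scattered_def by blast
      moreover have "vec.dim {u, v} = 2"
        unfolding dim2_iff
      proof (intro allI impI)
        fix r s assume "r *s u + s *s v = 0"
        then have "emb (r *s u + s *s v) = 0" by simp
        then have "to_ac r *s x + to_ac s *s y = 0" by (simp add: emb_add emb_scale u v)
        from dim2D[OF d this] show "r = 0 \<and> s = 0" by simp
      qed
      ultimately show False ..
    qed
  qed
  have "dot (e 0) (emb (Ph 0 m)) = 1" using e[rule_format, of 0 0] by simp
  then have "e 0 \<noteq> 0" by auto
  then have dual: "A.dual_pt (e 0) (emb a) (emb b)"
    unfolding A.dual_pt_def A.form_def by (simp add: eD W_def)
  obtain z g where g: "g \<in> {1, 2::nat}" and z5: "vec.dim ((\<lambda>i. (frob q ^^ i) z) ` {..<5}) = 5"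
    and zk: "\<exists>k. (frob q ^^ 5) z = k *s z" and zD: "D z ((frob q ^^ g) z) = 0"
    by (rule A.pentagon[OF dual])
  obtain k where k: "(frob q ^^ 5) z = k *s z" using zk by blast
  have "z \<noteq> 0"
  proof
    assume z: "z = 0"
    have "(frob q ^^ i) z = 0" for i by (induction i) (simp_all add: z)
    then have "vec.dim ((\<lambda>i. (frob q ^^ i) z) ` {..<5}) \<le> vec.dim {0 :: 'a alg_closure ^ 5}"
      by (intro vec.dim_subset) auto
    then show False using z5 by simp
  qed
  have kz: "frob (q ^ 5) z = k *s z" using k by (simp add: funpow_frob)
  have "k \<noteq> 0"
  proof
    assume "k = 0"
    then have "frob (q ^ 5) z = 0" using kz by simp
    then have "z = 0" by (simp add: frob_def vec_eq_iff)
    with \<open>z \<noteq> 0\<close> show False ..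
  qed
  have q5: "0 < q ^ 5 - 1" using q_ge2 one_less_power[of q 5] by simp
  \<comment> \<open>Solves \<open>\<mu> ^ (q ^ 5) * k = \<mu>\<close>, so that
    \<open>\<mu> *s z\<close> is fixed by the fifth power of Frobenius and descends.\<close>
  obtain \<mu> where \<mu>: "\<mu> ^ (q ^ 5 - 1) = inverse k" using nth_root_exists[OF q5] by blast
  have \<mu>0: "\<mu> \<noteq> 0" using \<mu> \<open>k \<noteq> 0\<close> q5 by (auto simp: zero_power)
  have \<mu>k: "\<mu> ^ (q ^ 5) * k = \<mu>"
  proof -
    have "\<mu> ^ (q ^ 5) = \<mu> ^ Suc (q ^ 5 - 1)" using q_ge2 by simp
    also have "\<dots> = \<mu> * inverse k" by (simp only: power_Suc \<mu>)
    finally show ?thesis using \<open>k \<noteq> 0\<close> by simp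
  qed
  have z'5: "frob (q ^ 5) (\<mu> *s z) = \<mu> *s z"
  proof -
    have "frob (q ^ 5) (\<mu> *s z) = \<mu> ^ (q ^ 5) *s frob (q ^ 5) z"
      by (simp add: frob_def vec_eq_iff power_mult_distrib)
    then show ?thesis by (simp add: kz vector_smult_assoc \<mu>k)
  qed
  have "\<forall>i. \<exists>y. (\<mu> *s z) $ i = to_ac y"
  proof
    fix i
    have "(\<mu> *s z) $ i ^ (q ^ 5) = (\<mu> *s z) $ i" using z'5 by (simp add: frob_def vec_eq_iff)
    then show "\<exists>y. (\<mu> *s z) $ i = to_ac y" using in_range_to_ac by metis
  qed
  then obtain y' where y': "\<And>i. (\<mu> *s z) $ i = to_ac (y' i)" by metis
  define y where "y = (\<chi> i. y' i)"
  have y: "emb y = \<mu> *s z" using y' by (simp add: vec_eq_iff y_def)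
  have fz: "(frob q ^^ i) (\<mu> *s z) = \<mu> ^ (q ^ i) *s (frob q ^^ i) z" for i
    by (simp add: funpow_frob) (simp add: frob_def vec_eq_iff power_mult_distrib)
  have 1: "vec.dim ((\<lambda>i. Ph i y) ` {..<5}) = 5"
  proof -
    let ?S = "(\<lambda>i. Ph i y) ` {..<5}" and ?Z = "(\<lambda>i. (frob q ^^ i) z) ` {..<5}"
    have "vec.dim (perp ?Z) = 0" unfolding dim_perp z5 by simp
    then have pz: "perp ?Z \<subseteq> {0}" by (simp add: vec.dim_eq_0)
    have "d = 0" if d: "d \<in> perp ?S" for d
    proof -
      have "dot (emb d) ((frob q ^^ i) z) = 0" if "i < 5" for i
      proof -
        have "dot d (Ph i y) = 0" using d that by (simp add: perp_iff)
        then have "dot (emb d) ((frob q ^^ i) (emb y)) = 0" by (simp add: fp dot_emb)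
        then show ?thesis using \<mu>0 by (simp add: y fz dot_simps)
      qed
      then have "emb d \<in> perp ?Z" by (simp add: perp_iff)
      then have "emb d = emb 0" using pz by auto
      then show ?thesis by (simp only: emb_eq_iff)
    qed
    then have "perp ?S = {0}" by (auto simp: perp_iff)
    then show ?thesis using dim_perp[of ?S] vec.dim_subset[of ?S UNIV]
      by (simp add: vec_dim_card del: vec.dim_UNIV)
  qed
  have "D (emb y) (emb (Ph g y)) = 0"
    unfolding fp[symmetric] y fz by (simp only: A.D_scale_left A.D_scale_right zD vec.scale_zero_right)
  then have Wy: "W i (emb y) (emb (Ph g y)) = 0" if "i < 5" for i
    using eD[OF that, of "emb y" "emb (Ph g y)"] by simp
  have 2: "wedge a b (Ph j y) (Ph (j + g) y) = 0" for j
  proof -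
    \<comment> \<open>\<open>i\<close> is -j modulo 5: conjugate number \<open>i\<close> of
      \<open>a \<and> b\<close> vanishes at \<open>y\<close> and \<open>Ph g y\<close>, and applying
      \<open>Ph j\<close> brings it back to \<open>a \<and> b\<close> at the vertices j and j +
      g.\<close>
    define i where "i = (4 * j) mod 5"
    have "i < 5" by (simp add: i_def)
    from Wy[OF this] have "wedge (Ph i a) (Ph i b) y (Ph g y) = 0" by (simp add: W_def wedge_emb)
    then have "wedge (Ph j (Ph i a)) (Ph j (Ph i b)) (Ph j y) (Ph j (Ph g y)) = 0"
      unfolding wedge_Ph using q_ge2 by (simp add: zero_power)
    moreover have "Ph j (Ph i v) = v" for v :: "'a ^ 5"
      using Ph_inv[of j v] frob_q_mod[of "4 * j" v] by (simp add: i_def)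
    ultimately show ?thesis by (simp add: Ph_add)
  qed
  have 3: "\<exists>x y. (\<Sum>i<5. \<kappa> i * wedge (Ph i a) (Ph i b) x y) \<noteq> 0" if \<kappa>: "\<exists>i<5. \<kappa> i \<noteq> 0" for \<kappa>
  proof (rule ccontr)
    assume n: "\<not> (\<exists>x y. (\<Sum>i<5. \<kappa> i * wedge (Ph i a) (Ph i b) x y) \<noteq> 0)"
    obtain i0 where i0: "i0 < 5" "\<kappa> i0 \<noteq> 0" using \<kappa> by blast
    define c where "c = (\<Sum>i<5. to_ac (\<kappa> i) *s e i)"
    have "dot c (emb (Ph i0 m)) = (\<Sum>i<5. to_ac (\<kappa> i) * dot (e i) (emb (Ph i0 m)))"
      by (simp add: c_def dot_sum_left dot_simps)
    also have "\<dots> = (\<Sum>i<5. if i = i0 then to_ac (\<kappa> i0) else 0)"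
      using i0(1) e by (intro sum.cong) auto
    finally have "dot c (emb (Ph i0 m)) = to_ac (\<kappa> i0)" using i0(1) by simp
    then have "c \<noteq> 0" using i0(2) by auto
    have fc: "A.form c x y = (\<Sum>i<5. to_ac (\<kappa> i) * W i x y)" for x y
      unfolding A.form_def c_def by (simp add: dot_sum_left dot_simps eD)
    have "A.form c (emb x) (emb y) = 0" for x y
    proof -
      have "A.form c (emb x) (emb y) = to_ac (\<Sum>i<5. \<kappa> i * wedge (Ph i a) (Ph i b) x y)"
        by (simp add: fc W_def wedge_emb to_ac_sum)
      then show ?thesis using n by simp
    qed
    moreover have ax: "emb (axis l 1) = axis l 1" for l by (simp add: vec_eq_iff axis_def)
    ultimately have 0: "A.form c (axis k 1) (axis l 1) = 0" for k l by metis
    have "A.fnl c (axis k 1) = 0" for k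
      using 0 by (simp add: vec_eq_iff A.dot_fnl flip: dot_axis)
    then have 1: "A.form c (axis k 1) y = 0" for k y by (metis A.dot_fnl dot_zero_left)
    have "A.form c y (axis k 1) = 0" for k y using 1 A.form_swap[of c y "axis k 1"] by simp
    then have "A.fnl c y = 0" for y by (simp add: vec_eq_iff A.dot_fnl flip: dot_axis)
    then have "A.form c x y = 0" for x y by (metis A.dot_fnl dot_zero_left)
    with A.form_nondegenerate[OF \<open>c \<noteq> 0\<close>] show False by blast
  qed
  show ?thesis using g 1 2 3 by blast
qed

end

section \<open>The normal form of a scattered pair\<close>

context quintic
begin

lemma mod5_add: "(m + x) mod 5 = (m + y) mod 5 \<longleftrightarrow> x mod 5 = y mod (5::nat)"
  using cong_add_lcancel_nat[of m x y 5] by (simp add: cong_def)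

text \<open>The dual basis of an orbit is again an orbit: the conjugates of its first vector have
  the required products with the conjugates of \<open>z\<close>.\<close>

lemma biorthogonal_orbit:
  fixes z :: "'a ^ 5"
  assumes "vec.dim ((\<lambda>i. Ph i z) ` {..<5}) = 5"
  obtains f where "\<And>i j. dot (Ph i f) (Ph j z) = (if i mod 5 = j mod 5 then 1 else 0)"
    and "\<And>c c'. (\<And>j. dot c (Ph j z) = dot c' (Ph j z)) \<Longrightarrow> c = c'"
proof -
  from family_dual_basis_ex[OF assms] obtain e where
    e: "\<forall>i<5. \<forall>j<5. dot (e i) (Ph j z) = (if i = j then 1 else 0)"
    and ex: "\<forall>c. c = (\<Sum>i<5. dot c (Ph i z) *s e i)" by blast
  have e0: "dot (e 0) (Ph j z) = (if j mod 5 = 0 then 1 else 0)" for j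
  proof -
    have "dot (e 0) (Ph (j mod 5) z) = (if j mod 5 = 0 then 1 else 0)"
      using e[rule_format, of 0 "j mod 5"] by (auto split: if_splits)
    then show ?thesis unfolding frob_q_mod .
  qed
  show thesis
  proof (rule that[of "e 0"])
    fix i j
    have "Ph j z = Ph i (Ph (4 * i) (Ph j z))" by (simp only: Ph_inv)
    also have "\<dots> = Ph i (Ph (4 * i + j) z)" by (simp only: Ph_add)
    finally have "dot (Ph i (e 0)) (Ph j z) = dot (e 0) (Ph (4 * i + j) z) ^ (q ^ i)"
      by (metis dot_Ph)
    also have "\<dots> = (if (4 * i + j) mod 5 = 0 then 1 else 0)"
      using q_ge2 by (simp add: e0 zero_power)
    also have "(4 * i + j) mod 5 = 0 \<longleftrightarrow> i mod 5 = j mod 5"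
    proof -
      have "(4 * i + i) mod 5 = 0" by simp
      with mod5_add[of "4 * i" i j] show ?thesis by argo
    qed
    finally show "dot (Ph i (e 0)) (Ph j z) = (if i mod 5 = j mod 5 then 1 else 0)" .
  next
    fix c c' assume "\<And>j. dot c (Ph j z) = dot c' (Ph j z)"
    then have "(\<Sum>i<5. dot c (Ph i z) *s e i) = (\<Sum>i<5. dot c' (Ph i z) *s e i)" by simp
    then show "c = c'" using ex[rule_format, of c] ex[rule_format, of c'] by simp
  qed
qed

lemma step_inj:
  assumes "t \<in> {1, 2::nat}" "r < 5" "r' < 5"
  shows "(m + r * t) mod 5 = (m + r' * t) mod 5 \<longleftrightarrow> r = r'"
proof -
  have "r \<in> {0, 1, 2, 3, 4}" "r' \<in> {0, 1, 2, 3, 4}" using assms by auto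
  then show ?thesis using assms(1) unfolding mod5_add by auto
qed

lemma step_cover:
  assumes "t \<in> {1, 2::nat}"
  shows "\<exists>r<5. (m + r * t) mod 5 = j mod 5"
proof (cases "t = 1")
  case True
  have "(m + (j + 4 * m) mod 5) mod 5 = (j + 5 * m) mod 5" by (simp add: mod_simps algebra_simps)
  then show ?thesis using True by (intro exI[of _ "(j + 4 * m) mod 5"]) simp
next
  case False
  then have t: "t = 2" using assms by simp
  \<comment> \<open>\<open>3\<close> inverts 2 modulo 5 and \<open>12\<close> is -3, so
    \<open>3 * j + 12 * m\<close> represents (j - m) / 2.\<close>
  have "(m + (3 * j + 12 * m) mod 5 * 2) mod 5 = (m + (3 * j + 12 * m) * 2) mod 5"
    by (metis mod_add_right_eq mod_mult_left_eq)
  also have "m + (3 * j + 12 * m) * 2 = j + 5 * (j + 5 * m)" by (simp add: algebra_simps)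
  also have "(j + 5 * (j + 5 * m)) mod 5 = j mod 5" by (rule mod_mult_self2)
  finally show ?thesis unfolding t by (intro exI[of _ "(3 * j + 12 * m) mod 5"] conjI) simp_all
qed

lemma N5_orbit:
  fixes x :: 'a
  assumes "t \<in> {1, 2::nat}"
  shows "(\<Prod>r<5. x ^ (q ^ (r * t))) = N5 q x"
proof -
  have p: "x ^ (q ^ (n + 5)) = x ^ (q ^ n)" for n
    using power_q5[of "x ^ (q ^ n)"] by (simp add: power_add flip: power_mult)
  have p68: "x ^ (q ^ 6) = x ^ q" "x ^ (q ^ 8) = x ^ (q ^ 3)" using p[of 1] p[of 3] by simp_all
  have "(\<Prod>r<5. f r) = f 0 * f 1 * f 2 * f 3 * f (4::nat)" for f :: "nat \<Rightarrow> 'a"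
    by (simp add: eval_nat_numeral)
  then show ?thesis using assms by (auto simp: N5_def power_add p68 mult_ac)
qed

lemma independence_step:
  fixes a b :: "'a ^ 5"
  assumes "scattered a b" "t \<in> {1, 2::nat}" "\<exists>r<5. \<kappa> r \<noteq> 0"
  shows "\<exists>x y. (\<Sum>r<5. \<kappa> r * wedge (Ph (r * t) a) (Ph (r * t) b) x y) \<noteq> 0"
proof -
  have ind: "\<exists>x y. (\<Sum>i<5. \<kappa> i * wedge (Ph i a) (Ph i b) x y) \<noteq> 0" if "\<exists>i<5. \<kappa> i \<noteq> 0" for \<kappa>
    using pentagon_and_independence[OF assms(1)] that by blast
  show ?thesis
  proof (cases "t = 1")
    case True
    then show ?thesis using ind[OF assms(3)] by simp
  next
    case False
    then have t: "t = 2" using assms(2) by simp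
    define \<kappa>' where "\<kappa>' i = \<kappa> ((3 * i) mod 5)" for i
    obtain r where r: "r < 5" "\<kappa> r \<noteq> 0" using assms(3) by blast
    have "r \<in> {0, 1, 2, 3, 4}" using r(1) by auto
    then have "(3 * ((2 * r) mod 5)) mod 5 = r" by auto
    then have "\<kappa>' ((2 * r) mod 5) \<noteq> 0" using r(2) by (simp add: \<kappa>'_def)
    then obtain x y where xy: "(\<Sum>i<5. \<kappa>' i * wedge (Ph i a) (Ph i b) x y) \<noteq> 0"
      using ind[of \<kappa>'] by (metis mod_less_divisor zero_less_numeral)
    have P: "Ph 6 v = Ph 1 v" "Ph 8 v = Ph 3 v" for v :: "'a ^ 5" by (rule Ph_cong, simp)+
    have "(\<Sum>i<5. \<kappa>' i * wedge (Ph i a) (Ph i b) x y)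
        = (\<Sum>r<5. \<kappa> r * wedge (Ph (r * t) a) (Ph (r * t) b) x y)"
    proof -
      have n: "(0::nat) * 2 = 0" "(1::nat) * 2 = 2" "(2::nat) * 2 = 4" "(3::nat) * 2 = 6" "(4::nat) * 2 = 8"
        by simp_all
      have "\<kappa>' 0 = \<kappa> 0" "\<kappa>' 1 = \<kappa> 3" "\<kappa>' 2 = \<kappa> 1" "\<kappa>' 3 = \<kappa> 4" "\<kappa>' 4 = \<kappa> 2" by (simp_all add: \<kappa>'_def)
      then show ?thesis unfolding sum_lessThan_5 t n P by (simp only: ac_simps)
    qed
    with xy show ?thesis by metis
  qed
qed

lemma wedge_nonzero:
  fixes a b :: "'a ^ 5"
  assumes "scattered a b"
  shows "\<exists>x y. wedge a b x y \<noteq> 0"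
proof -
  define \<kappa> :: "nat \<Rightarrow> 'a" where "\<kappa> i = (if i = 0 then 1 else 0)" for i
  have "\<exists>i<5. \<kappa> i \<noteq> 0" by (intro exI[of _ 0]) (simp add: \<kappa>_def)
  then obtain x y where "(\<Sum>r<5. \<kappa> r * wedge (Ph (r * 1) a) (Ph (r * 1) b) x y) \<noteq> 0"
    using independence_step[OF assms, of 1 \<kappa>] by auto
  then show ?thesis by (intro exI[of _ x] exI[of _ y]) (simp add: sum_lessThan_5 \<kappa>_def)
qed

text \<open>On the pentagon only the five values \<open>\<eta> i\<close> on the edges from i to i +
  t can be nonzero, and the Pluecker relation gives
  \<open>\<eta> i * \<eta> (i + 2 * t) = 0\<close>. Hence at most two edges survive, and two
  surviving edges share a vertex \<open>m\<close>. So \<open>a \<and> b\<close> is the dual vector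
  at \<open>m\<close> wedged with a combination of those at its neighbours m + t and m - t.\<close>

lemma normal_form_step:
  fixes a b z :: "'a ^ 5"
  assumes sc: "scattered a b" and z: "vec.dim ((\<lambda>i. Ph i z) ` {..<5}) = 5" and t: "t \<in> {1, 2::nat}"
    and Z2: "\<And>i. wedge a b (Ph i z) (Ph (i + 2 * t) z) = 0"
    and Z3: "\<And>i. wedge a b (Ph i z) (Ph (i + 3 * t) z) = 0"
  obtains f \<gamma> \<gamma>' where "vec.dim ((\<lambda>i. Ph i f) ` {..<5}) = 5" "\<gamma> \<noteq> 0 \<or> \<gamma>' \<noteq> 0"
    "vec.span {a, b} = vec.span {f, \<gamma> *s Ph t f + \<gamma>' *s Ph (4 * t) f}"
proof -
  obtain f0 where f0: "\<And>i j. dot (Ph i f0) (Ph j z) = (if i mod 5 = j mod 5 then 1 else 0)"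
    and ext: "\<And>c c'. (\<And>j. dot c (Ph j z) = dot c' (Ph j z)) \<Longrightarrow> c = c'"
    using biorthogonal_orbit[OF z] by metis
  define \<omega> where "\<omega> i j = wedge a b (Ph i z) (Ph j z)" for i j
  define \<eta> where "\<eta> i = \<omega> i (i + t)" for i
  have cong: "\<omega> i j = \<omega> i' j'" if "i mod 5 = i' mod 5" "j mod 5 = j' mod 5" for i j i' j'
    unfolding \<omega>_def using Ph_cong[OF that(1), of z] Ph_cong[OF that(2), of z] by simp
  have swap: "\<omega> i j = - \<omega> j i" for i j unfolding \<omega>_def by (rule wedge_swap)
  have \<omega>0: "\<omega> i i = 0" for i by (simp add: \<omega>_def wedge_self)
  have Z: "\<omega> i (i + 2 * t) = 0" "\<omega> i (i + 3 * t) = 0" for i using Z2 Z3 by (simp_all add: \<omega>_def)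
  have \<omega>4: "\<omega> i (i + 4 * t) = - \<eta> (i + 4 * t)" for i
  proof -
    have "\<omega> (i + 4 * t) (i + 4 * t + t) = \<omega> (i + 4 * t) i" by (rule cong) presburger+
    then show ?thesis unfolding \<eta>_def using swap[of i "i + 4 * t"] by simp
  qed
  have \<eta>_cong: "\<eta> i = \<eta> j" if "i mod 5 = j mod 5" for i j
    unfolding \<eta>_def by (rule cong) (rule that, rule mod_add_cong[OF that refl])
  have pl: "\<eta> i * \<eta> (i + 2 * t) = 0" for i
    using wedge_pluecker[of a b "Ph i z" "Ph (i + t) z" "Ph (i + 2 * t) z" "Ph (i + 3 * t) z"]
      Z2[of i] Z3[of i] by (simp add: \<eta>_def \<omega>_def algebra_simps)
  have ext5: "c = c'"
    if "dot c (Ph (m + 0 * t) z) = dot c' (Ph (m + 0 * t) z)" "dot c (Ph (m + 1 * t) z) = dot c' (Ph (m + 1 * t) z)"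
      "dot c (Ph (m + 2 * t) z) = dot c' (Ph (m + 2 * t) z)" "dot c (Ph (m + 3 * t) z) = dot c' (Ph (m + 3 * t) z)"
      "dot c (Ph (m + 4 * t) z) = dot c' (Ph (m + 4 * t) z)" for c c' m
  proof (rule ext)
    fix j
    obtain r where r: "r < 5" "(m + r * t) mod 5 = j mod 5" using step_cover[OF t] by blast
    have "Ph j z = Ph (m + r * t) z" by (rule Ph_cong) (simp add: r)
    moreover have "r \<in> {0, 1, 2, 3, 4}" using r(1) by auto
    ultimately show "dot c (Ph j z) = dot c' (Ph j z)" using that by auto
  qed
  define ct where "ct i = dot a (Ph i z) *s b - dot b (Ph i z) *s a" for i
  have ct: "dot (ct i) (Ph j z) = \<omega> i j" for i j unfolding ct_def \<omega>_def by (rule dot_contract)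
  have ctW: "ct i \<in> vec.span {a, b}" for i unfolding ct_def by (rule contract_in_span)
  have "\<exists>i. \<eta> i \<noteq> 0"
  proof (rule ccontr)
    assume "\<not> (\<exists>i. \<eta> i \<noteq> 0)"
    then have h: "\<eta> i = 0" for i by blast
    have "ct i = 0" for i
      by (rule ext5[of _ i]) (use Z[of i] \<omega>0[of i] \<omega>4[of i] h in \<open>simp_all add: ct, simp add: \<eta>_def\<close>)
    then have 1: "wedge a b (Ph i z) y = 0" for i y
      using dot_contract[of a "Ph i z" b y] by (simp add: ct_def)
    have "dot a y *s b - dot b y *s a = 0" for y
    proof (rule ext)
      fix j
      have "wedge a b y (Ph j z) = 0" using 1[of j y] wedge_swap[of a b y "Ph j z"] by simp
      then show "dot (dot a y *s b - dot b y *s a) (Ph j z) = dot 0 (Ph j z)" by (simp add: dot_contract)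
    qed
    then have 2: "wedge a b x y = 0" for x y by (metis dot_contract dot_zero_left)
    with wedge_nonzero[OF sc] show False by blast
  qed
  then obtain i where i: "\<eta> i \<noteq> 0" by blast
  have i2: "\<eta> (i + 2 * t) = 0" using pl[of i] i by simp
  have i3: "\<eta> (i + 3 * t) = 0"
  proof -
    have "\<eta> (i + 3 * t + 2 * t) = \<eta> i" by (rule \<eta>_cong) presburger
    then show ?thesis using pl[of "i + 3 * t"] i by simp
  qed
  have i41: "\<eta> (i + 4 * t) = 0 \<or> \<eta> (i + t) = 0"
  proof -
    have e: "i + 4 * t + 2 * t = i + t + 5 * t" by simp
    have "\<eta> (i + 4 * t + 2 * t) = \<eta> (i + t)" unfolding e by (rule \<eta>_cong) (rule mod_mult_self2)
    then show ?thesis using pl[of "i + 4 * t"] by simp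
  qed
  have "\<exists>m. \<eta> (m + t) = 0 \<and> \<eta> (m + 2 * t) = 0 \<and> \<eta> (m + 3 * t) = 0 \<and> (\<eta> m \<noteq> 0 \<or> \<eta> (m + 4 * t) \<noteq> 0)"
  proof (cases "\<eta> (i + 4 * t) = 0")
    case True
    have "\<eta> (i + t + 4 * t) = \<eta> i" by (rule \<eta>_cong) presburger
    moreover have e: "i + t + t = i + 2 * t" "i + t + 2 * t = i + 3 * t" "i + t + 3 * t = i + 4 * t" by auto
    have "\<eta> (i + t + t) = 0" "\<eta> (i + t + 2 * t) = 0" "\<eta> (i + t + 3 * t) = 0"
      unfolding e using i2 i3 True by blast+
    ultimately show ?thesis using i by metis
  next
    case False
    then show ?thesis using i i2 i3 i41 by (intro exI[of _ i]) simp
  qed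
  then obtain m where m: "\<eta> (m + t) = 0" "\<eta> (m + 3 * t) = 0" "\<eta> m \<noteq> 0 \<or> \<eta> (m + 4 * t) \<noteq> 0" by blast
  \<comment> \<open>The dual vector at the vertex common to the surviving edges; \<open>w\<close>
    below is the contraction of \<open>a \<and> b\<close> at this vertex.\<close>
  define f where "f = Ph m f0"
  define \<gamma> where "\<gamma> = \<eta> m"
  define \<gamma>' where "\<gamma>' = - \<eta> (m + 4 * t)"
  have fz: "dot (Ph k f) (Ph j z) = (if (m + k) mod 5 = j mod 5 then 1 else 0)" for k j
    unfolding f_def Ph_add using f0[of "k + m" j] by (simp add: add.commute)
  have f0z: "dot f (Ph j z) = (if m mod 5 = j mod 5 then 1 else 0)" for j using fz[of 0 j] by (simp add: Ph_0)
  define w where "w = \<gamma> *s Ph t f + \<gamma>' *s Ph (4 * t) f"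
  note ne = step_inj[OF t]
  have fr: "dot f (Ph (m + r * t) z) = (if r = 0 then 1 else 0)" if "r < 5" for r
    using ne[of 0 r m] that by (auto simp: f0z)
  have wr: "dot w (Ph (m + r * t) z) = (if r = 1 then \<gamma> else if r = 4 then \<gamma>' else 0)" if "r < 5" for r
    using ne[of 1 r m] ne[of 4 r m] that by (auto simp: w_def dot_simps fz)
  have w_ct: "w = ct m"
    by (rule ext5[of _ m]) (use wr[of 0] wr[of 1] wr[of 2] wr[of 3] wr[of 4] Z[of m] \<omega>0[of m] \<omega>4[of m] in
      \<open>simp_all add: ct, simp_all add: \<gamma>_def \<gamma>'_def \<eta>_def\<close>)
  have wW: "w \<in> vec.span {a, b}" unfolding w_ct by (rule ctW)
  \<comment> \<open>\<open>f\<close> is, up to a nonzero factor, the contraction at the other end of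
    a surviving edge; which neighbour serves depends on whether \<open>\<gamma>\<close> is
    zero.\<close>
  have fW: "f \<in> vec.span {a, b}"
  proof (cases "\<gamma> = 0")
    case False
    have "ct (m + t) = (- \<gamma>) *s f"
    proof (rule ext5[of _ "m + t"])
      have s: "m + t + r * t = m + Suc r * t" for r by simp
      have fr': "dot f (Ph (m + t + r * t) z) = (if r = 4 then 1 else 0)" if "r < 5" for r
      proof (cases "r = 4")
        case True
        have "(m + t + 4 * t) mod 5 = m mod 5" by presburger
        then show ?thesis using True by (simp add: f0z)
      next
        case False
        then show ?thesis using fr[of "Suc r"] that unfolding s by simp
      qed
      have "\<omega> (m + t) (m + t + 4 * t) = \<omega> (m + t) m" by (rule cong) presburger+
      then have "\<omega> (m + t) (m + t + 4 * t) = - \<gamma>" using swap[of "m + t" m] by (simp add: \<gamma>_def \<eta>_def)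
      moreover have "\<omega> (m + t) (m + t + 1 * t) = 0" using m(1) by (simp add: \<eta>_def)
      ultimately show "dot (ct (m + t)) (Ph (m + t + 0 * t) z) = dot ((- \<gamma>) *s f) (Ph (m + t + 0 * t) z)"
        "dot (ct (m + t)) (Ph (m + t + 1 * t) z) = dot ((- \<gamma>) *s f) (Ph (m + t + 1 * t) z)"
        "dot (ct (m + t)) (Ph (m + t + 2 * t) z) = dot ((- \<gamma>) *s f) (Ph (m + t + 2 * t) z)"
        "dot (ct (m + t)) (Ph (m + t + 3 * t) z) = dot ((- \<gamma>) *s f) (Ph (m + t + 3 * t) z)"
        "dot (ct (m + t)) (Ph (m + t + 4 * t) z) = dot ((- \<gamma>) *s f) (Ph (m + t + 4 * t) z)"
        using fr'[of 0] fr'[of 1] fr'[of 2] fr'[of 3] fr'[of 4] Z[of "m + t"] \<omega>0[of "m + t"]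
        unfolding ct dot_scale_left by simp_all
    qed
    then have "(- \<gamma>) *s f \<in> vec.span {a, b}" using ctW[of "m + t"] by simp
    then show ?thesis using False nonzero_multiple_in_subspace[OF vec.subspace_span] by (metis neg_equal_0_iff_equal)
  next
    case True
    then have \<gamma>'0: "\<gamma>' \<noteq> 0" using m(3) by (simp add: \<gamma>_def \<gamma>'_def)
    have "ct (m + 4 * t) = (- \<gamma>') *s f"
    proof (rule ext5[of _ "m + 4 * t"])
      have fr': "dot f (Ph (m + 4 * t + r * t) z) = (if r = 1 then 1 else 0)" if "r < 5" for r
      proof -
        have "m + 4 * t + r * t = m + (4 + r) * t" by (simp add: algebra_simps)
        moreover have "(m + (4 + r) * t) mod 5 = (m + ((4 + r) mod 5) * t) mod 5"
          by (metis mod_add_right_eq mod_mult_left_eq)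
        ultimately have "Ph (m + 4 * t + r * t) z = Ph (m + ((4 + r) mod 5) * t) z" by (intro Ph_cong) metis
        then have "dot f (Ph (m + 4 * t + r * t) z) = (if (4 + r) mod 5 = 0 then 1 else 0)"
          using fr[of "(4 + r) mod 5"] by simp
        moreover have "r \<in> {0, 1, 2, 3, 4}" using that by auto
        then have "(4 + r) mod 5 = 0 \<longleftrightarrow> r = 1" by auto
        ultimately show ?thesis by simp
      qed
      have "\<omega> (m + 4 * t) (m + 4 * t + 1 * t) = - \<gamma>'" by (simp add: \<gamma>'_def \<eta>_def)
      moreover have e: "m + 4 * t + 4 * t = m + 3 * t + 5 * t" by simp
      have "\<eta> (m + 4 * t + 4 * t) = \<eta> (m + 3 * t)" unfolding e by (rule \<eta>_cong) (rule mod_mult_self2)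
      then have "\<omega> (m + 4 * t) (m + 4 * t + 4 * t) = 0" using \<omega>4[of "m + 4 * t"] m(2) by simp
      ultimately show "dot (ct (m + 4 * t)) (Ph (m + 4 * t + 0 * t) z) = dot ((- \<gamma>') *s f) (Ph (m + 4 * t + 0 * t) z)"
        "dot (ct (m + 4 * t)) (Ph (m + 4 * t + 1 * t) z) = dot ((- \<gamma>') *s f) (Ph (m + 4 * t + 1 * t) z)"
        "dot (ct (m + 4 * t)) (Ph (m + 4 * t + 2 * t) z) = dot ((- \<gamma>') *s f) (Ph (m + 4 * t + 2 * t) z)"
        "dot (ct (m + 4 * t)) (Ph (m + 4 * t + 3 * t) z) = dot ((- \<gamma>') *s f) (Ph (m + 4 * t + 3 * t) z)"
        "dot (ct (m + 4 * t)) (Ph (m + 4 * t + 4 * t) z) = dot ((- \<gamma>') *s f) (Ph (m + 4 * t + 4 * t) z)"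
        using fr'[of 0] fr'[of 1] fr'[of 2] fr'[of 3] fr'[of 4] Z[of "m + 4 * t"] \<omega>0[of "m + 4 * t"]
        unfolding ct dot_scale_left by simp_all
    qed
    then have "(- \<gamma>') *s f \<in> vec.span {a, b}" using ctW[of "m + 4 * t"] by simp
    then show ?thesis using \<gamma>'0 nonzero_multiple_in_subspace[OF vec.subspace_span] by (metis neg_equal_0_iff_equal)
  qed
  have \<gamma>0: "\<gamma> \<noteq> 0 \<or> \<gamma>' \<noteq> 0" using m(3) by (simp add: \<gamma>_def \<gamma>'_def)
  have "vec.dim {f, w} = 2"
    unfolding dim2_iff
  proof (intro allI impI)
    fix r s assume 0: "r *s f + s *s w = 0"
    have "r * dot f x + s * dot w x = 0" for x
      using arg_cong[OF 0, of "\<lambda>v. dot v x"] by (simp add: dot_simps)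
    note this[of "Ph (m + 0 * t) z"] this[of "Ph (m + 1 * t) z"] this[of "Ph (m + 4 * t) z"]
    then show "r = 0 \<and> s = 0"
      using fr[of 0] fr[of 1] fr[of 4] wr[of 0] wr[of 1] wr[of 4] \<gamma>0 by auto
  qed
  then have "vec.span {a, b} = vec.span {f, w}" by (rule span2_eq_of_dim[OF fW wW])
  moreover have "vec.dim ((\<lambda>i. Ph i f) ` {..<5}) = 5"
  proof (rule biorthogonal_dim[where y = "\<lambda>j. Ph (m + j) z"])
    fix i j :: nat assume "i < 5" "j < 5"
    then have "(m + i) mod 5 = (m + j) mod 5 \<longleftrightarrow> i = j" by (simp add: mod5_add)
    then show "dot (Ph i f) (Ph (m + j) z) = 0 \<longleftrightarrow> i \<noteq> j" by (simp add: fz)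
  qed
  ultimately show thesis using that \<gamma>0 unfolding w_def by blast
qed

text \<open>With indices counted in steps of \<open>t\<close>, the r-th conjugate of
  \<open>a \<and> b\<close> is a multiple of \<open>G r * H r - G' r * H (r - 1)\<close>, where r -
  1 is written r + 4. A combination with coefficients that satisfy \<Lambda>(r+1) G'(r+1) =
  \<Lambda>(r) G(r) telescopes to zero around the pentagon when the two norms agree. This
  contradicts the independence of the conjugates.\<close>

lemma norm_condition:
  fixes a b f :: "'a ^ 5"
  assumes sc: "scattered a b" and t: "t \<in> {1, 2::nat}" and \<gamma>: "\<gamma> \<noteq> 0" "\<gamma>' \<noteq> 0"
    and sp: "vec.span {a, b} = vec.span {f, \<gamma> *s Ph t f + \<gamma>' *s Ph (4 * t) f}"
  shows "N5 q (\<gamma>' / \<gamma>) \<noteq> 1"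
proof
  assume N: "N5 q (\<gamma>' / \<gamma>) = 1"
  have N1: "N5 q \<gamma>' = N5 q \<gamma>"
    using N \<gamma> by (simp add: N5_def power_divide field_simps)
  let ?w = "\<gamma> *s Ph t f + \<gamma>' *s Ph (4 * t) f"
  have "a \<in> vec.span {f, ?w}" "b \<in> vec.span {f, ?w}" by (simp_all add: vec.span_base flip: sp)
  then obtain \<alpha> \<beta> \<alpha>' \<beta>' where ab: "a = \<alpha> *s f + \<beta> *s ?w" "b = \<alpha>' *s f + \<beta>' *s ?w"
    unfolding in_span_2 by blast
  define \<theta> where "\<theta> = \<alpha> * \<beta>' - \<beta> * \<alpha>'"
  have wab: "wedge a b x y = \<theta> * (\<gamma> * wedge f (Ph t f) x y + \<gamma>' * wedge f (Ph (4 * t) f) x y)" for x y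
    unfolding ab by (simp add: wedge_def \<theta>_def dot_simps algebra_simps)
  have "\<theta> \<noteq> 0"
  proof
    assume "\<theta> = 0"
    then have 0: "wedge a b x y = 0" for x y by (simp add: wab)
    with wedge_nonzero[OF sc] show False by blast
  qed
  define G where "G r = \<gamma> ^ (q ^ (r * t))" for r
  define G' where "G' r = \<gamma>' ^ (q ^ (r * t))" for r
  define \<Theta> where "\<Theta> r = \<theta> ^ (q ^ (r * t))" for r
  define H where "H r x y = wedge (Ph (r * t) f) (Ph (Suc r * t) f) x y" for r x y
  have nz: "G r \<noteq> 0" "G' r \<noteq> 0" "\<Theta> r \<noteq> 0" for r using \<gamma> \<open>\<theta> \<noteq> 0\<close> by (simp_all add: G_def G'_def \<Theta>_def)
  have Hp: "H (r + 5) = H r" for r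
  proof -
    have e: "(r + 5) * t = r * t + 5 * t" "Suc (r + 5) * t = Suc r * t + 5 * t"
      by (simp_all add: algebra_simps)
    have "Ph ((r + 5) * t) f = Ph (r * t) f" "Ph (Suc (r + 5) * t) f = Ph (Suc r * t) f"
      unfolding e by (rule Ph_cong, rule mod_mult_self2)+
    then show ?thesis by (intro ext) (simp only: H_def)
  qed
  have E: "wedge (Ph (r * t) a) (Ph (r * t) b) x y = \<Theta> r * (G r * H r x y - G' r * H (r + 4) x y)" for r x y
  proof -
    define n where "n = r * t"
    define x' where "x' = Ph (4 * n) x"
    define y' where "y' = Ph (4 * n) y"
    have xy: "x = Ph n x'" "y = Ph n y'" by (simp_all only: x'_def y'_def Ph_inv)
    have pw: "(u + v) ^ (q ^ n) = u ^ (q ^ n) + v ^ (q ^ n)" for u v :: 'a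
      by (rule additive_power.power_add[OF additive_a])
    have "wedge (Ph n a) (Ph n b) x y = wedge a b x' y' ^ (q ^ n)" unfolding xy by (rule wedge_Ph)
    also have "\<dots> = \<theta> ^ (q ^ n) * (\<gamma> ^ (q ^ n) * wedge f (Ph t f) x' y' ^ (q ^ n)
        + \<gamma>' ^ (q ^ n) * wedge f (Ph (4 * t) f) x' y' ^ (q ^ n))"
      unfolding wab by (simp add: power_mult_distrib pw)
    also have "wedge f (Ph t f) x' y' ^ (q ^ n) = wedge (Ph n f) (Ph (n + t) f) x y"
      unfolding xy wedge_Ph[symmetric] Ph_add ..
    also have "wedge f (Ph (4 * t) f) x' y' ^ (q ^ n) = wedge (Ph n f) (Ph (n + 4 * t) f) x y"
      unfolding xy wedge_Ph[symmetric] Ph_add ..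
    also have "wedge (Ph n f) (Ph (n + t) f) x y = H r x y" by (simp add: H_def n_def add.commute)
    also have "wedge (Ph n f) (Ph (n + 4 * t) f) x y = - H (r + 4) x y"
    proof -
      have e: "Suc (r + 4) * t = n + 5 * t" by (simp add: n_def algebra_simps)
      have "Ph (Suc (r + 4) * t) f = Ph n f" unfolding e by (rule Ph_cong) (rule mod_mult_self2)
      moreover have "(r + 4) * t = n + 4 * t" by (simp add: n_def algebra_simps)
      ultimately have "H (r + 4) x y = wedge (Ph (n + 4 * t) f) (Ph n f) x y" by (simp only: H_def)
      then show ?thesis using wedge_swap_left[of "Ph (n + 4 * t) f" "Ph n f" x y] by simp
    qed
    finally show ?thesis by (simp add: n_def \<Theta>_def G_def G'_def)
  qed
  \<comment> \<open>The solution of the recursion that starts with 1; equality of norms is the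
    condition \<open>\<Lambda>4\<close> for it to close up after five steps.\<close>
  define \<Lambda> where "\<Lambda> r = (\<Prod>k<r. G k / G' (Suc k))" for r
  have \<Lambda>S: "\<Lambda> (Suc r) * G' (Suc r) = \<Lambda> r * G r" for r using nz by (simp add: \<Lambda>_def)
  have \<Lambda>0: "\<Lambda> 0 = 1" by (simp add: \<Lambda>_def)
  have prodG: "(\<Prod>r<5. G r) = (\<Prod>r<5. G' r)"
    using N5_orbit[OF t, of \<gamma>] N5_orbit[OF t, of \<gamma>'] N1 by (simp add: G_def G'_def)
  have p5: "(\<Prod>r<5. g r) = g 0 * g 1 * g 2 * g 3 * g (4::nat)" for g :: "nat \<Rightarrow> 'a"
    by (simp add: eval_nat_numeral)
  have \<Lambda>4: "\<Lambda> 4 * G 4 = G' 0"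
  proof -
    have "\<Lambda> 4 = G 0 * G 1 * G 2 * G 3 / (G' 1 * G' 2 * G' 3 * G' 4)"
      by (simp add: \<Lambda>_def eval_nat_numeral)
    then have "\<Lambda> 4 * G 4 = (\<Prod>r<5. G r) / (G' 1 * G' 2 * G' 3 * G' 4)" by (simp add: p5)
    also have "\<dots> = (\<Prod>r<5. G' r) / (G' 1 * G' 2 * G' 3 * G' 4)" unfolding prodG ..
    also have "\<dots> = G' 0" unfolding p5 using nz by (simp add: field_simps)
    finally show ?thesis .
  qed
  obtain x y where xy: "(\<Sum>r<5. \<Lambda> r / \<Theta> r * wedge (Ph (r * t) a) (Ph (r * t) b) x y) \<noteq> 0"
    using independence_step[OF sc t, of "\<lambda>r. \<Lambda> r / \<Theta> r"] \<Lambda>0 nz(3)[of 0]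
    by (metis divide_eq_0_iff one_neq_zero zero_less_numeral)
  have "\<Lambda> r / \<Theta> r * wedge (Ph (r * t) a) (Ph (r * t) b) x y
      = \<Lambda> r * G r * H r x y - \<Lambda> r * G' r * H (r + 4) x y" for r
    unfolding E using nz(3)[of r] by (simp add: algebra_simps)
  then have "(\<Sum>r<5. \<Lambda> r / \<Theta> r * wedge (Ph (r * t) a) (Ph (r * t) b) x y)
    = (\<Sum>r<5. \<Lambda> r * G r * H r x y) - (\<Sum>r<5. \<Lambda> r * G' r * H (r + 4) x y)"
    by (simp add: sum_subtractf)
  also have "(\<Sum>r<5. \<Lambda> r * G' r * H (r + 4) x y) = (\<Sum>r<5. \<Lambda> r * G r * H r x y)"
  proof -
    have H': "H 5 = H 0" "H 6 = H 1" "H 7 = H 2" "H 8 = H 3" using Hp[of 0] Hp[of 1] Hp[of 2] Hp[of 3] by simp_all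
    have L: "\<Lambda> 1 * G' 1 = \<Lambda> 0 * G 0" "\<Lambda> 2 * G' 2 = \<Lambda> 1 * G 1" "\<Lambda> 3 * G' 3 = \<Lambda> 2 * G 2"
      "\<Lambda> 4 * G' 4 = \<Lambda> 3 * G 3"
      using \<Lambda>S[of 0] \<Lambda>S[of 1] \<Lambda>S[of 2] \<Lambda>S[of 3] by (simp_all add: eval_nat_numeral)
    have "(\<Sum>r<5. \<Lambda> r * G' r * H (r + 4) x y) = \<Lambda> 0 * G' 0 * H 4 x y + \<Lambda> 1 * G' 1 * H 0 x y
        + \<Lambda> 2 * G' 2 * H 1 x y + \<Lambda> 3 * G' 3 * H 2 x y + \<Lambda> 4 * G' 4 * H 3 x y"
      unfolding sum_lessThan_5 using H' by simp
    also have "\<dots> = (\<Sum>r<5. \<Lambda> r * G r * H r x y)"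
      unfolding L sum_lessThan_5 \<Lambda>4 by (simp add: \<Lambda>0)
    finally show ?thesis .
  qed
  finally show False using xy by simp
qed

theorem normal_form:
  fixes a b :: "'a ^ 5"
  assumes sc: "scattered a b"
  obtains f t \<gamma> \<gamma>' where "t \<in> {1, 2::nat}" "vec.dim ((\<lambda>i. Ph i f) ` {..<5}) = 5" "\<gamma> \<noteq> 0 \<or> \<gamma>' \<noteq> 0"
    "vec.span {a, b} = vec.span {f, \<gamma> *s Ph t f + \<gamma>' *s Ph (4 * t) f}"
    "\<gamma> \<noteq> 0 \<Longrightarrow> \<gamma>' \<noteq> 0 \<Longrightarrow> N5 q (\<gamma>' / \<gamma>) \<noteq> 1"
proof -
  obtain z g where g: "g \<in> {1, 2::nat}" and z: "vec.dim ((\<lambda>i. Ph i z) ` {..<5}) = 5"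
    and zg: "\<forall>i. wedge a b (Ph i z) (Ph (i + g) z) = 0"
    using conjunct1[OF pentagon_and_independence[OF sc]] by blast
  \<comment> \<open>The wedge vanishes on vertices at distance g, so the edges that may survive have
    distance t, the other element of {1, 2}; 2t and 3t are both g or -g modulo 5.\<close>
  define t where "t = 3 - g"
  have t: "t \<in> {1, 2}" using g by (auto simp: t_def)
  have zg': "wedge a b (Ph i z) (Ph j z) = 0" if "(i + g) mod 5 = j mod 5 \<or> (j + g) mod 5 = i mod 5" for i j
    using that
  proof
    assume "(i + g) mod 5 = j mod 5"
    from Ph_cong[OF this, of z] zg show ?thesis by metis
  next
    assume "(j + g) mod 5 = i mod 5"
    from Ph_cong[OF this, of z] have "wedge a b (Ph j z) (Ph i z) = 0" using zg by metis
    then show ?thesis using wedge_swap[of a b "Ph i z" "Ph j z"] by simp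
  qed
  have Z: "wedge a b (Ph i z) (Ph (i + 2 * t) z) = 0" "wedge a b (Ph i z) (Ph (i + 3 * t) z) = 0" for i
  proof -
    have "((i + g) mod 5 = (i + 2 * t) mod 5 \<or> (i + 2 * t + g) mod 5 = i mod 5) \<and>
      ((i + g) mod 5 = (i + 3 * t) mod 5 \<or> (i + 3 * t + g) mod 5 = i mod 5)"
    proof (cases "g = 1")
      case True
      have "(i + 2 * 2 + 1) mod 5 = i mod 5" by simp
      moreover have "(i + 1) mod 5 = (i + 3 * 2) mod 5" unfolding mod5_add by simp
      moreover have "t = 2" using True by (simp add: t_def)
      ultimately show ?thesis using True by blast
    next
      case False
      then have "g = 2" "t = 1" using g by (simp_all add: t_def)
      moreover have "(i + 3 * 1 + 2) mod 5 = i mod 5" by simp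
      moreover have "(i + 2) mod 5 = (i + 2 * 1) mod 5" by simp
      ultimately show ?thesis by blast
    qed
    then show "wedge a b (Ph i z) (Ph (i + 2 * t) z) = 0" "wedge a b (Ph i z) (Ph (i + 3 * t) z) = 0"
      using zg' by blast+
  qed
  obtain f \<gamma> \<gamma>' where f: "vec.dim ((\<lambda>i. Ph i f) ` {..<5}) = 5" "\<gamma> \<noteq> 0 \<or> \<gamma>' \<noteq> 0"
    "vec.span {a, b} = vec.span {f, \<gamma> *s Ph t f + \<gamma>' *s Ph (4 * t) f}"
    by (rule normal_form_step[OF sc z t Z])
  from that[OF t f norm_condition[OF sc t _ _ f(3)]] show thesis by blast
qed

end

section \<open>Counting points of the linear set and meeting conjugates of the centre\<close>

context quintic
begin

lemma card_rational: "card {v :: 'a ^ 5. \<forall>i. v $ i \<in> Fq q} = q ^ 5"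
proof -
  have "{v :: 'a ^ 5. \<forall>i. v $ i \<in> Fq q} = vec_lambda ` (UNIV \<rightarrow>\<^sub>E Fq q)"
  proof (intro equalityI subsetI)
    fix v :: "'a ^ 5" assume "v \<in> {v. \<forall>i. v $ i \<in> Fq q}"
    then have "vec_nth v \<in> UNIV \<rightarrow>\<^sub>E Fq q" by auto
    moreover have "v = vec_lambda (vec_nth v)" by simp
    ultimately show "v \<in> vec_lambda ` (UNIV \<rightarrow>\<^sub>E Fq q)" by (metis image_eqI)
  qed auto
  moreover have "inj_on vec_lambda ((UNIV :: 5 set) \<rightarrow>\<^sub>E (Fq q :: 'a set))"
    by (intro inj_onI) (simp add: vec_lambda_inject)
  ultimately have "card {v :: 'a ^ 5. \<forall>i. v $ i \<in> Fq q} = card ((UNIV :: 5 set) \<rightarrow>\<^sub>E (Fq q :: 'a set))"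
    by (simp add: card_image)
  then show ?thesis by (simp add: card_PiE card_Fq)
qed

lemma rational_Ph: "(\<forall>i. u $ i \<in> Fq q) \<Longrightarrow> Ph n u = u" for u :: "'a ^ 5"
proof -
  assume u: "\<forall>i. u $ i \<in> Fq q"
  have "u $ i ^ (q ^ n) = u $ i" for i
    by (induction n) (use u in \<open>simp_all add: power_mult Fq_def\<close>)
  then show ?thesis by (simp add: frob_def vec_eq_iff)
qed

lemma Fq_closed:
  "x \<in> Fq q \<Longrightarrow> y \<in> Fq q \<Longrightarrow> x * y \<in> Fq q"
  "x \<in> Fq q \<Longrightarrow> y \<in> Fq q \<Longrightarrow> x - y \<in> Fq q"
  "0 \<in> (Fq q :: 'a set)" "1 \<in> (Fq q :: 'a set)" for x y :: 'a
  using q_ge2 additive_power.power_diff[OF additive_a[of 1], of x y]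
  by (simp_all add: Fq_def power_mult_distrib zero_power)

text \<open>Homogeneous coordinates of the projection from the common kernel of \<open>a\<close> and
  \<open>b\<close>.\<close>

definition pair :: "'a ^ 5 \<Rightarrow> 'a ^ 5 \<Rightarrow> 'a ^ 5 \<Rightarrow> 'a ^ 2" where
  "pair a b u = vector [dot a u, dot b u]"

lemma pair_eq_0: "pair a b u = 0 \<longleftrightarrow> dot a u = 0 \<and> dot b u = 0"
  by (simp add: pair_def vec_eq_iff forall_2 vector_2)

lemma pair_linear: "pair a b (u + v) = pair a b u + pair a b v" "pair a b (k *s u) = k *s pair a b u"
  by (simp_all add: pair_def vec_eq_iff forall_2 vector_2 dot_simps)

lemma pt_scale: "k \<noteq> 0 \<Longrightarrow> pt (k *s v) = pt v" for v :: "'a ^ 'n"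
proof -
  assume k: "k \<noteq> 0"
  have "v = inverse k *s (k *s v)" using k by (simp add: vector_smult_assoc)
  then have "\<exists>s. r *s v = s *s (k *s v)" for r by (metis vector_smult_assoc)
  then show ?thesis unfolding pt_def set_eq_iff in_span_1 by (metis vector_smult_assoc)
qed

text \<open>Every point of the linear set comes from at least q - 1 rational vectors, the rational
  multiples of one of them. An independent pair with proportional images gives one point an extra
  preimage, and then the preimages number more than the q^5 - 1 available vectors.\<close>

lemma scattered_of_card:
  fixes a b :: "'a ^ 5"
  defines "R \<equiv> {u :: 'a ^ 5. u \<noteq> 0 \<and> (\<forall>i. u $ i \<in> Fq q)}"
  assumes nz: "\<And>u. u \<in> R \<Longrightarrow> pair a b u \<noteq> 0"
    and card: "card {pt (pair a b u) | u. u \<in> R} = (q ^ 5 - 1) div (q - 1)"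
  shows "scattered a b"
  unfolding scattered_def
proof (intro allI impI notI)
  fix u v :: "'a ^ 5"
  assume rat: "\<forall>i. u $ i \<in> Fq q" "\<forall>i. v $ i \<in> Fq q" and w: "wedge a b u v = 0"
    and d: "vec.dim {u, v} = 2"
  have "u \<noteq> 0" using dim2D[OF d, of 1 0] by auto
  have "v \<noteq> 0" using dim2D[OF d, of 0 1] by auto
  have uR: "u \<in> R" and vR: "v \<in> R" using rat \<open>u \<noteq> 0\<close> \<open>v \<noteq> 0\<close> by (simp_all add: R_def)
  define P where "P = (\<lambda>u. pt (pair a b u))"
  have "P u = P v"
  proof -
    have e: "dot a u * dot b v = dot a v * dot b u" using w by (simp add: wedge_def)
    have "\<exists>k. pair a b v = k *s pair a b u"
    proof (cases "dot a u = 0")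
      case True
      then have "dot b u \<noteq> 0" using nz[OF uR] by (simp add: pair_eq_0)
      then have "dot a v = 0" using e True by simp
      then show ?thesis using True \<open>dot b u \<noteq> 0\<close>
        by (intro exI[of _ "dot b v / dot b u"]) (simp add: pair_def vec_eq_iff forall_2 vector_2)
    next
      case False
      then show ?thesis using e
        by (intro exI[of _ "dot a v / dot a u"]) (simp add: pair_def vec_eq_iff forall_2 vector_2 field_simps)
    qed
    then obtain k where k: "pair a b v = k *s pair a b u" by blast
    then have "k \<noteq> 0" using nz[OF vR] by auto
    then show ?thesis unfolding P_def k by (rule pt_scale[symmetric])
  qed
  define Lp where "Lp = P ` R"
  have L: "card Lp = (q ^ 5 - 1) div (q - 1)" using card by (simp add: Lp_def P_def image_def Collect_disj_eq full_SetCompr_eq setcompr_eq_image)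
  have cR: "card R = q ^ 5 - 1"
  proof -
    have "R = {v :: 'a ^ 5. \<forall>i. v $ i \<in> Fq q} - {0}" by (auto simp: R_def)
    moreover have "(0 :: 'a ^ 5) \<in> {v. \<forall>i. v $ i \<in> Fq q}" using Fq_closed(3) by simp
    ultimately show ?thesis by (simp add: card_rational)
  qed
  define M where "M w = (\<lambda>k. k *s w) ` (Fq q - {0})" for w :: "'a ^ 5"
  have cM: "card (M w) = q - 1" if "w \<noteq> 0" for w
  proof -
    have "inj_on (\<lambda>k. k *s w) (Fq q - {0})" using that by (intro inj_onI) (simp add: vec.scale_cancel_right)
    then show ?thesis using card_Diff_singleton[OF Fq_closed(3)] card_Fq by (simp add: M_def card_image)
  qed
  have MR: "M w \<subseteq> {x \<in> R. P x = P w}" if "w \<in> R" for w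
    using that Fq_closed(1) by (auto simp: M_def R_def P_def pair_linear pt_scale vec.scale_eq_0_iff)
  have "u \<notin> M v"
  proof
    assume "u \<in> M v"
    then obtain k where "u = k *s v" by (auto simp: M_def)
    then have "1 *s u + (- k) *s v = 0" by simp
    from dim2D[OF d this] show False by simp
  qed
  have le: "q - 1 \<le> card {x \<in> R. P x = C}" if CL: "C \<in> Lp" for C
  proof -
    obtain w where w: "w \<in> R" "C = P w" using CL by (auto simp: Lp_def)
    have "card (M w) \<le> card {x \<in> R. P x = P w}" by (rule card_mono[OF _ MR[OF w(1)]]) simp
    then show ?thesis using cM[of w] w by (simp add: R_def)
  qed
  have lt: "q - 1 < card {x \<in> R. P x = P v}"
  proof -
    have "insert u (M v) \<subseteq> {x \<in> R. P x = P v}" using MR[OF vR] uR \<open>P u = P v\<close> by auto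
    then have "card (insert u (M v)) \<le> card {x \<in> R. P x = P v}" by (intro card_mono) simp_all
    then show ?thesis using cM[OF \<open>v \<noteq> 0\<close>] \<open>u \<notin> M v\<close> by simp
  qed
  have "card Lp * (q - 1) = (\<Sum>C\<in>Lp. q - 1)" by simp
  also have "\<dots> < (\<Sum>C\<in>Lp. card {x \<in> R. P x = C})"
    by (rule sum_strict_mono_ex1) (use le lt vR in \<open>auto simp: Lp_def\<close>)
  also have "\<dots> = card R"
    using sum.image_gen[of R "\<lambda>_. 1::nat" P] by (simp add: Lp_def)
  finally have "card Lp * (q - 1) < q ^ 5 - 1" by (simp add: cR)
  moreover have "(q - 1) dvd (q ^ 5 - 1)"
  proof -
    have "q ^ 5 - 1 = (q - 1) * (q ^ 4 + q ^ 3 + q ^ 2 + q + 1)"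
    proof -
      obtain n where n: "q = Suc n" using q_ge2 by (cases q) auto
      show ?thesis unfolding n by (simp add: eval_nat_numeral algebra_simps)
    qed
    then show ?thesis by simp
  qed
  ultimately show False using L by simp
qed

lemma orbit_coordinates:
  fixes f :: "'a ^ 5"
  assumes "vec.dim ((\<lambda>i. Ph i f) ` {..<5}) = 5" and "t \<in> {1, 2::nat}"
  obtains z where "vec.dim ((\<lambda>i. Ph i z) ` {..<5}) = 5"
    and "\<forall>i j. dot (Ph i f) (Ph j z) = (if i mod 5 = j mod 5 then 1 else 0)"
    and "\<forall>u. u = (\<Sum>r<5. dot (Ph (r * t) f) u *s Ph (r * t) z)"
proof -
  obtain z where z: "\<And>i j. dot (Ph i z) (Ph j f) = (if i mod 5 = j mod 5 then 1 else 0)"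
    and ext: "\<And>c c'. (\<And>j. dot c (Ph j f) = dot c' (Ph j f)) \<Longrightarrow> c = c'"
    using biorthogonal_orbit[OF assms(1)] by metis
  have z': "dot (Ph i f) (Ph j z) = (if i mod 5 = j mod 5 then 1 else 0)" for i j
    using z[of j i] by (simp add: dot_commute)
  have 1: "vec.dim ((\<lambda>i. Ph i z) ` {..<5}) = 5"
    by (rule biorthogonal_dim[where y = "\<lambda>j. Ph j f"]) (simp add: z)
  have 2: "u = (\<Sum>r<5. dot (Ph (r * t) f) u *s Ph (r * t) z)" for u
  proof (rule ext)
    fix j
    obtain s where s: "s < 5" "(0 + s * t) mod 5 = j mod 5" using step_cover[OF assms(2)] by blast
    have Pj: "Ph j f = Ph (s * t) f" by (rule Ph_cong) (use s in simp)
    have "dot (\<Sum>r<5. dot (Ph (r * t) f) u *s Ph (r * t) z) (Ph j f)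
        = (\<Sum>r<5. dot (Ph (r * t) f) u * dot (Ph (r * t) z) (Ph (s * t) f))"
      by (simp add: dot_sum_left dot_simps Pj)
    also have "\<dots> = (\<Sum>r<5. if r = s then dot (Ph (s * t) f) u else 0)"
    proof (rule sum.cong[OF refl])
      fix r assume "r \<in> {..<5::nat}"
      then have "(r * t) mod 5 = (s * t) mod 5 \<longleftrightarrow> r = s"
        using step_inj[OF assms(2), of r s 0] s(1) by simp
      then show "dot (Ph (r * t) f) u * dot (Ph (r * t) z) (Ph (s * t) f)
          = (if r = s then dot (Ph (s * t) f) u else 0)" by (simp add: z)
    qed
    also have "\<dots> = dot u (Ph j f)" using s(1) by (simp add: Pj dot_commute)
    finally show "dot u (Ph j f) = dot (\<Sum>r<5. dot (Ph (r * t) f) u *s Ph (r * t) z) (Ph j f)" ..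
  qed
  show thesis by (rule that[of z]) (use 1 2 z' in blast)+
qed

text \<open>In the coordinates \<open>x r = dot (Ph (r * t) f) u\<close>, \<open>r\<close> modulo \<open>5\<close>, the four equations defining
  this space read \<open>x 0 = 0\<close>, \<open>\<gamma> x 1 + \<gamma>' x 4 = 0\<close> and their shifts by \<open>r\<close> where \<open>d = r t\<close>.\<close>

lemma meet_conjugate:
  fixes f :: "'a ^ 5"
  assumes f: "vec.dim ((\<lambda>i. Ph i f) ` {..<5}) = 5" and t: "t \<in> {1, 2::nat}" and \<gamma>: "\<gamma> \<noteq> 0" "\<gamma>' \<noteq> 0"
    and d: "d mod 5 \<noteq> 0"
  defines "w \<equiv> \<gamma> *s Ph t f + \<gamma>' *s Ph (4 * t) f"
  shows "\<exists>v. v \<noteq> 0 \<and> perp {f, w, Ph d f, Ph d w} = vec.span {v} \<and>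
    (d mod 5 = t \<or> d mod 5 = (4 * t) mod 5 \<longrightarrow> vec.dim ((\<lambda>i. Ph i v) ` {..<5}) = 5)"
proof -
  obtain z where z5: "vec.dim ((\<lambda>i. Ph i z) ` {..<5}) = 5"
    and fz: "\<forall>i j. dot (Ph i f) (Ph j z) = (if i mod 5 = j mod 5 then 1 else 0)"
    and ex: "\<forall>u. u = (\<Sum>r<5. dot (Ph (r * t) f) u *s Ph (r * t) z)"
    by (rule orbit_coordinates[OF f t])
  define Z where "Z r = Ph (r * t) z" for r
  define x where "x u r = dot (Ph (r * t) f) u" for u r
  have xZ: "x (Z s) r = (if r = s then 1 else 0)" if "r < 5" "s < 5" for r s
    using step_inj[OF t that, of 0] by (simp add: x_def Z_def fz)
  have x_lin: "x (u + v) r = x u r + x v r" "x (k *s u) r = k * x u r" for u v k r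
    by (simp_all add: x_def dot_simps)
  have exp: "u = x u 0 *s Z 0 + x u 1 *s Z 1 + x u 2 *s Z 2 + x u 3 *s Z 3 + x u 4 *s Z 4" for u
    using ex[rule_format, of u] unfolding sum_lessThan_5 x_def Z_def by simp
  have xp: "x u (r + 5) = x u r" for u r
  proof -
    have e: "(r + 5) * t = r * t + 5 * t" by (simp add: algebra_simps)
    have "Ph ((r + 5) * t) f = Ph (r * t) f" unfolding e by (rule Ph_cong) (rule mod_mult_self2)
    then show ?thesis by (simp add: x_def)
  qed
  have xp': "x u 5 = x u 0" "x u 6 = x u 1" "x u 7 = x u 2" "x u 8 = x u 3" for u
    using xp[of u 0] xp[of u 1] xp[of u 2] xp[of u 3] by simp_all
  obtain r where r: "r < 5" "(0 + r * t) mod 5 = d mod 5" using step_cover[OF t] by blast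
  have r0: "r \<noteq> 0" using r(2) d by (cases "r = 0") auto
  define g where "g = \<gamma> ^ (q ^ d)"
  define g' where "g' = \<gamma>' ^ (q ^ d)"
  have g: "g \<noteq> 0" "g' \<noteq> 0" using \<gamma> by (simp_all add: g_def g'_def)
  have Phd: "Ph d v = Ph (r * t) v" for v :: "'a ^ 5" by (rule Ph_cong) (use r in simp)
  have Pw: "Ph d w = g *s Ph (Suc r * t) f + g' *s Ph ((r + 4) * t) f"
  proof -
    have "Ph d w = g *s Ph d (Ph t f) + g' *s Ph d (Ph (4 * t) f)"
      unfolding w_def by (simp only: Ph_linear g_def g'_def)
    also have "Ph d (Ph t f) = Ph (Suc r * t) f"
      using Phd[of "Ph t f"] Ph_add[of "r * t" t f] by (simp add: add.commute)
    also have "Ph d (Ph (4 * t) f) = Ph ((r + 4) * t) f"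
      using Phd[of "Ph (4 * t) f"] Ph_add[of "r * t" "4 * t" f] by (simp add: algebra_simps)
    finally show ?thesis .
  qed
  have S: "u \<in> perp {f, w, Ph d f, Ph d w} \<longleftrightarrow> x u 0 = 0 \<and> \<gamma> * x u 1 + \<gamma>' * x u 4 = 0 \<and> x u r = 0 \<and>
      g * x u (Suc r) + g' * x u (r + 4) = 0" for u
    unfolding perp_iff Pw unfolding Phd
    by (simp add: dot_simps w_def x_def dot_commute[of u] Ph_0[unfolded power_0])
  have span: "perp {f, w, Ph d f, Ph d w} = vec.span {v}" if "v \<in> perp {f, w, Ph d f, Ph d w}"
    "\<And>u. u \<in> perp {f, w, Ph d f, Ph d w} \<Longrightarrow> \<exists>k. u = k *s v" for v
  proof
    show "perp {f, w, Ph d f, Ph d w} \<subseteq> vec.span {v}" using that(2) by (auto simp: in_span_1)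
    show "vec.span {v} \<subseteq> perp {f, w, Ph d f, Ph d w}" by (rule vec.span_minimal) (use that(1) in auto)
  qed
  have Z0: "Z s \<noteq> 0" if "s < 5" for s
  proof
    assume "Z s = 0"
    then have "x (Z s) s = 0" by (simp add: x_def)
    then show False using xZ[OF that that] by simp
  qed
  have orbit: "vec.dim ((\<lambda>i. Ph i (Z s)) ` {..<5}) = 5" for s
  proof (rule biorthogonal_dim[where y = "\<lambda>j. Ph (s * t + j) f"])
    fix i j :: nat assume "i < 5" "j < 5"
    then have "(s * t + j) mod 5 = (s * t + i) mod 5 \<longleftrightarrow> i = j" by (auto simp: mod5_add)
    then show "dot (Ph i (Z s)) (Ph (s * t + j) f) = 0 \<longleftrightarrow> i \<noteq> j"
      using fz[rule_format, of "s * t + j" "s * t + i"] unfolding Z_def Ph_add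
      by (simp add: dot_commute add.commute)
  qed
  have d14: "d mod 5 = t \<longleftrightarrow> r = 1" "d mod 5 = (4 * t) mod 5 \<longleftrightarrow> r = 4"
    using step_inj[OF t r(1), of 1 0] step_inj[OF t r(1), of 4 0] r(2) t by auto
  consider "r = 1" | "r = 2" | "r = 3" | "r = 4" using r(1) r0 by linarith
  then show ?thesis
  proof cases
    case 1
    have "perp {f, w, Ph d f, Ph d w} = vec.span {Z 3}"
    proof (rule span)
      show "Z 3 \<in> perp {f, w, Ph d f, Ph d w}" unfolding S 1 by (simp add: xZ xp' flip: numeral_2_eq_2)
      fix u assume "u \<in> perp {f, w, Ph d f, Ph d w}"
      then have "x u 0 = 0" "x u 1 = 0" "x u 4 = 0" "x u 2 = 0"
        unfolding S 1 using \<gamma> g by (auto simp: xp' simp flip: numeral_2_eq_2)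
      then show "\<exists>k. u = k *s Z 3" using exp[of u] by (intro exI[of _ "x u 3"]) simp
    qed
    then show ?thesis using Z0[of 3] orbit[of 3] by (intro exI[of _ "Z 3"]) simp
  next
    case 4
    have "perp {f, w, Ph d f, Ph d w} = vec.span {Z 2}"
    proof (rule span)
      show "Z 2 \<in> perp {f, w, Ph d f, Ph d w}" unfolding S 4 by (simp add: xZ xp')
      fix u assume "u \<in> perp {f, w, Ph d f, Ph d w}"
      then have "x u 0 = 0" "x u 1 = 0" "x u 4 = 0" "x u 3 = 0"
        unfolding S 4 using \<gamma> g by (auto simp: xp')
      then show "\<exists>k. u = k *s Z 2" using exp[of u] by (intro exI[of _ "x u 2"]) simp
    qed
    then show ?thesis using Z0[of 2] orbit[of 2] by (intro exI[of _ "Z 2"]) simp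
  next
    case 2
    \<comment> \<open>At distance two the four equations couple x 1 with x 4 and with x 3; the
      solution is normalised by x 1 = 1. At distance one they leave a single vertex, whose orbit is
      the pentagon.\<close>
    define v where "v = Z 1 + (- \<gamma> / \<gamma>') *s Z 4 + (- g' / g) *s Z 3"
    have xv: "x v 0 = 0" "x v 1 = 1" "x v 2 = 0" "x v 3 = - g' / g" "x v 4 = - \<gamma> / \<gamma>'"
      unfolding v_def x_lin by (simp_all add: xZ)
    have "perp {f, w, Ph d f, Ph d w} = vec.span {v}"
    proof (rule span)
      show "v \<in> perp {f, w, Ph d f, Ph d w}"
        unfolding S 2 using \<gamma> g xv by (simp add: xp' flip: numeral_3_eq_3)
      fix u assume "u \<in> perp {f, w, Ph d f, Ph d w}"
      then have u: "x u 0 = 0" "x u 2 = 0" "\<gamma> * x u 1 + \<gamma>' * x u 4 = 0" "g * x u 3 + g' * x u 1 = 0"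
        unfolding S 2 by (auto simp: xp' simp flip: numeral_3_eq_3)
      have "x u 4 = - \<gamma> / \<gamma>' * x u 1" "x u 3 = - g' / g * x u 1"
        using u(3,4) \<gamma> g by (simp_all add: field_simps eq_neg_iff_add_eq_0 add.commute)
      then have "u = x u 1 *s v"
        using exp[of u] u(1,2) by (simp add: v_def vec_eq_iff algebra_simps)
      then show "\<exists>k. u = k *s v" by blast
    qed
    moreover have "v \<noteq> 0" using xv(2) by (auto simp: x_def)
    ultimately show ?thesis using d14 2 by (intro exI[of _ v]) simp
  next
    case 3
    define v where "v = Z 4 + (- \<gamma>' / \<gamma>) *s Z 1 + (- g / g') *s Z 2"
    have xv: "x v 0 = 0" "x v 1 = - \<gamma>' / \<gamma>" "x v 2 = - g / g'" "x v 3 = 0" "x v 4 = 1"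
      unfolding v_def x_lin by (simp_all add: xZ)
    have S4: "Suc 3 = 4" by simp
    have "perp {f, w, Ph d f, Ph d w} = vec.span {v}"
    proof (rule span)
      show "v \<in> perp {f, w, Ph d f, Ph d w}"
        unfolding S 3 S4 using \<gamma> g xv by (simp add: xp')
      fix u assume "u \<in> perp {f, w, Ph d f, Ph d w}"
      then have u: "x u 0 = 0" "x u 3 = 0" "\<gamma> * x u 1 + \<gamma>' * x u 4 = 0" "g * x u 4 + g' * x u 2 = 0"
        unfolding S 3 S4 by (auto simp: xp')
      have "x u 1 = - \<gamma>' / \<gamma> * x u 4" "x u 2 = - g / g' * x u 4"
        using u(3,4) \<gamma> g by (simp_all add: field_simps eq_neg_iff_add_eq_0 add.commute)
      then have "u = x u 4 *s v"
        using exp[of u] u(1,2) by (simp add: v_def vec_eq_iff algebra_simps)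
      then show "\<exists>k. u = k *s v" by blast
    qed
    moreover have "v \<noteq> 0" using xv(5) by (auto simp: x_def)
    ultimately show ?thesis using d14 3 by (intro exI[of _ v]) simp
  qed
qed

section \<open>Automorphisms over the field with q elements\<close>

lemma multiplicative_generator: "\<exists>g :: 'a. \<forall>x. x \<noteq> 0 \<longrightarrow> (\<exists>n. x = g ^ n)"
proof -
  let ?R = "ring_of_type_algebra :: 'a ring"
  interpret R: Ring.field ?R by (rule field_from_type_algebra)
  have c: "carrier ?R = UNIV" "\<zero>\<^bsub>?R\<^esub> = 0" "\<one>\<^bsub>?R\<^esub> = 1" "\<And>x y. x \<otimes>\<^bsub>?R\<^esub> y = x * y"
    by (simp_all add: ring_of_type_algebra_def)
  have "finite (carrier ?R)" by (simp add: c)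
  from R.finite_field_mult_group_has_gen[OF this] obtain g where
    g: "carrier (mult_of ?R) = {g [^]\<^bsub>?R\<^esub> i | i::nat. i \<in> UNIV}" by auto
  have p: "g [^]\<^bsub>?R\<^esub> (i::nat) = g ^ i" for i
    by (induction i) (simp_all add: c mult.commute)
  have "carrier (mult_of ?R) = UNIV - {0}" by (simp add: c)
  then have "x \<in> {g ^ i | i::nat. i \<in> UNIV}" if "x \<noteq> 0" for x
    using that g unfolding p by auto
  then show ?thesis by blast
qed

text \<open>The elementary symmetric functions of the five conjugates of a generator
  \<open>g\<close> are fixed by the q-th power, hence by \<open>\<psi>\<close>. So
  \<open>\<psi> g\<close> is a root of the same quintic, that is, a conjugate of \<open>g\<close>,
  and \<open>g\<close> generates all nonzero elements.\<close>

lemma automorphism_is_frobenius: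
  fixes \<psi> :: "'a \<Rightarrow> 'a"
  assumes "field_aut \<psi>" and fixq: "\<And>x. x \<in> Fq q \<Longrightarrow> \<psi> x = x"
  shows "\<exists>j. \<forall>x. \<psi> x = x ^ (q ^ j)"
proof -
  have add: "\<psi> (x + y) = \<psi> x + \<psi> y" and mult: "\<psi> (x * y) = \<psi> x * \<psi> y" and one: "\<psi> 1 = 1" for x y
    using assms(1) by (auto simp: field_aut_def)
  have zero: "\<psi> 0 = 0"
  proof -
    have "\<psi> 0 + \<psi> 0 = \<psi> 0 + 0" using add[of 0 0] by (simp only: add_0_right)
    then show ?thesis by (simp only: add_left_cancel)
  qed
  have pow: "\<psi> (x ^ n) = \<psi> x ^ n" for x n by (induction n) (simp_all add: one mult)
  have neg: "\<psi> (- x) = - \<psi> x" for x using add[of x "- x"] zero by (simp add: eq_neg_iff_add_eq_0 add.commute)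
  obtain g :: 'a where g: "\<And>x. x \<noteq> 0 \<Longrightarrow> \<exists>n. x = g ^ n" using multiplicative_generator by blast
  interpret A: additive_power q "TYPE('a)" using additive_a[of 1] by simp
  define c where "c i = g ^ (q ^ i)" for i
  have cS: "c 0 ^ q = c 1" "c 1 ^ q = c 2" "c 2 ^ q = c 3" "c 3 ^ q = c 4" "c 4 ^ q = c 0"
  proof -
    have cg: "c i ^ q = c (Suc i)" for i by (simp add: c_def mult.commute flip: power_mult)
    have "c 5 = c 0" using power_q5[of g] by (simp add: c_def)
    then show "c 0 ^ q = c 1" "c 1 ^ q = c 2" "c 2 ^ q = c 3" "c 3 ^ q = c 4" "c 4 ^ q = c 0"
      using cg[of 0] cg[of 1] cg[of 2] cg[of 3] cg[of 4] by (simp_all add: eval_nat_numeral)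
  qed
  note dist = A.power_add power_mult_distrib cS
  define s1 where "s1 = c 0 + c 1 + c 2 + c 3 + c 4"
  define s2 where "s2 = c 0 * c 1 + c 0 * c 2 + c 0 * c 3 + c 0 * c 4 + c 1 * c 2 + c 1 * c 3 + c 1 * c 4
    + c 2 * c 3 + c 2 * c 4 + c 3 * c 4"
  define s3 where "s3 = c 0 * c 1 * c 2 + c 0 * c 1 * c 3 + c 0 * c 1 * c 4 + c 0 * c 2 * c 3 + c 0 * c 2 * c 4
    + c 0 * c 3 * c 4 + c 1 * c 2 * c 3 + c 1 * c 2 * c 4 + c 1 * c 3 * c 4 + c 2 * c 3 * c 4"
  define s4 where "s4 = c 0 * c 1 * c 2 * c 3 + c 0 * c 1 * c 2 * c 4 + c 0 * c 1 * c 3 * c 4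
    + c 0 * c 2 * c 3 * c 4 + c 1 * c 2 * c 3 * c 4"
  define s5 where "s5 = c 0 * c 1 * c 2 * c 3 * c 4"
  have sF: "\<psi> s1 = s1" "\<psi> s2 = s2" "\<psi> s3 = s3" "\<psi> s4 = s4" "\<psi> s5 = s5"
    by (rule fixq, simp only: Fq_def mem_Collect_eq s1_def s2_def s3_def s4_def s5_def dist, simp only: ac_simps)+
  have viete: "(y - c 0) * (y - c 1) * (y - c 2) * (y - c 3) * (y - c 4)
      = y ^ 5 + - (s1 * y ^ 4) + s2 * y ^ 3 + - (s3 * y ^ 2) + s4 * y + - s5" for y
    unfolding s1_def s2_def s3_def s4_def s5_def by (simp add: eval_nat_numeral algebra_simps)
  have "g ^ 5 + - (s1 * g ^ 4) + s2 * g ^ 3 + - (s3 * g ^ 2) + s4 * g + - s5 = 0"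
    unfolding viete[symmetric] by (simp add: c_def)
  then have "\<psi> (g ^ 5 + - (s1 * g ^ 4) + s2 * g ^ 3 + - (s3 * g ^ 2) + s4 * g + - s5) = 0"
    using zero by simp
  then have "(\<psi> g - c 0) * (\<psi> g - c 1) * (\<psi> g - c 2) * (\<psi> g - c 3) * (\<psi> g - c 4) = 0"
    unfolding viete add neg mult pow sF .
  then have "\<exists>j. \<psi> g = c j" by auto
  then obtain j where j: "\<psi> g = g ^ (q ^ j)" unfolding c_def by blast
  have "\<psi> x = x ^ (q ^ j)" for x
  proof (cases "x = 0")
    case True
    then show ?thesis using zero q_ge2 by (simp add: zero_power)
  next
    case False
    then obtain n where "x = g ^ n" using g by blast
    then show ?thesis by (simp add: pow j mult.commute flip: power_mult)
  qed
  then show ?thesis by blast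
qed

end

lemma functional_vector:
  fixes F :: "'b::field ^ 'n \<Rightarrow> 'b"
  assumes "\<And>u v. F (u + v) = F u + F v" "\<And>k u. F (k *s u) = k * F u"
  shows "\<exists>c. \<forall>u. F u = dot c u"
proof (intro exI allI)
  fix u :: "'b ^ 'n"
  have "F 0 = 0" using assms(2)[of 0 0] by simp
  then have s: "F (\<Sum>i\<in>A. h i) = (\<Sum>i\<in>A. F (h i))" for A and h :: "'n \<Rightarrow> 'b ^ 'n"
    by (induction A rule: infinite_finite_induct) (simp_all add: assms)
  have "F u = F (\<Sum>i\<in>UNIV. u $ i *s axis i 1)" by (simp add: basis_expansion)
  also have "\<dots> = dot (\<chi> i. F (axis i 1)) u" by (simp add: s assms scalar_product_def mult.commute)
  finally show "F u = dot (\<chi> i. F (axis i 1)) u" .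
qed

lemma semilinear_image_subspace:
  fixes g :: "'b::field ^ 'n \<Rightarrow> 'b ^ 'm"
  assumes "\<And>u v. g (u + v) = g u + g v" "\<And>c u. g (c *s u) = \<psi> c *s g u" "surj \<psi>" "vec.subspace Y"
  shows "vec.subspace (g ` Y)"
proof (rule vec.subspaceI)
  have "g 0 = 0" using assms(1)[of 0 0] by simp
  then show "0 \<in> g ` Y" using vec.subspace_0[OF assms(4)] by force
  show "x + y \<in> g ` Y" if "x \<in> g ` Y" "y \<in> g ` Y" for x y
    using that vec.subspace_add[OF assms(4)] by (auto simp flip: assms(1))
  show "c *s x \<in> g ` Y" if xY: "x \<in> g ` Y" for c x
  proof -
    obtain d where "c = \<psi> d" using assms(3) by (metis surjD)
    then show ?thesis using xY vec.subspace_scale[OF assms(4)] by (auto simp flip: assms(2))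
  qed
qed

lemma scale_subspace_image: "vec.subspace S \<Longrightarrow> k \<noteq> 0 \<Longrightarrow> (\<lambda>x. k *s x) ` S = S" for S :: "('b::field ^ 'n) set"
proof (intro equalityI subsetI)
  fix x assume "vec.subspace S" "k \<noteq> 0" "x \<in> S"
  then have "inverse k *s x \<in> S" "x = k *s (inverse k *s x)"
    by (simp_all add: vec.subspace_scale vector_smult_assoc)
  then show "x \<in> (\<lambda>x. k *s x) ` S" by blast
qed (auto intro: vec.subspace_scale)

section \<open>Projections and the pointwise stabilizer of the subgeometry\<close>

context quintic
begin

lemma pair_eq_0_iff:
  assumes "vec.subspace \<Gamma>" "vec.dim \<Gamma> = 3" "A0 \<in> perp \<Gamma>" "B0 \<in> perp \<Gamma>" "vec.dim {A0, B0} = 2"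
  shows "pair A0 B0 w = 0 \<longleftrightarrow> w \<in> \<Gamma>"
proof -
  have "vec.dim (perp \<Gamma>) = 2" by (simp add: dim_perp assms(2))
  then have "perp \<Gamma> = vec.span {A0, B0}"
    using subspace_dim2_span[OF subspace_perp _ assms(3,4,5)] by blast
  then have "\<Gamma> = perp {A0, B0}" using perp_perp[OF assms(1)] by (simp add: perp_span)
  then show ?thesis by (simp add: pair_eq_0 perp_iff dot_commute[of w])
qed

text \<open>Projecting onto \<open>\<Lambda>\<close> and evaluating two functionals that cut out
  \<open>\<Gamma>\<close> differ by a linear isomorphism of the plane. So the auxiliary line and its
  coordinates disappear, and the basis of the annihilator of \<open>\<Gamma>\<close> can be chosen
  to suit the normal form.\<close>

lemma projection_equiv:
  assumes \<Gamma>: "vec.subspace \<Gamma>" "vec.dim \<Gamma> = 3" and L: "is_projection \<Gamma> \<Sigma> L"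
    and \<Sigma>: "\<Sigma> = pt ` S" and AB: "A0 \<in> perp \<Gamma>" "B0 \<in> perp \<Gamma>" "vec.dim {A0, B0} = 2"
  shows "PGammaL_equiv L ((\<lambda>w. pt (pair A0 B0 w)) ` S)"
    and "card ((\<lambda>w. pt (pair A0 B0 w)) ` S) = card L"
proof -
  obtain \<Lambda> h where \<Lambda>: "vec.subspace \<Lambda>" "\<Gamma> \<inter> \<Lambda> = {0}" and hl: "Vector_Spaces.linear (*s) (*s) h"
    and hb: "bij_betw h \<Lambda> UNIV" and L': "L = (\<lambda>P. h ` P) ` projection \<Gamma> \<Lambda> \<Sigma>"
    using L unfolding is_projection_def by blast
  interpret h: Vector_Spaces.linear "(*s)" "(*s)" h by (rule hl)
  define g where "g = pair A0 B0"
  have g_lin: "g (u + v) = g u + g v" "g (k *s u) = k *s g u" for u v k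
    by (simp_all add: g_def pair_linear)
  have g_diff: "g (u - v) = g u - g v" for u v
    using g_lin(1)[of u "(-1) *s v"] g_lin(2)[of "-1" v] by simp
  have ker: "g w = 0 \<longleftrightarrow> w \<in> \<Gamma>" for w unfolding g_def by (rule pair_eq_0_iff[OF \<Gamma> AB])
  have inj: "inj_on g \<Lambda>"
  proof (rule inj_onI)
    fix u v assume uv: "u \<in> \<Lambda>" "v \<in> \<Lambda>" "g u = g v"
    then have "u - v \<in> \<Gamma>" using ker[of "u - v"] by (simp add: g_diff)
    moreover have "u - v \<in> \<Lambda>" using uv \<Lambda>(1) by (simp add: vec.subspace_diff)
    ultimately have "u - v = 0" using \<Lambda>(2) by blast
    then show "u = v" by simp
  qed
  have surj: "g ` \<Lambda> = UNIV"
  proof (rule card_subset_eq)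
    show "card (g ` \<Lambda>) = card (UNIV :: ('a ^ 2) set)"
      using bij_betw_same_card[OF hb] by (simp add: card_image[OF inj])
  qed auto
  define k where "k = inv_into \<Lambda> h"
  have hinj: "inj_on h \<Lambda>" using hb by (simp add: bij_betw_def)
  have k\<Lambda>: "k v \<in> \<Lambda>" "h (k v) = v" for v
    using hb unfolding k_def bij_betw_def by (auto intro: inv_into_into f_inv_into_f)
  have kh: "k (h x) = x" if "x \<in> \<Lambda>" for x using that hinj by (simp add: k_def)
  have k_add: "k (u + v) = k u + k v" for u v
    using kh[of "k u + k v"] k\<Lambda> \<Lambda>(1) by (simp add: h.add vec.subspace_add)
  have k_scale: "k (c *s u) = c *s k u" for c u
    using kh[of "c *s k u"] k\<Lambda> \<Lambda>(1) by (simp add: h.scale vec.subspace_scale)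
  \<comment> \<open>\<open>k\<close> inverts the coordinates \<open>h\<close> on
    \<open>\<Lambda>\<close>, and \<open>T\<close> passes from these to the coordinates given by
    \<open>A0\<close> and \<open>B0\<close>.\<close>
  define T where "T v = g (k v)" for v
  have T_lin: "T (u + v) = T u + T v" "T (c *s u) = c *s T u" for u v c
    by (simp_all add: T_def k_add k_scale g_lin)
  have Tinj: "inj T"
  proof (rule injI)
    fix u v assume "T u = T v"
    then have "k u = k v" using inj k\<Lambda>(1) by (simp add: T_def inj_on_eq_iff)
    then show "u = v" using k\<Lambda>(2) by metis
  qed
  have "surj T"
  proof (rule surjI)
    fix y
    have "inv_into \<Lambda> g y \<in> \<Lambda>" "g (inv_into \<Lambda> g y) = y"
      using surj by (auto intro: inv_into_into f_inv_into_f)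
    then show "T (h (inv_into \<Lambda> g y)) = y" by (simp add: T_def kh)
  qed
  then have "bij T" using Tinj by (simp add: bij_def)
  moreover have "field_aut (\<lambda>x::'a. x)" by (simp add: field_aut_def bij_def inj_def surj_def)
  ultimately have "T \<in> GammaL" using T_lin unfolding GammaL_def by blast
  then have \<kappa>: "collineation T \<in> PGammaL" by (simp add: PGammaL_def)
  define Q where "Q w = vec.span (\<Gamma> \<union> pt w) \<inter> \<Lambda>" for w
  have TQ: "T ` h ` Q w = pt (g w)" for w
  proof -
    have "T ` h ` Q w = g ` Q w"
      unfolding image_image T_def by (rule image_cong) (auto simp: Q_def kh)
    also have "\<dots> = pt (g w)"
    proof (intro equalityI subsetI)
      fix y assume "y \<in> g ` Q w"
      then obtain x where x: "y = g x" "x \<in> vec.span (\<Gamma> \<union> pt w)" by (auto simp: Q_def)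
      then obtain v p where vp: "x = v + p" "v \<in> vec.span \<Gamma>" "p \<in> vec.span (pt w)"
        unfolding vec.span_Un by blast
      have "v \<in> \<Gamma>" using vp(2) vec.span_eq_iff[THEN iffD2, OF \<Gamma>(1)] by simp
      moreover obtain r where "p = r *s w" using vp(3) unfolding pt_def vec.span_span in_span_1 by blast
      ultimately have "y = r *s g w" using x vp ker by (simp add: g_lin)
      then show "y \<in> pt (g w)" by (auto simp: pt_def in_span_1)
    next
      fix y assume "y \<in> pt (g w)"
      then obtain r where r: "y = r *s g w" by (auto simp: pt_def in_span_1)
      obtain x where x: "x \<in> \<Lambda>" "g x = y" using surj by (metis UNIV_I imageE)
      then have "x - r *s w \<in> \<Gamma>" using ker[of "x - r *s w"] r by (simp add: g_diff g_lin)
      moreover have "r *s w \<in> pt w" by (auto simp: pt_def in_span_1)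
      ultimately have "(x - r *s w) + r *s w \<in> vec.span (\<Gamma> \<union> pt w)"
        by (intro vec.span_add) (auto intro: vec.span_base)
      then show "y \<in> g ` Q w" using x by (auto simp: Q_def)
    qed
    finally show ?thesis .
  qed
  have sub: "h ` Q w \<in> subspaces" for w
    unfolding subspaces_def Q_def using \<Lambda>(1)
    by (auto intro!: semilinear_image_subspace[where \<psi> = "\<lambda>x. x"] vec.subspace_inter simp: h.add h.scale)
  have LQ: "L = (\<lambda>w. h ` Q w) ` S"
    unfolding L' projection_def \<Sigma> Q_def by auto
  have im: "collineation T ` L = (\<lambda>w. pt (pair A0 B0 w)) ` S"
    unfolding LQ image_image collineation_def
    by (rule image_cong) (simp_all add: sub TQ, simp add: g_def)
  show "PGammaL_equiv L ((\<lambda>w. pt (pair A0 B0 w)) ` S)"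
    unfolding PGammaL_equiv_def using \<kappa> im by blast
  have "inj_on (collineation T) L"
  proof (rule inj_onI)
    fix C C' assume C: "C \<in> L" "C' \<in> L" "collineation T C = collineation T C'"
    have "C \<in> subspaces" "C' \<in> subspaces" using C(1,2) sub unfolding LQ by blast+
    then have "T ` C = T ` C'" using C(3) by (simp add: collineation_def)
    then show "C = C'" by (simp add: inj_image_eq_iff[OF Tinj])
  qed
  then show "card ((\<lambda>w. pt (pair A0 B0 w)) ` S) = card L"
    unfolding im[symmetric] by (rule card_image)
qed

lemma Ph_surj: "\<exists>y. x = Ph n y" for x :: "'a ^ 'n"
  using Ph_inv[of n x] by metis

lemma scalar_frob_surj: "surj (\<lambda>c::'a. c ^ (q ^ n))"
proof (rule surjI)
  fix c :: 'a
  have "Ph n (Ph (4 * n) (\<chi> i. c)) = (\<chi> i::5. c)" by (rule Ph_inv)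
  then show "(c ^ (q ^ (4 * n))) ^ (q ^ n) = c" by (simp add: frob_def vec_eq_iff)
qed

lemma Ph_image_subspace: "vec.subspace Y \<Longrightarrow> vec.subspace (Ph n ` Y)" for Y :: "('a ^ 5) set"
  by (rule semilinear_image_subspace[where \<psi> = "\<lambda>c. c ^ (q ^ n)"]) (simp_all add: Ph_linear scalar_frob_surj)

lemma Ph_image_perp: "Ph n ` perp {f, w} = perp {Ph n f, Ph n w}" for f w :: "'a ^ 5"
proof (intro equalityI subsetI)
  fix x assume x: "x \<in> perp {Ph n f, Ph n w}"
  obtain y where y: "x = Ph n y" using Ph_surj by blast
  then have "y \<in> perp {f, w}" using x q_ge2 by (simp add: perp_iff dot_Ph)
  with y show "x \<in> Ph n ` perp {f, w}" by blast
qed (use q_ge2 in \<open>auto simp: perp_iff dot_Ph zero_power\<close>)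

lemma rational_axis: "\<forall>i. (axis k 1 :: 'a ^ 5) $ i \<in> Fq q"
  using Fq_closed(3,4) by (simp add: axis_def)

text \<open>A semilinear map that fixes the points of a frame is, in those coordinates, a scalar
  times a field automorphism, and fixing all rational points makes the automorphism trivial on
  \<open>Fq q\<close>, hence a power of Frobenius. For j divisible by 5 the generated group would be
  trivial, although Frobenius itself stabilizes the rational points and moves others.\<close>

lemma stabilizer_frobenius:
  fixes f0 :: "'a ^ 5 \<Rightarrow> 'a ^ 5"
  defines "R \<equiv> {u :: 'a ^ 5. u \<noteq> 0 \<and> (\<forall>i. u $ i \<in> Fq q)}"
  assumes f0: "Vector_Spaces.linear (*s) (*s) f0" "bij f0"
    and \<sigma>: "\<sigma> \<in> pointwise_stabilizer ((\<lambda>u. pt (f0 u)) ` R)"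
    and gen: "generate (BijGroup subspaces) {\<sigma>} = pointwise_stabilizer ((\<lambda>u. pt (f0 u)) ` R)"
  obtains j where "j mod 5 \<noteq> 0" "\<forall>Y. vec.subspace Y \<longrightarrow> \<sigma> (f0 ` Y) = f0 ` Ph j ` Y"
proof -
  interpret f0: Vector_Spaces.linear "(*s)" "(*s)" f0 by (rule f0(1))
  have f0inj: "f0 x = f0 y \<longleftrightarrow> x = y" for x y using f0(2) by (simp add: bij_def inj_eq)
  have f0surj: "\<exists>x. y = f0 x" for y using f0(2) by (metis bij_pointE)
  obtain F \<psi> where F: "\<sigma> = collineation F" "bij F" "\<And>u v. F (u + v) = F u + F v"
    "field_aut \<psi>" "\<And>c v. F (c *s v) = \<psi> c *s F v"
    using \<sigma> unfolding pointwise_stabilizer_def PGammaL_def GammaL_def by blast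
  have ptS: "pt v \<in> subspaces" for v :: "'a ^ 5" by (simp add: pt_def subspaces_def)
  have fixed_pt: "\<exists>k. F (f0 u) = k *s f0 u" if "u \<in> R" for u
  proof -
    have "\<sigma> (pt (f0 u)) = pt (f0 u)" using \<sigma> that by (auto simp: pointwise_stabilizer_def)
    then have "F ` pt (f0 u) = pt (f0 u)" by (simp add: F(1) collineation_def ptS)
    moreover have "f0 u \<in> pt (f0 u)" by (simp add: pt_def vec.span_base)
    ultimately have "F (f0 u) \<in> pt (f0 u)" by blast
    then show ?thesis by (simp add: pt_def in_span_1)
  qed
  have axR: "axis i 1 \<in> R" for i using rational_axis by (simp add: R_def axis_eq_0_iff)
  have "\<forall>i. \<exists>l. F (f0 (axis i 1)) = l *s f0 (axis i 1)" using fixed_pt axR by blast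
  then obtain l where l: "\<And>i. F (f0 (axis i 1)) = l i *s f0 (axis i 1)" by metis
  have F0: "F 0 = 0" using F(3)[of 0 0] by simp
  have Fs: "F (\<Sum>i\<in>A. h i) = (\<Sum>i\<in>A. F (h i))" for A and h :: "5 \<Rightarrow> 'a ^ 5"
    by (induction A rule: infinite_finite_induct) (simp_all add: F(3) F0)
  have Fx: "F (f0 x) = f0 (\<chi> i. l i * \<psi> (x $ i))" for x
  proof -
    have "F (f0 x) = F (f0 (\<Sum>i\<in>UNIV. x $ i *s axis i 1))" by (simp add: basis_expansion)
    also have "\<dots> = (\<Sum>i\<in>UNIV. \<psi> (x $ i) *s (l i *s f0 (axis i 1)))"
      by (simp add: f0.sum f0.scale Fs F(5) l)
    also have "\<dots> = f0 (\<Sum>i\<in>UNIV. (l i * \<psi> (x $ i)) *s axis i 1)"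
      by (simp add: f0.sum f0.scale vector_smult_assoc mult.commute)
    also have "(\<Sum>i\<in>UNIV. (l i * \<psi> (x $ i)) *s axis i 1) = (\<chi> i. l i * \<psi> (x $ i))"
      using basis_expansion[of "\<chi> i. l i * \<psi> (x $ i)"] by simp
    finally show ?thesis .
  qed
  have \<psi>1: "\<psi> 1 = 1" using F(4) by (simp add: field_aut_def)
  have eig: "\<exists>k. \<forall>i. l i * \<psi> (x $ i) = k * x $ i" if x: "x \<in> R" for x
  proof -
    obtain k where "F (f0 x) = k *s f0 x" using fixed_pt[OF x] by blast
    then have "f0 (\<chi> i. l i * \<psi> (x $ i)) = f0 (k *s x)" by (simp add: Fx f0.scale)
    then have "(\<chi> i. l i * \<psi> (x $ i)) = k *s x" by (simp only: f0inj)
    then show ?thesis by (auto simp: vec_eq_iff)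
  qed
  \<comment> \<open>The unit point of the frame forces the five eigenvalues \<open>l i\<close> to
    coincide.\<close>
  have "(\<chi> i. 1) \<in> R" using Fq_closed(4) by (simp add: R_def vec_eq_iff)
  from eig[OF this] obtain m where m: "\<And>i. l i = m" by (auto simp: \<psi>1)
  have m0: "m \<noteq> 0"
  proof
    assume "m = 0"
    then have "F (f0 (axis 1 1)) = F 0" using l[of 1] by (simp add: m F0)
    then have "f0 (axis 1 1) = f0 0" using F(2) by (simp add: bij_def inj_eq)
    then show False by (simp only: f0inj axis_eq_0_iff) simp
  qed
  have \<psi>fix: "\<psi> x = x" if x: "x \<in> Fq q" for x
  proof -
    \<comment> \<open>The entry 1 identifies the eigenvalue as \<open>m\<close>, after which the
      entry \<open>x\<close> shows that \<open>\<psi>\<close> fixes it.\<close>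
    define v :: "'a ^ 5" where "v = (\<chi> i. if i = 1 then x else 1)"
    have "v $ 2 = 1" "v $ 1 = x" by (simp_all add: v_def)
    moreover have "v \<noteq> 0" using \<open>v $ 2 = 1\<close> by (metis zero_index zero_neq_one)
    then have "v \<in> R" using x Fq_closed(4) by (simp add: R_def v_def)
    ultimately obtain k where "m * \<psi> x = k * x" "m * \<psi> 1 = k * 1" using eig[of v] m by metis
    then show ?thesis using m0 \<psi>1 by simp
  qed
  obtain j where j: "\<And>x. \<psi> x = x ^ (q ^ j)" using automorphism_is_frobenius[OF F(4) \<psi>fix] by blast
  have Fj: "F (f0 x) = f0 (m *s Ph j x)" for x
  proof -
    have "(\<chi> i. l i * \<psi> (x $ i)) = m *s Ph j x" by (simp add: vec_eq_iff frob_def m j)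
    then show ?thesis by (simp add: Fx)
  qed
  have f0sub: "vec.subspace (f0 ` Y)" if "vec.subspace Y" for Y
    by (rule semilinear_image_subspace[where \<psi> = "\<lambda>x. x", OF _ _ _ that]) (simp_all add: f0.add f0.scale)
  have act: "\<sigma> (f0 ` Y) = f0 ` Ph j ` Y" if Y: "vec.subspace Y" for Y
  proof -
    have "\<sigma> (f0 ` Y) = F ` f0 ` Y" using f0sub[OF Y] by (simp add: F(1) collineation_def subspaces_def)
    also have "\<dots> = f0 ` ((\<lambda>x. m *s x) ` Ph j ` Y)" by (simp add: image_image Fj)
    also have "(\<lambda>x. m *s x) ` Ph j ` Y = Ph j ` Y"
      by (rule scale_subspace_image[OF Ph_image_subspace[OF Y] m0])
    finally show ?thesis .
  qed
  have "j mod 5 \<noteq> 0"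
  proof
    assume j0: "j mod 5 = 0"
    have "Ph j x = x" for x :: "'a ^ 5" using frob_q_mod[of j x] j0 by simp
    then have idY: "\<sigma> (f0 ` Y) = f0 ` Y" if "vec.subspace Y" for Y using act[OF that] by simp
    have id: "\<sigma> C = C" if C: "C \<in> subspaces" for C
    proof -
      define Y where "Y = {u. f0 u \<in> C}"
      have "vec.subspace Y"
        using C by (auto simp: Y_def subspaces_def vec.subspace_def f0.add f0.scale f0.zero)
      moreover have "C = f0 ` Y"
      proof (intro equalityI subsetI)
        fix x assume x: "x \<in> C"
        obtain u where "x = f0 u" using f0surj by blast
        with x show "x \<in> f0 ` Y" by (simp add: Y_def)
      qed (auto simp: Y_def)
      ultimately show ?thesis using idY by simp
    qed
    \<comment> \<open>The q-power Frobenius transported by \<open>f0\<close>: a member of the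
      stabilizer that a trivial group would have to contain as the identity.\<close>
    define F1 where "F1 y = f0 (Ph 1 (inv_into UNIV f0 y))" for y
    have inv_f0: "inv_into UNIV f0 (f0 x) = x" for x using f0(2) by (simp add: bij_def)
    have F1: "F1 (f0 x) = f0 (Ph 1 x)" for x by (simp add: F1_def inv_f0)
    have PhB: "bij (Ph 1 :: 'a ^ 5 \<Rightarrow> _)"
    proof (rule bijI)
      show "inj (Ph 1 :: 'a ^ 5 \<Rightarrow> _)"
        by (rule injI) (simp only: additive_power.frob_eq_iff[OF additive_a])
      show "surj (Ph 1 :: 'a ^ 5 \<Rightarrow> _)" unfolding surj_def by (intro allI Ph_surj)
    qed
    have "bij F1" unfolding F1_def[abs_def]
      using bij_comp[OF bij_comp[OF bij_imp_bij_inv[OF f0(2)] PhB] f0(2)] by (simp add: comp_def)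
    moreover have "F1 (u + v) = F1 u + F1 v" for u v
    proof -
      obtain x y where "u = f0 x" "v = f0 y" using f0surj by blast
      then show ?thesis by (metis F1 Ph_linear(1) f0.add)
    qed
    moreover have "F1 (c *s u) = c ^ (q ^ 1) *s F1 u" for c u
    proof -
      obtain x where "u = f0 x" using f0surj by blast
      then show ?thesis by (metis F1 Ph_linear(2) f0.scale)
    qed
    moreover have "field_aut (\<lambda>c::'a. c ^ (q ^ 1))"
      using additive_power.power_add[OF additive_a[of 1]] additive_power.power_eq_iff[OF additive_a[of 1]]
        scalar_frob_surj[of 1] by (simp add: field_aut_def bij_def inj_def power_mult_distrib)
    ultimately have "F1 \<in> GammaL" unfolding GammaL_def by blast
    moreover have "collineation F1 P = P" if PR: "P \<in> (\<lambda>u. pt (f0 u)) ` R" for P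
    proof -
      obtain u where u: "u \<in> R" "P = pt (f0 u)" using PR by blast
      have "Ph 1 (r *s u) = r ^ (q ^ 1) *s u" for r
        using rational_Ph[of u 1] u(1) Ph_linear(2)[of 1 r u] by (simp add: R_def)
      then have "F1 (r *s f0 u) = f0 (r ^ (q ^ 1) *s u)" for r by (simp only: f0.scale[symmetric] F1)
      then have "F1 ` pt (f0 u) = (\<lambda>r. f0 (r ^ (q ^ 1) *s u)) ` UNIV"
        unfolding pt_def vec.span_singleton image_image by (simp only:)
      also have "\<dots> = (\<lambda>r. r *s f0 u) ` (\<lambda>r. r ^ (q ^ 1)) ` UNIV" by (simp add: image_image f0.scale)
      also have "\<dots> = pt (f0 u)" unfolding scalar_frob_surj pt_def vec.span_singleton ..
      finally show ?thesis by (simp add: u(2) collineation_def ptS)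
    qed
    ultimately have c1: "collineation F1 \<in> generate (BijGroup subspaces) {\<sigma>}"
      unfolding gen pointwise_stabilizer_def PGammaL_def by blast
    have grp: "group (BijGroup (subspaces :: ('a ^ 5) set set))" by (rule group_BijGroup)
    have "\<sigma> = (\<lambda>C\<in>subspaces. C)" using id by (auto simp: F(1) collineation_def fun_eq_iff)
    then have one: "\<sigma> = \<one>\<^bsub>BijGroup subspaces\<^esub>" by (simp add: BijGroup_def)
    have "x = \<one>\<^bsub>BijGroup subspaces\<^esub>" if "x \<in> generate (BijGroup subspaces) {\<sigma>}" for x
      using that
    proof (induction rule: generate.induct)
      case (inv h)
      then show ?case using one monoid.inv_one[OF group.is_monoid[OF grp]] by auto
    next
      case (eng h1 h2)
      then show ?case using monoid.l_one[OF group.is_monoid[OF grp]] monoid.one_closed[OF group.is_monoid[OF grp]]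
        by simp
    qed (simp_all add: one)
    with c1 have "collineation F1 = \<sigma>" unfolding one by blast
    then have F1id: "F1 ` C = C" if "C \<in> subspaces" for C :: "('a ^ 5) set"
      using id[OF that] that by (metis collineation_def restrict_apply')
    have "card (Fq q :: 'a set) < CARD('a)"
      unfolding card_Fq card_field using q_ge2 power_strict_increasing[of 1 5 q] by simp
    then have "(Fq q :: 'a set) \<noteq> UNIV" by auto
    then obtain y :: 'a where y: "y ^ q \<noteq> y" by (auto simp: Fq_def)
    define v :: "'a ^ 5" where "v = (\<chi> i. if i = 1 then y else 1)"
    have "F1 (f0 v) \<in> F1 ` pt (f0 v)" by (simp add: pt_def vec.span_base)
    then have "F1 (f0 v) \<in> pt (f0 v)" using F1id[OF ptS] by blast
    then obtain r where "f0 (Ph 1 v) = f0 (r *s v)" by (auto simp: pt_def in_span_1 F1 f0.scale)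
    then have "Ph 1 v = r *s v" by (simp only: f0inj)
    then have "(v $ 2) ^ q = r * v $ 2" "(v $ 1) ^ q = r * v $ 1" by (simp_all add: frob_def vec_eq_iff)
    then show False using y by (simp add: v_def)
  qed
  with that act show thesis by blast
qed

end

section \<open>Ranks of the two points and the classification\<close>

context quintic
begin

lemma mod5_cases: "j mod 5 \<noteq> 0 \<Longrightarrow> j mod 5 \<in> {1, 2, 3, 4::nat}"
proof -
  assume "j mod 5 \<noteq> 0"
  moreover have "j mod 5 < 5" by simp
  ultimately show ?thesis by auto
qed

text \<open>\<open>j\<close> is a unit modulo 5, so the first five iterates of
  \<open>\<sigma>\<close> run through all conjugates of \<open>v\<close>, in another order.\<close>

lemma orbit_rank:
  fixes f0 :: "'a ^ 5 \<Rightarrow> 'a ^ 5"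
  assumes f0: "Vector_Spaces.linear (*s) (*s) f0" "bij f0" and j: "j mod 5 \<noteq> 0"
    and act: "\<forall>n Y. vec.subspace Y \<longrightarrow> (\<sigma> ^^ n) (f0 ` Y) = f0 ` Ph (n * j) ` Y"
    and v: "vec.dim ((\<lambda>i. Ph i v) ` {..<5}) = 5"
  shows "rk \<sigma> (f0 ` vec.span {v}) = 5"
proof -
  interpret f0: Vector_Spaces.linear "(*s)" "(*s)" f0 by (rule f0(1))
  let ?U = "\<Union>i<5. (\<sigma> ^^ i) (f0 ` vec.span {v})"
  have in_U: "f0 (Ph (i * j) v) \<in> ?U" if "i < 5" for i
  proof -
    have "f0 (Ph (i * j) v) \<in> f0 ` Ph (i * j) ` vec.span {v}" by (simp add: vec.span_base)
    then have "f0 (Ph (i * j) v) \<in> (\<sigma> ^^ i) (f0 ` vec.span {v})" using act vec.subspace_span by simp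
    with that show ?thesis by blast
  qed
  have "vec.dim (perp ((\<lambda>i. Ph i v) ` {..<5})) = 0" unfolding dim_perp v by simp
  then have p0: "perp ((\<lambda>i. Ph i v) ` {..<5}) \<subseteq> {0}" by (simp add: vec.dim_eq_0)
  have "c = 0" if c: "c \<in> perp ?U" for c
  proof -
    obtain d where d: "\<forall>u. dot c (f0 u) = dot d u"
      using functional_vector[of "\<lambda>u. dot c (f0 u)"] by (auto simp: f0.add f0.scale dot_simps)
    have "dot d (Ph k v) = 0" if k: "k < 5" for k
    proof -
      have "j mod 5 \<in> {1, 2, 3, 4}" by (rule mod5_cases[OF j])
      moreover have "k \<in> {0, 1, 2, 3, 4}" using k by auto
      moreover have "\<exists>i\<in>{0, 1, 2, 3, 4}. (i * m) mod 5 = k'"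
        if "m \<in> {1, 2, 3, 4}" "k' \<in> {0, 1, 2, 3, 4}" for m k' :: nat
        using that by (elim insertE emptyE) simp_all
      ultimately obtain i where i1: "i \<in> {0, 1, 2, 3, 4}" "(i * (j mod 5)) mod 5 = k" by meson
      have i: "i \<in> {0, 1, 2, 3, 4}" "(i * j) mod 5 = k"
        using i1 mod_mult_right_eq[of i j 5] by simp_all
      have "Ph k v = Ph (i * j) v" by (rule Ph_cong) (use i k in simp)
      moreover have "i < 5" using i(1) by auto
      then have "dot c (f0 (Ph (i * j) v)) = 0" using in_U[of i] c unfolding perp_iff by blast
      ultimately show ?thesis using d by simp
    qed
    then have "d \<in> perp ((\<lambda>i. Ph i v) ` {..<5})" by (simp add: perp_iff)
    then have "d = 0" using p0 by blast
    then have "dot c (f0 u) = 0" for u using d by simp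
    then have "dot c x = 0" for x using f0(2) by (metis bij_pointE)
    then show ?thesis by (rule dot_eq_0_all)
  qed
  then have "perp ?U = {0}" by (auto simp: perp_iff)
  then have "vec.dim ?U = 5" using dim_perp[of ?U] vec.dim_subset[of ?U UNIV]
    by (simp add: vec_dim_card del: vec.dim_UNIV)
  then show ?thesis by (simp add: rk_def)
qed

text \<open>On rational vectors \<open>u\<close>, \<open>dot f u = 0\<close> implies that all
  conjugates of \<open>f\<close> kill \<open>u\<close>, so the map is injective, and both sides have
  q^5 elements. It replaces the rational vector \<open>u\<close> by a field element, the variable in
  the definitions of the linear sets.\<close>

lemma functional_values:
  fixes f :: "'a ^ 5"
  defines "R \<equiv> {u :: 'a ^ 5. u \<noteq> 0 \<and> (\<forall>i. u $ i \<in> Fq q)}"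
  assumes f: "vec.dim ((\<lambda>i. Ph i f) ` {..<5}) = 5"
  shows "(\<lambda>u. dot f u) ` R = UNIV - {0}"
proof -
  let ?Q = "{u :: 'a ^ 5. \<forall>i. u $ i \<in> Fq q}"
  have "vec.dim (perp ((\<lambda>i. Ph i f) ` {..<5})) = 0" unfolding dim_perp f by simp
  then have p0: "perp ((\<lambda>i. Ph i f) ` {..<5}) \<subseteq> {0}" by (simp add: vec.dim_eq_0)
  have zero: "u = 0" if u: "u \<in> ?Q" "dot f u = 0" for u
  proof -
    have "dot (Ph i f) u = 0" for i
    proof -
      have "Ph i u = u" using rational_Ph[of u i] u(1) by simp
      then have "dot (Ph i f) u = dot f u ^ (q ^ i)" using dot_Ph[of i f u] by simp
      then show ?thesis using u(2) q_ge2 by (simp add: zero_power)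
    qed
    then have "u \<in> perp ((\<lambda>i. Ph i f) ` {..<5})" by (simp add: perp_iff dot_commute[of u])
    then show ?thesis using p0 by blast
  qed
  have inj: "inj_on (\<lambda>u. dot f u) ?Q"
  proof (rule inj_onI)
    fix u v assume uv: "u \<in> ?Q" "v \<in> ?Q" "dot f u = dot f v"
    then have "u - v \<in> ?Q" using Fq_closed(2) by simp
    moreover have "dot f (u - v) = 0" using uv(3) by (simp add: dot_simps)
    ultimately have "u - v = 0" by (rule zero)
    then show "u = v" by simp
  qed
  have all: "(\<lambda>u. dot f u) ` ?Q = UNIV"
    by (rule card_subset_eq) (simp_all add: card_image[OF inj] card_rational card_field)
  show ?thesis
  proof (intro equalityI subsetI)
    fix y assume "y \<in> (\<lambda>u. dot f u) ` R"
    then show "y \<in> UNIV - {0}" using zero by (auto simp: R_def)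
  next
    fix y :: 'a assume y: "y \<in> UNIV - {0}"
    have "y \<in> (\<lambda>u. dot f u) ` ?Q" unfolding all by simp
    then obtain u where u: "u \<in> ?Q" "y = dot f u" by (rule imageE)
    then have "u \<noteq> 0" using y by auto
    then show "y \<in> (\<lambda>u. dot f u) ` R" using u by (auto simp: R_def)
  qed
qed

text \<open>In coordinates where the subgeometry is standard, the normal form of the annihilator of
  \<open>\<Gamma>\<close> gives both conclusions: its two functionals are the two coordinates of the
  LP form, and their common zeros with a conjugate give the points
  \<open>\<Gamma> \<inter> (\<sigma> ^^ n) \<Gamma>\<close>.\<close>

lemma classification:
  fixes f0 :: "'a ^ 5 \<Rightarrow> 'a ^ 5"
  defines "R \<equiv> {u :: 'a ^ 5. u \<noteq> 0 \<and> (\<forall>i. u $ i \<in> Fq q)}"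
  assumes f0: "Vector_Spaces.linear (*s) (*s) f0" "bij f0"
    and \<Sigma>: "\<Sigma> = (\<lambda>u. pt (f0 u)) ` R"
    and \<Gamma>: "vec.subspace \<Gamma>" "vec.dim \<Gamma> = 3" "\<forall>P\<in>\<Sigma>. \<not> P \<subseteq> \<Gamma>"
    and L: "is_projection \<Gamma> \<Sigma> L" "card L = (q ^ 5 - 1) div (q - 1)" "\<not> pseudoregulus_type q L"
    and \<sigma>: "\<sigma> \<in> pointwise_stabilizer \<Sigma>"
    and gen: "generate (BijGroup subspaces) {\<sigma>} = pointwise_stabilizer \<Sigma>"
  shows "LP_type q L \<and> \<Gamma> \<inter> (\<sigma> ^^ 4) \<Gamma> \<in> points \<and> \<Gamma> \<inter> (\<sigma> ^^ 3) \<Gamma> \<in> points \<and>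
    (rk \<sigma> (\<Gamma> \<inter> (\<sigma> ^^ 4) \<Gamma>) = 5 \<or> rk \<sigma> (\<Gamma> \<inter> (\<sigma> ^^ 3) \<Gamma>) = 5)"
proof -
  interpret f0: Vector_Spaces.linear "(*s)" "(*s)" f0 by (rule f0(1))
  have f0inj: "f0 x = f0 y \<longleftrightarrow> x = y" for x y using f0(2) by (simp add: bij_def inj_eq)
  have f0surj: "\<exists>x. y = f0 x" for y using f0(2) by (metis bij_pointE)
  have \<Sigma>': "\<Sigma> = pt ` f0 ` R" unfolding \<Sigma> by (simp add: image_image)
  have R\<Gamma>: "f0 u \<notin> \<Gamma>" if u: "u \<in> R" for u
  proof
    assume "f0 u \<in> \<Gamma>"
    then have "pt (f0 u) \<subseteq> \<Gamma>" unfolding pt_def using \<Gamma>(1) by (intro vec.span_minimal) auto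
    moreover have "pt (f0 u) \<in> \<Sigma>" using u by (simp add: \<Sigma>)
    ultimately show False using \<Gamma>(3) by blast
  qed
  have "vec.dim (perp \<Gamma>) = 2" by (simp add: dim_perp \<Gamma>(2))
  then obtain a0 b0 where ab0: "vec.dim {a0, b0} = 2" "a0 \<in> perp \<Gamma>" "b0 \<in> perp \<Gamma>"
    by (rule obtain_basis2[OF subspace_perp])
  \<comment> \<open>\<open>pl\<close> is the transpose of \<open>f0\<close>; it pulls functionals
    back to the coordinates in which the points of \<open>\<Sigma>\<close> are rational.\<close>
  have "\<forall>c. \<exists>d. \<forall>u. dot c (f0 u) = dot d u"
    by (intro allI functional_vector) (simp_all add: f0.add f0.scale dot_simps)
  then obtain pl where pl: "\<And>c u. dot (pl c) u = dot c (f0 u)" by metis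
  define a where "a = pl a0"
  define b where "b = pl b0"
  have pair0: "pair a b u = pair a0 b0 (f0 u)" for u by (simp add: pair_def a_def b_def pl)
  have "scattered a b"
  proof (rule scattered_of_card)
    show "pair a b u \<noteq> 0" if "u \<in> {u :: 'a ^ 5. u \<noteq> 0 \<and> (\<forall>i. u $ i \<in> Fq q)}" for u
      using R\<Gamma>[of u] that pair_eq_0_iff[OF \<Gamma>(1,2) ab0(2,3,1)] by (simp add: pair0 R_def)
    have "{pt (pair a b u) | u. u \<in> R} = (\<lambda>w. pt (pair a0 b0 w)) ` f0 ` R" by (auto simp: pair0)
    then show "card {pt (pair a b u) | u. u \<in> {u :: 'a ^ 5. u \<noteq> 0 \<and> (\<forall>i. u $ i \<in> Fq q)}} = (q ^ 5 - 1) div (q - 1)"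
      using projection_equiv(2)[OF \<Gamma>(1,2) L(1) \<Sigma>' ab0(2,3,1)] L(2) unfolding R_def by simp
  qed
  then obtain f t \<gamma> \<gamma>' where t: "t \<in> {1, 2::nat}" and f5: "vec.dim ((\<lambda>i. Ph i f) ` {..<5}) = 5"
    and \<gamma>0: "\<gamma> \<noteq> 0 \<or> \<gamma>' \<noteq> 0"
    and sp: "vec.span {a, b} = vec.span {f, \<gamma> *s Ph t f + \<gamma>' *s Ph (4 * t) f}"
    and N: "\<gamma> \<noteq> 0 \<Longrightarrow> \<gamma>' \<noteq> 0 \<Longrightarrow> N5 q (\<gamma>' / \<gamma>) \<noteq> 1"
    using normal_form by metis
  define w where "w = \<gamma> *s Ph t f + \<gamma>' *s Ph (4 * t) f"
  have pl_comb: "pl (r *s x + s *s y) = r *s pl x + s *s pl y" for r s x y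
  proof -
    have "dot (pl (r *s x + s *s y) - (r *s pl x + s *s pl y)) u = 0" for u by (simp add: dot_simps pl)
    then have "pl (r *s x + s *s y) - (r *s pl x + s *s pl y) = 0" by (rule dot_eq_0_all)
    then show ?thesis by simp
  qed
  have "f \<in> vec.span {a, b}" "w \<in> vec.span {a, b}" unfolding sp w_def by (simp_all add: vec.span_base)
  then obtain r s r' s' where fw: "f = r *s a + s *s b" "w = r' *s a + s' *s b" unfolding in_span_2 by blast
  define A0 where "A0 = r *s a0 + s *s b0"
  define W0 where "W0 = r' *s a0 + s' *s b0"
  have plA: "pl A0 = f" "pl W0 = w" by (simp_all add: A0_def W0_def pl_comb fw a_def b_def)
  have AW: "A0 \<in> perp \<Gamma>" "W0 \<in> perp \<Gamma>"
    unfolding A0_def W0_def by (intro vec.subspace_add vec.subspace_scale subspace_perp ab0)+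
  have dfw: "vec.dim {f, w} = 2"
  proof -
    have "vec.dim {a, b} = 2"
      unfolding dim2_iff
    proof (intro allI impI)
      fix k l assume 0: "k *s a + l *s b = 0"
      have "dot (k *s a0 + l *s b0) x = 0" for x
      proof -
        obtain u where "x = f0 u" using f0surj by blast
        moreover have "dot (k *s a + l *s b) u = 0" using 0 by simp
        ultimately show ?thesis by (simp add: dot_simps a_def b_def pl)
      qed
      then have "k *s a0 + l *s b0 = 0" by (rule dot_eq_0_all)
      from dim2D[OF ab0(1) this] show "k = 0 \<and> l = 0" .
    qed
    then have "vec.dim (vec.span {f, w}) = 2" unfolding w_def sp[symmetric] by simp
    then show ?thesis by simp
  qed
  have pl0: "pl (k *s x + l *s y) = 0" if "k *s x + l *s y = 0" for k l x y
    using that dot_eq_0_all[of "pl 0"] pl[of 0] by simp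
  have dAW: "vec.dim {A0, c *s W0} = 2" if c: "c \<noteq> 0" for c
    unfolding dim2_iff
  proof (intro allI impI)
    fix k l assume "k *s A0 + l *s (c *s W0) = 0"
    then have "k *s A0 + (l * c) *s W0 = 0" by (simp add: vector_smult_assoc)
    from pl0[OF this] have "k *s f + (l * c) *s w = 0" by (simp add: pl_comb plA)
    from dim2D[OF dfw this] show "k = 0 \<and> l = 0" using c by simp
  qed
  \<comment> \<open>The free factor \<open>c\<close> rescales the second coordinate; below it is
    taken as the inverse of \<open>\<gamma>\<close> or of \<open>\<gamma>'\<close>.\<close>
  have equiv: "PGammaL_equiv L {pt (vector [y, c * (\<gamma> * y ^ (q ^ t) + \<gamma>' * y ^ (q ^ (4 * t)))]) | y. y \<noteq> 0}"
    if c: "c \<noteq> 0" for c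
  proof -
    let ?p = "\<lambda>y. pt (vector [y, c * (\<gamma> * y ^ (q ^ t) + \<gamma>' * y ^ (q ^ (4 * t)))] :: 'a ^ 2)"
    have "pair A0 (c *s W0) (f0 u)
        = vector [dot f u, c * (\<gamma> * dot f u ^ (q ^ t) + \<gamma>' * dot f u ^ (q ^ (4 * t)))]" if u: "u \<in> R" for u
    proof -
      have "Ph n u = u" for n using rational_Ph[of u n] u by (simp add: R_def)
      then have "dot (Ph n f) u = dot f u ^ (q ^ n)" for n using dot_Ph[of n f u] by simp
      then have "dot w u = \<gamma> * dot f u ^ (q ^ t) + \<gamma>' * dot f u ^ (q ^ (4 * t))" by (simp add: w_def dot_simps)
      moreover have "dot A0 (f0 u) = dot f u" "dot W0 (f0 u) = dot w u" by (simp_all flip: pl add: plA)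
      ultimately show ?thesis by (simp add: pair_def dot_simps)
    qed
    then have "(\<lambda>w. pt (pair A0 (c *s W0) w)) ` f0 ` R = ?p ` (\<lambda>u. dot f u) ` R"
      unfolding image_image by (intro image_cong) simp_all
    also have "\<dots> = ?p ` (UNIV - {0})" using functional_values[OF f5] unfolding R_def by simp
    also have "\<dots> = {?p y | y. y \<noteq> 0}" by auto
    finally show ?thesis
      using projection_equiv(1)[OF \<Gamma>(1,2) L(1) \<Sigma>' AW(1) _ dAW[OF c]] AW(2)
      by (simp add: vec.subspace_scale)
  qed
  have "gcd 1 5 = (1::nat)" "gcd 2 5 = (1::nat)" "gcd 4 5 = (1::nat)" "gcd 8 5 = (1::nat)"
    by (simp_all add: gcd_non_0_nat)
  then have gcds: "gcd t 5 = 1" "gcd (4 * t) 5 = 1" "t < 5" using t by auto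
  \<comment> \<open>If one coefficient vanishes, a single Frobenius power remains and the set is of
    pseudoregulus type. So both are nonzero, and \<open>norm_condition\<close> applies.\<close>
  have \<gamma>: "\<gamma> \<noteq> 0"
  proof
    assume g0: "\<gamma> = 0"
    then have "\<gamma>' \<noteq> 0" using \<gamma>0 by simp
    then have e: "PGammaL_equiv L {pt (vector [y, y ^ (q ^ (4 * t))]) | y. y \<noteq> 0}"
      using equiv[of "inverse \<gamma>'"] by (simp add: g0 flip: mult.assoc)
    have "pseudoregulus_type q L"
      unfolding pseudoregulus_type_def by (rule exI[of _ "4 * t"], rule conjI[OF gcds(2) e])
    with L(3) show False ..
  qed
  have \<gamma>': "\<gamma>' \<noteq> 0"
  proof
    assume g0: "\<gamma>' = 0"
    have e: "PGammaL_equiv L {pt (vector [y, y ^ (q ^ t)]) | y. y \<noteq> 0}"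
      using equiv[of "inverse \<gamma>"] \<gamma> by (simp add: g0 flip: mult.assoc)
    have "pseudoregulus_type q L"
      unfolding pseudoregulus_type_def by (rule exI[of _ t], rule conjI[OF gcds(1) e])
    with L(3) show False ..
  qed
  have LP: "LP_type q L"
  proof -
    have "y ^ (q ^ (4 * t)) = y ^ (q ^ (5 - t))" for y :: 'a
    proof -
      have "Ph (4 * t) (\<chi> i. y) = Ph (5 - t) (\<chi> i::5. y)" by (rule Ph_cong) (use t in auto)
      then show ?thesis by (simp add: frob_def vec_eq_iff)
    qed
    moreover have "inverse \<gamma> * (\<gamma> * x + \<gamma>' * y) = x + \<gamma>' / \<gamma> * y" for x y using \<gamma> by (simp add: field_simps)
    ultimately have e: "PGammaL_equiv L {pt (vector [y, y ^ (q ^ t) + \<gamma>' / \<gamma> * y ^ (q ^ (5 - t))]) | y. y \<noteq> 0}"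
      using equiv[of "inverse \<gamma>"] \<gamma> by simp
    have n: "N5 q (\<gamma>' / \<gamma>) \<notin> {0, 1}" using N[OF \<gamma> \<gamma>'] \<gamma> \<gamma>' by (simp add: N5_def)
    show ?thesis unfolding LP_type_def
      by (rule exI[of _ t], rule exI[of _ "\<gamma>' / \<gamma>"], intro conjI, rule gcds(3), rule gcds(1), rule n, rule e)
  qed
  obtain j where j: "j mod 5 \<noteq> 0" and act1: "\<forall>Y. vec.subspace Y \<longrightarrow> \<sigma> (f0 ` Y) = f0 ` Ph j ` Y"
    by (rule stabilizer_frobenius[OF f0 \<sigma>[unfolded \<Sigma> R_def] gen[unfolded \<Sigma> R_def]])
  have act: "(\<sigma> ^^ n) (f0 ` Y) = f0 ` Ph (n * j) ` Y" if Y: "vec.subspace Y" for n Y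
  proof (induction n)
    case 0
    have "Ph 0 ` Y = Y" by (simp only: Ph_0 image_ident)
    then show ?case by simp
  next
    case (Suc n)
    have "(\<sigma> ^^ Suc n) (f0 ` Y) = \<sigma> (f0 ` Ph (n * j) ` Y)" using Suc by simp
    also have "\<dots> = f0 ` Ph j ` Ph (n * j) ` Y" using act1 Ph_image_subspace[OF Y] by blast
    also have "Ph j ` Ph (n * j) ` Y = Ph (Suc n * j) ` Y" by (simp add: image_image Ph_add)
    finally show ?case .
  qed
  have \<Gamma>Y: "\<Gamma> = f0 ` perp {f, w}"
  proof -
    have "f0 u \<in> \<Gamma> \<longleftrightarrow> u \<in> perp {f, w}" for u
    proof -
      have "f0 u \<in> \<Gamma> \<longleftrightarrow> pair A0 W0 (f0 u) = 0"
        using pair_eq_0_iff[OF \<Gamma>(1,2) AW] dAW[of 1] by simp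
      also have "\<dots> \<longleftrightarrow> u \<in> perp {f, w}" by (simp add: pair_eq_0 perp_iff dot_commute[of u] plA flip: pl)
      finally show ?thesis .
    qed
    note iff = this
    show ?thesis
    proof (intro equalityI subsetI)
      fix x assume x: "x \<in> \<Gamma>"
      obtain u where "x = f0 u" using f0surj by blast
      with x show "x \<in> f0 ` perp {f, w}" by (simp add: iff)
    qed (auto simp: iff)
  qed
  have meet: "\<Gamma> \<inter> (\<sigma> ^^ n) \<Gamma> = f0 ` perp {f, w, Ph (n * j) f, Ph (n * j) w}" for n
  proof -
    have "(\<sigma> ^^ n) \<Gamma> = f0 ` perp {Ph (n * j) f, Ph (n * j) w}"
      unfolding \<Gamma>Y act[OF subspace_perp] Ph_image_perp ..
    then have "\<Gamma> \<inter> (\<sigma> ^^ n) \<Gamma> = f0 ` (perp {f, w} \<inter> perp {Ph (n * j) f, Ph (n * j) w})"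
      using \<Gamma>Y f0(2) by (simp add: image_Int bij_def)
    also have "perp {f, w} \<inter> perp {Ph (n * j) f, Ph (n * j) w} = perp {f, w, Ph (n * j) f, Ph (n * j) w}"
      by (auto simp: perp_iff)
    finally show ?thesis .
  qed
  have actall: "\<forall>n Y. vec.subspace Y \<longrightarrow> (\<sigma> ^^ n) (f0 ` Y) = f0 ` Ph (n * j) ` Y" using act by blast
  have point: "\<Gamma> \<inter> (\<sigma> ^^ n) \<Gamma> \<in> points \<and>
      ((n * j) mod 5 = t \<or> (n * j) mod 5 = (4 * t) mod 5 \<longrightarrow> rk \<sigma> (\<Gamma> \<inter> (\<sigma> ^^ n) \<Gamma>) = 5)"
    if n: "(n * j) mod 5 \<noteq> 0" for n
  proof -
    obtain v where v: "v \<noteq> 0" "perp {f, w, Ph (n * j) f, Ph (n * j) w} = vec.span {v}"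
      "(n * j) mod 5 = t \<or> (n * j) mod 5 = (4 * t) mod 5 \<longrightarrow> vec.dim ((\<lambda>i. Ph i v) ` {..<5}) = 5"
      using meet_conjugate[OF f5 t \<gamma> \<gamma>' n] unfolding w_def by blast
    have "f0 ` vec.span {v} = pt (f0 v)"
      unfolding pt_def vec.span_singleton by (auto simp: f0.scale image_image)
    moreover have "f0 v \<noteq> 0" using v(1) f0inj[of v 0] by (simp add: f0.zero)
    ultimately have "f0 ` vec.span {v} \<in> points" unfolding points_def by blast
    moreover have "rk \<sigma> (f0 ` vec.span {v}) = 5" if "vec.dim ((\<lambda>i. Ph i v) ` {..<5}) = 5"
      by (rule orbit_rank[OF f0 j actall that])
    ultimately show ?thesis unfolding meet v(2) using v(3) by blast
  qed
  have jc: "j mod 5 \<in> {1, 2, 3, 4}" by (rule mod5_cases[OF j])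
  have m4: "(4 * j) mod 5 = (4 * (j mod 5)) mod 5" and m3: "(3 * j) mod 5 = (3 * (j mod 5)) mod 5"
    by (simp_all add: mod_mult_right_eq)
  have n4: "(4 * j) mod 5 \<noteq> 0" unfolding m4 using jc by auto
  have n3: "(3 * j) mod 5 \<noteq> 0" unfolding m3 using jc by auto
  \<comment> \<open>Modulo 5, \<open>4 * j\<close> is -j and \<open>3 * j\<close> is -2j. Up to sign
    j and 2j exhaust the nonzero residues, so one of the two shifts is t or -t, where the meeting
    point is a vertex of the pentagon.\<close>
  have "((4 * j) mod 5 = t \<or> (4 * j) mod 5 = (4 * t) mod 5) \<or> ((3 * j) mod 5 = t \<or> (3 * j) mod 5 = (4 * t) mod 5)"
    unfolding m4 m3 using jc t by auto
  then show ?thesis using LP point[OF n4] point[OF n3] by blast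
qed

end

theorem theorem6p1:
  fixes q :: nat
    and \<Sigma> :: "('a::{field, finite} ^ 5) set set"
    and \<Gamma> :: "('a ^ 5) set"
    and \<sigma> :: "('a ^ 5) set \<Rightarrow> ('a ^ 5) set"
    and L :: "('a ^ 2) set set"
    and A B :: "('a ^ 5) set"
  assumes "primepow q" and "CARD('a) = q ^ 5"
    and "canonical_subgeometry q \<Sigma>"
    and "vec.subspace \<Gamma>" and "vec.dim \<Gamma> = 3"
    and "\<forall>P\<in>\<Sigma>. \<not> P \<subseteq> \<Gamma>"
    and "is_projection \<Gamma> \<Sigma> L"
    and "max_scattered q L"
    and "\<not> pseudoregulus_type q L"
    and "\<sigma> \<in> pointwise_stabilizer \<Sigma>"
    and "generate (BijGroup subspaces) {\<sigma>} = pointwise_stabilizer \<Sigma>"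
    and "A = \<Gamma> \<inter> (\<sigma> ^^ 4) \<Gamma>" and "B = \<Gamma> \<inter> (\<sigma> ^^ 3) \<Gamma>"
  shows "A \<in> points \<and> B \<in> points \<and>
    (rk \<sigma> A = 5 \<or> rk \<sigma> B = 5 \<longrightarrow> LP_type q L) \<and>
    (\<not> (rk \<sigma> A = 5 \<or> rk \<sigma> B = 5) \<longrightarrow>
       q > 25 \<and> \<not> LP_type q L \<and>
       ((\<exists>\<eta> \<rho>. \<eta> \<noteq> 0 \<and> Tr5 q \<eta> = 0 \<and> Tr5 q \<rho> \<noteq> 0 \<and> PGammaL_equiv L (E_set q \<eta> \<rho>)) \<or>
        (\<exists>k. N5 q k = 1 \<and> PGammaL_equiv L (LF_set q k))))"
proof -
  interpret quintic q "TYPE('a)" by unfold_locales (fact assms(1), fact assms(2))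
  obtain \<kappa> where \<kappa>: "\<kappa> \<in> PGL"
    "\<Sigma> = \<kappa> ` {pt v | v :: 'a ^ 5. v \<noteq> 0 \<and> (\<forall>i. v $ i \<in> Fq q)}"
    using assms(3) unfolding canonical_subgeometry_def by blast
  then obtain f0 where f0: "\<kappa> = collineation f0" "Vector_Spaces.linear (*s) (*s) f0" "bij f0"
    unfolding PGL_def by blast
  interpret f0: Vector_Spaces.linear "(*s)" "(*s)" f0 by (rule f0(2))
  have "\<kappa> (pt v) = pt (f0 v)" for v
  proof -
    have "\<kappa> (pt v) = f0 ` pt v" by (simp add: f0(1) collineation_def subspaces_def pt_def)
    also have "\<dots> = pt (f0 v)" unfolding pt_def vec.span_singleton by (auto simp: f0.scale image_image)
    finally show ?thesis .
  qed
  then have \<Sigma>: "\<Sigma> = (\<lambda>u. pt (f0 u)) ` {u :: 'a ^ 5. u \<noteq> 0 \<and> (\<forall>i. u $ i \<in> Fq q)}"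
    unfolding \<kappa>(2) by (simp add: setcompr_eq_image image_image)
  have "card L = (q ^ 5 - 1) div (q - 1)" using assms(8) by (simp add: max_scattered_def)
  \<comment> \<open>One of the two ranks is always 5, so the second implication follows from the
    failure of its premise.\<close>
  from classification[OF f0(2,3) \<Sigma> assms(4-7) this assms(9-11)]
  show ?thesis unfolding assms(12,13) by blast
qed

end
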